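(* Let $u_0\in L^2_\sigma(\mathbb{R}^3)$ and let $u(\cdot,t)$, $t\ge 0$, be any Leray-Hopf solution of the incompressible Navier-Stokes equations in $\mathbb{R}^3$ with initial data $u_0$ (in the sense described in the context). Then $$\lim_{t\to\infty} t^{3/4}\,\|u(\cdot,t)\|_{L^\infty(\mathbb{R}^3)}=0 .$$
   Context: $L^2_\sigma(\mathbb{R}^3)$ is the space of vector fields $\mathrm{u}=(\mathrm{u}_1,\mathrm{u}_2,\mathrm{u}_3)\in L^2(\mathbb{R}^3)$ with $\nabla\cdot \mathrm{u}=0$ in the distributional sense. The Navier-Stokes problem is $$u_t+u\cdot\nabla u+\nabla p=\Delta u,\qquad \nabla\cdot u(\cdot,t)=0,\qquad u(\cdot,0)=u_0\in L^2_\sigma(\mathbb{R}^3).$$ A Leray-Hopf solution is a global weak solution as constructed by Leray: $u\in L^\infty([0,\infty),L^2_\sigma(\mathbb{R}^3))\cap L^2([0,\infty),\dot H^1(\mathbb{R}^3))$, weakly continuous in $L^2(\mathbb{R}^3)$ on $[0,\infty)$, solving the equations in the distributional sense, with $\|u(\cdot,t)-u_0\|_{L^2}\to 0$ as $t\searrow 0$, and satisfying the energy inequality $\|u(\cdot,t)\|_{L^2}^2+2\int_0^t\|Du(\cdot,s)\|_{L^2}^2\,ds\le\|u_0\|_{L^2}^2$ for all $t\ge 0$. It is obtained as follows: for a nonnegative $G\in C_0^\infty(\mathbb{R}^3)$ with $\int G=1$, put $G_\delta(x)=\delta^{-3}G(x/\delta)$, and let $u_\delta,p_\delta\in C^\infty(\mathbb{R}^3\times[0,\infty))$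 be the unique global classical $L^2$ solutions of $\partial_t u_\delta+(G_\delta * u_\delta)\cdot\nabla u_\delta+\nabla p_\delta=\Delta u_\delta$, $\nabla\cdot u_\delta=0$, $u_\delta(\cdot,0)=G_\delta * u_0$; then for some sequence $\delta'\to 0$ one has $u_{\delta'}(\cdot,t)\rightharpoonup u(\cdot,t)$ weakly in $L^2(\mathbb{R}^3)$ for every $t\ge 0$. Such a solution has the property (shown by Leray) that there is $t_*$ (depending on $u$) with $u\in C^\infty(\mathbb{R}^3\times[t_*,\infty))$ and $u\in L^\infty([t_*,T],H^m(\mathbb{R}^3))$ for each $m\ge 1$ and each $t_*<T<\infty$. Norms: $\|u\|_{L^2}^2=\sum_{i}\int|u_i|^2dx$, $\|Du\|_{L^2}^2=\sum_{i,j}\int|D_ju_i|^2dx$ with $D_j=\partial/\partial x_j$, and $\|u\|_{L^\infty(\mathbb{R}^3)}=\max_{1\le i\le 3}\|u_i\|_{L^\infty(\mathbb{R}^3)}$. *)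

theory Defs
  imports "HOL-Analysis.Analysis" "HOL-Probability.Essential_Supremum"
begin

section \<open>Smooth functions, test functions, distributions\<close>

definition partial_within ::
    "'a::euclidean_space set \<Rightarrow> 'a \<Rightarrow> ('a \<Rightarrow> 'b::real_normed_vector) \<Rightarrow> 'a \<Rightarrow> 'b" where
  "partial_within S b f x = frechet_derivative f (at x within S) b"

abbreviation partial ::
    "'a::euclidean_space \<Rightarrow> ('a \<Rightarrow> 'b::real_normed_vector) \<Rightarrow> 'a \<Rightarrow> 'b" where
  "partial \<equiv> partial_within UNIV"

text \<open>
  Only used for \<^term>\<open>S = UNIV\<close> and for closed half spaces. There derivatives relative to
  \<^term>\<open>S\<close> are unique; on a half space they are one-sided at the boundary, so that smoothness
  includes smoothness up to the boundary.
\<close>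

primrec Ck_on ::
    "nat \<Rightarrow> 'a::euclidean_space set \<Rightarrow> ('a \<Rightarrow> 'b::real_normed_vector) \<Rightarrow> bool" where
  "Ck_on 0 S f \<longleftrightarrow> continuous_on S f"
| "Ck_on (Suc k) S f \<longleftrightarrow>
     f differentiable_on S \<and> (\<forall>b\<in>Basis. Ck_on k S (partial_within S b f))"

definition smooth_on ::
    "'a::euclidean_space set \<Rightarrow> ('a \<Rightarrow> 'b::real_normed_vector) \<Rightarrow> bool" where
  "smooth_on S f \<longleftrightarrow> (\<forall>k. Ck_on k S f)"

definition test_function :: "'a::euclidean_space set \<Rightarrow> ('a \<Rightarrow> real) \<Rightarrow> bool" where
  "test_function \<Omega> \<phi> \<longleftrightarrow>
     smooth_on UNIV \<phi> \<and> compact (closure {x. \<phi> x \<noteq> 0}) \<and> closure {x. \<phi> x \<noteq> 0} \<subseteq> \<Omega>"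

text \<open>
  In the continuity condition, \<^term>\<open>M\<close> ranges over the upper bounds of the \<open>C\<^sup>N\<close> norm of
  \<^term>\<open>\<phi>\<close>; the list \<^term>\<open>bs\<close> plays the role of a multi-index of order
  \<^term>\<open>length bs\<close>.
\<close>

definition distribution_on ::
    "'a::euclidean_space set \<Rightarrow> (('a \<Rightarrow> real) \<Rightarrow> real) \<Rightarrow> bool" where
  "distribution_on \<Omega> T \<longleftrightarrow>
     (\<forall>\<phi> \<psi>. test_function \<Omega> \<phi> \<longrightarrow> test_function \<Omega> \<psi> \<longrightarrow> T (\<lambda>x. \<phi> x + \<psi> x) = T \<phi> + T \<psi>) \<and>
     (\<forall>c \<phi>. test_function \<Omega> \<phi> \<longrightarrow> T (\<lambda>x. c * \<phi> x) = c * T \<phi>) \<and>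
     (\<forall>K. compact K \<and> K \<subseteq> \<Omega> \<longrightarrow>
        (\<exists>C N. \<forall>\<phi> M. test_function K \<phi> \<longrightarrow>
           (\<forall>bs x. set bs \<subseteq> Basis \<and> length bs \<le> N \<longrightarrow> \<bar>foldr partial bs \<phi> x\<bar> \<le> M) \<longrightarrow>
           \<bar>T \<phi>\<bar> \<le> C * M))"


section \<open>Vector fields on three-dimensional space\<close>

type_synonym vec3 = "real ^ 3"
type_synonym field3 = "vec3 \<Rightarrow> vec3"

definition in_L2 :: "field3 \<Rightarrow> bool" where
  "in_L2 f \<longleftrightarrow> f \<in> borel_measurable lebesgue \<and> integrable lebesgue (\<lambda>x. (norm (f x))\<^sup>2)"

definition L2_norm :: "field3 \<Rightarrow> real" where
  "L2_norm f = sqrt (LINT x|lebesgue. (norm (f x))\<^sup>2)"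

definition L2_sigma :: "field3 set" where
  "L2_sigma = {f. in_L2 f \<and>
     (\<forall>\<phi>. test_function UNIV \<phi> \<longrightarrow>
        (LINT x|lebesgue. (\<Sum>j\<in>UNIV. f x $ j * partial (axis j 1) \<phi> x)) = 0)}"

definition weakly_converges_L2 :: "(nat \<Rightarrow> field3) \<Rightarrow> field3 \<Rightarrow> bool" where
  "weakly_converges_L2 F f \<longleftrightarrow> (\<forall>n. in_L2 (F n)) \<and> in_L2 f \<and>
     (\<forall>g. in_L2 g \<longrightarrow>
        (\<lambda>n. LINT x|lebesgue. F n x \<bullet> g x) \<longlonglongrightarrow> (LINT x|lebesgue. f x \<bullet> g x))"

definition weakly_continuous_L2 :: "(real \<Rightarrow> field3) \<Rightarrow> bool" where
  "weakly_continuous_L2 u \<longleftrightarrow> (\<forall>t\<ge>0. in_L2 (u t)) \<and>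
     (\<forall>g. in_L2 g \<longrightarrow> continuous_on {0..} (\<lambda>t. LINT x|lebesgue. u t x \<bullet> g x))"

text \<open>The entry \<^term>\<open>V x $ i $ j\<close> is the weak derivative of the \<open>i\<close>-th component in
  direction \<open>j\<close>.\<close>

definition weak_gradient :: "field3 \<Rightarrow> (vec3 \<Rightarrow> real ^ 3 ^ 3) \<Rightarrow> bool" where
  "weak_gradient f V \<longleftrightarrow>
     V \<in> borel_measurable lebesgue \<and>
     (\<forall>K. compact K \<longrightarrow> set_integrable lebesgue K V) \<and>
     (\<forall>\<phi> i j. test_function UNIV \<phi> \<longrightarrow>
        (LINT x|lebesgue. f x $ i * partial (axis j 1) \<phi> x) =
        - (LINT x|lebesgue. V x $ i $ j * \<phi> x))"

text \<open>
  The square of the \<open>L\<^sup>2\<close> norm of the weak gradient. Weak gradients are unique almost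
  everywhere, so the infimum is over at most one value; it is \<open>\<infinity>\<close> if there is no weak
  gradient.
\<close>

definition gradient_L2_norm_sq :: "field3 \<Rightarrow> ennreal" where
  "gradient_L2_norm_sq f =
     (INF V\<in>{V. weak_gradient f V}.
        \<integral>\<^sup>+ x. ennreal (\<Sum>i\<in>UNIV. \<Sum>j\<in>UNIV. (V x $ i $ j)\<^sup>2) \<partial>lebesgue)"

definition Linf_norm :: "field3 \<Rightarrow> ennreal" where
  "Linf_norm f = Max (range (\<lambda>i. esssup lebesgue (\<lambda>x. ennreal \<bar>f x $ i\<bar>)))"

definition divergence :: "field3 \<Rightarrow> vec3 \<Rightarrow> real" where
  "divergence f x = (\<Sum>j\<in>UNIV. partial (axis j 1) f x $ j)"

definition gradient :: "(vec3 \<Rightarrow> real) \<Rightarrow> field3" where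
  "gradient q x = (\<chi> j. partial (axis j 1) q x)"

definition advection :: "field3 \<Rightarrow> field3 \<Rightarrow> field3" where
  "advection b f x = (\<Sum>j\<in>UNIV. b x $ j *\<^sub>R partial (axis j 1) f x)"

definition vector_laplacian :: "field3 \<Rightarrow> field3" where
  "vector_laplacian f x = (\<Sum>j\<in>UNIV. partial (axis j 1) (partial (axis j 1) f) x)"


section \<open>Weak solutions and Leray's construction\<close>

text \<open>
  The equation in the sense of distributions on \<open>\<real>\<^sup>3 \<times> (0,\<infinity>)\<close>: the \<open>i\<close>-th momentum equation
  is tested with \<^term>\<open>\<phi>\<close>, the convection term being read as
  \<open>u \<cdot> \<nabla>u\<^sub>i = \<Sum>\<^sub>j D\<^sub>j (u\<^sub>j u\<^sub>i)\<close>, which is legitimate for solenoidal fields. The pressure is an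
  arbitrary distribution. The integrals are iterated, since only the time slices of
  \<^term>\<open>u\<close> are given, each up to a null set.
\<close>

definition distributional_NS_solution :: "(real \<Rightarrow> field3) \<Rightarrow> bool" where
  "distributional_NS_solution u \<longleftrightarrow>
     (\<exists>P. distribution_on (UNIV \<times> {0<..}) P \<and>
       (\<forall>(\<phi> :: vec3 \<times> real \<Rightarrow> real) i. test_function (UNIV \<times> {0<..}) \<phi> \<longrightarrow>
          (LINT t:{0<..}|lebesgue. LINT x|lebesgue.
              u t x $ i * partial (0, 1) \<phi> (x, t)
            + (\<Sum>j\<in>UNIV. u t x $ j * u t x $ i * partial (axis j 1, 0) \<phi> (x, t))
            + u t x $ i * (\<Sum>j\<in>UNIV. partial (axis j 1, 0) (partial (axis j 1, 0) \<phi>) (x, t)))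
          + P (partial (axis i 1, 0) \<phi>) = 0))"

definition mollifier :: "(vec3 \<Rightarrow> real) \<Rightarrow> bool" where
  "mollifier G \<longleftrightarrow> test_function UNIV G \<and> (\<forall>x. 0 \<le> G x) \<and> (LINT x|lebesgue. G x) = 1"

definition mollify :: "(vec3 \<Rightarrow> real) \<Rightarrow> real \<Rightarrow> field3 \<Rightarrow> field3" where
  "mollify G \<delta> f x = (LINT y|lebesgue. (G ((x - y) /\<^sub>R \<delta>) / \<delta> ^ 3) *\<^sub>R f y)"

text \<open>
  Classical \<open>L\<^sup>2\<close> solutions of the regularized problem. Boundedness of the \<open>L\<^sup>2\<close> norm on bounded
  time intervals determines \<^term>\<open>v\<close> uniquely, and \<^term>\<open>q\<close> up to a function of time.
\<close>

definition regularized_solution ::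
    "(vec3 \<Rightarrow> real) \<Rightarrow> real \<Rightarrow> field3 \<Rightarrow> (real \<Rightarrow> field3) \<Rightarrow> (real \<Rightarrow> vec3 \<Rightarrow> real) \<Rightarrow> bool" where
  "regularized_solution G \<delta> u0 v q \<longleftrightarrow>
     smooth_on (UNIV \<times> {0..}) (\<lambda>(x, t). v t x) \<and>
     smooth_on (UNIV \<times> {0..}) (\<lambda>(x, t). q t x) \<and>
     (\<forall>t\<ge>0. in_L2 (v t)) \<and>
     (\<forall>T. \<exists>C. \<forall>t\<in>{0..T}. L2_norm (v t) \<le> C) \<and>
     (\<forall>t\<ge>0. \<forall>x.
        vector_derivative (\<lambda>s. v s x) (at t within {0..})
          + advection (mollify G \<delta> (v t)) (v t) x + gradient (q t) x
        = vector_laplacian (v t) x) \<and>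
     (\<forall>t\<ge>0. \<forall>x. divergence (v t) x = 0) \<and>
     (\<forall>x. v 0 x = mollify G \<delta> u0 x)"

definition leray_hopf_solution :: "field3 \<Rightarrow> (real \<Rightarrow> field3) \<Rightarrow> bool" where
  "leray_hopf_solution u0 u \<longleftrightarrow>
     (\<forall>t\<ge>0. u t \<in> L2_sigma) \<and>
     (\<exists>C. \<forall>t\<ge>0. L2_norm (u t) \<le> C) \<and>
     (\<integral>\<^sup>+ t\<in>{0..}. gradient_L2_norm_sq (u t) \<partial>lebesgue) < \<infinity> \<and>
     weakly_continuous_L2 u \<and>
     distributional_NS_solution u \<and>
     ((\<lambda>t. L2_norm (\<lambda>x. u t x - u0 x)) \<longlongrightarrow> 0) (at_right 0) \<and>
     (\<forall>t\<ge>0. ennreal ((L2_norm (u t))\<^sup>2)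
               + 2 * (\<integral>\<^sup>+ s\<in>{0..t}. gradient_L2_norm_sq (u s) \<partial>lebesgue)
             \<le> ennreal ((L2_norm u0)\<^sup>2)) \<and>
     (\<exists>G U Q. mollifier G \<and>
        (\<forall>\<delta>>0. regularized_solution G \<delta> u0 (U \<delta>) (Q \<delta>)) \<and>
        (\<exists>d. (\<forall>n. d n > 0) \<and> d \<longlonglongrightarrow> 0 \<and>
           (\<forall>t\<ge>0. weakly_converges_L2 (\<lambda>n. U (d n) t) (u t))))"

end

theory Submission
  imports Defs "HOL-Probability.Distributions"
begin

text \<open>
  The solution is a weak limit of solutions \<open>v\<close> of the regularized problem, whose advecting field is
  the mollification \<open>b\<close> of \<open>v\<close>. A bound for the components of \<open>v\<close> that does not depend on the
  regularization passes to the weak limit (\<open>weak_limit_bound\<close>), so it suffices to find for every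
  \<open>\<epsilon> > 0\<close> a time \<open>T\<close>, depending only on the initial data, such that \<open>\<bar>v(x,t)\<bar> \<le> \<epsilon> t\<^sup>-\<^sup>3\<^sup>/\<^sup>4\<close> for all
  \<open>t \<ge> T\<close> (\<open>regularized_decay\<close>). Below, \<open>C\<close> stands for absolute constants and \<open>S(s)\<close> for the heat
  semigroup. The constants are uniform in the regularization because mollification increases neither
  the supremum nor the \<open>L\<^sup>2\<close> norm.

  The mild inequality (\<open>mild_inequality\<close>). Testing the equation with solenoidal fields
  \<open>e\<^sub>k \<Delta>\<phi> - \<nabla>\<partial>\<^sub>k\<phi>\<close>, where \<open>\<phi>\<close> approximates the Newtonian potential of the heat kernel, removes the
  pressure. In the limit one gets \<open>\<bar>v(t)\<bar> \<le> \<bar>S(t-t0) v(t0)\<bar> + C \<integral> k(t-r) * (\<bar>b\<bar> \<bar>v\<bar>)(r) dr\<close>, where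
  the kernel \<open>k(s)\<close> bounds the first derivatives of the Oseen kernel; its \<open>L\<^sup>1\<close> norm is at most
  \<open>C s\<^sup>-\<^sup>1\<^sup>/\<^sup>2\<close> and its \<open>L\<^sup>2\<close> norm at most \<open>C s\<^sup>-\<^sup>5\<^sup>/\<^sup>4\<close>.

  The energy inequality (\<open>energy_mollified\<close>). It is proved for \<open>S(s) v\<close> with an error \<open>O(s)\<close>, so that
  no integrability of the gradient of \<open>v\<close> has to be known in advance. It shows that
  the \<open>L\<^sup>2\<close> norm decreases, and that every interval \<open>(t/4, t/2)\<close> contains a time \<open>t0\<close> at which the
  gradient of \<open>v\<close> has \<open>L\<^sup>2\<close> norm at most \<open>\<eta> = C \<rho> t\<^sup>-\<^sup>1\<^sup>/\<^sup>2\<close>, where \<open>\<rho>\<close> bounds the \<open>L\<^sup>2\<close> norm of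
  \<open>v(t/4)\<close>.

  Decay of the supremum (\<open>sup_decay\<close>). From such a time on, the linear part satisfies
  \<open>\<bar>S(s) v(t0)\<bar> \<le> C \<eta> s\<^sup>-\<^sup>1\<^sup>/\<^sup>4\<close>. If \<open>t\<close> is larger than \<open>C \<rho>\<^sup>4\<close>, the quadratic term of the mild
  inequality is too small to destroy this rate up to time \<open>t\<close> (\<open>bootstrap\<close>), and at time \<open>t\<close> the
  result is \<open>\<bar>v(t)\<bar> \<le> C \<rho> t\<^sup>-\<^sup>3\<^sup>/\<^sup>4\<close>.

  Decay of the \<open>L\<^sup>2\<close> norm. Taking for \<open>\<rho>\<close> the \<open>L\<^sup>2\<close> norm of the initial data gives the rate
  \<open>t\<^sup>-\<^sup>3\<^sup>/\<^sup>4\<close> with some constant. Inserting this rate into the mild inequality shows that the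
  nonlinear contribution to the \<open>L\<^sup>2\<close> norm tends to zero (\<open>L2_decay\<close>). The linear contribution
  does so as well, because \<open>L\<^sup>2\<close> data are the sum of an integrable part, which the heat flow spreads out,
  and a part of small norm (\<open>linear_decay\<close>). Hence \<open>\<rho>\<close> may be taken as small as desired at late
  times, and a second application of \<open>sup_decay\<close> gives the assertion.
\<close>

section \<open>Square integrable functions and convolutions\<close>

definition sqi :: "('a::euclidean_space \<Rightarrow> real) \<Rightarrow> bool" where
  "sqi f \<longleftrightarrow> f \<in> borel_measurable borel \<and> integrable lborel (\<lambda>x. (f x)\<^sup>2)"

definition l2n :: "('a::euclidean_space \<Rightarrow> real) \<Rightarrow> real" where
  "l2n f = sqrt (LINT x|lborel. (f x)\<^sup>2)"

definition l1n :: "('a::euclidean_space \<Rightarrow> real) \<Rightarrow> real" where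
  "l1n f = (LINT x|lborel. \<bar>f x\<bar>)"

lemma sqi_meas[measurable_dest]: "sqi f \<Longrightarrow> f \<in> borel_measurable borel"
  by (simp add: sqi_def)

lemma ennreal_power2_le_imp_le:
  fixes x y :: ennreal
  assumes "x\<^sup>2 \<le> y\<^sup>2" shows "x \<le> y"
proof (rule ccontr)
  assume "\<not> x \<le> y"
  then have lt: "y < x" by simp
  then obtain r where r: "y = ennreal r" "r \<ge> 0" by (cases y) auto
  show False
  proof (cases x)
    case (real s)
    then have "s\<^sup>2 \<le> r\<^sup>2" using assms r by (simp add: ennreal_power)
    then have "s \<le> r" using r(2) by (rule power2_le_imp_le)
    then have "x \<le> y" using real r by (metis ennreal_leI)
    then show False using lt by (meson leD)
  next
    case top
    have "y\<^sup>2 = top" using assms top by (simp add: top_unique)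
    moreover have "y\<^sup>2 = ennreal (r\<^sup>2)" using r by (simp add: ennreal_power)
    ultimately show False by simp
  qed
qed

lemma l2n_nonneg[simp]: "0 \<le> l2n f" by (simp add: l2n_def)
lemma l1n_nonneg[simp]: "0 \<le> l1n f" by (simp add: l1n_def)

lemma l2n_sq: "(l2n f)\<^sup>2 = (LINT x|lborel. (f x)\<^sup>2)"
  by (simp add: l2n_def)

lemma nn_sqi: "sqi f \<Longrightarrow> (\<integral>\<^sup>+x. ennreal ((f x)\<^sup>2) \<partial>lborel) = ennreal ((l2n f)\<^sup>2)"
  unfolding l2n_sq sqi_def by (intro nn_integral_eq_integral) auto

lemma sqiI_nn:
  assumes [measurable]: "f \<in> borel_measurable borel"
    and le: "(\<integral>\<^sup>+x. ennreal ((f x)\<^sup>2) \<partial>lborel) \<le> ennreal (B\<^sup>2)" and B: "B \<ge> 0"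
  shows "sqi f" "l2n f \<le> B"
proof -
  have "integrable lborel (\<lambda>x. (f x)\<^sup>2)"
    using le by (intro integrableI_bounded) (auto simp: less_top[symmetric] top_unique)
  then show s: "sqi f" by (simp add: sqi_def)
  have "ennreal ((l2n f)\<^sup>2) \<le> ennreal (B\<^sup>2)" using nn_sqi[OF s] le by simp
  then have "(l2n f)\<^sup>2 \<le> B\<^sup>2" by simp
  then show "l2n f \<le> B" using B by (rule power2_le_imp_le)
qed

lemma sqi_dominated:
  assumes [measurable]: "f \<in> borel_measurable borel" and g: "sqi g" and le: "\<And>x. \<bar>f x\<bar> \<le> \<bar>g x\<bar>"
  shows "sqi f" "l2n f \<le> l2n g"
proof -
  have "(\<integral>\<^sup>+x. ennreal ((f x)\<^sup>2) \<partial>lborel) \<le> (\<integral>\<^sup>+x. ennreal ((g x)\<^sup>2) \<partial>lborel)"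
    by (intro nn_integral_mono ennreal_leI) (simp add: abs_le_square_iff[symmetric] le)
  also have "\<dots> = ennreal ((l2n g)\<^sup>2)" by (rule nn_sqi[OF g])
  finally have *: "(\<integral>\<^sup>+x. ennreal ((f x)\<^sup>2) \<partial>lborel) \<le> ennreal ((l2n g)\<^sup>2)" .
  show "sqi f" "l2n f \<le> l2n g" using sqiI_nn[OF _ *] by auto
qed

lemma sqi_abs[simp]: "sqi f \<Longrightarrow> sqi (\<lambda>x. \<bar>f x\<bar>)"
  by (rule sqi_dominated(1)[of _ f]) (auto simp: sqi_def)

lemma l2n_abs[simp]: "l2n (\<lambda>x. \<bar>f x\<bar>) = l2n f"
  by (simp add: l2n_def)

lemma sqi_cmult: "sqi f \<Longrightarrow> sqi (\<lambda>x. c * f x)"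
  by (auto simp: sqi_def power_mult_distrib)

lemma l2n_cmult: "l2n (\<lambda>x. c * f x) = \<bar>c\<bar> * l2n f"
  by (simp add: l2n_def power_mult_distrib real_sqrt_mult)

lemma sqi_mult:
  assumes f: "sqi f" and g: "sqi g"
  shows "integrable lborel (\<lambda>x. f x * g x)"
proof (rule Bochner_Integration.integrable_bound[where f="\<lambda>x. (f x)\<^sup>2 + (g x)\<^sup>2"])
  show "integrable lborel (\<lambda>x. (f x)\<^sup>2 + (g x)\<^sup>2)" using f g by (auto simp: sqi_def)
  show "(\<lambda>x. f x * g x) \<in> borel_measurable lborel" using f g by (auto simp: sqi_def)
  show "AE x in lborel. norm (f x * g x) \<le> norm ((f x)\<^sup>2 + (g x)\<^sup>2)"
  proof (rule AE_I2)
    fix x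
    have "2 * (\<bar>f x\<bar> * \<bar>g x\<bar>) \<le> (f x)\<^sup>2 + (g x)\<^sup>2"
      using sum_squares_bound[of "\<bar>f x\<bar>" "\<bar>g x\<bar>"] by simp
    moreover have "0 \<le> \<bar>f x\<bar> * \<bar>g x\<bar>" by simp
    ultimately have "\<bar>f x\<bar> * \<bar>g x\<bar> \<le> (f x)\<^sup>2 + (g x)\<^sup>2" by linarith
    then show "norm (f x * g x) \<le> norm ((f x)\<^sup>2 + (g x)\<^sup>2)"
      unfolding real_norm_def abs_mult by (rule order_trans) (rule abs_ge_self)
  qed
qed

lemma sqi_add: assumes f: "sqi f" and g: "sqi g" shows "sqi (\<lambda>x. f x + g x)"
proof -
  have "integrable lborel (\<lambda>x. (f x)\<^sup>2 + (g x)\<^sup>2 + 2 * (f x * g x))"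
    using f g sqi_mult[OF f g] by (auto simp: sqi_def)
  moreover have "(\<lambda>x. f x + g x) \<in> borel_measurable borel"
    by (intro borel_measurable_add sqi_meas f g)
  moreover have "(\<lambda>x. (f x + g x)\<^sup>2) = (\<lambda>x. (f x)\<^sup>2 + (g x)\<^sup>2 + 2 * (f x * g x))"
    by (simp add: fun_eq_iff power2_sum)
  ultimately show ?thesis unfolding sqi_def by metis
qed

lemma sqi_zero[simp]: "sqi (\<lambda>x. 0)" by (simp add: sqi_def)

lemma sqi_sum: "(\<And>i. i \<in> I \<Longrightarrow> sqi (f i)) \<Longrightarrow> sqi (\<lambda>x. \<Sum>i\<in>I. f i x)"
  by (induction I rule: infinite_finite_induct) (auto intro: sqi_add)

lemma sqi_diff: "sqi f \<Longrightarrow> sqi g \<Longrightarrow> sqi (\<lambda>x. f x - g x)"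
  using sqi_add[of f "\<lambda>x. (-1) * g x"] sqi_cmult[of g "-1"] by simp

lemma nn_pair_le:
  assumes f: "sqi f" and g: "sqi g"
  shows "(\<integral>\<^sup>+x. ennreal \<bar>f x\<bar> * ennreal \<bar>g x\<bar> \<partial>lborel) \<le> ennreal (l2n f * l2n g)"
proof -
  note [measurable] = sqi_meas[OF f] sqi_meas[OF g]
  have "(\<integral>\<^sup>+x. ennreal \<bar>f x\<bar> * ennreal \<bar>g x\<bar> \<partial>lborel)\<^sup>2 \<le>
     (\<integral>\<^sup>+x. ennreal \<bar>f x\<bar> ^ 2 \<partial>lborel) * (\<integral>\<^sup>+x. ennreal \<bar>g x\<bar> ^ 2 \<partial>lborel)"
    by (rule Cauchy_Schwarz_nn_integral) auto
  also have "\<dots> = ennreal ((l2n f * l2n g)\<^sup>2)"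
    using nn_sqi[OF f] nn_sqi[OF g] by (simp add: ennreal_power ennreal_mult power_mult_distrib)
  finally have "(\<integral>\<^sup>+x. ennreal \<bar>f x\<bar> * ennreal \<bar>g x\<bar> \<partial>lborel)\<^sup>2 \<le> (ennreal (l2n f * l2n g))\<^sup>2"
    by (simp add: ennreal_power)
  then show ?thesis by (rule ennreal_power2_le_imp_le)
qed

lemma pair_abs_le:
  assumes f: "sqi f" and g: "sqi g"
  shows "(LINT x|lborel. \<bar>f x * g x\<bar>) \<le> l2n f * l2n g"
proof -
  have "ennreal (LINT x|lborel. \<bar>f x * g x\<bar>) = (\<integral>\<^sup>+x. ennreal \<bar>f x * g x\<bar> \<partial>lborel)"
    using sqi_mult[OF f g] by (intro nn_integral_eq_integral[symmetric]) auto
  also have "\<dots> = (\<integral>\<^sup>+x. ennreal \<bar>f x\<bar> * ennreal \<bar>g x\<bar> \<partial>lborel)"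
    by (simp add: abs_mult ennreal_mult)
  also have "\<dots> \<le> ennreal (l2n f * l2n g)" by (rule nn_pair_le[OF f g])
  finally show ?thesis by simp
qed

lemma pair_le:
  assumes f: "sqi f" and g: "sqi g"
  shows "\<bar>LINT x|lborel. f x * g x\<bar> \<le> l2n f * l2n g"
  using integral_abs_bound[of lborel "\<lambda>x. f x * g x"] pair_abs_le[OF f g] by linarith

lemma sqi_bounded:
  assumes [measurable]: "f \<in> borel_measurable borel" and i: "integrable lborel f"
    and le: "\<And>x. \<bar>f x\<bar> \<le> B" and l1: "l1n f \<le> L" and B: "B \<ge> 0"
  shows "sqi f" "l2n f \<le> sqrt (B * L)"
proof -
  have L: "0 \<le> L" using l1 l1n_nonneg[of f] by linarith
  have "(\<integral>\<^sup>+x. ennreal ((f x)\<^sup>2) \<partial>lborel) \<le> (\<integral>\<^sup>+x. ennreal (B * \<bar>f x\<bar>) \<partial>lborel)"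
    by (intro nn_integral_mono ennreal_leI)
       (metis abs_ge_zero le mult_right_mono power2_abs power2_eq_square)
  also have "\<dots> = ennreal (B * l1n f)"
    using i B by (subst nn_integral_eq_integral) (auto simp: l1n_def)
  also have "\<dots> \<le> ennreal ((sqrt (B * L))\<^sup>2)"
    using B L by (intro ennreal_leI) (simp add: mult_left_mono l1)
  finally have *: "(\<integral>\<^sup>+x. ennreal ((f x)\<^sup>2) \<partial>lborel) \<le> ennreal ((sqrt (B * L))\<^sup>2)" .
  show "sqi f" "l2n f \<le> sqrt (B * L)" using sqiI_nn[OF _ *] B L by auto
qed

lemma lborel_distr_reflect: "distr lborel borel (\<lambda>x. a - x :: 'a::euclidean_space) = lborel"
  using lborel_affine[of "-1" a] by (simp add: density_1)

lemma nn_shift: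
  assumes [measurable]: "f \<in> borel_measurable borel"
  shows "(\<integral>\<^sup>+x. f (x - a) \<partial>lborel) = (\<integral>\<^sup>+x. f (x::'a::euclidean_space) \<partial>lborel)"
  by (subst (2) lborel_distr_plus[of "-a", symmetric], subst nn_integral_distr) auto

lemma nn_reflect:
  assumes [measurable]: "f \<in> borel_measurable borel"
  shows "(\<integral>\<^sup>+x. f (a - x) \<partial>lborel) = (\<integral>\<^sup>+x. f (x::'a::euclidean_space) \<partial>lborel)"
  by (subst (2) lborel_distr_reflect[of a, symmetric], subst nn_integral_distr) auto

lemma integrable_shift:
  fixes f :: "'a::euclidean_space \<Rightarrow> real"
  assumes f: "integrable lborel f"
  shows "integrable lborel (\<lambda>x. f (x - a))"
proof -
  have [measurable]: "f \<in> borel_measurable borel" using f by auto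
  show ?thesis using f
    by (subst (asm) lborel_distr_plus[of "-a", symmetric], subst (asm) integrable_distr_eq) auto
qed

lemma integrable_reflect_vec:
  fixes f :: "'a::euclidean_space \<Rightarrow> real"
  assumes f: "integrable lborel f"
  shows "integrable lborel (\<lambda>x. f (a - x))"
proof -
  have [measurable]: "f \<in> borel_measurable borel" using f by auto
  show ?thesis using f
    by (subst (asm) lborel_distr_reflect[of a, symmetric], subst (asm) integrable_distr_eq) auto
qed

lemma integral_shift:
  fixes f :: "'a::euclidean_space \<Rightarrow> real"
  assumes [measurable]: "f \<in> borel_measurable borel"
  shows "(LINT x|lborel. f (x - a)) = (LINT x|lborel. f x)"
  by (subst (2) lborel_distr_plus[of "-a", symmetric], subst integral_distr) auto

lemma integral_reflect_vec:
  fixes f :: "'a::euclidean_space \<Rightarrow> real"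
  assumes [measurable]: "f \<in> borel_measurable borel"
  shows "(LINT x|lborel. f (a - x)) = (LINT x|lborel. f x)"
  by (subst (2) lborel_distr_reflect[of a, symmetric], subst integral_distr) auto

lemma sqi_shift:
  assumes f: "sqi f" shows "sqi (\<lambda>x. f (x - a))" "l2n (\<lambda>x. f (x - a)) = l2n f"
proof -
  note [measurable] = sqi_meas[OF f]
  show "sqi (\<lambda>x. f (x - a))"
    using f integrable_shift[of "\<lambda>x. (f x)\<^sup>2" a] by (simp add: sqi_def)
  show "l2n (\<lambda>x. f (x - a)) = l2n f"
    unfolding l2n_def using integral_shift[of "\<lambda>x. (f x)\<^sup>2" a] by simp
qed

lemma sqi_reflect:
  assumes f: "sqi f" shows "sqi (\<lambda>x. f (a - x))" "l2n (\<lambda>x. f (a - x)) = l2n f"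
proof -
  note [measurable] = sqi_meas[OF f]
  show "sqi (\<lambda>x. f (a - x))"
    using f integrable_reflect_vec[of "\<lambda>x. (f x)\<^sup>2" a] by (simp add: sqi_def)
  show "l2n (\<lambda>x. f (a - x)) = l2n f"
    unfolding l2n_def using integral_reflect_vec[of "\<lambda>x. (f x)\<^sup>2" a] by simp
qed

lemma nn_l1n: "integrable lborel f \<Longrightarrow> (\<integral>\<^sup>+x. ennreal \<bar>f x\<bar> \<partial>lborel) = ennreal (l1n f)"
  unfolding l1n_def by (intro nn_integral_eq_integral) auto

text \<open>Cauchy--Schwarz with the weight \<open>\<bar>k\<bar>\<close> followed by Fubini. Convolutions are written as
  \<open>\<integral> k(y - x) f(y) dy\<close> throughout, so that a derivative in \<open>x\<close> falls on the kernel with a minus sign.\<close>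

lemma Young_nn:
  fixes k :: "'a::euclidean_space \<Rightarrow> real" and f :: "'a \<Rightarrow> ennreal"
  assumes [measurable]: "k \<in> borel_measurable borel" "f \<in> borel_measurable borel"
  shows "(\<integral>\<^sup>+x. (\<integral>\<^sup>+y. ennreal \<bar>k (y - x)\<bar> * f y \<partial>lborel)\<^sup>2 \<partial>lborel)
    \<le> (\<integral>\<^sup>+x. ennreal \<bar>k x\<bar> \<partial>lborel)\<^sup>2 * (\<integral>\<^sup>+x. (f x)\<^sup>2 \<partial>lborel)"
proof -
  let ?K = "\<integral>\<^sup>+x. ennreal \<bar>k x\<bar> \<partial>lborel"
  have sq: "ennreal (sqrt \<bar>c\<bar>) * ennreal (sqrt \<bar>c\<bar>) = ennreal \<bar>c\<bar>" for c
    by (simp flip: ennreal_mult)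
  have 1: "(\<integral>\<^sup>+y. ennreal \<bar>k (y - x)\<bar> * f y \<partial>lborel)\<^sup>2 \<le> ?K * (\<integral>\<^sup>+y. ennreal \<bar>k (y - x)\<bar> * (f y)\<^sup>2 \<partial>lborel)" for x
  proof -
    have "(\<integral>\<^sup>+y. ennreal \<bar>k (y - x)\<bar> * f y \<partial>lborel)\<^sup>2 =
      (\<integral>\<^sup>+y. ennreal (sqrt \<bar>k (y - x)\<bar>) * (ennreal (sqrt \<bar>k (y - x)\<bar>) * f y) \<partial>lborel)\<^sup>2"
      by (simp add: sq mult.assoc[symmetric])
    also have "\<dots> \<le> (\<integral>\<^sup>+y. (ennreal (sqrt \<bar>k (y - x)\<bar>))\<^sup>2 \<partial>lborel) *
        (\<integral>\<^sup>+y. (ennreal (sqrt \<bar>k (y - x)\<bar>) * f y)\<^sup>2 \<partial>lborel)"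
      by (rule Cauchy_Schwarz_nn_integral) auto
    also have "\<dots> = (\<integral>\<^sup>+y. ennreal \<bar>k (y - x)\<bar> \<partial>lborel) * (\<integral>\<^sup>+y. ennreal \<bar>k (y - x)\<bar> * (f y)\<^sup>2 \<partial>lborel)"
      by (simp add: power_mult_distrib) (simp add: power2_eq_square sq)
    also have "(\<integral>\<^sup>+y. ennreal \<bar>k (y - x)\<bar> \<partial>lborel) = ?K"
      by (rule nn_shift[of "\<lambda>y. ennreal \<bar>k y\<bar>"]) auto
    finally show ?thesis .
  qed
  have "(\<integral>\<^sup>+x. (\<integral>\<^sup>+y. ennreal \<bar>k (y - x)\<bar> * f y \<partial>lborel)\<^sup>2 \<partial>lborel)
     \<le> (\<integral>\<^sup>+x. ?K * (\<integral>\<^sup>+y. ennreal \<bar>k (y - x)\<bar> * (f y)\<^sup>2 \<partial>lborel) \<partial>lborel)"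
    by (intro nn_integral_mono 1)
  also have "\<dots> = ?K * (\<integral>\<^sup>+x. (\<integral>\<^sup>+y. ennreal \<bar>k (y - x)\<bar> * (f y)\<^sup>2 \<partial>lborel) \<partial>lborel)"
    by (rule nn_integral_cmult) measurable
  also have "(\<integral>\<^sup>+x. (\<integral>\<^sup>+y. ennreal \<bar>k (y - x)\<bar> * (f y)\<^sup>2 \<partial>lborel) \<partial>lborel)
     = (\<integral>\<^sup>+y. (\<integral>\<^sup>+x. ennreal \<bar>k (y - x)\<bar> * (f y)\<^sup>2 \<partial>lborel) \<partial>lborel)"
    by (rule lborel_pair.Fubini') measurable
  also have "\<dots> = (\<integral>\<^sup>+y. ?K * (f y)\<^sup>2 \<partial>lborel)"
  proof (rule nn_integral_cong)
    fix y
    have "(\<integral>\<^sup>+x. ennreal \<bar>k (y - x)\<bar> \<partial>lborel) = ?K"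
      by (rule nn_reflect[of "\<lambda>y. ennreal \<bar>k y\<bar>"]) auto
    then show "(\<integral>\<^sup>+x. ennreal \<bar>k (y - x)\<bar> * (f y)\<^sup>2 \<partial>lborel) = ?K * (f y)\<^sup>2"
      by (subst nn_integral_multc) auto
  qed
  also have "\<dots> = ?K * (\<integral>\<^sup>+y. (f y)\<^sup>2 \<partial>lborel)"
    by (rule nn_integral_cmult) auto
  finally show ?thesis by (simp add: power2_eq_square mult.assoc)
qed

text \<open>Absolute convergence of the double integral, which is what all later exchanges of the order of
  integration rest on.\<close>

lemma bilinear_nn:
  assumes f: "sqi f" and g: "sqi g" and k: "integrable lborel k"
  shows "(\<integral>\<^sup>+x. (\<integral>\<^sup>+y. ennreal \<bar>g x\<bar> * (ennreal \<bar>k (y - x)\<bar> * ennreal \<bar>f y\<bar>) \<partial>lborel) \<partial>lborel)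
    \<le> ennreal (l1n k * l2n g * l2n f)"
proof -
  note [measurable] = sqi_meas[OF f] sqi_meas[OF g]
  have [measurable]: "k \<in> borel_measurable borel" using k by auto
  let ?H = "\<lambda>x. \<integral>\<^sup>+y. ennreal \<bar>k (y - x)\<bar> * ennreal \<bar>f y\<bar> \<partial>lborel"
  have "(\<integral>\<^sup>+x. (\<integral>\<^sup>+y. ennreal \<bar>g x\<bar> * (ennreal \<bar>k (y - x)\<bar> * ennreal \<bar>f y\<bar>) \<partial>lborel) \<partial>lborel)\<^sup>2
     = (\<integral>\<^sup>+x. ennreal \<bar>g x\<bar> * ?H x \<partial>lborel)\<^sup>2"
    by (subst nn_integral_cmult) auto
  also have "\<dots> \<le> (\<integral>\<^sup>+x. (ennreal \<bar>g x\<bar>)\<^sup>2 \<partial>lborel) * (\<integral>\<^sup>+x. (?H x)\<^sup>2 \<partial>lborel)"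
    by (rule Cauchy_Schwarz_nn_integral) measurable
  also have "\<dots> \<le> (\<integral>\<^sup>+x. (ennreal \<bar>g x\<bar>)\<^sup>2 \<partial>lborel) *
       ((\<integral>\<^sup>+x. ennreal \<bar>k x\<bar> \<partial>lborel)\<^sup>2 * (\<integral>\<^sup>+x. (ennreal \<bar>f x\<bar>)\<^sup>2 \<partial>lborel))"
    by (intro mult_left_mono Young_nn) auto
  also have "\<dots> = (ennreal (l1n k * l2n g * l2n f))\<^sup>2"
    using nn_sqi[OF f] nn_sqi[OF g] nn_l1n[OF k]
    by (simp add: ennreal_power ennreal_mult[symmetric] power_mult_distrib mult_ac)
  finally show ?thesis by (rule ennreal_power2_le_imp_le)
qed

lemma bilinear_integrable:
  assumes f: "sqi f" and g: "sqi g" and k: "integrable lborel k"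
  shows "integrable (lborel \<Otimes>\<^sub>M lborel) (\<lambda>(x,y). g x * (k (y - x) * f y))"
proof (rule integrableI_bounded)
  note [measurable] = sqi_meas[OF f] sqi_meas[OF g]
  have [measurable]: "k \<in> borel_measurable borel" using k by auto
  show "(\<lambda>(x,y). g x * (k (y - x) * f y)) \<in> borel_measurable (lborel \<Otimes>\<^sub>M lborel)" by measurable
  have "(\<integral>\<^sup>+p. ennreal (norm (case p of (x,y) \<Rightarrow> g x * (k (y - x) * f y))) \<partial>(lborel \<Otimes>\<^sub>M lborel))
     = (\<integral>\<^sup>+x. (\<integral>\<^sup>+y. ennreal \<bar>g x\<bar> * (ennreal \<bar>k (y - x)\<bar> * ennreal \<bar>f y\<bar>) \<partial>lborel) \<partial>lborel)"
    by (subst lborel.nn_integral_fst[symmetric]) (auto simp: abs_mult ennreal_mult)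
  also have "\<dots> \<le> ennreal (l1n k * l2n g * l2n f)" by (rule bilinear_nn[OF f g k])
  finally show "(\<integral>\<^sup>+p. ennreal (norm (case p of (x,y) \<Rightarrow> g x * (k (y - x) * f y))) \<partial>(lborel \<Otimes>\<^sub>M lborel)) < \<infinity>"
    by (rule le_less_trans) simp
qed

lemma conv_L2:
  fixes k f :: "'a::euclidean_space \<Rightarrow> real"
  assumes f: "sqi f" and k: "integrable lborel k"
  shows "sqi (\<lambda>x. LINT y|lborel. k (y - x) * f y)"
    and "l2n (\<lambda>x. LINT y|lborel. k (y - x) * f y) \<le> l1n k * l2n f"
proof -
  note [measurable] = sqi_meas[OF f]
  have km[measurable]: "k \<in> borel_measurable borel" using k by auto
  have "(\<integral>\<^sup>+x. ennreal ((LINT y|lborel. k (y - x) * f y)\<^sup>2) \<partial>lborel)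
     \<le> (\<integral>\<^sup>+x. (\<integral>\<^sup>+y. ennreal \<bar>k (y - x)\<bar> * ennreal \<bar>f y\<bar> \<partial>lborel)\<^sup>2 \<partial>lborel)"
  proof (rule nn_integral_mono)
    fix x
    have "ennreal \<bar>LINT y|lborel. k (y - x) * f y\<bar> \<le> (\<integral>\<^sup>+y. ennreal \<bar>k (y - x)\<bar> * ennreal \<bar>f y\<bar> \<partial>lborel)"
      using integral_norm_bound_ennreal[of lborel "\<lambda>y. k (y - x) * f y"]
      by (cases "integrable lborel (\<lambda>y. k (y - x) * f y)")
         (auto simp: abs_mult ennreal_mult not_integrable_integral_eq)
    then have "(ennreal \<bar>LINT y|lborel. k (y - x) * f y\<bar>)\<^sup>2 \<le> (\<integral>\<^sup>+y. ennreal \<bar>k (y - x)\<bar> * ennreal \<bar>f y\<bar> \<partial>lborel)\<^sup>2"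
      by (rule power_mono) auto
    then show "ennreal ((LINT y|lborel. k (y - x) * f y)\<^sup>2) \<le> (\<integral>\<^sup>+y. ennreal \<bar>k (y - x)\<bar> * ennreal \<bar>f y\<bar> \<partial>lborel)\<^sup>2"
      by (simp add: ennreal_power)
  qed
  also have "\<dots> \<le> (\<integral>\<^sup>+x. ennreal \<bar>k x\<bar> \<partial>lborel)\<^sup>2 * (\<integral>\<^sup>+x. (ennreal \<bar>f x\<bar>)\<^sup>2 \<partial>lborel)"
    by (rule Young_nn) auto
  also have "\<dots> = ennreal ((l1n k * l2n f)\<^sup>2)"
    using nn_sqi[OF f] nn_l1n[OF k]
    by (simp add: ennreal_power ennreal_mult[symmetric] power_mult_distrib)
  finally have *: "(\<integral>\<^sup>+x. ennreal ((LINT y|lborel. k (y - x) * f y)\<^sup>2) \<partial>lborel) \<le> ennreal ((l1n k * l2n f)\<^sup>2)" .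
  show "sqi (\<lambda>x. LINT y|lborel. k (y - x) * f y)"
    "l2n (\<lambda>x. LINT y|lborel. k (y - x) * f y) \<le> l1n k * l2n f"
    by (rule sqiI_nn[OF _ *]; simp)+
qed

lemma conv_L2_left:
  fixes f k :: "'a::euclidean_space \<Rightarrow> real"
  assumes "sqi f" "integrable lborel k"
  shows "sqi (\<lambda>x. LINT y|lborel. f y * k (y - x))" "l2n (\<lambda>x. LINT y|lborel. f y * k (y - x)) \<le> l1n k * l2n f"
  using conv_L2[OF assms] by (simp_all add: mult.commute)

lemma sqi_minus: "sqi f \<Longrightarrow> sqi (\<lambda>x. - f x)" "l2n (\<lambda>x. - f x) = l2n f"
  using sqi_cmult[of f "-1"] by (simp_all add: l2n_def)

lemma l2n_triangle:
  fixes f g :: "'a::euclidean_space \<Rightarrow> real"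
  assumes f: "sqi f" and g: "sqi g"
  shows "l2n (\<lambda>x. f x + g x) \<le> l2n f + l2n g"
proof (rule power2_le_imp_le)
  have "(l2n (\<lambda>x. f x + g x))\<^sup>2 = (LINT x|lborel. (f x)\<^sup>2 + (g x)\<^sup>2 + 2 * (f x * g x))"
    unfolding l2n_sq by (simp add: power2_sum mult.assoc)
  also have "\<dots> = (l2n f)\<^sup>2 + (l2n g)\<^sup>2 + 2 * (LINT x|lborel. f x * g x)"
    using f g sqi_mult[OF f g] by (simp add: l2n_sq sqi_def)
  also have "\<dots> \<le> (l2n f + l2n g)\<^sup>2" using pair_le[OF f g] by (simp add: power2_sum abs_le_iff)
  finally show "(l2n (\<lambda>x. f x + g x))\<^sup>2 \<le> (l2n f + l2n g)\<^sup>2" .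
qed simp

section \<open>Differentiation and continuity of integrals\<close>

text \<open>The mean value theorem bounds the difference quotients by the dominating function, so dominated
  convergence applies.\<close>

lemma DERIV_integral_dominated:
  fixes f :: "real \<Rightarrow> 'b \<Rightarrow> real"
  assumes int: "\<And>s. a < s \<Longrightarrow> s < b \<Longrightarrow> integrable M (f s)"
    and der: "\<And>s y. a < s \<Longrightarrow> s < b \<Longrightarrow> ((\<lambda>s. f s y) has_real_derivative f' s y) (at s)"
    and bd: "\<And>s y. a < s \<Longrightarrow> s < b \<Longrightarrow> \<bar>f' s y\<bar> \<le> g y" and g: "integrable M g"
    and meas: "f' s0 \<in> borel_measurable M" and s0: "a < s0" "s0 < b"
  shows "((\<lambda>s. LINT y|M. f s y) has_real_derivative (LINT y|M. f' s0 y)) (at s0)"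
  unfolding has_field_derivative_iff tendsto_at_iff_sequentially
proof (intro allI impI)
  fix X :: "nat \<Rightarrow> real" assume X: "\<forall>i. X i \<in> UNIV - {s0}" "X \<longlonglongrightarrow> s0"
  have ev: "eventually (\<lambda>n. a < X n \<and> X n < b) sequentially"
    using order_tendstoD[OF X(2)] s0 by (auto intro: eventually_conj)
  then obtain N where N: "\<And>n. n \<ge> N \<Longrightarrow> a < X n \<and> X n < b"
    by (auto simp: eventually_sequentially)
  define Y where "Y n = X (n + N)" for n
  have Y: "a < Y n" "Y n < b" "Y n \<noteq> s0" for n using N X(1) by (auto simp: Y_def)
  have Yl: "Y \<longlonglongrightarrow> s0" unfolding Y_def by (rule LIMSEQ_ignore_initial_segment[OF X(2)])
  have "(\<lambda>n. LINT y|M. (f (Y n) y - f s0 y) / (Y n - s0)) \<longlonglongrightarrow> (LINT y|M. f' s0 y)"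
  proof (rule integral_dominated_convergence[where w=g])
    show "f' s0 \<in> borel_measurable M" by (rule meas)
    show "(\<lambda>y. (f (Y n) y - f s0 y) / (Y n - s0)) \<in> borel_measurable M" for n
      using int[of "Y n"] int[of s0] Y s0 by auto
    show "integrable M g" by (rule g)
    show "AE y in M. (\<lambda>n. (f (Y n) y - f s0 y) / (Y n - s0)) \<longlonglongrightarrow> f' s0 y"
    proof (rule AE_I2)
      fix y
      have "((\<lambda>s. (f s y - f s0 y) / (s - s0)) \<longlongrightarrow> f' s0 y) (at s0)"
        using der[OF s0, of y] by (simp add: has_field_derivative_iff)
      then show "(\<lambda>n. (f (Y n) y - f s0 y) / (Y n - s0)) \<longlonglongrightarrow> f' s0 y"
        using Yl Y(3) by (auto simp: tendsto_at_iff_sequentially o_def)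
    qed
    show "AE y in M. norm ((f (Y n) y - f s0 y) / (Y n - s0)) \<le> g y" for n
    proof (rule AE_I2)
      fix y
      have "\<exists>z. a < z \<and> z < b \<and> (f (Y n) y - f s0 y) / (Y n - s0) = f' z y"
      proof (cases "s0 < Y n")
        case True
        have "\<exists>z. s0 < z \<and> z < Y n \<and> f (Y n) y - f s0 y = (Y n - s0) * f' z y"
          using Y[of n] s0 by (intro MVT2[OF True] der) auto
        then show ?thesis using True Y[of n] s0 by (auto intro: exI less_trans)
      next
        case False
        then have lt: "Y n < s0" using Y(3)[of n] by simp
        have "\<exists>z. Y n < z \<and> z < s0 \<and> f s0 y - f (Y n) y = (s0 - Y n) * f' z y"
          using Y[of n] s0 by (intro MVT2[OF lt] der) auto
        then obtain z where z: "Y n < z" "z < s0" "f s0 y - f (Y n) y = (s0 - Y n) * f' z y" by auto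
        have "(f (Y n) y - f s0 y) / (Y n - s0) = f' z y"
          using z(3) lt by (simp add: divide_simps) (simp add: algebra_simps)
        then show ?thesis using z lt Y[of n] s0 by (intro exI[of _ z]) auto
      qed
      then obtain z where z: "a < z" "z < b" and e: "(f (Y n) y - f s0 y) / (Y n - s0) = f' z y" by blast
      show "norm ((f (Y n) y - f s0 y) / (Y n - s0)) \<le> g y" unfolding e using bd[OF z, of y] by simp
    qed
  qed
  moreover have "(LINT y|M. (f (Y n) y - f s0 y) / (Y n - s0)) =
      ((LINT y|M. f (Y n) y) - (LINT y|M. f s0 y)) / (Y n - s0)" for n
    using int[of "Y n"] int[of s0] Y s0 by simp
  ultimately have "(\<lambda>n. ((LINT y|M. f (Y n) y) - (LINT y|M. f s0 y)) / (Y n - s0)) \<longlonglongrightarrow> (LINT y|M. f' s0 y)"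
    by (simp only:)
  then show "((\<lambda>s. ((LINT y|M. f s y) - (LINT y|M. f s0 y)) / (s - s0)) \<circ> X) \<longlonglongrightarrow> (LINT y|M. f' s0 y)"
    unfolding Y_def o_def by (rule LIMSEQ_offset)
qed

text \<open>The factor \<open>f p\<close> is bounded in \<open>L\<^sup>2\<close> but has no common majorant. The integrals over large boxes are
  continuous, and by Cauchy--Schwarz they converge uniformly because the tails of the majorant \<open>h\<close> of
  the other factor are small in \<open>L\<^sup>2\<close>.\<close>

lemma continuous_integral_L2_pair:
  fixes f g :: "'p::topological_space \<Rightarrow> 'a::euclidean_space \<Rightarrow> real"
  assumes cf: "continuous_on (P \<times> UNIV) (\<lambda>(p,y). f p y)"
    and cg: "continuous_on (P \<times> UNIV) (\<lambda>(p,y). g p y)"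
    and f: "\<And>p. p \<in> P \<Longrightarrow> sqi (f p)" "\<And>p. p \<in> P \<Longrightarrow> l2n (f p) \<le> M"
    and g: "\<And>p y. p \<in> P \<Longrightarrow> \<bar>g p y\<bar> \<le> h y" and h: "sqi h"
  shows "continuous_on P (\<lambda>p. LINT y|lborel. f p y * g p y)"
proof -
  note [measurable] = sqi_meas[OF h]
  have h0: "0 \<le> h y" if "p \<in> P" for p y using g[OF that, of y] by linarith
  define C where "C n = cbox (- (real n *\<^sub>R One)) (real n *\<^sub>R One :: 'a)" for n :: nat
  define I where "I n p = integral (C n) (\<lambda>y. f p y * g p y)" for n p
  define t where "t n = l2n (\<lambda>y. indicator (- C n) y * h y)" for n
  have [measurable]: "C n \<in> sets borel" for n by (simp add: C_def)
  have tq: "sqi (\<lambda>y. indicator (- C n) y * h y)" for n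
    by (rule sqi_dominated(1)[OF _ h]) (auto simp: indicator_def)
  have inC: "eventually (\<lambda>n. y \<in> C n) sequentially" for y :: 'a
  proof -
    obtain N :: nat where N: "norm y \<le> real N" using real_arch_simple by blast
    have "y \<in> C n" if "n \<ge> N" for n
      unfolding C_def mem_box
    proof (safe)
      fix i :: 'a assume i: "i \<in> Basis"
      have "\<bar>y \<bullet> i\<bar> \<le> real n" using Basis_le_norm[OF i, of y] N that by linarith
      then show "- (real n *\<^sub>R One) \<bullet> i \<le> y \<bullet> i" "y \<bullet> i \<le> (real n *\<^sub>R One) \<bullet> i"
        using i by auto
    qed
    then show ?thesis by (auto simp: eventually_sequentially)
  qed
  have t0: "t \<longlonglongrightarrow> 0"
  proof -
    have "(\<lambda>n. LINT y|lborel. (indicator (- C n) y * h y)\<^sup>2) \<longlonglongrightarrow> (LINT y|(lborel::'a measure). 0)"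
    proof (rule integral_dominated_convergence[where w="\<lambda>y. (h y)\<^sup>2"])
      show "integrable lborel (\<lambda>y. (h y)\<^sup>2)" using h by (simp add: sqi_def)
      show "AE y in lborel. (\<lambda>n. (indicator (- C n) y * h y)\<^sup>2) \<longlonglongrightarrow> 0"
      proof (rule AE_I2)
        fix y
        have "eventually (\<lambda>n. (indicator (- C n) y * h y)\<^sup>2 = 0) sequentially"
          using inC[of y] by eventually_elim simp
        then show "(\<lambda>n. (indicator (- C n) y * h y)\<^sup>2) \<longlonglongrightarrow> 0" by (rule tendsto_eventually)
      qed
      show "AE y in lborel. norm ((indicator (- C n) y * h y)\<^sup>2) \<le> (h y)\<^sup>2" for n
        by (rule AE_I2) (auto simp: indicator_def)
    qed auto
    then have "(\<lambda>n. sqrt (LINT y|lborel. (indicator (- C n) y * h y)\<^sup>2)) \<longlonglongrightarrow> sqrt 0"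
      by (intro tendsto_real_sqrt) simp
    then show ?thesis unfolding t_def l2n_def by simp
  qed
  have gm: "g p \<in> borel_measurable borel" if "p \<in> P" for p
  proof (rule borel_measurable_continuous_onI)
    have "continuous_on UNIV (\<lambda>y. (p, y))" by (intro continuous_intros)
    from continuous_on_compose2[OF cg this] show "continuous_on UNIV (g p)" using that by auto
  qed
  have gs: "sqi (g p)" if "p \<in> P" for p
    by (rule sqi_dominated(1)[OF gm[OF that] h]) (use g[OF that] h0[OF that] in auto)
  have diff: "\<bar>I n p - (LINT y|lborel. f p y * g p y)\<bar> \<le> M * t n" if p: "p \<in> P" for n p
  proof -
    note fp = f(1)[OF p] and [measurable] = sqi_meas[OF f(1)[OF p]] gm[OF p]
    have fg: "integrable lborel (\<lambda>y. f p y * g p y)" by (rule sqi_mult[OF fp gs[OF p]])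
    have "set_integrable lborel (C n) (\<lambda>y. f p y * g p y)"
      unfolding set_integrable_def by (rule integrable_mult_indicator[OF _ fg]) auto
    then have "I n p = (LINT y:C n|lborel. f p y * g p y)"
      unfolding I_def by (rule set_borel_integral_eq_integral(2)[symmetric])
    then have "(LINT y|lborel. f p y * g p y) - I n p =
       (LINT y|lborel. f p y * g p y - indicator (C n) y *\<^sub>R (f p y * g p y))"
      unfolding set_lebesgue_integral_def
      by (subst Bochner_Integration.integral_diff) (auto intro!: fg integrable_mult_indicator[OF _ fg, simplified])
    also have "\<dots> = (LINT y|lborel. f p y * (indicator (- C n) y * g p y))"
      by (intro Bochner_Integration.integral_cong) (auto simp: indicator_def)
    finally have "\<bar>I n p - (LINT y|lborel. f p y * g p y)\<bar> = \<bar>LINT y|lborel. f p y * (indicator (- C n) y * g p y)\<bar>"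
      by (simp add: abs_minus_commute)
    also have "\<dots> \<le> l2n (f p) * l2n (\<lambda>y. indicator (- C n) y * g p y)"
      by (intro pair_le fp sqi_dominated(1)[OF _ gs[OF p]]) (auto simp: indicator_def)
    also have "\<dots> \<le> M * t n"
    proof (rule mult_mono)
      show "l2n (\<lambda>y. indicator (- C n) y * g p y) \<le> t n" unfolding t_def
        by (rule sqi_dominated(2)[OF _ tq]) (use g[OF p] h0[OF p] in \<open>auto simp: indicator_def\<close>)
      show "0 \<le> M" using f(2)[OF p] l2n_nonneg[of "f p"] by linarith
    qed (use f(2)[OF p] in auto)
    finally show ?thesis .
  qed
  have unif: "uniform_limit P I (\<lambda>p. LINT y|lborel. f p y * g p y) sequentially"
  proof (rule uniform_limitI)
    fix e :: real assume "e > 0"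
    have "(\<lambda>n. M * t n) \<longlonglongrightarrow> M * 0" by (intro tendsto_intros t0)
    then have "eventually (\<lambda>n. M * t n < e) sequentially" using \<open>e > 0\<close> by (intro order_tendstoD) auto
    then show "\<forall>\<^sub>F n in sequentially. \<forall>x\<in>P. dist (I n x) (LINT y|lborel. f x y * g x y) < e"
      by eventually_elim (auto simp: dist_real_def intro: le_less_trans[OF diff])
  qed
  have "continuous_on P (I n)" for n
    unfolding I_def C_def
    by (rule integral_continuous_on_param)
       (auto simp: split_beta intro!: continuous_intros continuous_on_subset[OF cf[unfolded split_beta]] continuous_on_subset[OF cg[unfolded split_beta]])
  then show ?thesis
    by (intro uniform_limit_theorem[OF _ unif]) auto
qed

section \<open>Directional derivatives and integration by parts\<close>

text \<open>Differentiability along one line direction only: enough for integration by parts, and stable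
  under convolution without any discussion of total derivatives.\<close>

definition deriv_along :: "'a::euclidean_space \<Rightarrow> ('a \<Rightarrow> real) \<Rightarrow> ('a \<Rightarrow> real) \<Rightarrow> bool" where
  "deriv_along e f f' \<longleftrightarrow> (\<forall>x. ((\<lambda>h. f (x + h *\<^sub>R e)) has_real_derivative f' x) (at 0))"

lemma deriv_alongD:
  assumes "deriv_along e f f'"
  shows "((\<lambda>h. f (x + h *\<^sub>R e)) has_real_derivative f' (x + r *\<^sub>R e)) (at r)"
proof -
  have "((\<lambda>h. f ((x + r *\<^sub>R e) + h *\<^sub>R e)) has_real_derivative f' (x + r *\<^sub>R e)) (at 0)"
    using assms by (simp add: deriv_along_def)
  then have "((\<lambda>h. f (x + (h + r) *\<^sub>R e)) has_real_derivative f' (x + r *\<^sub>R e)) (at 0)"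
    by (simp add: algebra_simps)
  then show ?thesis using DERIV_shift[of "\<lambda>h. f (x + h *\<^sub>R e)" _ 0 r] by simp
qed

lemma deriv_along_mult:
  "deriv_along e f f' \<Longrightarrow> deriv_along e g g' \<Longrightarrow> deriv_along e (\<lambda>x. f x * g x) (\<lambda>x. f' x * g x + f x * g' x)"
  unfolding deriv_along_def by (auto intro!: derivative_eq_intros)

lemma deriv_along_add:
  "deriv_along e f f' \<Longrightarrow> deriv_along e g g' \<Longrightarrow> deriv_along e (\<lambda>x. f x + g x) (\<lambda>x. f' x + g' x)"
  unfolding deriv_along_def by (auto intro!: derivative_eq_intros)

lemma deriv_along_cmult:
  "deriv_along e f f' \<Longrightarrow> deriv_along e (\<lambda>x. c * f x) (\<lambda>x. c * f' x)"
  unfolding deriv_along_def by (auto intro!: derivative_eq_intros)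

lemma deriv_along_shift:
  assumes "deriv_along e f f'" shows "deriv_along e (\<lambda>y. f (y - a)) (\<lambda>y. f' (y - a))"
  unfolding deriv_along_def
proof
  fix x show "((\<lambda>h. f (x + h *\<^sub>R e - a)) has_real_derivative f' (x - a)) (at 0)"
    using assms[unfolded deriv_along_def, rule_format, of "x - a"] by (simp add: algebra_simps)
qed

lemma deriv_along_reflect:
  assumes "deriv_along e f f'" shows "deriv_along e (\<lambda>y. f (a - y)) (\<lambda>y. - f' (a - y))"
  unfolding deriv_along_def
proof
  fix x
  have "((\<lambda>h. f ((a - x) + h *\<^sub>R e)) has_real_derivative f' (a - x)) (at (- 0))"
    using assms by (simp add: deriv_along_def)
  then have "((\<lambda>h. f ((a - x) + (- h) *\<^sub>R e)) has_real_derivative - f' (a - x)) (at 0)"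
    by (subst (asm) DERIV_mirror) simp
  then show "((\<lambda>h. f (a - (x + h *\<^sub>R e))) has_real_derivative - f' (a - x)) (at 0)"
    by (simp add: algebra_simps)
qed

text \<open>Averaging \<open>f'(x + s e)\<close> over \<open>s \<in> [0,1]\<close> gives \<open>f(x + e) - f(x)\<close>, whose integral vanishes by
  translation invariance.\<close>

lemma integral_deriv_along_zero:
  fixes f :: "'a::euclidean_space \<Rightarrow> real"
  assumes d: "deriv_along e f f'" and c': "continuous_on UNIV f'"
    and i: "integrable lborel f" and i': "integrable lborel f'"
  shows "(LINT x|lborel. f' x) = 0"
proof -
  have [measurable]: "f \<in> borel_measurable borel" "f' \<in> borel_measurable borel" using i i' by auto
  let ?S = "{0..1::real}"
  let ?F = "\<lambda>s x. indicator ?S s * f' (x + s *\<^sub>R e)"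
  have sh: "(\<integral>\<^sup>+x. ennreal \<bar>f' (x + a)\<bar> \<partial>lborel) = ennreal (l1n f')" for a
    using nn_shift[of "\<lambda>x. ennreal \<bar>f' x\<bar>" "-a"] nn_l1n[OF i'] by simp
  have int: "integrable (lborel \<Otimes>\<^sub>M lborel) (\<lambda>(s,x). ?F s x)"
  proof (rule integrableI_bounded)
    show "(\<lambda>(s,x). ?F s x) \<in> borel_measurable (lborel \<Otimes>\<^sub>M lborel)" by measurable
    have "(\<integral>\<^sup>+p. ennreal (norm (case p of (s,x) \<Rightarrow> ?F s x)) \<partial>(lborel \<Otimes>\<^sub>M lborel)) =
      (\<integral>\<^sup>+s. (\<integral>\<^sup>+x. indicator ?S s * ennreal \<bar>f' (x + s *\<^sub>R e)\<bar> \<partial>lborel) \<partial>lborel)"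
      by (subst lborel.nn_integral_fst[symmetric]) (auto simp: abs_mult indicator_def intro!: nn_integral_cong)
    also have "\<dots> = (\<integral>\<^sup>+s. indicator ?S s * ennreal (l1n f') \<partial>lborel)"
      by (intro nn_integral_cong, subst nn_integral_cmult) (auto simp: sh)
    also have "\<dots> < \<infinity>" by (subst nn_integral_multc) auto
    finally show "(\<integral>\<^sup>+p. ennreal (norm (case p of (s,x) \<Rightarrow> ?F s x)) \<partial>(lborel \<Otimes>\<^sub>M lborel)) < \<infinity>" .
  qed
  have inner: "(LINT s|lborel. ?F s x) = f (x + e) - f x" for x
  proof -
    have "(LINT s|lborel. f' (x + s *\<^sub>R e) * indicator {0..1} s) = f (x + 1 *\<^sub>R e) - f (x + 0 *\<^sub>R e)"
      by (rule integral_FTC_Icc_real) (auto intro!: deriv_alongD[OF d] continuous_on_interior isCont_o2[OF _ continuous_on_interior[OF c']] continuous_intros)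
    then show ?thesis by (simp add: mult.commute)
  qed
  have "(LINT x|lborel. (LINT s|lborel. ?F s x)) = 0"
  proof -
    have 1: "integrable lborel (\<lambda>x. f (x + e))" using integrable_shift[OF i, of "-e"] by simp
    have 2: "(LINT x|lborel. f (x + e)) = (LINT x|lborel. f x)" using integral_shift[of f "-e"] by simp
    have "(LINT x|lborel. (LINT s|lborel. ?F s x)) = (LINT x|lborel. f (x + e) - f x)"
      by (simp only: inner)
    also have "\<dots> = 0" by (subst Bochner_Integration.integral_diff[OF 1 i]) (simp add: 2)
    finally show ?thesis .
  qed
  then have "0 = (LINT s|lborel. (LINT x|lborel. ?F s x))"
    using lborel_pair.Fubini_integral[OF int] by (simp only:)
  also have "\<dots> = (LINT s|lborel. indicator ?S s * (LINT x|lborel. f' x))"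
  proof (rule Bochner_Integration.integral_cong[OF refl])
    fix s :: real
    show "(LINT x|lborel. ?F s x) = indicator ?S s * (LINT x|lborel. f' x)"
      using integral_shift[of f' "- (s *\<^sub>R e)"] by simp
  qed
  also have "\<dots> = (LINT s|lborel. indicator ?S s) * (LINT x|lborel. f' x)"
    by (rule integral_mult_left_zero)
  also have "(LINT s|lborel. indicator ?S s) = (1::real)" by simp
  finally show ?thesis by simp
qed

lemma integral_by_parts_along:
  fixes f g :: "'a::euclidean_space \<Rightarrow> real"
  assumes "deriv_along e f f'" "deriv_along e g g'"
    and c: "continuous_on UNIV f" "continuous_on UNIV g" "continuous_on UNIV f'" "continuous_on UNIV g'"
    and i: "integrable lborel (\<lambda>x. f x * g x)" "integrable lborel (\<lambda>x. f' x * g x)" "integrable lborel (\<lambda>x. f x * g' x)"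
  shows "(LINT x|lborel. f' x * g x) = - (LINT x|lborel. f x * g' x)"
proof -
  have "(LINT x|lborel. f' x * g x + f x * g' x) = 0"
    by (rule integral_deriv_along_zero[OF deriv_along_mult[OF assms(1,2)]])
       (use i in \<open>auto intro!: continuous_intros c\<close>)
  then show ?thesis using i by simp
qed

lemma integrable_compact_supp:
  fixes f g :: "'a::euclidean_space \<Rightarrow> real"
  assumes c: "continuous_on UNIV f" "continuous_on UNIV g" and z: "\<And>x. norm x > R \<Longrightarrow> g x = 0"
  shows "integrable lborel (\<lambda>x. f x * g x)"
proof -
  have "integrable lborel (\<lambda>x. indicator (cball 0 R) x *\<^sub>R (f x * g x))"
    by (intro borel_integrable_compact continuous_intros continuous_on_subset[OF c(1)] continuous_on_subset[OF c(2)]) auto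
  also have "(\<lambda>x. indicator (cball 0 R) x *\<^sub>R (f x * g x)) = (\<lambda>x. f x * g x)"
    using z by (auto simp: indicator_def fun_eq_iff not_le)
  finally show ?thesis .
qed


section \<open>Radial functions and their derivatives\<close>

lemma deriv_along_eq: "deriv_along e f f' \<Longrightarrow> (\<And>x. f' x = g x) \<Longrightarrow> deriv_along e f g"
  by (simp add: deriv_along_def)

definition dl :: "3 \<Rightarrow> 3 \<Rightarrow> real" where "dl i j = (if i = j then 1 else 0)"

text \<open>Let \<open>P 0\<close> be a function on the half line and \<open>P m\<close> its \<open>m\<close>-th derivative up to the sign \<open>(-1)\<^sup>m\<close>.
  Then \<open>T0\<close> is the radial function \<open>P 0 (\<bar>z\<bar>\<^sup>2)\<close>, and \<open>T1\<close>, ..., \<open>T4\<close> are the components of its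
  derivatives of order one to four.\<close>

definition T0 :: "(nat \<Rightarrow> real \<Rightarrow> real) \<Rightarrow> vec3 \<Rightarrow> real" where "T0 P z = P 0 (z \<bullet> z)"
definition T1 :: "(nat \<Rightarrow> real \<Rightarrow> real) \<Rightarrow> 3 \<Rightarrow> vec3 \<Rightarrow> real" where
  "T1 P i z = - 2 * z $ i * P 1 (z \<bullet> z)"
definition T2 :: "(nat \<Rightarrow> real \<Rightarrow> real) \<Rightarrow> 3 \<Rightarrow> 3 \<Rightarrow> vec3 \<Rightarrow> real" where
  "T2 P i j z = 4 * (z $ i * z $ j) * P 2 (z \<bullet> z) - 2 * dl i j * P 1 (z \<bullet> z)"
definition T3 :: "(nat \<Rightarrow> real \<Rightarrow> real) \<Rightarrow> 3 \<Rightarrow> 3 \<Rightarrow> 3 \<Rightarrow> vec3 \<Rightarrow> real" where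
  "T3 P i j k z = - 8 * (z $ i * z $ j * z $ k) * P 3 (z \<bullet> z)
     + 4 * (dl i j * z $ k + dl i k * z $ j + dl j k * z $ i) * P 2 (z \<bullet> z)"
definition T4 :: "(nat \<Rightarrow> real \<Rightarrow> real) \<Rightarrow> 3 \<Rightarrow> 3 \<Rightarrow> 3 \<Rightarrow> 3 \<Rightarrow> vec3 \<Rightarrow> real" where
  "T4 P i j k l z = 16 * (z $ i * z $ j * z $ k * z $ l) * P 4 (z \<bullet> z)
     - 8 * (dl i l * (z $ j * z $ k) + dl j l * (z $ i * z $ k) + dl k l * (z $ i * z $ j)
          + dl i j * (z $ k * z $ l) + dl i k * (z $ j * z $ l) + dl j k * (z $ i * z $ l)) * P 3 (z \<bullet> z)
     + 4 * (dl i j * dl k l + dl i k * dl j l + dl j k * dl i l) * P 2 (z \<bullet> z)"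

text \<open>The Laplacian of the radial function belonging to \<open>P\<close> is the radial function belonging to \<open>LP P\<close>;
  the constant \<open>6 + 4 m\<close> is \<open>2 (3 + 2 m)\<close>, with the dimension \<open>3\<close>.\<close>

definition LP :: "(nat \<Rightarrow> real \<Rightarrow> real) \<Rightarrow> nat \<Rightarrow> real \<Rightarrow> real" where
  "LP P m u = 4 * u * P (m + 2) u - (6 + 4 * real m) * P (m + 1) u"

lemma dl_sym: "dl i j = dl j i" by (simp add: dl_def)
lemma dl_abs: "\<bar>dl i j\<bar> \<le> 1" by (simp add: dl_def)

lemma inner_vec3: "(z::vec3) \<bullet> z = (\<Sum>l\<in>UNIV. z $ l * z $ l)"
  by (simp add: inner_vec_def)

text \<open>Contracting two indices of the derivatives of order two, three and four takes the Laplacian.\<close>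

lemma sum_T2: "(\<Sum>a\<in>UNIV. T2 P a a z) = T0 (LP P) z"
  by (simp add: T2_def T0_def LP_def sum_3 dl_def inner_vec3 algebra_simps numeral_2_eq_2 One_nat_def)

lemma sum_T3: "(\<Sum>a\<in>UNIV. T3 P a a k z) = T1 (LP P) k z"
  using exhaust_3[of k]
  by (auto simp add: T3_def T1_def LP_def sum_3 dl_def inner_vec3 algebra_simps numeral_3_eq_3 numeral_2_eq_2)

lemma dl_sum: "(\<Sum>l\<in>UNIV. dl i l * f l) = f i"
  by (simp add: dl_def if_distrib[of "\<lambda>x. x * _"] cong: if_cong)

lemma sum_T4: "(\<Sum>l\<in>UNIV. T4 P i j l l z) = T2 (LP P) i j z"
proof -
  define u where "u = z \<bullet> z"
  have u: "(\<Sum>l\<in>UNIV. z $ l * z $ l) = u" by (simp add: u_def inner_vec3)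
  have "T4 P i j l l z = 16 * (z $ i * z $ j) * P 4 u * (z $ l * z $ l)
     - 8 * P 3 u * (2 * (dl i l * (z $ j * z $ l)) + 2 * (dl j l * (z $ i * z $ l)) + z $ i * z $ j + dl i j * (z $ l * z $ l))
     + 4 * P 2 u * (dl i j + 2 * (dl i l * dl j l))" for l
    by (simp add: T4_def u_def dl_def[of l l] algebra_simps)
  then have "(\<Sum>l\<in>UNIV. T4 P i j l l z) = 16 * (z $ i * z $ j) * P 4 u * u
     - 8 * P 3 u * (2 * (z $ j * z $ i) + 2 * (z $ i * z $ j) + 3 * (z $ i * z $ j) + dl i j * u)
     + 4 * P 2 u * (3 * dl i j + 2 * dl j i)"
    by (simp add: sum.distrib sum_subtractf sum_distrib_left[symmetric] dl_sum u)
  then show ?thesis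
    by (simp add: T2_def LP_def u_def[symmetric] dl_sym[of j i] eval_nat_numeral algebra_simps)
qed

lemma T3_perm: "T3 P i j k = T3 P j i k" "T3 P i j k = T3 P i k j"
  by (auto simp: T3_def dl_sym algebra_simps fun_eq_iff)

lemma T2_sym: "T2 P i j = T2 P j i"
  by (auto simp: T2_def dl_sym algebra_simps fun_eq_iff)

lemma deriv_along_coord: "deriv_along (axis j 1) (\<lambda>z::vec3. z $ i) (\<lambda>z. dl i j)"
  unfolding deriv_along_def by (auto intro!: derivative_eq_intros simp: axis_def dl_def)

lemma deriv_along_radial:
  assumes "\<And>u. (p has_real_derivative - p' u) (at u)"
  shows "deriv_along (axis j 1) (\<lambda>z::vec3. p (z \<bullet> z)) (\<lambda>z. - 2 * z $ j * p' (z \<bullet> z))"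
  unfolding deriv_along_def
proof
  fix x :: vec3
  have e: "(x + h *\<^sub>R axis j 1) \<bullet> (x + h *\<^sub>R axis j 1) = x \<bullet> x + 2 * h * x $ j + h\<^sup>2" for h
    by (simp add: inner_add_left inner_add_right inner_axis inner_axis' inner_axis_axis power2_eq_square algebra_simps)
  have "((\<lambda>h. x \<bullet> x + 2 * h * x $ j + h\<^sup>2) has_real_derivative 2 * x $ j) (at 0)"
    by (auto intro!: derivative_eq_intros)
  from DERIV_chain2[OF assms this]
  show "((\<lambda>h. p ((x + h *\<^sub>R axis j 1) \<bullet> (x + h *\<^sub>R axis j 1))) has_real_derivative - 2 * x $ j * p' (x \<bullet> x)) (at 0)"
    unfolding e by (simp add: algebra_simps)
qed

lemma deriv_T0:
  assumes "\<And>u. (P 0 has_real_derivative - P 1 u) (at u)"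
  shows "deriv_along (axis j 1) (T0 P) (T1 P j)"
  unfolding T0_def[abs_def] T1_def[abs_def] by (rule deriv_along_radial[OF assms])

lemma deriv_T1:
  assumes "\<And>u. (P 1 has_real_derivative - P 2 u) (at u)"
  shows "deriv_along (axis j 1) (T1 P i) (T2 P i j)"
  unfolding T1_def[abs_def]
  by (rule deriv_along_eq[OF deriv_along_mult[OF deriv_along_cmult[OF deriv_along_coord] deriv_along_radial[OF assms]]])
     (simp add: T2_def algebra_simps)

lemma deriv_T2:
  assumes "\<And>u. (P 1 has_real_derivative - P 2 u) (at u)" "\<And>u. (P 2 has_real_derivative - P 3 u) (at u)"
  shows "deriv_along (axis k 1) (T2 P i j) (T3 P i j k)"
proof -
  have "T2 P i j = (\<lambda>z. 4 * (z $ i * z $ j) * P 2 (z \<bullet> z) + (- 2 * dl i j) * P 1 (z \<bullet> z))"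
    by (auto simp: T2_def fun_eq_iff)
  then show ?thesis
    by (simp only:)
       (rule deriv_along_eq[OF deriv_along_add[OF
          deriv_along_mult[OF deriv_along_cmult[OF deriv_along_mult[OF deriv_along_coord deriv_along_coord]] deriv_along_radial[OF assms(2)]]
          deriv_along_cmult[OF deriv_along_radial[OF assms(1)]]]],
        simp add: T3_def algebra_simps)
qed

lemma deriv_T3:
  assumes "\<And>u. (P 2 has_real_derivative - P 3 u) (at u)" "\<And>u. (P 3 has_real_derivative - P 4 u) (at u)"
  shows "deriv_along (axis l 1) (T3 P i j k) (T4 P i j k l)"
  unfolding T3_def[abs_def]
  by (rule deriv_along_eq[OF deriv_along_add[OF
          deriv_along_mult[OF deriv_along_cmult[OF deriv_along_mult[OF deriv_along_mult[OF deriv_along_coord deriv_along_coord] deriv_along_coord]] deriv_along_radial[OF assms(2)]]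
          deriv_along_mult[OF deriv_along_cmult[OF deriv_along_add[OF deriv_along_add[OF deriv_along_cmult[OF deriv_along_coord] deriv_along_cmult[OF deriv_along_coord]] deriv_along_cmult[OF deriv_along_coord]]] deriv_along_radial[OF assms(1)]]]])
     (simp add: T4_def algebra_simps)

lemma DERIV_LP:
  assumes "\<And>u. (P (m+1) has_real_derivative - P (m+2) u) (at u)" "\<And>u. (P (m+2) has_real_derivative - P (m+3) u) (at u)"
  shows "(LP P m has_real_derivative - LP P (m+1) u) (at u)"
  unfolding LP_def[abs_def]
  by (rule derivative_eq_intros assms refl)+ (simp add: numeral_3_eq_3 numeral_2_eq_2 algebra_simps)

section \<open>The Newtonian potential of the heat kernel and its compactly supported approximants\<close>

text \<open>Up to sign, the \<open>m\<close>-th derivative of \<open>max 0 (1 - a/n) ^ n\<close>, which approximates \<open>exp (- a)\<close> from below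
  and has compact support on the half line.\<close>

definition Ef :: "nat \<Rightarrow> nat \<Rightarrow> real \<Rightarrow> real" where
  "Ef n m a = (\<Prod>i<m. 1 - real i / real n) * max 0 (1 - a / real n) ^ (n - m)"

definition Pa :: "nat \<Rightarrow> real \<Rightarrow> nat \<Rightarrow> real \<Rightarrow> real" where
  "Pa n l m u = integral {1 / real n..l} (\<lambda>\<sigma>. \<sigma> ^ (2*m) * Ef n m (u * \<sigma>\<^sup>2))"

text \<open>For \<open>m = 0\<close> and \<open>l = 1 / (2 sqrt t)\<close>, evaluated at \<open>u = \<bar>z\<bar>\<^sup>2\<close>, this is a multiple of the Newtonian
  potential of the heat kernel at time \<open>t\<close>. The approximants \<open>Pa n l\<close> replace the exponential by
  its compactly supported approximation and cut off small \<open>\<sigma>\<close>, which makes them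
  compactly supported in \<open>u\<close>.\<close>

definition Pl :: "real \<Rightarrow> nat \<Rightarrow> real \<Rightarrow> real" where
  "Pl l m u = integral {0..l} (\<lambda>\<sigma>. \<sigma> ^ (2*m) * exp (- (u * \<sigma>\<^sup>2)))"

lemma DERIV_max0_power:
  assumes "p \<ge> 2"
  shows "((\<lambda>x. max 0 x ^ p) has_real_derivative real p * max 0 x ^ (p - 1)) (at (x::real))"
proof (cases "x = 0")
  case False
  consider "x > 0" | "x < 0" using False by linarith
  then show ?thesis
  proof cases
    case 1
    have "((\<lambda>x. x ^ p) has_real_derivative real p * max 0 x ^ (p - 1)) (at x)"
      using 1 by (auto intro!: derivative_eq_intros)
    then show ?thesis
      by (rule has_field_derivative_transform_within_open[where S="{0<..}"]) (use 1 in auto)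
  next
    case 2
    have "((\<lambda>x. 0) has_real_derivative real p * max 0 x ^ (p - 1)) (at x)"
      using 2 assms by (auto intro!: derivative_eq_intros)
    then show ?thesis
      by (rule has_field_derivative_transform_within_open[where S="{..<0}"]) (use 2 assms in auto)
  qed
next
  case True
  obtain q where q: "p = Suc (Suc q)" using assms by (metis add_2_eq_Suc le_Suc_ex)
  have "((\<lambda>h. \<bar>h\<bar>) \<longlongrightarrow> 0) (at (0::real))" by (auto intro!: tendsto_eq_intros)
  have "((\<lambda>h. (max 0 (0 + h) ^ p - max 0 0 ^ p) / h) \<longlongrightarrow> 0) (at (0::real))"
  proof (rule Lim_null_comparison)
    show "((\<lambda>h. \<bar>h\<bar> ^ Suc q) \<longlongrightarrow> 0) (at (0::real))" by (auto intro!: tendsto_eq_intros)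
    show "\<forall>\<^sub>F h in at 0. norm ((max 0 (0 + h) ^ p - max 0 0 ^ p) / h) \<le> \<bar>h\<bar> ^ Suc q"
    proof (rule always_eventually, rule allI)
      fix h :: real
      show "norm ((max 0 (0 + h) ^ p - max 0 0 ^ p) / h) \<le> \<bar>h\<bar> ^ Suc q"
      proof (cases "h \<ge> 0")
        case True then show ?thesis by (simp add: q abs_mult)
      next
        case False
        then have "max 0 (0 + h) = 0" by simp
        then show ?thesis using zero_le_power_abs[of h "Suc q"] by (simp only: diff_self div_0 norm_zero max.idem)
      qed
    qed
  qed
  then show ?thesis using True assms by (simp add: DERIV_def q)
qed

lemma DERIV_Ef:
  assumes "n \<ge> m + 2"
  shows "(Ef n m has_real_derivative - Ef n (Suc m) a) (at a)"
proof -
  have "((\<lambda>a. (\<Prod>i<m. 1 - real i / real n) * max 0 (1 - a / real n) ^ (n - m)) has_real_derivative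
      (\<Prod>i<m. 1 - real i / real n) * (real (n - m) * max 0 (1 - a / real n) ^ (n - m - 1) * (- 1 / real n))) (at a)"
    by (rule DERIV_cmult, rule DERIV_chain2[OF DERIV_max0_power]) (use assms in \<open>auto intro!: derivative_eq_intros\<close>)
  moreover have e: "1 - real m / real n = real (n - m) / real n" using assms by (simp add: field_simps of_nat_diff)
  moreover have "- Ef n (Suc m) a =
     (\<Prod>i<m. 1 - real i / real n) * (real (n - m) * max 0 (1 - a / real n) ^ (n - m - 1) * (- 1 / real n))"
  proof -
    have alg: "- (A * (R / N) * X) = A * (R * X * (- 1 / N))" for A R N X :: real by simp
    have "n - Suc m = n - m - 1" by simp
    then show ?thesis unfolding Ef_def prod.lessThan_Suc e by (simp only: alg)
  qed
  moreover have "Ef n m = (\<lambda>a. (\<Prod>i<m. 1 - real i / real n) * max 0 (1 - a / real n) ^ (n - m))"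
    by (simp add: Ef_def fun_eq_iff)
  ultimately show ?thesis by (simp only:)
qed

lemma continuous_Ef: "continuous_on S (Ef n m)"
  unfolding Ef_def[abs_def] divide_inverse by (intro continuous_intros)

lemma Ef_coeff: assumes "m \<le> n" shows "0 \<le> (\<Prod>i<m. 1 - real i / real n)" "(\<Prod>i<m. 1 - real i / real n) \<le> 1"
proof -
  have "0 \<le> 1 - real i / real n \<and> 1 - real i / real n \<le> 1" if "i < m" for i
    using that assms by (auto simp: field_simps)
  then show "0 \<le> (\<Prod>i<m. 1 - real i / real n)" "(\<Prod>i<m. 1 - real i / real n) \<le> 1"
    by (auto intro!: prod_nonneg prod_le_1)
qed

text \<open>The exponent \<open>n - m\<close> is at least \<open>n / 2\<close>, which costs half of the exponential decay.\<close>

lemma Ef_bound: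
  assumes n: "n \<ge> 2 * m" "n > 0" and a: "a \<ge> 0"
  shows "0 \<le> Ef n m a" "Ef n m a \<le> exp (- a / 2)"
proof -
  have mn: "m \<le> n" using n by simp
  show "0 \<le> Ef n m a" unfolding Ef_def using Ef_coeff(1)[OF mn] by simp
  have "max 0 (1 - a / real n) \<le> exp (- a / real n)"
    using exp_ge_add_one_self[of "- a / real n"] by simp
  then have "max 0 (1 - a / real n) ^ (n - m) \<le> exp (- a / real n) ^ (n - m)"
    by (rule power_mono) auto
  also have "\<dots> = exp (- a * (real (n - m) / real n))" by (simp add: exp_of_nat_mult[symmetric])
  also have "\<dots> \<le> exp (- a / 2)"
  proof -
    have "real n \<le> 2 * real (n - m)" using n by (simp add: of_nat_diff)
    then have "1/2 \<le> real (n - m) / real n" using n by (simp add: field_simps)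
    then have "a * (1/2) \<le> a * (real (n - m) / real n)" using a by (rule mult_left_mono)
    then show ?thesis by simp
  qed
  finally have le: "max 0 (1 - a / real n) ^ (n - m) \<le> exp (- a / 2)" .
  show "Ef n m a \<le> exp (- a / 2)" unfolding Ef_def
    using mult_mono[OF Ef_coeff(2)[OF mn] le] by simp
qed

lemma Ef_limit: "(\<lambda>n. Ef n m a) \<longlonglongrightarrow> exp (- a)"
proof -
  have inv0: "(\<lambda>n. c / real n) \<longlonglongrightarrow> 0" for c :: real by (rule lim_const_over_n)
  have "(\<lambda>n. \<Prod>i<m. 1 - real i / real n) \<longlonglongrightarrow> (\<Prod>i<m. 1 - 0)"
    by (intro tendsto_intros inv0)
  then have 1: "(\<lambda>n. \<Prod>i<m. 1 - real i / real n) \<longlonglongrightarrow> 1" by simp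
  have 2: "(\<lambda>n. (1 - a / real n) ^ n) \<longlonglongrightarrow> exp (- a)"
    using tendsto_exp_limit_sequentially[of "-a"] by simp
  have "(\<lambda>n. (1 - a / real n) ^ m) \<longlonglongrightarrow> (1 - 0) ^ m" by (intro tendsto_intros inv0)
  then have 3: "(\<lambda>n. (1 - a / real n) ^ m) \<longlonglongrightarrow> 1" by simp
  have "(\<lambda>n. (\<Prod>i<m. 1 - real i / real n) * ((1 - a / real n) ^ n / (1 - a / real n) ^ m)) \<longlonglongrightarrow> 1 * (exp (- a) / 1)"
    by (intro tendsto_intros 1 2 3) auto
  moreover have "eventually (\<lambda>n. (\<Prod>i<m. 1 - real i / real n) * ((1 - a / real n) ^ n / (1 - a / real n) ^ m) = Ef n m a) sequentially"
  proof -
    have "eventually (\<lambda>n. a / real n < 1) sequentially" by (rule order_tendstoD(2)[OF inv0]) simp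
    moreover have "eventually (\<lambda>n. n \<ge> m) sequentially" by (rule eventually_ge_at_top)
    ultimately show ?thesis 
    proof eventually_elim
      case (elim n)
      have p: "0 < 1 - a / real n" using elim by simp
      have "(1 - a / real n) ^ (n - m) = (1 - a / real n) ^ n / (1 - a / real n) ^ m"
        by (rule power_diff) (use p elim in auto)
      moreover have "max 0 (1 - a / real n) = 1 - a / real n" using p by simp
      ultimately show ?case unfolding Ef_def by (simp only:)
    qed
  qed
  ultimately show ?thesis by (simp add: tendsto_cong)
qed

lemma continuous_Pa_integrand: "continuous_on S (\<lambda>\<sigma>. \<sigma> ^ (2*m) * Ef n m (u * \<sigma>\<^sup>2))"
  by (intro continuous_intros continuous_on_compose2[OF continuous_Ef[of UNIV]]) auto

lemma DERIV_Pa: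
  assumes n: "n \<ge> m + 3"
  shows "(Pa n l m has_real_derivative - Pa n l (Suc m) u) (at u)"
proof -
  have "((\<lambda>u. integral (cbox (1 / real n) l) (\<lambda>\<sigma>. \<sigma> ^ (2*m) * Ef n m (u * \<sigma>\<^sup>2))) has_real_derivative
      integral (cbox (1 / real n) l) (\<lambda>\<sigma>. - (\<sigma> ^ (2 * Suc m) * Ef n (Suc m) (u * \<sigma>\<^sup>2)))) (at u within UNIV)"
  proof (rule leibniz_rule_field_derivative)
    fix u \<sigma> :: real
    have "((\<lambda>u. \<sigma> ^ (2*m) * Ef n m (u * \<sigma>\<^sup>2)) has_real_derivative \<sigma> ^ (2*m) * (- Ef n (Suc m) (u * \<sigma>\<^sup>2) * \<sigma>\<^sup>2)) (at u)"
      by (rule DERIV_cmult, rule DERIV_chain2[OF DERIV_Ef]) (use n in \<open>auto intro!: derivative_eq_intros\<close>)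
    then show "((\<lambda>u. \<sigma> ^ (2*m) * Ef n m (u * \<sigma>\<^sup>2)) has_real_derivative - (\<sigma> ^ (2 * Suc m) * Ef n (Suc m) (u * \<sigma>\<^sup>2))) (at u within UNIV)"
      by (simp add: power2_eq_square mult_ac)
    show "(\<lambda>\<sigma>. \<sigma> ^ (2*m) * Ef n m (u * \<sigma>\<^sup>2)) integrable_on cbox (1 / real n) l"
      by (rule integrable_continuous[OF continuous_Pa_integrand])
  next
    show "continuous_on (UNIV \<times> cbox (1 / real n) l) (\<lambda>(u,\<sigma>). - (\<sigma> ^ (2 * Suc m) * Ef n (Suc m) (u * \<sigma>\<^sup>2)))"
      unfolding split_beta
      by (intro continuous_intros continuous_on_compose2[OF continuous_Ef[of UNIV]]) auto
  qed auto
  then show ?thesis unfolding Pa_def[abs_def] by simp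
qed

lemma continuous_Pa: "continuous_on S (Pa n l m)"
proof -
  have "continuous_on UNIV (Pa n l m)"
    unfolding Pa_def[abs_def] box_real(2)[symmetric]
    by (rule integral_continuous_on_param)
      (unfold split_beta, intro continuous_intros continuous_on_compose2[OF continuous_Ef[of UNIV]], auto)
  then show ?thesis by (rule continuous_on_subset) simp
qed

lemma Pa_zero:
  assumes n: "n > m" and u: "u \<ge> real n ^ 3"
  shows "Pa n l m u = 0"
proof -
  have "\<sigma> ^ (2*m) * Ef n m (u * \<sigma>\<^sup>2) = 0" if "\<sigma> \<in> {1 / real n..l}" for \<sigma>
  proof -
    have n0: "real n > 0" using n by simp
    have "1 / real n \<le> \<sigma>" using that by simp
    then have s: "(1 / real n)\<^sup>2 \<le> \<sigma>\<^sup>2" by (rule power_mono) simp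
    have "real n = real n ^ 3 * (1 / real n)\<^sup>2" using n0 by (simp add: power2_eq_square power3_eq_cube)
    also have "\<dots> \<le> u * \<sigma>\<^sup>2" by (rule mult_mono[OF u s]) (use u n0 in \<open>auto intro: order_trans[OF _ u]\<close>)
    finally have "1 - u * \<sigma>\<^sup>2 / real n \<le> 0" using n0 by (simp add: field_simps)
    then show ?thesis using n by (simp add: Ef_def max_def)
  qed
  then show ?thesis unfolding Pa_def by (subst Henstock_Kurzweil_Integration.integral_cong[of _ _ "\<lambda>_. 0"]) auto
qed

text \<open>A common majorant of \<open>Pa n l m\<close> and \<open>Pl l m\<close>, with half of the rate in the exponent.\<close>

definition Ql :: "real \<Rightarrow> nat \<Rightarrow> real \<Rightarrow> real" where
  "Ql l m u = integral {0..l} (\<lambda>\<sigma>. \<sigma> ^ (2*m) * exp (- (u * \<sigma>\<^sup>2 / 2)))"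

lemma integrable_exp_half: "(\<lambda>\<sigma>::real. \<sigma> ^ k * exp (- (u * \<sigma>\<^sup>2 / 2))) integrable_on {a..b}"
  by (intro integrable_continuous_interval continuous_intros) simp

lemma Pa_bound:
  assumes n: "n \<ge> 2 * m" "n > 0" and u: "u \<ge> 0"
  shows "\<bar>Pa n l m u\<bar> \<le> Ql l m u"
proof -
  have bd: "\<bar>\<sigma> ^ (2*m) * Ef n m (u * \<sigma>\<^sup>2)\<bar> \<le> \<sigma> ^ (2*m) * exp (- (u * \<sigma>\<^sup>2 / 2))" for \<sigma>
    using Ef_bound[OF n, of "u * \<sigma>\<^sup>2"] u by (simp add: abs_mult mult_left_mono power_even_abs)
  have "norm (Pa n l m u) \<le> integral {1 / real n..l} (\<lambda>\<sigma>. \<sigma> ^ (2*m) * exp (- (u * \<sigma>\<^sup>2 / 2)))"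
    unfolding Pa_def
    by (rule integral_norm_bound_integral[OF integrable_continuous_interval[OF continuous_Pa_integrand] integrable_exp_half])
       (use bd in auto)
  also have "\<dots> \<le> Ql l m u" unfolding Ql_def
    by (rule integral_subset_le[OF _ integrable_exp_half integrable_exp_half]) (auto intro: order_trans[rotated])
  finally show ?thesis by simp
qed

lemma Pl_bound:
  assumes u: "u \<ge> 0" shows "\<bar>Pl l m u\<bar> \<le> Ql l m u"
proof -
  have "norm (Pl l m u) \<le> Ql l m u"
    unfolding Pl_def Ql_def
    by (rule integral_norm_bound_integral[OF _ integrable_exp_half])
       (use u in \<open>auto intro!: integrable_continuous_interval continuous_intros mult_left_mono simp: abs_mult power_even_abs\<close>)
  then show ?thesis by simp
qed

lemma Pa_limit:
  assumes u: "u \<ge> 0"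
  shows "(\<lambda>n. Pa n l m u) \<longlonglongrightarrow> Pl l m u"
proof -
  define f where "f n \<sigma> = (if \<sigma> \<in> {1 / real n..l} then \<sigma> ^ (2*m) * Ef n m (u * \<sigma>\<^sup>2) else 0)" for n \<sigma>
  define g where "g \<sigma> = (if \<sigma> \<le> 0 then 0 else \<sigma> ^ (2*m) * exp (- (u * \<sigma>\<^sup>2)))" for \<sigma>
  define N where "N = 2 * m + 1"
  have fi: "f n integrable_on {0..l} \<and> integral {0..l} (f n) = Pa n l m u" for n
  proof -
    let ?h = "\<lambda>\<sigma>. \<sigma> ^ (2*m) * Ef n m (u * \<sigma>\<^sup>2)"
    have "?h integrable_on {1 / real n..l}"
      by (rule integrable_continuous_interval[OF continuous_Pa_integrand])
    moreover have e: "{0..l} \<inter> {1 / real n..l} = {1 / real n..l}" "{1 / real n..l} \<inter> {0..l} = {1 / real n..l}"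
      by (auto intro: order_trans[rotated])
    ultimately show ?thesis
      unfolding f_def Pa_def using integrable_restrict_Int[of "{1 / real n..l}" ?h "{0..l}"] integral_restrict_Int[of "{0..l}" "{1 / real n..l}" ?h]
      unfolding e by (simp only:)
  qed
  have "(\<lambda>k. integral {0..l} (f (k + N))) \<longlonglongrightarrow> integral {0..l} g"
  proof (rule dominated_convergence(2)[where h="\<lambda>\<sigma>. \<sigma> ^ (2*m) * exp (- (u * \<sigma>\<^sup>2 / 2))"])
    show "f (k + N) integrable_on {0..l}" for k using fi by blast
    show "(\<lambda>\<sigma>. \<sigma> ^ (2*m) * exp (- (u * \<sigma>\<^sup>2 / 2))) integrable_on {0..l}"
      by (rule integrable_exp_half)
    show "norm (f (k + N) \<sigma>) \<le> \<sigma> ^ (2*m) * exp (- (u * \<sigma>\<^sup>2 / 2))" for k \<sigma>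
      using Ef_bound[of m "k + N" "u * \<sigma>\<^sup>2"] u by (auto simp: f_def N_def abs_mult mult_left_mono power_even_abs)
    show "(\<lambda>k. f (k + N) \<sigma>) \<longlonglongrightarrow> g \<sigma>" if "\<sigma> \<in> {0..l}" for \<sigma>
    proof (cases "\<sigma> = 0")
      case True
      have "f (k + N) \<sigma> = 0" for k using True by (auto simp: f_def N_def)
      then show ?thesis using True by (simp add: g_def)
    next
      case False
      then have s: "\<sigma> > 0" "\<sigma> \<le> l" using that by auto
      have "(\<lambda>n. \<sigma> ^ (2*m) * Ef n m (u * \<sigma>\<^sup>2)) \<longlonglongrightarrow> \<sigma> ^ (2*m) * exp (- (u * \<sigma>\<^sup>2))"
        by (intro tendsto_intros Ef_limit)
      moreover have "eventually (\<lambda>n. \<sigma> ^ (2*m) * Ef n m (u * \<sigma>\<^sup>2) = f n \<sigma>) sequentially"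
      proof -
        have "eventually (\<lambda>n. 1 / real n < \<sigma>) sequentially"
          by (rule order_tendstoD(2)[OF lim_const_over_n]) (use s in auto)
        then show ?thesis by eventually_elim (use s in \<open>auto simp: f_def\<close>)
      qed
      ultimately have "(\<lambda>n. f n \<sigma>) \<longlonglongrightarrow> g \<sigma>" using s by (simp add: g_def tendsto_cong)
      then show ?thesis by (rule LIMSEQ_ignore_initial_segment)
    qed
  qed
  moreover have "integral {0..l} g = Pl l m u"
    unfolding Pl_def by (rule integral_spike[of "{0}"]) (auto simp: g_def)
  ultimately have "(\<lambda>k. Pa (k + N) l m u) \<longlonglongrightarrow> Pl l m u" using fi by simp
  then show ?thesis by (rule LIMSEQ_offset)
qed

text \<open>The integrand of the Laplacian is an exact derivative in \<open>\<sigma>\<close>; only the Gaussian at \<open>\<sigma> = l\<close> remains.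
  This identifies the Laplacian of the potential with a multiple of the heat kernel.\<close>

lemma LP_Pl:
  assumes l: "l \<ge> 0"
  shows "LP (Pl l) m u = - 2 * l ^ (2*m + 3) * exp (- (u * l\<^sup>2))"
proof -
  have i: "(\<lambda>\<sigma>. \<sigma> ^ k * exp (- (u * \<sigma>\<^sup>2))) integrable_on {0..l}" for k
    by (intro integrable_continuous_interval continuous_intros)
  have "((\<lambda>\<sigma>. real (2*m+3) * (\<sigma> ^ (2*(m+1)) * exp (- (u * \<sigma>\<^sup>2))) - 2 * u * (\<sigma> ^ (2*(m+2)) * exp (- (u * \<sigma>\<^sup>2))))
      has_integral (l ^ (2*m+3) * exp (- (u * l\<^sup>2)) - 0 ^ (2*m+3) * exp (- (u * 0\<^sup>2)))) {0..l}"
  proof (rule fundamental_theorem_of_calculus[OF l])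
    fix x :: real
    have "((\<lambda>\<sigma>. \<sigma> ^ (2*m+3) * exp (- (u * \<sigma>\<^sup>2))) has_real_derivative
       real (2*m+3) * (x ^ (2*(m+1)) * exp (- (u * x\<^sup>2))) - 2 * u * (x ^ (2*(m+2)) * exp (- (u * x\<^sup>2)))) (at x within {0..l})"
    proof -
      have e: "x ^ (2*(m+1)) = x ^ (2*m+2)" "x ^ (2*(m+2)) = x ^ (2*m+3) * x" by (simp_all add: power_add power2_eq_square power3_eq_cube)
      show ?thesis unfolding e
        by (rule derivative_eq_intros refl)+ (simp add: algebra_simps)
    qed
    then show "((\<lambda>\<sigma>. \<sigma> ^ (2*m+3) * exp (- (u * \<sigma>\<^sup>2))) has_vector_derivative
       real (2*m+3) * (x ^ (2*(m+1)) * exp (- (u * x\<^sup>2))) - 2 * u * (x ^ (2*(m+2)) * exp (- (u * x\<^sup>2)))) (at x within {0..l})"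
      by (simp only: has_real_derivative_iff_has_vector_derivative)
  qed
  moreover have "((\<lambda>\<sigma>. real (2*m+3) * (\<sigma> ^ (2*(m+1)) * exp (- (u * \<sigma>\<^sup>2))) - 2 * u * (\<sigma> ^ (2*(m+2)) * exp (- (u * \<sigma>\<^sup>2))))
      has_integral (real (2*m+3) * Pl l (m+1) u - 2 * u * Pl l (m+2) u)) {0..l}"
    unfolding Pl_def by (intro has_integral_diff has_integral_mult_right integrable_integral i)
  ultimately have "l ^ (2*m+3) * exp (- (u * l\<^sup>2)) - 0 ^ (2*m+3) * exp (- (u * 0\<^sup>2)) = real (2*m+3) * Pl l (m+1) u - 2 * u * Pl l (m+2) u"
    by (rule has_integral_unique)
  then have "real (2*m+3) * Pl l (m+1) u - 2 * u * Pl l (m+2) u = l ^ (2*m+3) * exp (- (u * l\<^sup>2))"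
    by (simp add: power_add)
  then show ?thesis by (simp add: LP_def algebra_simps)
qed

lemma DERIV_Pl: "(Pl l m has_real_derivative - Pl l (Suc m) u) (at u)"
proof -
  have "((\<lambda>u. integral (cbox 0 l) (\<lambda>\<sigma>. \<sigma> ^ (2*m) * exp (- (u * \<sigma>\<^sup>2)))) has_real_derivative
      integral (cbox 0 l) (\<lambda>\<sigma>. - (\<sigma> ^ (2 * Suc m) * exp (- (u * \<sigma>\<^sup>2))))) (at u within UNIV)"
  proof (rule leibniz_rule_field_derivative)
    fix u \<sigma> :: real
    show "((\<lambda>u. \<sigma> ^ (2*m) * exp (- (u * \<sigma>\<^sup>2))) has_real_derivative - (\<sigma> ^ (2 * Suc m) * exp (- (u * \<sigma>\<^sup>2)))) (at u within UNIV)"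
      by (rule derivative_eq_intros refl)+ (simp add: power2_eq_square algebra_simps)
    show "(\<lambda>\<sigma>. \<sigma> ^ (2*m) * exp (- (u * \<sigma>\<^sup>2))) integrable_on cbox 0 l"
      by (intro integrable_continuous continuous_intros)
  next
    show "continuous_on (UNIV \<times> cbox 0 l) (\<lambda>(u,\<sigma>). - (\<sigma> ^ (2 * Suc m) * exp (- (u * \<sigma>\<^sup>2))))"
      unfolding split_beta by (intro continuous_intros)
  qed auto
  then show ?thesis unfolding Pl_def[abs_def] by simp
qed

lemma continuous_Pl: "continuous_on S (Pl l m)"
  by (intro continuous_at_imp_continuous_on ballI DERIV_isCont[OF DERIV_Pl])


section \<open>Bounds for the kernels\<close>

lemma gauss_1d:
  assumes a: "a > 0"
  shows "(\<integral>\<^sup>+x. ennreal (exp (- (a * x\<^sup>2))) \<partial>lborel) = ennreal (sqrt (pi / a))"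
proof -
  define s where "s = sqrt (1 / (2 * a))"
  have s: "s > 0" "s\<^sup>2 = 1 / (2 * a)" using a by (auto simp: s_def)
  have e: "normal_density 0 s x = sqrt (a / pi) * exp (- (a * x\<^sup>2))" for x
    unfolding normal_density_def s(2) using a by (simp add: real_sqrt_divide field_simps)
  have "(\<integral>\<^sup>+x. ennreal (normal_density 0 s x) \<partial>lborel) = ennreal (LINT x|lborel. normal_density 0 s x)"
    by (rule nn_integral_eq_integral) (use s in auto)
  also have "\<dots> = 1" using s by simp
  finally have 1: "ennreal (sqrt (a / pi)) * (\<integral>\<^sup>+x. ennreal (exp (- (a * x\<^sup>2))) \<partial>lborel) = 1"
    unfolding e using a by (subst nn_integral_cmult[symmetric]) (auto simp: ennreal_mult)
  have "ennreal (sqrt (pi / a)) * (ennreal (sqrt (a / pi)) * (\<integral>\<^sup>+x. ennreal (exp (- (a * x\<^sup>2))) \<partial>lborel)) = ennreal (sqrt (pi / a))"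
    unfolding 1 by simp
  moreover have "ennreal (sqrt (pi / a)) * ennreal (sqrt (a / pi)) = 1"
    using a by (simp add: ennreal_mult[symmetric] real_sqrt_mult[symmetric])
  ultimately show ?thesis by (simp add: mult.assoc[symmetric])
qed

lemma gauss_3d_nn:
  assumes a: "a > 0"
  shows "(\<integral>\<^sup>+z. ennreal (exp (- (a * (z \<bullet> (z::vec3))))) \<partial>lborel) = ennreal (sqrt (pi / a) ^ 3)"
proof -
  have "ennreal (exp (- (a * (z \<bullet> z)))) = (\<Prod>b\<in>Basis. ennreal (exp (- (a * (z \<bullet> b)\<^sup>2))))" for z :: vec3
  proof -
    have "exp (- (a * (z \<bullet> z))) = exp (\<Sum>b\<in>Basis. - (a * (z \<bullet> b)\<^sup>2))"
      by (subst euclidean_inner) (simp add: sum_negf sum_distrib_left power2_eq_square)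
    also have "\<dots> = (\<Prod>b\<in>Basis. exp (- (a * (z \<bullet> b)\<^sup>2)))" by (rule exp_sum) simp
    finally show ?thesis by (simp add: prod_ennreal)
  qed
  then have "(\<integral>\<^sup>+z. ennreal (exp (- (a * (z \<bullet> (z::vec3))))) \<partial>lborel) =
     (\<Prod>b\<in>(Basis::vec3 set). (\<integral>\<^sup>+x. ennreal (exp (- (a * x\<^sup>2))) \<partial>lborel))"
    by (simp only:) (rule nn_integral_lborel_prod, auto)
  also have "\<dots> = ennreal (sqrt (pi / a)) ^ 3" by (simp add: gauss_1d[OF a])
  also have "\<dots> = ennreal (sqrt (pi / a) ^ 3)" using a by (simp add: ennreal_power)
  finally show ?thesis .
qed

lemma gauss_3d:
  assumes a: "a > 0"
  shows "integrable lborel (\<lambda>z::vec3. exp (- (a * (z \<bullet> z))))"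
    "(LINT z|lborel. exp (- (a * (z \<bullet> (z::vec3))))) = sqrt (pi / a) ^ 3"
proof -
  have m: "(\<lambda>z::vec3. exp (- (a * (z \<bullet> z)))) \<in> borel_measurable borel" by measurable
  show "integrable lborel (\<lambda>z::vec3. exp (- (a * (z \<bullet> z))))"
    using m gauss_3d_nn[OF a] by (intro integrableI_nonneg) auto
  show "(LINT z|lborel. exp (- (a * (z \<bullet> (z::vec3))))) = sqrt (pi / a) ^ 3"
    using m a by (subst integral_eq_nn_integral) (auto simp: gauss_3d_nn[OF a])
qed

text \<open>Gaussians integrated over scales: \<open>kf l m z\<close> is of the size of \<open>(min l (1/\<bar>z\<bar>)) ^ (m + 1)\<close>.
  The kernels that occur below are bounded by multiples of these functions.\<close>

definition kf :: "real \<Rightarrow> nat \<Rightarrow> vec3 \<Rightarrow> real" where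
  "kf l m z = integral {0..l} (\<lambda>\<sigma>. \<sigma> ^ m * exp (- ((z \<bullet> z) * \<sigma>\<^sup>2 / 4)))"

lemma kf_integrable: "(\<lambda>\<sigma>::real. \<sigma> ^ m * exp (- (u * \<sigma>\<^sup>2 / 4))) integrable_on {a..b}"
  by (intro integrable_continuous_interval continuous_intros) simp

lemma kf_lborel: "kf l m z = (LINT \<sigma>|lborel. (if 0 \<le> \<sigma> \<and> \<sigma> \<le> l then \<sigma> ^ m * exp (- ((z \<bullet> z) * \<sigma>\<^sup>2 / 4)) else 0))"
  and kf_lborel_integrable: "integrable lborel (\<lambda>\<sigma>. (if 0 \<le> \<sigma> \<and> \<sigma> \<le> l then \<sigma> ^ m * exp (- ((z \<bullet> z) * \<sigma>\<^sup>2 / 4)) else 0))"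
proof -
  have c: "continuous_on {0..l} (\<lambda>\<sigma>::real. \<sigma> ^ m * exp (- ((z \<bullet> z) * \<sigma>\<^sup>2 / 4)))"
    by (intro continuous_intros) simp
  have s: "set_integrable lborel {0..l} (\<lambda>\<sigma>::real. \<sigma> ^ m * exp (- ((z \<bullet> z) * \<sigma>\<^sup>2 / 4)))"
    by (rule borel_integrable_atLeastAtMost') (rule c)
  have e: "(\<lambda>\<sigma>. indicator {0..l} \<sigma> *\<^sub>R (\<sigma> ^ m * exp (- ((z \<bullet> z) * \<sigma>\<^sup>2 / 4)))) =
    (\<lambda>\<sigma>. (if 0 \<le> \<sigma> \<and> \<sigma> \<le> l then \<sigma> ^ m * exp (- ((z \<bullet> z) * \<sigma>\<^sup>2 / 4)) else 0))"
    by (auto simp: indicator_def fun_eq_iff)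
  show "kf l m z = (LINT \<sigma>|lborel. (if 0 \<le> \<sigma> \<and> \<sigma> \<le> l then \<sigma> ^ m * exp (- ((z \<bullet> z) * \<sigma>\<^sup>2 / 4)) else 0))"
    unfolding kf_def e[symmetric]
    using set_borel_integral_eq_integral(2)[OF s] by (simp add: set_lebesgue_integral_def)
  show "integrable lborel (\<lambda>\<sigma>. (if 0 \<le> \<sigma> \<and> \<sigma> \<le> l then \<sigma> ^ m * exp (- ((z \<bullet> z) * \<sigma>\<^sup>2 / 4)) else 0))"
    using s unfolding set_integrable_def e .
qed

lemma kf_measurable_pair: "(\<lambda>(l,z). kf l m z) \<in> borel_measurable (borel \<Otimes>\<^sub>M borel)"
  unfolding kf_lborel by measurable

lemma kf_measurable[measurable]:
  assumes [measurable]: "f \<in> borel_measurable M" "g \<in> borel_measurable M"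
  shows "(\<lambda>x. kf (f x) m (g x)) \<in> borel_measurable M"
  using measurable_compose[OF measurable_Pair[OF assms] kf_measurable_pair, of m] by simp

lemma kf_nonneg[simp]: "0 \<le> kf l m z"
  unfolding kf_def by (rule Henstock_Kurzweil_Integration.integral_nonneg[OF kf_integrable]) auto

lemma kf_mono: assumes "l \<le> l'" shows "kf l m z \<le> kf l' m z"
  unfolding kf_def by (rule integral_subset_le[OF _ kf_integrable kf_integrable]) (use assms in auto)

lemma kf_le: assumes l: "l \<ge> 0" shows "kf l m z \<le> l ^ (m + 1)"
proof -
  have "kf l m z \<le> integral {0..l} (\<lambda>_. l ^ m)"
    unfolding kf_def
  proof (rule integral_le[OF kf_integrable])
    fix s assume s: "s \<in> {0..l}"
    have "s ^ m * exp (- ((z \<bullet> z) * s\<^sup>2 / 4)) \<le> l ^ m * 1"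
      by (rule mult_mono) (use s in \<open>auto intro!: power_mono\<close>)
    then show "s ^ m * exp (- ((z \<bullet> z) * s\<^sup>2 / 4)) \<le> l ^ m" by simp
  qed auto
  also have "\<dots> = l ^ (m + 1)" using l by simp
  finally show ?thesis .
qed

text \<open>By Fubini, since the Gaussian at scale \<open>\<sigma>\<close> has integral \<open>(2 sqrt pi / \<sigma>)\<^sup>3\<close>.\<close>

lemma kf_L1:
  assumes l: "l \<ge> 0" and m: "m \<ge> 3"
  shows "integrable lborel (kf l m)" "l1n (kf l m) \<le> 8 * sqrt pi ^ 3 * l ^ (m - 2)"
proof -
  let ?h = "\<lambda>\<sigma> z::vec3. (if 0 \<le> \<sigma> \<and> \<sigma> \<le> l then \<sigma> ^ m * exp (- ((z \<bullet> z) * \<sigma>\<^sup>2 / 4)) else (0::real))"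
  have "(\<integral>\<^sup>+z. ennreal (kf l m z) \<partial>lborel) = (\<integral>\<^sup>+z. (\<integral>\<^sup>+\<sigma>. ennreal (?h \<sigma> z) \<partial>lborel) \<partial>lborel)"
    unfolding kf_lborel
    by (intro nn_integral_cong nn_integral_eq_integral[symmetric] kf_lborel_integrable) auto
  also have "\<dots> = (\<integral>\<^sup>+\<sigma>. (\<integral>\<^sup>+z. ennreal (?h \<sigma> z) \<partial>lborel) \<partial>lborel)"
    by (rule lborel_pair.Fubini') measurable
  also have "\<dots> \<le> (\<integral>\<^sup>+\<sigma>. ennreal (8 * sqrt pi ^ 3 * l ^ (m - 3)) * indicator {0..l} \<sigma> \<partial>lborel)"
  proof (rule nn_integral_mono)
    fix \<sigma> :: real
    consider "\<sigma> < 0 \<or> \<sigma> > l" | "\<sigma> = 0" | "0 < \<sigma>" "\<sigma> \<le> l" by linarith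
    then show "(\<integral>\<^sup>+z. ennreal (?h \<sigma> z) \<partial>lborel) \<le> ennreal (8 * sqrt pi ^ 3 * l ^ (m - 3)) * indicator {0..l} \<sigma>"
    proof cases
      case 1 then have "?h \<sigma> z = 0" for z by auto
      then show ?thesis by (simp only: ennreal_0) simp
    next
      case 2 then have "?h \<sigma> z = 0" for z using m by auto
      then show ?thesis by (simp only: ennreal_0) simp
    next
      case 3
      have "(\<integral>\<^sup>+z. ennreal (?h \<sigma> z) \<partial>lborel) = (\<integral>\<^sup>+z. ennreal (\<sigma> ^ m) * ennreal (exp (- (\<sigma>\<^sup>2 / 4 * (z \<bullet> (z::vec3))))) \<partial>lborel)"
        using 3 by (intro nn_integral_cong) (simp add: ennreal_mult[symmetric] mult.commute)
      also have "\<dots> = ennreal (\<sigma> ^ m) * ennreal (sqrt (pi / (\<sigma>\<^sup>2 / 4)) ^ 3)"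
      proof -
        have "(\<integral>\<^sup>+z. ennreal (exp (- (\<sigma>\<^sup>2 / 4 * (z \<bullet> (z::vec3))))) \<partial>lborel) = ennreal (sqrt (pi / (\<sigma>\<^sup>2 / 4)) ^ 3)"
          by (rule gauss_3d_nn) (use 3 in simp)
        then show ?thesis by (subst nn_integral_cmult) (simp, simp only:)
      qed
      also have "sqrt (pi / (\<sigma>\<^sup>2 / 4)) = 2 * sqrt pi / \<sigma>"
        using 3 by (simp add: real_sqrt_divide real_sqrt_mult)
      also have "ennreal (\<sigma> ^ m) * ennreal ((2 * sqrt pi / \<sigma>) ^ 3) = ennreal (8 * sqrt pi ^ 3 * \<sigma> ^ (m - 3))"
      proof -
        have "\<sigma> ^ m = \<sigma> ^ (m - 3) * \<sigma> ^ 3" using m by (simp add: power_add[symmetric])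
        then have "\<sigma> ^ m * (2 * sqrt pi / \<sigma>) ^ 3 = 8 * sqrt pi ^ 3 * \<sigma> ^ (m - 3)"
          using 3 by (simp add: power_mult_distrib power_divide)
        then show ?thesis using 3 by (simp flip: ennreal_mult)
      qed
      also have "\<dots> \<le> ennreal (8 * sqrt pi ^ 3 * l ^ (m - 3))"
        using 3 by (intro ennreal_leI mult_left_mono power_mono) auto
      finally show ?thesis using 3 by simp
    qed
  qed
  also have "\<dots> = ennreal (8 * sqrt pi ^ 3 * l ^ (m - 3)) * ennreal l"
    using l by (subst nn_integral_cmult_indicator) auto
  also have "\<dots> = ennreal (8 * sqrt pi ^ 3 * l ^ (m - 2))"
  proof -
    have "l ^ (m - 2) = l ^ (m - 3) * l" using m by (metis Suc_diff_le diff_Suc_Suc numeral_2_eq_2 numeral_3_eq_3 power_Suc2)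
    then show ?thesis using l by (simp add: ennreal_mult[symmetric] mult.assoc)
  qed
  finally have *: "(\<integral>\<^sup>+z. ennreal (kf l m z) \<partial>lborel) \<le> ennreal (8 * sqrt pi ^ 3 * l ^ (m - 2))" .
  have [measurable]: "kf l m \<in> borel_measurable borel" by measurable
  show i: "integrable lborel (kf l m)"
    by (rule integrableI_nonneg) (auto intro: le_less_trans[OF *])
  show "l1n (kf l m) \<le> 8 * sqrt pi ^ 3 * l ^ (m - 2)"
    using * nn_l1n[OF i] l by simp
qed

lemma kf_sqi:
  assumes l: "l \<ge> 0" and m: "m \<ge> 3"
  shows "sqi (kf l m)" "l2n (kf l m) \<le> sqrt (l ^ (m + 1) * (8 * sqrt pi ^ 3 * l ^ (m - 2)))"
proof -
  have [measurable]: "kf l m \<in> borel_measurable borel" by measurable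
  have "\<bar>kf l m z\<bar> \<le> l ^ (m + 1)" for z using kf_le[OF l] by simp
  from sqi_bounded[OF _ kf_L1(1)[OF l m] this kf_L1(2)[OF l m]] l
  show "sqi (kf l m)" "l2n (kf l m) \<le> sqrt (l ^ (m + 1) * (8 * sqrt pi ^ 3 * l ^ (m - 2)))" by auto
qed

text \<open>The function \<open>kf l 2\<close> is not integrable, but Cauchy--Schwarz in the scale variable bounds its square
  by the integrable function \<open>l * kf l 4\<close>.\<close>

lemma kf_two_sqi:
  assumes l: "l \<ge> 0" shows "sqi (kf l 2)"
proof -
  have [measurable]: "kf l 2 \<in> borel_measurable borel" by measurable
  have le: "(kf l 2 z)\<^sup>2 \<le> l * kf l 4 z" for z
  proof -
    let ?a = "\<lambda>\<sigma>. (if 0 \<le> \<sigma> \<and> \<sigma> \<le> l then 1 else 0::real)"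
    let ?b = "\<lambda>\<sigma>. (if 0 \<le> \<sigma> \<and> \<sigma> \<le> l then \<sigma>\<^sup>2 * exp (- ((z \<bullet> z) * \<sigma>\<^sup>2 / 4)) else 0::real)"
    have a: "sqi ?a"
    proof -
      have "(\<lambda>\<sigma>. (?a \<sigma>)\<^sup>2) = (indicator {0..l} :: real \<Rightarrow> real)" by (auto simp: indicator_def fun_eq_iff)
      then show ?thesis unfolding sqi_def by (auto simp: emeasure_lborel_Icc_eq)
    qed
    have la: "(LINT \<sigma>|lborel. (?a \<sigma>)\<^sup>2) = l"
    proof -
      have "(\<lambda>\<sigma>. (?a \<sigma>)\<^sup>2) = (indicator {0..l} :: real \<Rightarrow> real)" by (auto simp: indicator_def fun_eq_iff)
      then show ?thesis using l by simp
    qed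
    have ble: "(?b \<sigma>)\<^sup>2 \<le> (if 0 \<le> \<sigma> \<and> \<sigma> \<le> l then \<sigma> ^ 4 * exp (- ((z \<bullet> z) * \<sigma>\<^sup>2 / 4)) else 0)" for \<sigma>
    proof -
      have "exp (- ((z \<bullet> z) * \<sigma>\<^sup>2 / 4)) * exp (- ((z \<bullet> z) * \<sigma>\<^sup>2 / 4)) \<le> 1 * exp (- ((z \<bullet> z) * \<sigma>\<^sup>2 / 4))"
        by (rule mult_right_mono) auto
      then have "\<sigma> ^ 4 * (exp (- ((z \<bullet> z) * \<sigma>\<^sup>2 / 4)) * exp (- ((z \<bullet> z) * \<sigma>\<^sup>2 / 4))) \<le> \<sigma> ^ 4 * (1 * exp (- ((z \<bullet> z) * \<sigma>\<^sup>2 / 4)))"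
        by (rule mult_left_mono) simp
      moreover have "(\<sigma>\<^sup>2 * exp (- ((z \<bullet> z) * \<sigma>\<^sup>2 / 4)))\<^sup>2 = \<sigma> ^ 4 * (exp (- ((z \<bullet> z) * \<sigma>\<^sup>2 / 4)) * exp (- ((z \<bullet> z) * \<sigma>\<^sup>2 / 4)))"
        by (simp add: power_mult_distrib power2_eq_square power4_eq_xxxx)
      ultimately show ?thesis by simp
    qed
    have b: "sqi ?b" unfolding sqi_def
    proof
      show "?b \<in> borel_measurable borel" by measurable
      show "integrable lborel (\<lambda>\<sigma>. (?b \<sigma>)\<^sup>2)"
        by (rule Bochner_Integration.integrable_bound[OF kf_lborel_integrable[of l 4 z]]) (use ble in auto)
    qed
    have lb: "(l2n ?b)\<^sup>2 \<le> kf l 4 z"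
      unfolding l2n_sq kf_lborel
      by (rule integral_mono[OF _ kf_lborel_integrable]) (use b ble in \<open>auto simp: sqi_def\<close>)
    have "kf l 2 z = (LINT \<sigma>|lborel. ?a \<sigma> * ?b \<sigma>)"
      unfolding kf_lborel by (rule Bochner_Integration.integral_cong) auto
    then have "\<bar>kf l 2 z\<bar> \<le> l2n ?a * l2n ?b" using pair_le[OF a b] by simp
    then have "(kf l 2 z)\<^sup>2 \<le> (l2n ?a * l2n ?b)\<^sup>2" using power_mono[of "\<bar>kf l 2 z\<bar>" _ 2] by simp
    also have "\<dots> = l * (l2n ?b)\<^sup>2" unfolding power_mult_distrib l2n_sq[of ?a] la ..
    also have "\<dots> \<le> l * kf l 4 z" using lb l by (rule mult_left_mono)
    finally show ?thesis .
  qed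
  have "integrable lborel (\<lambda>z. (kf l 2 z)\<^sup>2)"
    by (rule Bochner_Integration.integrable_bound[of _ "\<lambda>z. l * kf l 4 z"])
       (use le kf_L1(1)[OF l, of 4] l in auto)
  then show ?thesis by (simp add: sqi_def)
qed

lemma power_exp_bound:
  fixes x :: real
  assumes "j \<le> 4" "x \<ge> 0"
  shows "x ^ j * exp (- (x\<^sup>2 / 4)) \<le> 33"
proof -
  have "x ^ j \<le> 1 + x ^ 4"
  proof (cases "x \<le> 1")
    case True then have "x ^ j \<le> 1" using assms by (intro power_le_one) auto
    then show ?thesis using zero_le_power[OF assms(2), of 4] by linarith
  next
    case False then have "x ^ j \<le> x ^ 4" using assms by (intro power_increasing) auto
    then show ?thesis by simp
  qed
  also have "\<dots> \<le> 33 * exp (x\<^sup>2 / 4)"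
  proof -
    have "1 + x\<^sup>2 / 4 + (x\<^sup>2 / 4)\<^sup>2 / 2 \<le> exp (x\<^sup>2 / 4)" by (rule exp_lower_Taylor_quadratic) simp
    moreover have "(x\<^sup>2 / 4)\<^sup>2 / 2 = x ^ 4 / 32" by (simp add: power_divide)
    moreover have "1 \<le> exp (x\<^sup>2 / 4)" by simp
    ultimately show ?thesis using zero_le_power[OF assms(2), of 4] zero_le_power2[of x] by linarith
  qed
  finally have "x ^ j * exp (- (x\<^sup>2 / 4)) \<le> 33 * exp (x\<^sup>2 / 4) * exp (- (x\<^sup>2 / 4))"
    by (rule mult_right_mono) simp
  then show ?thesis by (simp add: mult.assoc exp_minus)
qed

text \<open>Powers of \<open>\<bar>z\<bar> \<sigma>\<close> are absorbed by half of the exponential factor, at the price of the constant \<open>33\<close>.\<close>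

lemma Ql_kf:
  assumes j: "j \<le> 4" "j \<le> 2 * m"
  shows "norm z ^ j * Ql l m (z \<bullet> z) \<le> 33 * kf l (2 * m - j) z"
proof -
  have "norm z ^ j * Ql l m (z \<bullet> z) = integral {0..l} (\<lambda>\<sigma>. norm z ^ j * (\<sigma> ^ (2*m) * exp (- ((z \<bullet> z) * \<sigma>\<^sup>2 / 2))))"
    unfolding Ql_def by simp
  also have "\<dots> \<le> integral {0..l} (\<lambda>\<sigma>. 33 * (\<sigma> ^ (2 * m - j) * exp (- ((z \<bullet> z) * \<sigma>\<^sup>2 / 4))))"
  proof (rule integral_le)
    fix s assume s: "s \<in> {0..l}"
    define E where "E = exp (- ((norm z * s)\<^sup>2 / 4))"
    have e: "exp (- ((z \<bullet> z) * s\<^sup>2 / 2)) = E * E" "exp (- ((z \<bullet> z) * s\<^sup>2 / 4)) = E"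
      unfolding E_def by (simp_all add: exp_add[symmetric] power_mult_distrib power2_norm_eq_inner)
    have p: "s ^ (2*m) = s ^ (2*m - j) * s ^ j" using j by (simp add: power_add[symmetric])
    have "norm z ^ j * (s ^ (2*m) * (E * E)) = (s ^ (2*m - j) * E) * ((norm z * s) ^ j * E)"
      unfolding p by (simp add: power_mult_distrib)
    also have "\<dots> \<le> (s ^ (2*m - j) * E) * 33"
      unfolding E_def by (rule mult_left_mono[OF power_exp_bound[OF j(1)]]) (use s in auto)
    finally show "norm z ^ j * (s ^ (2*m) * exp (- ((z \<bullet> z) * s\<^sup>2 / 2))) \<le> 33 * (s ^ (2 * m - j) * exp (- ((z \<bullet> z) * s\<^sup>2 / 4)))"
      unfolding e by simp
  qed (intro integrable_on_mult_right integrable_exp_half kf_integrable)+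
  also have "\<dots> = 33 * kf l (2 * m - j) z" unfolding kf_def by simp
  finally show ?thesis .
qed

text \<open>All bounds for the derivatives of the potential use only this domination, so they hold for the
  limit and, uniformly in \<open>n\<close>, for the approximants.\<close>

definition domQ :: "real \<Rightarrow> (nat \<Rightarrow> real \<Rightarrow> real) \<Rightarrow> bool" where
  "domQ l P \<longleftrightarrow> (\<forall>m\<le>4. \<forall>u\<ge>0. \<bar>P m u\<bar> \<le> Ql l m u)"

lemma domQD: "domQ l P \<Longrightarrow> m \<le> 4 \<Longrightarrow> j \<le> 4 \<Longrightarrow> j \<le> 2 * m \<Longrightarrow> norm z ^ j * \<bar>P m (z \<bullet> z)\<bar> \<le> 33 * kf l (2 * m - j) z"
  unfolding domQ_def by (rule order_trans[OF _ Ql_kf]) (auto intro: mult_left_mono)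

lemma domQ_Pa: "n \<ge> 8 \<Longrightarrow> domQ l (Pa n l)"
  unfolding domQ_def by (auto intro!: Pa_bound)

lemma domQ_Pl: "domQ l (Pl l)"
  unfolding domQ_def by (auto intro!: Pl_bound)

text \<open>Here and in the following lemmas the constant is \<open>33\<close>, from \<open>Ql_kf\<close>, times the sum of the absolute
  values of the coefficients.\<close>

lemma T0LP_bound: assumes "domQ l P" shows "\<bar>T0 (LP P) z\<bar> \<le> 330 * kf l 2 z"
proof -
  have "T0 (LP P) z = 4 * (norm z ^ 2 * P 2 (z \<bullet> z)) - 6 * P 1 (z \<bullet> z)"
    unfolding power2_norm_eq_inner by (simp add: T0_def LP_def numeral_2_eq_2)
  then have "\<bar>T0 (LP P) z\<bar> \<le> 4 * (norm z ^ 2 * \<bar>P 2 (z \<bullet> z)\<bar>) + 6 * \<bar>P 1 (z \<bullet> z)\<bar>"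
    by (simp add: abs_mult abs_triangle_ineq4[THEN order_trans])
  then show ?thesis using domQD[OF assms, of 2 2 z] domQD[OF assms, of 1 0 z] by (simp add: numeral_2_eq_2)
qed

lemma T2_bound: assumes "domQ l P" shows "\<bar>T2 P i j z\<bar> \<le> 198 * kf l 2 z"
proof -
  have "\<bar>T2 P i j z\<bar> \<le> 4 * (\<bar>z $ i\<bar> * \<bar>z $ j\<bar> * \<bar>P 2 (z \<bullet> z)\<bar>) + 2 * (\<bar>dl i j\<bar> * \<bar>P 1 (z \<bullet> z)\<bar>)"
    unfolding T2_def by (rule order_trans[OF abs_triangle_ineq4]) (simp add: abs_mult)
  also have "\<dots> \<le> 4 * (norm z * norm z * \<bar>P 2 (z \<bullet> z)\<bar>) + 2 * (1 * \<bar>P 1 (z \<bullet> z)\<bar>)"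
    by (intro add_mono mult_mono component_le_norm_cart dl_abs) auto
  finally show ?thesis using domQD[OF assms, of 2 2 z] domQD[OF assms, of 1 0 z]
    by (simp add: power2_eq_square numeral_2_eq_2)
qed

lemma T3_bound: assumes "domQ l P" shows "\<bar>T3 P i j k z\<bar> \<le> 660 * kf l 3 z"
proof -
  have "\<bar>T3 P i j k z\<bar> \<le> 8 * (\<bar>z $ i\<bar> * \<bar>z $ j\<bar> * \<bar>z $ k\<bar> * \<bar>P 3 (z \<bullet> z)\<bar>) + 4 * (\<bar>dl i j * z $ k + dl i k * z $ j + dl j k * z $ i\<bar> * \<bar>P 2 (z \<bullet> z)\<bar>)"
    unfolding T3_def by (rule order_trans[OF abs_triangle_ineq]) (simp add: abs_mult del: distrib_left_numeral)
  also have "\<dots> \<le> 8 * (norm z * norm z * norm z * \<bar>P 3 (z \<bullet> z)\<bar>) + 4 * ((1 * norm z + 1 * norm z + 1 * norm z) * \<bar>P 2 (z \<bullet> z)\<bar>)"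
  proof (intro add_mono mult_mono component_le_norm_cart)
    have "\<bar>dl a b * z $ c\<bar> \<le> 1 * norm z" for a b c
      unfolding abs_mult by (intro mult_mono dl_abs component_le_norm_cart) auto
    from this[of i j k] this[of i k j] this[of j k i]
    show "\<bar>dl i j * z $ k + dl i k * z $ j + dl j k * z $ i\<bar> \<le> 1 * norm z + 1 * norm z + 1 * norm z"
      by linarith
  qed auto
  finally show ?thesis using domQD[OF assms, of 3 3 z] domQD[OF assms, of 2 1 z]
    by (simp add: power3_eq_cube)
qed

lemma T1LP_bound: assumes "domQ l P" shows "\<bar>T1 (LP P) j z\<bar> \<le> 924 * kf l 3 z"
proof -
  have "T1 (LP P) j z = z $ j * (- 8 * ((z \<bullet> z) * P 3 (z \<bullet> z)) + 20 * P 2 (z \<bullet> z))"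
    by (simp add: T1_def LP_def numeral_3_eq_3 numeral_2_eq_2 algebra_simps)
  then have "\<bar>T1 (LP P) j z\<bar> = \<bar>z $ j\<bar> * \<bar>- 8 * ((z \<bullet> z) * P 3 (z \<bullet> z)) + 20 * P 2 (z \<bullet> z)\<bar>" by (simp only: abs_mult)
  also have "\<dots> \<le> norm z * (8 * (norm z ^ 2 * \<bar>P 3 (z \<bullet> z)\<bar>) + 20 * \<bar>P 2 (z \<bullet> z)\<bar>)"
  proof (rule mult_mono[OF component_le_norm_cart])
    have "\<bar>- 8 * ((z \<bullet> z) * P 3 (z \<bullet> z)) + 20 * P 2 (z \<bullet> z)\<bar> \<le> \<bar>- 8 * ((z \<bullet> z) * P 3 (z \<bullet> z))\<bar> + \<bar>20 * P 2 (z \<bullet> z)\<bar>"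
      by (rule abs_triangle_ineq)
    also have "\<dots> = 8 * (norm z ^ 2 * \<bar>P 3 (z \<bullet> z)\<bar>) + 20 * \<bar>P 2 (z \<bullet> z)\<bar>"
      by (simp add: abs_mult power2_norm_eq_inner)
    finally show "\<bar>- 8 * ((z \<bullet> z) * P 3 (z \<bullet> z)) + 20 * P 2 (z \<bullet> z)\<bar> \<le> 8 * (norm z ^ 2 * \<bar>P 3 (z \<bullet> z)\<bar>) + 20 * \<bar>P 2 (z \<bullet> z)\<bar>" .
  qed auto
  also have "\<dots> = 8 * (norm z ^ 3 * \<bar>P 3 (z \<bullet> z)\<bar>) + 20 * (norm z ^ 1 * \<bar>P 2 (z \<bullet> z)\<bar>)"
    by (simp add: power3_eq_cube power2_eq_square algebra_simps)
  finally show ?thesis using domQD[OF assms, of 3 3 z] domQD[OF assms, of 2 1 z] by simp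
qed

lemma T2LP_bound: assumes "domQ l P" shows "\<bar>T2 (LP P) i j z\<bar> \<le> 3300 * kf l 4 z"
proof -
  have e: "LP P 2 u = 4 * u * P 4 u - 14 * P 3 u" "LP P 1 u = 4 * u * P 3 u - 10 * P 2 u" for u
    by (simp_all add: LP_def eval_nat_numeral)
  have "\<bar>T2 (LP P) i j z\<bar> \<le> 4 * (\<bar>z $ i\<bar> * \<bar>z $ j\<bar> * \<bar>LP P 2 (z \<bullet> z)\<bar>) + 2 * (\<bar>dl i j\<bar> * \<bar>LP P 1 (z \<bullet> z)\<bar>)"
    unfolding T2_def by (rule order_trans[OF abs_triangle_ineq4]) (simp add: abs_mult)
  also have "\<dots> \<le> 4 * (norm z * norm z * (4 * (norm z ^ 2 * \<bar>P 4 (z \<bullet> z)\<bar>) + 14 * \<bar>P 3 (z \<bullet> z)\<bar>))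
       + 2 * (1 * (4 * (norm z ^ 2 * \<bar>P 3 (z \<bullet> z)\<bar>) + 10 * \<bar>P 2 (z \<bullet> z)\<bar>))"
    unfolding e power2_norm_eq_inner
    by (intro add_mono mult_mono component_le_norm_cart dl_abs order_trans[OF abs_triangle_ineq4]) (auto simp: abs_mult)
  also have "\<dots> = 16 * (norm z ^ 4 * \<bar>P 4 (z \<bullet> z)\<bar>) + 64 * (norm z ^ 2 * \<bar>P 3 (z \<bullet> z)\<bar>) + 20 * \<bar>P 2 (z \<bullet> z)\<bar>"
    by (simp add: power4_eq_xxxx power2_eq_square algebra_simps)
  finally show ?thesis using domQD[OF assms, of 4 4 z] domQD[OF assms, of 3 2 z] domQD[OF assms, of 2 0 z]
    by simp
qed

lemma T0LLP_bound: assumes "domQ l P" shows "\<bar>T0 (LP (LP P)) z\<bar> \<le> 5148 * kf l 4 z"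
proof -
  have "T0 (LP (LP P)) z = 16 * (norm z ^ 4 * P 4 (z \<bullet> z)) - 80 * (norm z ^ 2 * P 3 (z \<bullet> z)) + 60 * P 2 (z \<bullet> z)"
  proof -
    have n4: "norm z ^ 4 = (z \<bullet> z) * (z \<bullet> z)" using power2_norm_eq_inner[of z] by (simp add: power4_eq_xxxx power2_eq_square)
    show ?thesis unfolding n4 power2_norm_eq_inner
      by (simp add: T0_def LP_def eval_nat_numeral algebra_simps)
  qed
  then have "\<bar>T0 (LP (LP P)) z\<bar> \<le> 16 * \<bar>norm z ^ 4 * P 4 (z \<bullet> z)\<bar> + 80 * \<bar>norm z ^ 2 * P 3 (z \<bullet> z)\<bar> + 60 * \<bar>P 2 (z \<bullet> z)\<bar>"
    by linarith
  then show ?thesis using domQD[OF assms, of 4 4 z] domQD[OF assms, of 3 2 z] domQD[OF assms, of 2 0 z]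
    by (simp add: abs_mult)
qed


section \<open>The heat kernel\<close>

text \<open>With this choice \<open>exp (- (lam t)\<^sup>2 * \<bar>z\<bar>\<^sup>2)\<close> is the heat kernel at time \<open>t\<close> up to normalization.\<close>

definition lam :: "real \<Rightarrow> real" where "lam t = 1 / (2 * sqrt t)"
definition PL :: "real \<Rightarrow> nat \<Rightarrow> real \<Rightarrow> real" where "PL t = Pl (lam t)"
definition cN :: real where "cN = 1 / (2 * sqrt pi ^ 3)"
text \<open>The heat kernel, introduced as a Laplacian because the test fields below are built from the
  potential; the closed formula is lemma \<open>hk_eq\<close>.\<close>

definition hk :: "real \<Rightarrow> vec3 \<Rightarrow> real" where "hk t z = - cN * T0 (LP (PL t)) z"
definition hk1 :: "real \<Rightarrow> 3 \<Rightarrow> vec3 \<Rightarrow> real" where "hk1 t j z = - cN * T1 (LP (PL t)) j z"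
definition hk2 :: "real \<Rightarrow> 3 \<Rightarrow> 3 \<Rightarrow> vec3 \<Rightarrow> real" where "hk2 t i j z = - cN * T2 (LP (PL t)) i j z"
text \<open>The Laplacian of the heat kernel.\<close>

definition hkL :: "real \<Rightarrow> vec3 \<Rightarrow> real" where "hkL t z = - cN * T0 (LP (LP (PL t))) z"
text \<open>The derivative in direction \<open>j\<close> of the Oseen kernel, that is, of the heat kernel followed by the
  projection onto solenoidal fields.\<close>

definition Dk :: "real \<Rightarrow> 3 \<Rightarrow> 3 \<Rightarrow> 3 \<Rightarrow> vec3 \<Rightarrow> real" where
  "Dk t k i j z = - cN * (dl i k * T1 (LP (PL t)) j z - T3 (PL t) i j k z)"
text \<open>The bound for the first derivatives of the heat kernel and of the Oseen kernel.\<close>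

definition kk :: "real \<Rightarrow> vec3 \<Rightarrow> real" where "kk t = kf (lam t) 3"
definition cK :: real where "cK = 8 * sqrt pi ^ 3"

lemma sqrt_pi_ge: "1 \<le> sqrt pi" using pi_gt3 by simp
lemma sqrt_pi3_ge: "1 \<le> sqrt pi ^ 3" using sqrt_pi_ge by (rule one_le_power)
lemma cN_bounds: "0 < cN" "cN \<le> 1" using sqrt_pi3_ge by (auto simp: cN_def field_simps)
lemma cK_pos: "cK > 0" by (simp add: cK_def)

lemma lam_pos: "t > 0 \<Longrightarrow> lam t > 0" by (simp add: lam_def)
lemma lam_nonneg[simp]: "t \<ge> 0 \<Longrightarrow> lam t \<ge> 0" by (simp add: lam_def)
lemma lam_sq: "t > 0 \<Longrightarrow> (lam t)\<^sup>2 = 1 / (4 * t)" by (simp add: lam_def power_divide power_mult_distrib)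
lemma lam_anti: "0 < s \<Longrightarrow> s \<le> t \<Longrightarrow> lam t \<le> lam s"
  unfolding lam_def by (intro divide_left_mono) auto

lemma DERIV_lam: assumes "t > 0" shows "(lam has_real_derivative - 2 * lam t ^ 3) (at t)"
proof -
  have "((\<lambda>t. 1 / (2 * sqrt t)) has_real_derivative - (inverse (sqrt t) / 2 * 2) / (2 * sqrt t * (2 * sqrt t))) (at t)"
    using assms by (auto intro!: derivative_eq_intros simp: field_simps)
  moreover have "- (inverse (sqrt t) / 2 * 2) / (2 * sqrt t * (2 * sqrt t)) = - 2 * lam t ^ 3"
    using assms by (simp add: lam_def power3_eq_cube field_simps)
  ultimately show ?thesis unfolding lam_def[abs_def] by (simp add: lam_def)
qed

lemma LP_PL: assumes "t > 0" shows "LP (PL t) m u = - 2 * lam t ^ (2*m + 3) * exp (- (u * (lam t)\<^sup>2))"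
  unfolding PL_def by (rule LP_Pl) (use assms in simp)

lemma hk_eq: assumes "t > 0" shows "hk t z = lam t ^ 3 / sqrt pi ^ 3 * exp (- ((lam t)\<^sup>2 * (z \<bullet> z)))"
  unfolding hk_def T0_def LP_PL[OF assms] cN_def by (simp add: mult.commute)

lemma domQ_PL: "domQ (lam t) (PL t)" unfolding PL_def by (rule domQ_Pl)

lemma DERIV_PL: "(PL t m has_real_derivative - PL t (Suc m) u) (at u)"
  unfolding PL_def by (rule DERIV_Pl)
lemma DERIV_PL': "Suc m = n \<Longrightarrow> (PL t m has_real_derivative - PL t n u) (at u)"
  using DERIV_PL by auto

lemma DERIV_LPL: "Suc m = n \<Longrightarrow> (LP (PL t) m has_real_derivative - LP (PL t) n u) (at u)"
  using DERIV_LP[of "PL t" m u] DERIV_PL'[of "m+1" "m+2"] DERIV_PL'[of "m+2" "m+3"] by auto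

lemma deriv_hk: "deriv_along (axis j 1) (hk t) (hk1 t j)"
  unfolding hk_def[abs_def] hk1_def[abs_def] by (intro deriv_along_cmult deriv_T0 DERIV_LPL) simp
lemma deriv_hk1: "deriv_along (axis j 1) (hk1 t i) (hk2 t i j)"
  unfolding hk1_def[abs_def] hk2_def[abs_def] by (intro deriv_along_cmult deriv_T1 DERIV_LPL) simp
lemma sum_hk2: "(\<Sum>a\<in>UNIV. hk2 t a a z) = hkL t z"
  unfolding hk2_def hkL_def by (simp only: sum_distrib_left[symmetric] sum_T2)

lemma cont_T:
  assumes "\<And>m. m \<le> 3 \<Longrightarrow> continuous_on UNIV (P m)"
  shows "continuous_on UNIV (T0 P)" "continuous_on UNIV (T1 P i)" "continuous_on UNIV (T2 P i j)" "continuous_on UNIV (T3 P i j k)"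
proof -
  have c: "continuous_on UNIV (\<lambda>z::vec3. P m (z \<bullet> z))" if "m \<le> 3" for m
    by (rule continuous_on_compose2[OF assms[OF that]]) (auto intro: continuous_intros)
  show "continuous_on UNIV (T0 P)" "continuous_on UNIV (T1 P i)" "continuous_on UNIV (T2 P i j)" "continuous_on UNIV (T3 P i j k)"
    unfolding T0_def[abs_def] T1_def[abs_def] T2_def[abs_def] T3_def[abs_def]
    by (intro continuous_intros c; simp)+
qed

lemma cont_PL: "continuous_on S (PL t m)" unfolding PL_def by (rule continuous_Pl)
lemma cont_LP: "continuous_on S (P (m+2)) \<Longrightarrow> continuous_on S (P (m+1)) \<Longrightarrow> continuous_on S (LP P m)"
  unfolding LP_def[abs_def] by (intro continuous_intros)
lemma cont_LPL: "continuous_on S (LP (PL t) m)" by (intro cont_LP cont_PL)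
lemma cont_LLPL: "continuous_on S (LP (LP (PL t)) m)" by (intro cont_LP cont_LPL)

lemma cont_hk: "continuous_on UNIV (hk t)" unfolding hk_def[abs_def] by (intro continuous_intros cont_T cont_LPL)
lemma cont_hk1: "continuous_on UNIV (hk1 t j)" unfolding hk1_def[abs_def] by (intro continuous_intros cont_T cont_LPL)
lemma cont_hk2: "continuous_on UNIV (hk2 t i j)" unfolding hk2_def[abs_def] by (intro continuous_intros cont_T cont_LPL)
lemma cont_hkL: "continuous_on UNIV (hkL t)" unfolding hkL_def[abs_def] by (intro continuous_intros cont_T cont_LLPL)
lemma cont_T3PL: "continuous_on UNIV (T3 (PL t) i j k)" by (intro cont_T cont_PL)
lemma cont_T2PL: "continuous_on UNIV (T2 (PL t) i j)" by (intro cont_T cont_PL)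
lemma cont_Dk: "continuous_on UNIV (Dk t k i j)"
  unfolding Dk_def[abs_def] by (intro continuous_intros cont_T cont_LPL cont_T3PL)

lemma continuous_on_shift: "continuous_on UNIV f \<Longrightarrow> continuous_on UNIV (\<lambda>y. f (y - (x::vec3)))"
  by (rule continuous_on_compose2[of UNIV f]) (auto intro!: continuous_intros)

lemma meas_hk[measurable]: "hk t \<in> borel_measurable borel" "hk1 t j \<in> borel_measurable borel" "hk2 t i j \<in> borel_measurable borel"
  "hkL t \<in> borel_measurable borel" "Dk t k i j \<in> borel_measurable borel" "T2 (PL t) i j \<in> borel_measurable borel" "T3 (PL t) i j k \<in> borel_measurable borel"
  by (intro borel_measurable_continuous_onI cont_hk cont_hk1 cont_hk2 cont_hkL cont_Dk cont_T2PL cont_T3PL)+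

lemma kk_nonneg[simp]: "0 \<le> kk t z" by (simp add: kk_def)
lemma kk_anti: "0 < s \<Longrightarrow> s \<le> t \<Longrightarrow> kk t z \<le> kk s z" unfolding kk_def by (intro kf_mono lam_anti)
lemma kk_L1: assumes "t > 0" shows "integrable lborel (kk t)" "l1n (kk t) \<le> cK * lam t"
  using kf_L1[of "lam t" 3] assms by (auto simp: kk_def cK_def)
lemma kk_sqi: assumes "t > 0" shows "sqi (kk t)" "l2n (kk t) \<le> sqrt (lam t ^ 4 * (cK * lam t))"
  using kf_sqi[of "lam t" 3] assms by (auto simp: kk_def cK_def)
lemma kk_measurable[measurable]:
  assumes [measurable]: "f \<in> borel_measurable M" "g \<in> borel_measurable M"
  shows "(\<lambda>x. kk (f x) (g x)) \<in> borel_measurable M"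
  unfolding kk_def lam_def by measurable
lemma abs_cN_le: "\<bar>- cN * x\<bar> \<le> \<bar>x\<bar>"
  using cN_bounds mult_right_mono[of cN 1 "\<bar>x\<bar>"] by (simp add: abs_mult)

lemma hk1_bound: "\<bar>hk1 t j z\<bar> \<le> 924 * kk t z"
  unfolding hk1_def kk_def by (rule order_trans[OF abs_cN_le T1LP_bound[OF domQ_PL]])
lemma hk2_bound: "\<bar>hk2 t i j z\<bar> \<le> 3300 * kf (lam t) 4 z"
  unfolding hk2_def by (rule order_trans[OF abs_cN_le T2LP_bound[OF domQ_PL]])
lemma hkL_bound: "\<bar>hkL t z\<bar> \<le> 5148 * kf (lam t) 4 z"
  unfolding hkL_def by (rule order_trans[OF abs_cN_le T0LLP_bound[OF domQ_PL]])
lemma T3PL_bound: "\<bar>T3 (PL t) i j k z\<bar> \<le> 660 * kk t z"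
  unfolding kk_def by (rule T3_bound[OF domQ_PL])
lemma T2PL_bound: "\<bar>T2 (PL t) i j z\<bar> \<le> 198 * kf (lam t) 2 z"
  by (rule T2_bound[OF domQ_PL])
text \<open>The constant is \<open>924 + 660\<close>, from the two parts of the kernel.\<close>

lemma Dk_bound: "\<bar>Dk t k i j z\<bar> \<le> 1584 * kk t z"
proof -
  have "\<bar>Dk t k i j z\<bar> \<le> \<bar>dl i k * T1 (LP (PL t)) j z - T3 (PL t) i j k z\<bar>"
    unfolding Dk_def by (rule abs_cN_le)
  also have "\<dots> \<le> \<bar>dl i k\<bar> * \<bar>T1 (LP (PL t)) j z\<bar> + \<bar>T3 (PL t) i j k z\<bar>"
    by (rule order_trans[OF abs_triangle_ineq4]) (simp add: abs_mult)
  also have "\<dots> \<le> 1 * (924 * kk t z) + 660 * kk t z"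
    unfolding kk_def by (intro add_mono mult_mono dl_abs T1LP_bound T3_bound domQ_PL) auto
  finally show ?thesis by simp
qed

text \<open>A measurable function dominated by one of the kernels is integrable and square integrable.\<close>

lemma kf_bounded_class:
  assumes t: "t > 0" and m: "m \<ge> 3" and f: "f \<in> borel_measurable borel" "\<And>z. \<bar>f z\<bar> \<le> C * kf (lam t) m z" and C: "C \<ge> 0"
  shows "integrable lborel f" "l1n f \<le> C * (8 * sqrt pi ^ 3 * lam t ^ (m - 2))" "sqi f"
proof -
  note k = kf_L1[of "lam t" m] kf_sqi[of "lam t" m]
  have i: "integrable lborel (\<lambda>z. C * kf (lam t) m z)" using k t m by auto
  show fi: "integrable lborel f"
    by (rule Bochner_Integration.integrable_bound[OF i]) (use f C in \<open>auto simp: abs_mult\<close>)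
  have "l1n f \<le> (LINT z|lborel. C * kf (lam t) m z)"
    unfolding l1n_def by (rule integral_mono) (use fi i f in auto)
  also have "\<dots> = C * l1n (kf (lam t) m)" by (simp add: l1n_def)
  also have "\<dots> \<le> C * (8 * sqrt pi ^ 3 * lam t ^ (m - 2))" using k(2) t m C by (intro mult_left_mono) auto
  finally show "l1n f \<le> C * (8 * sqrt pi ^ 3 * lam t ^ (m - 2))" .
  show "sqi f" by (rule sqi_dominated(1)[OF f(1) sqi_cmult[of "kf (lam t) m" C]])
      (use f C k t m in \<open>auto simp: abs_mult\<close>)
qed

lemma hk1_class: assumes "t > 0" shows "integrable lborel (hk1 t j)" "l1n (hk1 t j) \<le> 924 * (cK * lam t)" "sqi (hk1 t j)"
  using kf_bounded_class[OF assms _ meas_hk(2) hk1_bound[unfolded kk_def]] by (auto simp: cK_def)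
lemma hk2_class: assumes "t > 0" shows "integrable lborel (hk2 t i j)" "sqi (hk2 t i j)"
  using kf_bounded_class[OF assms _ meas_hk(3) hk2_bound] by auto
lemma hkL_class: assumes "t > 0" shows "integrable lborel (hkL t)" "sqi (hkL t)"
  using kf_bounded_class[OF assms _ meas_hk(4) hkL_bound] by auto
lemma Dk_class: assumes "t > 0" shows "integrable lborel (Dk t k i j)" "sqi (Dk t k i j)"
  using kf_bounded_class[OF assms _ meas_hk(5) Dk_bound[unfolded kk_def]] by auto
lemma T3PL_class: assumes "t > 0" shows "integrable lborel (T3 (PL t) i j k)" "sqi (T3 (PL t) i j k)"
  using kf_bounded_class[OF assms _ meas_hk(7) T3PL_bound[unfolded kk_def]] by auto
lemma T2PL_class: assumes "t > 0" shows "sqi (T2 (PL t) i j)"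
  by (rule sqi_dominated(1)[OF meas_hk(6) sqi_cmult[OF kf_two_sqi[of "lam t"], of 198]])
     (use assms T2PL_bound in \<open>auto simp: abs_mult\<close>)

lemma hk_nonneg: "t > 0 \<Longrightarrow> 0 \<le> hk t z" by (simp add: hk_eq lam_def)

lemma hk_le: assumes "t > 0" shows "hk t z \<le> lam t ^ 3"
proof -
  have "lam t ^ 3 / sqrt pi ^ 3 * exp (- ((lam t)\<^sup>2 * (z \<bullet> z))) \<le> lam t ^ 3 * 1"
    using sqrt_pi3_ge lam_pos[OF assms] by (intro mult_mono) (auto simp: field_simps)
  then show ?thesis by (simp add: hk_eq[OF assms])
qed

lemma hk_L1: assumes t: "t > 0" shows "integrable lborel (hk t)" "(LINT z|lborel. hk t z) = 1" "l1n (hk t) = 1"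
proof -
  have a: "(lam t)\<^sup>2 > 0" using lam_pos[OF t] by simp
  show "integrable lborel (hk t)" unfolding hk_eq[OF t] using gauss_3d(1)[OF a] by simp
  have "sqrt (pi / (lam t)\<^sup>2) = sqrt pi / lam t" using lam_pos[OF t] by (simp add: real_sqrt_divide)
  then show 1: "(LINT z|lborel. hk t z) = 1" unfolding hk_eq[OF t] using lam_pos[OF t]
    by (simp add: gauss_3d(2)[OF a] power_divide)
  then show "l1n (hk t) = 1" using hk_nonneg[OF t] by (simp add: l1n_def)
qed

lemma hk_sqi: assumes t: "t > 0" shows "sqi (hk t)" "l2n (hk t) \<le> sqrt (lam t ^ 3)"
proof -
  have "\<bar>hk t z\<bar> \<le> lam t ^ 3" for z using hk_le[OF t] hk_nonneg[OF t] by simp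
  from sqi_bounded[OF _ hk_L1(1)[OF t] this, of 1] hk_L1(3)[OF t] lam_pos[OF t]
  show "sqi (hk t)" "l2n (hk t) \<le> sqrt (lam t ^ 3)" by auto
qed

lemma hk_even: "hk t (- z) = hk t z" by (simp add: hk_def T0_def)

lemma DERIV_hk: assumes t: "t > 0" shows "((\<lambda>t. hk t z) has_real_derivative hkL t z) (at t)"
proof -
  define u where "u = z \<bullet> z"
  define E where "E = exp (- ((lam t)\<^sup>2 * u))"
  define S where "S = sqrt pi ^ 3"
  have "((\<lambda>t. lam t ^ 3 * exp (- ((lam t)\<^sup>2 * u))) has_real_derivative
     3 * lam t ^ 2 * (- 2 * lam t ^ 3) * E + E * (- (2 * lam t * (- 2 * lam t ^ 3) * u)) * lam t ^ 3) (at t)"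
    unfolding E_def by (rule derivative_eq_intros DERIV_lam[OF t] refl | simp)+
  from DERIV_cmult[OF this, of "1 / S"]
  have "((\<lambda>t. lam t ^ 3 / sqrt pi ^ 3 * exp (- ((lam t)\<^sup>2 * u))) has_real_derivative
     1 / S * (3 * lam t ^ 2 * (- 2 * lam t ^ 3) * E + E * (- (2 * lam t * (- 2 * lam t ^ 3) * u)) * lam t ^ 3)) (at t)"
    by (simp add: S_def)
  moreover have "1 / S * (3 * lam t ^ 2 * (- 2 * lam t ^ 3) * E + E * (- (2 * lam t * (- 2 * lam t ^ 3) * u)) * lam t ^ 3) = hkL t z"
  proof -
    have "hkL t z = - cN * (4 * u * (- 2 * lam t ^ 7 * E) - 6 * (- 2 * lam t ^ 5 * E))"
      unfolding hkL_def T0_def LP_def[of "LP (PL t)"] LP_PL[OF t] u_def E_def by (simp add: mult.commute)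
    also have "\<dots> = 1 / S * (3 * lam t ^ 2 * (- 2 * lam t ^ 3) * E + E * (- (2 * lam t * (- 2 * lam t ^ 3) * u)) * lam t ^ 3)"
      unfolding cN_def S_def[symmetric] by (simp add: eval_nat_numeral algebra_simps)
    finally show ?thesis by simp
  qed
  ultimately have "((\<lambda>t. lam t ^ 3 / sqrt pi ^ 3 * exp (- ((lam t)\<^sup>2 * u))) has_real_derivative hkL t z) (at t)" by simp
  then show ?thesis unfolding u_def
    by (rule has_field_derivative_transform_within_open[where S="{0<..}"]) (use t hk_eq in auto)
qed

lemma continuous_lam: "continuous_on {0<..} lam"
  unfolding lam_def[abs_def] by (intro continuous_intros) auto

lemma cont2_hk: "continuous_on ({0<..} \<times> UNIV) (\<lambda>(t,z). hk t z)"
proof -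
  have "continuous_on ({0<..} \<times> UNIV) (\<lambda>p::real \<times> vec3. lam (fst p) ^ 3 / sqrt pi ^ 3 * exp (- ((lam (fst p))\<^sup>2 * (snd p \<bullet> snd p))))"
    by (intro continuous_intros continuous_on_compose2[OF continuous_lam]) auto
  then show ?thesis by (rule continuous_on_eq) (auto simp: hk_eq)
qed

lemma cont2_hkL: "continuous_on ({0<..} \<times> UNIV) (\<lambda>(t,z). hkL t z)"
proof -
  have "continuous_on ({0<..} \<times> UNIV) (\<lambda>p::real \<times> vec3. - cN * (4 * (snd p \<bullet> snd p) * (- 2 * lam (fst p) ^ 7 * exp (- ((snd p \<bullet> snd p) * (lam (fst p))\<^sup>2)))
     - 6 * (- 2 * lam (fst p) ^ 5 * exp (- ((snd p \<bullet> snd p) * (lam (fst p))\<^sup>2)))))"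
    by (intro continuous_intros continuous_on_compose2[OF continuous_lam]) auto
  then show ?thesis
    by (rule continuous_on_eq) (auto simp: hkL_def T0_def LP_def[of "LP (PL t)" for t] LP_PL)
qed

text \<open>Completing the square: the exponents add up to a Gaussian around the point \<open>m\<close> plus the exponent of
  the kernel at time \<open>s + t\<close>.\<close>

lemma hk_semigroup:
  assumes s: "s > 0" and t: "t > 0"
  shows "(LINT y|lborel. hk s (y - x) * hk t (z - y)) = hk (s + t) (z - x)"
proof -
  have st: "s + t > 0" using s t by simp
  define m where "m = (t / (s + t)) *\<^sub>R x + (s / (s + t)) *\<^sub>R z"
  define a where "a = (s + t) / (4 * s * t)"
  have a: "a > 0" using s t by (simp add: a_def)
  have ex: "(lam s)\<^sup>2 * ((y - x) \<bullet> (y - x)) + (lam t)\<^sup>2 * ((z - y) \<bullet> (z - y)) =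
     a * ((y - m) \<bullet> (y - m)) + (lam (s + t))\<^sup>2 * ((z - x) \<bullet> (z - x))" for y
  proof -
    define p where "p = y - m"
    define d where "d = z - x"
    have yx: "y - x = p + (s / (s + t)) *\<^sub>R d"
    proof -
      have "x = (t / (s + t)) *\<^sub>R x + (s / (s + t)) *\<^sub>R x"
        using st by (simp add: scaleR_add_left[symmetric] add_divide_distrib[symmetric] add.commute)
      then show ?thesis unfolding p_def d_def m_def by (simp add: algebra_simps)
    qed
    have zy: "z - y = (t / (s + t)) *\<^sub>R d - p"
    proof -
      have "z = (t / (s + t)) *\<^sub>R z + (s / (s + t)) *\<^sub>R z"
        using st by (simp add: scaleR_add_left[symmetric] add_divide_distrib[symmetric] add.commute)
      then show ?thesis unfolding p_def d_def m_def by (simp add: algebra_simps)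
    qed
    have "(1 / (4 * s)) * (P + 2 * (s / (s + t)) * Q + (s / (s + t))\<^sup>2 * R) + (1 / (4 * t)) * ((t / (s + t))\<^sup>2 * R - 2 * (t / (s + t)) * Q + P)
      = (s + t) / (4 * s * t) * P + (1 / (4 * (s + t))) * R" for P Q R
    proof -
      have c1: "1 / (4 * s) + 1 / (4 * t) = (s + t) / (4 * s * t)" using s t by (simp add: field_simps)
      have c2: "(1 / (4 * s)) * (2 * (s / (s + t))) - (1 / (4 * t)) * (2 * (t / (s + t))) = 0" using s t by simp
      have c3: "(1 / (4 * s)) * (s / (s + t))\<^sup>2 + (1 / (4 * t)) * (t / (s + t))\<^sup>2 = 1 / (4 * (s + t))"
      proof -
        have "(1 / (4 * s)) * (s / (s + t))\<^sup>2 + (1 / (4 * t)) * (t / (s + t))\<^sup>2 = (s + t) / (4 * (s + t)\<^sup>2)"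
          using s t by (simp add: power_divide add_divide_distrib) (simp add: power2_eq_square)
        then show ?thesis using st by (simp add: power2_eq_square)
      qed
      have "A * (P + X * Q + X2 * R) + B * (Y2 * R - Y * Q + P) = (A + B) * P + (A * X - B * Y) * Q + (A * X2 + B * Y2) * R"
        for A B X Y X2 Y2 :: real by (simp add: algebra_simps)
      from this[of "1 / (4 * s)" "2 * (s / (s + t))" "(s / (s + t))\<^sup>2" "1 / (4 * t)" "(t / (s + t))\<^sup>2" "2 * (t / (s + t))"]
      show ?thesis unfolding c1 c2 c3 by simp
    qed
    from this[of "p \<bullet> p" "p \<bullet> d" "d \<bullet> d"] show ?thesis
      unfolding yx zy lam_sq[OF s] lam_sq[OF t] lam_sq[OF st] a_def d_def[symmetric] p_def[symmetric]
      by (simp add: inner_add_left inner_add_right inner_diff_left inner_diff_right inner_commute[of d p] power2_eq_square algebra_simps)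
  qed
  have "hk s (y - x) * hk t (z - y) = lam s ^ 3 / sqrt pi ^ 3 * (lam t ^ 3 / sqrt pi ^ 3) * exp (- ((lam (s + t))\<^sup>2 * ((z - x) \<bullet> (z - x)))) * exp (- (a * ((y - m) \<bullet> (y - m))))" for y
  proof -
    have "exp (- ((lam s)\<^sup>2 * ((y - x) \<bullet> (y - x)))) * exp (- ((lam t)\<^sup>2 * ((z - y) \<bullet> (z - y))))
      = exp (- ((lam s)\<^sup>2 * ((y - x) \<bullet> (y - x)) + (lam t)\<^sup>2 * ((z - y) \<bullet> (z - y))))"
      by (simp add: exp_add[symmetric])
    also have "\<dots> = exp (- (a * ((y - m) \<bullet> (y - m)))) * exp (- ((lam (s + t))\<^sup>2 * ((z - x) \<bullet> (z - x))))"
      unfolding ex by (simp add: exp_add[symmetric])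
    finally show ?thesis unfolding hk_eq[OF s] hk_eq[OF t] by (simp add: mult_ac)
  qed
  then have "(LINT y|lborel. hk s (y - x) * hk t (z - y)) = lam s ^ 3 / sqrt pi ^ 3 * (lam t ^ 3 / sqrt pi ^ 3) * exp (- ((lam (s + t))\<^sup>2 * ((z - x) \<bullet> (z - x)))) * (LINT y|lborel. exp (- (a * ((y - m) \<bullet> (y - m)))))"
    by simp
  also have "(LINT y|lborel. exp (- (a * ((y - m) \<bullet> (y - m))))) = sqrt (pi / a) ^ 3"
    using integral_shift[of "\<lambda>y. exp (- (a * (y \<bullet> y)))" m] gauss_3d(2)[OF a] by simp
  also have "lam s ^ 3 / sqrt pi ^ 3 * (lam t ^ 3 / sqrt pi ^ 3) * exp (- ((lam (s + t))\<^sup>2 * ((z - x) \<bullet> (z - x)))) * sqrt (pi / a) ^ 3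
     = (lam s * lam t / pi * sqrt (pi / a)) ^ 3 * exp (- ((lam (s + t))\<^sup>2 * ((z - x) \<bullet> (z - x))))"
    by (simp add: power_mult_distrib power_divide flip: power_mult_distrib)
  also have "lam s * lam t / pi * sqrt (pi / a) = lam (s + t) / sqrt pi"
  proof -
    have p: "sqrt pi * sqrt pi = pi" "sqrt s * sqrt s = s" "sqrt t * sqrt t = t" using s t by auto
    have "sqrt (pi / a) = sqrt pi * (2 * sqrt s * sqrt t) / sqrt (s + t)"
      unfolding a_def using s t by (simp add: real_sqrt_divide real_sqrt_mult)
    then show ?thesis unfolding lam_def using s t by (simp add: field_simps)
  qed
  finally show ?thesis by (simp add: hk_eq[OF st] power_divide)
qed

text \<open>The factor \<open>\<bar>z\<bar>\<close> gains \<open>sqrt t\<close>. This is the source of the small commutator in the energy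
  inequality.\<close>

lemma hk_moment:
  assumes t: "t > 0"
  shows "integrable lborel (\<lambda>z. norm z * hk t z)" "l1n (\<lambda>z. norm z * hk t z) \<le> 6 * sqrt t"
proof -
  let ?l = "lam t"
  let ?g = "\<lambda>z::vec3. 2 * sqrt t * (?l ^ 3 / sqrt pi ^ 3 * exp (- (?l\<^sup>2 / 2 * (z \<bullet> z))))"
  have l: "?l > 0" by (rule lam_pos[OF t])
  have le: "\<bar>norm z * hk t z\<bar> \<le> ?g z" for z
  proof -
    define x where "x = norm z * ?l"
    have x0: "x \<ge> 0" using l by (simp add: x_def)
    have "x \<le> exp (x\<^sup>2 / 2)"
    proof -
      have "1 + x\<^sup>2 / 2 \<le> exp (x\<^sup>2 / 2)" by (rule exp_ge_add_one_self)
      moreover have "x \<le> 1 + x\<^sup>2 / 2" using zero_le_power2[of "x - 1"] by (simp add: power2_diff)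
      ultimately show ?thesis by linarith
    qed
    then have "x * exp (- (x\<^sup>2 / 2) - x\<^sup>2 / 2) \<le> exp (x\<^sup>2 / 2) * exp (- (x\<^sup>2 / 2) - x\<^sup>2 / 2)"
      by (rule mult_right_mono) simp
    then have xe: "x * exp (- x\<^sup>2) \<le> exp (- (x\<^sup>2 / 2))" by (simp add: exp_add[symmetric])
    have e: "x\<^sup>2 = ?l\<^sup>2 * (z \<bullet> z)" by (simp add: x_def power_mult_distrib power2_norm_eq_inner mult.commute)
    have n: "norm z = 2 * sqrt t * x" using t by (simp add: x_def lam_def)
    have "\<bar>norm z * hk t z\<bar> = 2 * sqrt t * (?l ^ 3 / sqrt pi ^ 3 * (x * exp (- x\<^sup>2)))"
      unfolding hk_eq[OF t] e[symmetric] using x0 l t by (simp add: abs_mult n)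
    also have "\<dots> \<le> 2 * sqrt t * (?l ^ 3 / sqrt pi ^ 3 * exp (- (x\<^sup>2 / 2)))"
      using xe l t by (intro mult_left_mono) auto
    finally show ?thesis unfolding e by simp
  qed
  have a: "?l\<^sup>2 / 2 > 0" using l by simp
  have gi: "integrable lborel ?g" using gauss_3d(1)[OF a] by simp
  show i: "integrable lborel (\<lambda>z. norm z * hk t z)"
    by (rule Bochner_Integration.integrable_bound[OF gi])
       (measurable, rule AE_I2, unfold real_norm_def, rule order_trans[OF le abs_ge_self])
  have "l1n (\<lambda>z. norm z * hk t z) \<le> (LINT z|lborel. ?g z)"
    unfolding l1n_def by (rule integral_mono) (use i gi le in auto)
  also have "\<dots> = 2 * sqrt t * (?l ^ 3 / sqrt pi ^ 3 * sqrt (pi / (?l\<^sup>2 / 2)) ^ 3)"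
    by (simp only: integral_mult_right_zero gauss_3d(2)[OF a])
  also have "sqrt (pi / (?l\<^sup>2 / 2)) = sqrt pi * sqrt 2 / ?l" using l by (simp add: real_sqrt_divide real_sqrt_mult)
  also have "2 * sqrt t * (?l ^ 3 / sqrt pi ^ 3 * (sqrt pi * sqrt 2 / ?l) ^ 3) = 2 * sqrt t * sqrt 2 ^ 3"
    using l by (simp add: power_mult_distrib power_divide)
  also have "\<dots> \<le> 6 * sqrt t"
  proof -
    have "sqrt 2 ^ 3 = 2 * sqrt 2" by (simp add: power3_eq_cube)
    moreover have "sqrt 2 \<le> 3/2" by (rule real_le_lsqrt) (auto simp: power2_eq_square)
    ultimately have "sqrt 2 ^ 3 \<le> 3" by linarith
    then have "2 * sqrt t * sqrt 2 ^ 3 \<le> 2 * sqrt t * 3" using t by (intro mult_left_mono) auto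
    then show ?thesis by simp
  qed
  finally show "l1n (\<lambda>z. norm z * hk t z) \<le> 6 * sqrt t" .
qed

text \<open>Away from the origin the kernel is small, uniformly against a fixed Gaussian that does not depend on
  the time.\<close>

lemma hk_tail:
  assumes t: "t > 0" "t \<le> 1/2" and z: "norm z \<ge> r" "r \<ge> 0"
  shows "hk t z \<le> lam t ^ 3 * exp (- (r\<^sup>2 * (lam t)\<^sup>2 / 2)) * exp (- (1/4 * (z \<bullet> z)))"
proof -
  have l: "(lam t)\<^sup>2 \<ge> 1/2" unfolding lam_sq[OF t(1)] using t by (simp add: field_simps)
  have "r\<^sup>2 \<le> (norm z)\<^sup>2" using z by (intro power_mono) auto
  then have r: "r\<^sup>2 \<le> z \<bullet> z" by (simp add: power2_norm_eq_inner)
  have "r\<^sup>2 * (lam t)\<^sup>2 / 2 + 1/4 * (z \<bullet> z) \<le> (z \<bullet> z) * (lam t)\<^sup>2 / 2 + (lam t)\<^sup>2 / 2 * (z \<bullet> z)"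
    by (intro add_mono divide_right_mono mult_right_mono r) (use l in auto)
  then have "r\<^sup>2 * (lam t)\<^sup>2 / 2 + 1/4 * (z \<bullet> z) \<le> (lam t)\<^sup>2 * (z \<bullet> z)" by (simp add: mult.commute)
  then have "exp (- ((lam t)\<^sup>2 * (z \<bullet> z))) \<le> exp (- (r\<^sup>2 * (lam t)\<^sup>2 / 2) + - (1/4 * (z \<bullet> z)))" by simp
  then have le: "exp (- ((lam t)\<^sup>2 * (z \<bullet> z))) \<le> exp (- (r\<^sup>2 * (lam t)\<^sup>2 / 2)) * exp (- (1/4 * (z \<bullet> z)))"
    unfolding exp_add .
  have "lam t ^ 3 / sqrt pi ^ 3 * exp (- ((lam t)\<^sup>2 * (z \<bullet> z))) \<le> lam t ^ 3 * (exp (- (r\<^sup>2 * (lam t)\<^sup>2 / 2)) * exp (- (1/4 * (z \<bullet> z))))"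
    by (rule mult_mono[OF _ le]) (use sqrt_pi3_ge lam_pos[OF t(1)] in \<open>auto simp: field_simps\<close>)
  then show ?thesis by (simp add: hk_eq[OF t(1)] mult.assoc)
qed


section \<open>The equation tested with solenoidal fields\<close>

lemma pair_limit:
  assumes f: "sqi f" and g: "\<And>n. g n \<in> borel_measurable borel" and lim: "\<And>z. (\<lambda>n. g n z) \<longlonglongrightarrow> g' z"
    and le: "\<And>n z. \<bar>g n z\<bar> \<le> G z" and G: "sqi G"
  shows "(\<lambda>n. LINT y|lborel. f y * g n (y - x)) \<longlonglongrightarrow> (LINT y|lborel. f y * g' (y - (x::vec3)))"
proof (rule integral_dominated_convergence[where w="\<lambda>y. \<bar>f y\<bar> * G (y - x)"])
  note [measurable] = sqi_meas[OF f] g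
  have [measurable]: "g' \<in> borel_measurable borel"
    by (rule borel_measurable_LIMSEQ_real[OF lim]) auto
  show "(\<lambda>y. f y * g' (y - x)) \<in> borel_measurable lborel" "\<And>n. (\<lambda>y. f y * g n (y - x)) \<in> borel_measurable lborel" by measurable
  show "integrable lborel (\<lambda>y. \<bar>f y\<bar> * G (y - x))" by (rule sqi_mult[OF sqi_abs[OF f] sqi_shift(1)[OF G]])
  show "AE y in lborel. (\<lambda>n. f y * g n (y - x)) \<longlonglongrightarrow> f y * g' (y - x)" by (auto intro!: tendsto_intros lim)
  show "AE y in lborel. norm (f y * g n (y - x)) \<le> \<bar>f y\<bar> * G (y - x)" for n
    by (auto simp: abs_mult intro!: mult_left_mono le)
qed

text \<open>A minimal class of test functions: the approximants are only finitely often differentiable, and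
  derivatives are supplied separately through \<open>deriv_along\<close>.\<close>

definition csupp :: "(vec3 \<Rightarrow> real) \<Rightarrow> bool" where
  "csupp g \<longleftrightarrow> continuous_on UNIV g \<and> (\<exists>R. \<forall>y. norm y > R \<longrightarrow> g y = 0)"

lemma csupp_cont: "csupp g \<Longrightarrow> continuous_on UNIV g" by (simp add: csupp_def)

lemma csupp_shift: assumes "csupp g" shows "csupp (\<lambda>y. g (y - x))"
proof -
  obtain R where R: "\<And>y. norm y > R \<Longrightarrow> g y = 0" using assms by (auto simp: csupp_def)
  have "g (y - x) = 0" if "norm y > R + norm x" for y
    using R[of "y - x"] norm_triangle_ineq2[of y x] that by auto
  then show ?thesis using continuous_on_shift[OF csupp_cont[OF assms]] by (auto simp: csupp_def)
qed

lemma csupp_integrable: "csupp g \<Longrightarrow> continuous_on UNIV f \<Longrightarrow> integrable lborel (\<lambda>y. f y * g y)"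
  unfolding csupp_def using integrable_compact_supp by blast

lemma ibp_csupp:
  assumes "deriv_along e f f'" "continuous_on UNIV f" "continuous_on UNIV f'"
    and "deriv_along e g g'" "csupp g" "csupp g'"
  shows "(LINT y|lborel. f' y * g (y - x)) = - (LINT y|lborel. f y * g' (y - x))"
  by (rule integral_by_parts_along[OF assms(1) deriv_along_shift[OF assms(4)] assms(2) _ assms(3)])
     (intro continuous_on_shift csupp_cont csupp_integrable csupp_shift assms)+

lemma T_radial_zero:
  assumes "\<And>m. m \<le> 3 \<Longrightarrow> P m (z \<bullet> z) = 0"
  shows "T0 P z = 0" "T1 P i z = 0" "T2 P i j z = 0" "T3 P i j k z = 0"
  using assms by (auto simp: T0_def T1_def T2_def T3_def)

lemma csupp_T:
  assumes c: "\<And>m. m \<le> 3 \<Longrightarrow> continuous_on UNIV (P m)" and z: "\<And>m u. m \<le> 3 \<Longrightarrow> u \<ge> R \<Longrightarrow> P m u = 0"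
  shows "csupp (T0 P)" "csupp (T1 P i)" "csupp (T2 P i j)" "csupp (T3 P i j k)"
proof -
  have zz: "P m (y \<bullet> y) = 0" if "norm y > sqrt \<bar>R\<bar>" "m \<le> 3" for y :: vec3 and m
  proof (rule z[OF that(2)])
    have "sqrt \<bar>R\<bar> ^ 2 \<le> norm y ^ 2" using that by (intro power_mono) auto
    then show "R \<le> y \<bullet> y" by (simp add: power2_norm_eq_inner)
  qed
  have "\<forall>y. norm y > sqrt \<bar>R\<bar> \<longrightarrow> T0 P y = 0 \<and> T1 P i y = 0 \<and> T2 P i j y = 0 \<and> T3 P i j k y = 0"
    using T_radial_zero[of P] zz by auto
  moreover have "continuous_on UNIV (T0 P)" "continuous_on UNIV (T1 P i)" "continuous_on UNIV (T2 P i j)" "continuous_on UNIV (T3 P i j k)"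
    by (rule cont_T; rule c; assumption)+
  ultimately show "csupp (T0 P)" "csupp (T1 P i)" "csupp (T2 P i j)" "csupp (T3 P i j k)"
    unfolding csupp_def by auto
qed

lemma cont_Pair: "continuous_on UNIV (Pair t)"
proof -
  have "continuous_on UNIV (\<lambda>x. (t, x))" by (intro continuous_intros)
  then show ?thesis .
qed

text \<open>The properties of a solution \<open>v\<close> of the regularized problem that are used, in coordinates:
  \<open>b\<close> is the mollified velocity, \<open>d1\<close>, \<open>d2\<close> and \<open>db\<close> are spatial derivatives, \<open>vt\<close> is the time
  derivative and \<open>q\<close> the pressure with gradient \<open>dq\<close>. The bounds in \<open>b_bound\<close>, \<open>b_lip\<close> and \<open>db_bound\<close>
  depend on the regularization and may only be used qualitatively; the assumptions \<open>b_sup\<close> and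
  \<open>b_L2\<close> are the uniform ones. The fields are defined for all times, so that they are jointly
  continuous on the whole space-time, while the equation holds for positive times.\<close>

locale regularized_flow =
  fixes v b :: "3 \<Rightarrow> real \<Rightarrow> vec3 \<Rightarrow> real"
    and d1 d2 db :: "3 \<Rightarrow> 3 \<Rightarrow> real \<Rightarrow> vec3 \<Rightarrow> real"
    and vt dq :: "3 \<Rightarrow> real \<Rightarrow> vec3 \<Rightarrow> real" and q :: "real \<Rightarrow> vec3 \<Rightarrow> real"
  assumes cont_v: "continuous_on UNIV (\<lambda>(t,x). v k t x)"
    and cont_b: "continuous_on UNIV (\<lambda>(t,x). b k t x)"
    and sqi_v: "sqi (v k t)"
    and v_bound: "\<exists>M. \<forall>t\<le>T. \<forall>k. l2n (v k t) \<le> M"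
    and b_bound: "\<exists>B. \<forall>t\<le>T. \<forall>k x. \<bar>b k t x\<bar> \<le> B"
    and b_lip: "\<exists>L\<ge>0. \<forall>t\<le>T. \<forall>k x y. \<bar>b k t x - b k t y\<bar> \<le> L * norm (x - y)"
    and b_sup: "(\<And>j x. \<bar>v j t x\<bar> \<le> a) \<Longrightarrow> \<bar>b k t x\<bar> \<le> a"
    and b_L2: "sqi (b k t)" "l2n (b k t) \<le> l2n (v k t)"
    and d_b: "deriv_along (axis j 1) (b k t) (db j k t)" and cont_db: "continuous_on UNIV (db j k t)"
    and db_bound: "\<exists>B. \<forall>j k x. \<bar>db j k t x\<bar> \<le> B"
    and div_b: "(\<Sum>j\<in>UNIV. db j j t x) = 0"
    and d_t: "t > 0 \<Longrightarrow> ((\<lambda>s. v k s x) has_real_derivative vt k t x) (at t)"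
    and cont_vt: "continuous_on ({0<..} \<times> UNIV) (\<lambda>(t,x). vt k t x)"
    and d_1: "t > 0 \<Longrightarrow> deriv_along (axis j 1) (v k t) (d1 j k t)" and cont_d1: "t > 0 \<Longrightarrow> continuous_on UNIV (d1 j k t)"
    and d_2: "t > 0 \<Longrightarrow> deriv_along (axis j 1) (d1 j k t) (d2 j k t)" and cont_d2: "t > 0 \<Longrightarrow> continuous_on UNIV (d2 j k t)"
    and d_q: "t > 0 \<Longrightarrow> deriv_along (axis j 1) (q t) (dq j t)" and cont_q: "t > 0 \<Longrightarrow> continuous_on UNIV (q t)"
    and cont_dq: "t > 0 \<Longrightarrow> continuous_on UNIV (dq j t)"
    and div_v: "t > 0 \<Longrightarrow> (\<Sum>j\<in>UNIV. d1 j j t x) = 0"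
    and pde: "t > 0 \<Longrightarrow> vt k t x + (\<Sum>j\<in>UNIV. b j t x * d1 j k t x) + dq k t x = (\<Sum>j\<in>UNIV. d2 j k t x)"
begin

lemma cont_slice: "continuous_on UNIV (\<lambda>x. v k t x)" "continuous_on UNIV (\<lambda>x. b k t x)"
  using continuous_on_compose2[OF cont_v cont_Pair[of t]] continuous_on_compose2[OF cont_b cont_Pair[of t]] by auto

lemma cont_vt_slice: "t > 0 \<Longrightarrow> continuous_on UNIV (\<lambda>x. vt k t x)"
  using continuous_on_compose2[OF cont_vt cont_Pair[of t]] by auto

lemma deriv_csupp:
  assumes t: "t > 0" and g: "csupp g"
  shows "((\<lambda>t. LINT y|lborel. v k t y * g y) has_real_derivative (LINT y|lborel. vt k t y * g y)) (at t)"
proof -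
  obtain R where R: "\<And>y. norm y > R \<Longrightarrow> g y = 0" using g by (auto simp: csupp_def)
  have "compact ((\<lambda>(t,x). vt k t x) ` ({t/2..2*t} \<times> cball 0 R))"
    by (rule compact_continuous_image[OF continuous_on_subset[OF cont_vt]]) (use t in \<open>auto intro!: compact_Times\<close>)
  then obtain C where C: "\<And>z. z \<in> (\<lambda>(t,x). vt k t x) ` ({t/2..2*t} \<times> cball 0 R) \<Longrightarrow> norm z \<le> C"
    using compact_imp_bounded bounded_iff by metis
  show ?thesis
  proof (rule DERIV_integral_dominated[where a="t/2" and b="2*t" and g="\<lambda>y. C * \<bar>g y\<bar>"])
    show "integrable lborel (\<lambda>y. v k s y * g y)" for s by (rule csupp_integrable[OF g cont_slice(1)])
    show "((\<lambda>s. v k s y * g y) has_real_derivative vt k s y * g y) (at s)" if "t/2 < s" for s y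
      by (rule DERIV_cmult_right[OF d_t]) (use t that in auto)
    show "\<bar>vt k s y * g y\<bar> \<le> C * \<bar>g y\<bar>" if "t/2 < s" "s < 2*t" for s y
    proof (cases "norm y > R")
      case False
      then have "vt k s y \<in> (\<lambda>(t,x). vt k t x) ` ({t/2..2*t} \<times> cball 0 R)"
        using that by (intro image_eqI[of _ _ "(s,y)"]) auto
      then have "\<bar>vt k s y\<bar> \<le> C" using C by auto
      then show ?thesis by (simp add: abs_mult mult_right_mono)
    qed (use R in simp)
    show "integrable lborel (\<lambda>y. C * \<bar>g y\<bar>)"
      using csupp_integrable[OF g, of "\<lambda>_. 1"] by simp
    show "(\<lambda>y. vt k t y * g y) \<in> borel_measurable lborel"
      using csupp_integrable[OF g cont_vt_slice[OF t]] by auto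
  qed (use t in auto)
qed

text \<open>Gradients of test functions are orthogonal to solenoidal fields.\<close>

lemma grad_test:
  assumes t: "t > 0" and g: "csupp g" and g': "\<And>a. csupp (g' a)" and d: "\<And>a. deriv_along (axis a 1) g (g' a)"
  shows "(\<Sum>a\<in>UNIV. LINT y|lborel. v a t y * g' a (y - x)) = 0"
proof -
  have "(\<Sum>a\<in>UNIV. LINT y|lborel. v a t y * g' a (y - x)) = (\<Sum>a\<in>UNIV. - (LINT y|lborel. d1 a a t y * g (y - x)))"
    by (rule sum.cong[OF refl]) (use ibp_csupp[OF d_1[OF t] cont_slice(1) cont_d1[OF t] d g g'] in simp)
  also have "\<dots> = - (LINT y|lborel. (\<Sum>a\<in>UNIV. d1 a a t y * g (y - x)))"
    by (subst Bochner_Integration.integral_sum) (auto simp: sum_negf intro!: csupp_integrable csupp_shift g cont_d1 t)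
  also have "\<dots> = 0" unfolding sum_distrib_right[symmetric] div_v[OF t] by simp
  finally show ?thesis .
qed

context
  fixes P :: "nat \<Rightarrow> real \<Rightarrow> real" and R :: real
  assumes DP: "\<And>m u. m \<le> 3 \<Longrightarrow> (P m has_real_derivative - P (Suc m) u) (at u)"
    and CP: "\<And>m. continuous_on UNIV (P m)"
    and SP: "\<And>m u. m \<le> 7 \<Longrightarrow> u \<ge> R \<Longrightarrow> P m u = 0"
begin

lemma DP': "m \<le> 3 \<Longrightarrow> n = Suc m \<Longrightarrow> (P m has_real_derivative - P n u) (at u)" using DP by auto
lemma DLP': "m \<le> 1 \<Longrightarrow> n = Suc m \<Longrightarrow> (LP P m has_real_derivative - LP P n u) (at u)"
  using DERIV_LP[of P m u] DP'[of "m+1" "m+2"] DP'[of "m+2" "m+3"] by auto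
lemma CLP: "continuous_on UNIV (LP P m)" by (intro cont_LP CP)
lemma SLP: "m \<le> 5 \<Longrightarrow> u \<ge> R \<Longrightarrow> LP P m u = 0" by (simp add: LP_def SP)
lemma tP: "csupp (T1 P i)" "csupp (T2 P i j)" "csupp (T3 P i j k)"
  by (rule csupp_T[of P R]; auto intro: CP SP)+
lemma tLP: "csupp (T0 (LP P))" "csupp (T1 (LP P) i)" "csupp (T2 (LP P) i j)"
  by (rule csupp_T[of "LP P" R]; auto intro: CLP SLP)+
lemma cT4: "csupp (T4 P i j k l)"
proof -
  have "continuous_on UNIV (\<lambda>z::vec3. P m (z \<bullet> z))" for m
    by (rule continuous_on_compose2[OF CP]) (auto intro: continuous_intros)
  then have c: "continuous_on UNIV (T4 P i j k l)"
    unfolding T4_def[abs_def] by (intro continuous_intros) auto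
  have "T4 P i j k l y = 0" if "norm y > sqrt \<bar>R\<bar>" for y :: vec3
  proof -
    have "sqrt \<bar>R\<bar> ^ 2 \<le> norm y ^ 2" using that by (intro power_mono) auto
    then have "R \<le> y \<bullet> y" by (simp add: power2_norm_eq_inner)
    then show ?thesis by (simp add: T4_def SP)
  qed
  then show ?thesis using c unfolding csupp_def by blast
qed

lemma dT1: "deriv_along (axis j 1) (T1 P i) (T2 P i j)" by (rule deriv_T1) (rule DP'; simp)
lemma dT2: "deriv_along (axis k 1) (T2 P i j) (T3 P i j k)" by (rule deriv_T2) (rule DP'; simp)+
lemma dT3: "deriv_along (axis l 1) (T3 P i j k) (T4 P i j k l)" by (rule deriv_T3) (rule DP'; simp)+
lemma dT0L: "deriv_along (axis j 1) (T0 (LP P)) (T1 (LP P) j)" by (rule deriv_T0) (rule DLP'; simp)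
lemma dT1L: "deriv_along (axis j 1) (T1 (LP P) i) (T2 (LP P) i j)" by (rule deriv_T1) (rule DLP'; simp)

text \<open>The test field \<open>w\<^sub>i = \<delta>\<^sub>i\<^sub>k \<Delta>\<phi> - \<partial>\<^sub>i\<partial>\<^sub>k\<phi>\<close> is solenoidal, hence orthogonal to the pressure gradient, and
  the part \<open>\<partial>\<^sub>i\<partial>\<^sub>k\<phi>\<close>, a gradient in \<open>i\<close>, is invisible to the solenoidal fields \<open>v\<close> and \<open>\<partial>\<^sub>tv\<close>. So the left-hand
  side only sees \<open>v\<^sub>k\<close> tested with \<open>\<Delta>\<phi>\<close>, and the full field \<open>w\<close> enters only in the advection term.\<close>

lemma tested_pde:
  assumes t: "t > 0"
  shows "((\<lambda>t. LINT y|lborel. v k t y * T0 (LP P) (y - x)) has_real_derivative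
     (LINT y|lborel. v k t y * T0 (LP (LP P)) (y - x)) +
     (\<Sum>i\<in>UNIV. \<Sum>j\<in>UNIV. LINT y|lborel. (b j t y * v i t y) * (dl i k * T1 (LP P) j (y - x) - T3 P i j k (y - x)))) (at t)"
proof -
  let ?I = "\<lambda>f g. LINT y|lborel. f y * g (y - x)"
  define w where "w i = (\<lambda>z. dl i k * T0 (LP P) z - T2 P i k z)" for i
  define dw where "dw j i = (\<lambda>z. dl i k * T1 (LP P) j z - T3 P i k j z)" for j i
  note cs = cont_slice cont_d1[OF t] cont_d2[OF t] cont_q[OF t] cont_dq[OF t] cont_vt_slice[OF t]
  have tw: "csupp (w i)" "csupp (dw j i)" for i j
  proof -
    have aux: "csupp (\<lambda>z. c * f z - g z)" if "csupp f" "csupp g" for c f g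
    proof -
      obtain R1 where "\<And>y. norm y > R1 \<Longrightarrow> f y = 0" using \<open>csupp f\<close> by (auto simp: csupp_def)
      moreover obtain R2 where "\<And>y. norm y > R2 \<Longrightarrow> g y = 0" using \<open>csupp g\<close> by (auto simp: csupp_def)
      ultimately have "\<forall>y. norm y > max R1 R2 \<longrightarrow> c * f y - g y = 0" by auto
      then have "\<exists>R. \<forall>y. norm y > R \<longrightarrow> c * f y - g y = 0" by blast
      then show ?thesis using that unfolding csupp_def by (auto intro!: continuous_intros)
    qed
    show "csupp (w i)" "csupp (dw j i)" unfolding w_def dw_def by (intro aux tP tLP)+
  qed
  have dwd: "deriv_along (axis j 1) (w i) (dw j i)" for i j
  proof -
    have "deriv_along (axis j 1) (\<lambda>z. dl i k * T0 (LP P) z + (-1) * T2 P i k z) (\<lambda>z. dl i k * T1 (LP P) j z + (-1) * T3 P i k j z)"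
      by (intro deriv_along_add deriv_along_cmult dT0L dT2)
    then show ?thesis by (simp add: w_def dw_def)
  qed
  have split_w: "(\<Sum>i\<in>UNIV. ?I (f i) (w i)) = ?I (f k) (T0 (LP P)) - (\<Sum>i\<in>UNIV. ?I (f i) (T2 P i k))"
    if "\<And>i. continuous_on UNIV (f i)" for f :: "3 \<Rightarrow> vec3 \<Rightarrow> real"
  proof -
    have 1: "?I (f i) (w i) = dl k i * ?I (f i) (T0 (LP P)) - ?I (f i) (T2 P i k)" for i
    proof -
      have "?I (f i) (w i) = (LINT y|lborel. dl k i * (f i y * T0 (LP P) (y - x)) - f i y * T2 P i k (y - x))"
        by (rule Bochner_Integration.integral_cong[OF refl]) (simp add: w_def dl_sym[of i k] algebra_simps)
      also have "\<dots> = dl k i * ?I (f i) (T0 (LP P)) - ?I (f i) (T2 P i k)"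
        by (subst Bochner_Integration.integral_diff) (auto intro!: csupp_integrable csupp_shift tLP tP that)
      finally show ?thesis .
    qed
    show ?thesis unfolding 1 sum_subtractf dl_sum ..
  qed
  \<comment> \<open>\<open>v\<close> is orthogonal to this gradient at all positive times, so the same holds for its time derivative\<close>
  have vt0: "(\<Sum>i\<in>UNIV. ?I (vt i t) (T2 P i k)) = 0"
  proof -
    have "((\<lambda>t. \<Sum>i\<in>UNIV. ?I (v i t) (T2 P i k)) has_real_derivative (\<Sum>i\<in>UNIV. ?I (vt i t) (T2 P i k))) (at t)"
      by (intro DERIV_sum deriv_csupp[OF t] csupp_shift tP)
    moreover have "((\<lambda>t. \<Sum>i\<in>UNIV. ?I (v i t) (T2 P i k)) has_real_derivative 0) (at t)"
    proof (rule has_field_derivative_transform_within_open[where f="\<lambda>_. 0" and S="{0<..}"])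
      show "0 = (\<Sum>i\<in>UNIV. ?I (v i s) (T2 P i k))" if "s \<in> {0<..}" for s
        using grad_test[of s "T1 P k" "\<lambda>a. T2 P a k" x] that tP dT1[of _ k] T2_sym[of P k] by simp
    qed (use t in auto)
    ultimately show ?thesis by (rule DERIV_unique)
  qed
  \<comment> \<open>the test field is solenoidal\<close>
  have q0: "(\<Sum>i\<in>UNIV. ?I (dq i t) (w i)) = 0"
  proof -
    have "(\<Sum>i\<in>UNIV. ?I (dq i t) (w i)) = (\<Sum>i\<in>UNIV. - ?I (q t) (dw i i))"
      by (intro sum.cong[OF refl] ibp_csupp[OF d_q[OF t] _ _ dwd tw] cs)
    also have "\<dots> = - (LINT y|lborel. (\<Sum>i\<in>UNIV. q t y * dw i i (y - x)))"
      by (subst Bochner_Integration.integral_sum) (auto simp: sum_negf intro!: csupp_integrable csupp_shift tw cs)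
    also have "(\<lambda>y. \<Sum>i\<in>UNIV. q t y * dw i i (y - x)) = (\<lambda>y. 0)"
    proof
      fix y
      have "(\<Sum>i\<in>UNIV. dw i i z) = 0" for z
      proof -
        have "(\<Sum>i\<in>UNIV. dw i i z) = (\<Sum>i\<in>UNIV. dl k i * T1 (LP P) i z) - (\<Sum>i\<in>UNIV. T3 P i i k z)"
          unfolding dw_def sum_subtractf by (simp add: dl_sym[of _ k] T3_perm(2)[of P _ k])
        then show ?thesis by (simp add: dl_sum sum_T3)
      qed
      then show "(\<Sum>i\<in>UNIV. q t y * dw i i (y - x)) = 0" unfolding sum_distrib_left[symmetric] by simp
    qed
    finally show ?thesis by simp
  qed
  have lap1: "(\<Sum>j\<in>UNIV. ?I (d2 j k t) (T0 (LP P))) = ?I (v k t) (T0 (LP (LP P)))"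
  proof -
    have "?I (d2 j k t) (T0 (LP P)) = ?I (v k t) (T2 (LP P) j j)" for j
    proof -
      have "?I (d2 j k t) (T0 (LP P)) = - ?I (d1 j k t) (T1 (LP P) j)"
        by (intro ibp_csupp[OF d_2[OF t] _ _ dT0L] tLP cs)
      also have "?I (d1 j k t) (T1 (LP P) j) = - ?I (v k t) (T2 (LP P) j j)"
        by (intro ibp_csupp[OF d_1[OF t] _ _ dT1L] tLP cs)
      finally show ?thesis by simp
    qed
    then have "(\<Sum>j\<in>UNIV. ?I (d2 j k t) (T0 (LP P))) = (\<Sum>j\<in>UNIV. ?I (v k t) (T2 (LP P) j j))" by simp
    also have "\<dots> = (LINT y|lborel. (\<Sum>j\<in>UNIV. v k t y * T2 (LP P) j j (y - x)))"
      by (subst Bochner_Integration.integral_sum) (auto intro!: csupp_integrable csupp_shift tLP cs)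
    also have "\<dots> = ?I (v k t) (T0 (LP (LP P)))"
      unfolding sum_distrib_left[symmetric] sum_T2 ..
    finally show ?thesis .
  qed
  \<comment> \<open>the Laplacian of the gradient is again a gradient\<close>
  have lap2: "(\<Sum>i\<in>UNIV. \<Sum>j\<in>UNIV. ?I (d2 j i t) (T2 P i k)) = 0"
  proof -
    have "?I (d2 j i t) (T2 P i k) = ?I (v i t) (T4 P i k j j)" for i j
    proof -
      have "?I (d2 j i t) (T2 P i k) = - ?I (d1 j i t) (T3 P i k j)"
        by (intro ibp_csupp[OF d_2[OF t] _ _ dT2] tP cs)
      also have "?I (d1 j i t) (T3 P i k j) = - ?I (v i t) (T4 P i k j j)"
        by (intro ibp_csupp[OF d_1[OF t] _ _ dT3] tP cT4 cs)
      finally show ?thesis by simp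
    qed
    then have "(\<Sum>i\<in>UNIV. \<Sum>j\<in>UNIV. ?I (d2 j i t) (T2 P i k)) = (\<Sum>i\<in>UNIV. \<Sum>j\<in>UNIV. ?I (v i t) (T4 P i k j j))" by simp
    also have "\<dots> = (\<Sum>i\<in>UNIV. LINT y|lborel. (\<Sum>j\<in>UNIV. v i t y * T4 P i k j j (y - x)))"
      by (intro sum.cong[OF refl] Bochner_Integration.integral_sum[symmetric]) (auto intro!: csupp_integrable csupp_shift cT4 cs)
    also have "\<dots> = (\<Sum>i\<in>UNIV. ?I (v i t) (T2 (LP P) k i))"
      unfolding sum_distrib_left[symmetric] sum_T4 by (simp add: T2_sym[of "LP P" k])
    also have "\<dots> = 0" by (rule grad_test[OF t tLP(2) tLP(3) dT1L])
    finally show ?thesis .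
  qed
  \<comment> \<open>\<open>b\<close> is solenoidal, so the advection term is the divergence of the products \<open>b\<^sub>j v\<^sub>i\<close>\<close>
  have adv: "(\<Sum>i\<in>UNIV. \<Sum>j\<in>UNIV. LINT y|lborel. (b j t y * d1 j i t y) * w i (y - x)) =
     - (\<Sum>i\<in>UNIV. \<Sum>j\<in>UNIV. LINT y|lborel. (b j t y * v i t y) * dw j i (y - x))"
  proof -
    have "(\<Sum>j\<in>UNIV. LINT y|lborel. (b j t y * d1 j i t y) * w i (y - x)) = - (\<Sum>j\<in>UNIV. LINT y|lborel. (b j t y * v i t y) * dw j i (y - x))" for i
    proof -
      have 1: "(LINT y|lborel. (b j t y * d1 j i t y) * w i (y - x)) =
        - (LINT y|lborel. (b j t y * v i t y) * dw j i (y - x)) - (LINT y|lborel. (db j j t y * v i t y) * w i (y - x))" for j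
      proof -
        have "(LINT y|lborel. (db j j t y * v i t y + b j t y * d1 j i t y) * w i (y - x)) = - (LINT y|lborel. (b j t y * v i t y) * dw j i (y - x))"
          by (intro ibp_csupp[OF deriv_along_mult[OF d_b d_1[OF t]] _ _ dwd tw] continuous_intros cs cont_db)
        moreover have "(LINT y|lborel. (db j j t y * v i t y + b j t y * d1 j i t y) * w i (y - x)) =
           (LINT y|lborel. (db j j t y * v i t y) * w i (y - x)) + (LINT y|lborel. (b j t y * d1 j i t y) * w i (y - x))"
          unfolding distrib_right
          by (intro Bochner_Integration.integral_add csupp_integrable csupp_shift tw continuous_intros cs cont_db)
        ultimately show ?thesis by simp
      qed
      have "(\<Sum>j\<in>UNIV. LINT y|lborel. (db j j t y * v i t y) * w i (y - x)) = (LINT y|lborel. (\<Sum>j\<in>UNIV. (db j j t y * v i t y) * w i (y - x)))"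
        by (intro Bochner_Integration.integral_sum[symmetric] csupp_integrable csupp_shift tw continuous_intros cs cont_db)
      also have "\<dots> = 0"
        unfolding mult.assoc sum_distrib_right[symmetric] div_b by simp
      finally show ?thesis unfolding 1 by (simp add: sum_subtractf sum_negf)
    qed
    then show ?thesis by (simp add: sum_negf)
  qed
  have "?I (vt k t) (T0 (LP P)) = (\<Sum>i\<in>UNIV. ?I (vt i t) (w i))"
    unfolding split_w[of "\<lambda>i. vt i t", OF cs(7)] vt0 by simp
  also have "\<dots> = (\<Sum>i\<in>UNIV. (\<Sum>j\<in>UNIV. ?I (d2 j i t) (w i)) - (\<Sum>j\<in>UNIV. LINT y|lborel. (b j t y * d1 j i t y) * w i (y - x)) - ?I (dq i t) (w i))"
  proof (rule sum.cong[OF refl])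
    fix i
    have "vt i t y = (\<Sum>j\<in>UNIV. d2 j i t y) - (\<Sum>j\<in>UNIV. b j t y * d1 j i t y) - dq i t y" for y
      using pde[OF t, of i y] by simp
    then have "?I (vt i t) (w i) = (LINT y|lborel. (\<Sum>j\<in>UNIV. d2 j i t y * w i (y - x)) - (\<Sum>j\<in>UNIV. b j t y * d1 j i t y * w i (y - x)) - dq i t y * w i (y - x))"
      by (simp add: left_diff_distrib sum_distrib_right)
    also have "\<dots> = (LINT y|lborel. (\<Sum>j\<in>UNIV. d2 j i t y * w i (y - x))) - (LINT y|lborel. (\<Sum>j\<in>UNIV. b j t y * d1 j i t y * w i (y - x))) - ?I (dq i t) (w i)"
      by (subst Bochner_Integration.integral_diff, (intro Bochner_Integration.integrable_diff Bochner_Integration.integrable_sum csupp_integrable csupp_shift tw continuous_intros cs)+)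
         (subst Bochner_Integration.integral_diff, (intro Bochner_Integration.integrable_sum csupp_integrable csupp_shift tw continuous_intros cs)+, rule refl)
    also have "(LINT y|lborel. (\<Sum>j\<in>UNIV. d2 j i t y * w i (y - x))) = (\<Sum>j\<in>UNIV. ?I (d2 j i t) (w i))"
      by (intro Bochner_Integration.integral_sum csupp_integrable csupp_shift tw cs)
    also have "(LINT y|lborel. (\<Sum>j\<in>UNIV. b j t y * d1 j i t y * w i (y - x))) = (\<Sum>j\<in>UNIV. LINT y|lborel. (b j t y * d1 j i t y) * w i (y - x))"
      by (intro Bochner_Integration.integral_sum csupp_integrable csupp_shift tw continuous_intros cs)
    finally show "?I (vt i t) (w i) = (\<Sum>j\<in>UNIV. ?I (d2 j i t) (w i)) - (\<Sum>j\<in>UNIV. LINT y|lborel. (b j t y * d1 j i t y) * w i (y - x)) - ?I (dq i t) (w i)" .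
  qed
  also have "\<dots> = (\<Sum>i\<in>UNIV. \<Sum>j\<in>UNIV. ?I (d2 j i t) (w i)) + (\<Sum>i\<in>UNIV. \<Sum>j\<in>UNIV. LINT y|lborel. (b j t y * v i t y) * dw j i (y - x))"
    unfolding sum_subtractf adv q0 by simp
  also have "(\<Sum>i\<in>UNIV. \<Sum>j\<in>UNIV. ?I (d2 j i t) (w i)) = ?I (v k t) (T0 (LP (LP P)))"
  proof -
    have "(\<Sum>i\<in>UNIV. \<Sum>j\<in>UNIV. ?I (d2 j i t) (w i)) = (\<Sum>j\<in>UNIV. \<Sum>i\<in>UNIV. ?I (d2 j i t) (w i))" by (rule sum.swap)
    also have "\<dots> = (\<Sum>j\<in>UNIV. ?I (d2 j k t) (T0 (LP P)) - (\<Sum>i\<in>UNIV. ?I (d2 j i t) (T2 P i k)))"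
      by (intro sum.cong[OF refl] split_w cs)
    also have "\<dots> = ?I (v k t) (T0 (LP (LP P))) - (\<Sum>j\<in>UNIV. \<Sum>i\<in>UNIV. ?I (d2 j i t) (T2 P i k))"
      unfolding sum_subtractf lap1 ..
    also have "(\<Sum>j\<in>UNIV. \<Sum>i\<in>UNIV. ?I (d2 j i t) (T2 P i k)) = 0"
      by (subst sum.swap) (rule lap2)
    finally show ?thesis by simp
  qed
  finally have "?I (vt k t) (T0 (LP P)) = ?I (v k t) (T0 (LP (LP P))) + (\<Sum>i\<in>UNIV. \<Sum>j\<in>UNIV. LINT y|lborel. (b j t y * v i t y) * (dl i k * T1 (LP P) j (y - x) - T3 P i j k (y - x)))"
    unfolding dw_def by (simp only: T3_perm(2)[of P _ k])
  with deriv_csupp[OF t csupp_shift[OF tLP(1)], of k x] show ?thesis by simp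
qed

end

end


section \<open>The mollified equation\<close>

lemma sqi_bmul:
  assumes b: "b \<in> borel_measurable borel" "\<And>x. \<bar>b x\<bar> \<le> B" and f: "sqi f"
  shows "sqi (\<lambda>x. b x * f x)" "l2n (\<lambda>x. b x * f x) \<le> B * l2n f"
proof -
  note [measurable] = b(1) sqi_meas[OF f]
  have B: "B \<ge> 0" using b(2)[of undefined] by linarith
  have le: "\<bar>b x * f x\<bar> \<le> \<bar>B * f x\<bar>" for x using b(2)[of x] B by (simp add: abs_mult mult_right_mono)
  show "sqi (\<lambda>x. b x * f x)" by (rule sqi_dominated(1)[OF _ sqi_cmult[OF f] le]) simp
  have "l2n (\<lambda>x. b x * f x) \<le> l2n (\<lambda>x. B * f x)" by (rule sqi_dominated(2)[OF _ sqi_cmult[OF f] le]) simp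
  then show "l2n (\<lambda>x. b x * f x) \<le> B * l2n f" using B by (simp add: l2n_cmult)
qed

context regularized_flow
begin

lemma meas_v[measurable]: "v k t \<in> borel_measurable borel" "b k t \<in> borel_measurable borel"
  by (intro borel_measurable_continuous_onI cont_slice)+

lemma obtain_bounds:
  obtains M B where "\<And>t k. t \<le> T \<Longrightarrow> l2n (v k t) \<le> M" "\<And>t k x. t \<le> T \<Longrightarrow> \<bar>b k t x\<bar> \<le> B" "M \<ge> 0" "B \<ge> 0"
proof -
  obtain M where M: "\<And>t k. t \<le> T \<Longrightarrow> l2n (v k t) \<le> M" using v_bound[of T] by blast
  obtain B where B: "\<And>t k x. t \<le> T \<Longrightarrow> \<bar>b k t x\<bar> \<le> B" using b_bound[of T] by blast
  have "M \<ge> 0" using M[of T undefined] l2n_nonneg[of "v undefined T"] by linarith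
  moreover have "B \<ge> 0" using B[of T undefined undefined] by linarith
  ultimately show ?thesis using that M B by blast
qed

lemma sqi_bv: "sqi (\<lambda>y. b j t y * v i t y)"
proof -
  obtain M B where "\<And>k x. \<bar>b k t x\<bar> \<le> B" using obtain_bounds[of t] by (metis order_refl)
  then show ?thesis by (intro sqi_bmul(1) sqi_v) auto
qed

lemma bv_le:
  assumes "\<And>x. \<bar>b j t x\<bar> \<le> B" "l2n (v i t) \<le> M"
  shows "l2n (\<lambda>y. b j t y * v i t y) \<le> B * M"
proof -
  have "B \<ge> 0" using assms(1)[of undefined] by linarith
  then show ?thesis
  using sqi_bmul(2)[OF meas_v(2) assms(1) sqi_v[of i t]] mult_left_mono[OF assms(2), of B] by linarith
qed

lemma cont_bv: "continuous_on UNIV (\<lambda>(t,y). b j t y * v i t y)"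
  using continuous_on_mult[OF cont_b[of j] cont_v[of i]] by (simp add: split_beta)

text \<open>The heat flow \<open>S(s) v(t)\<close>. Here \<open>s\<close> is a mollification parameter and \<open>t\<close> the time. Correspondingly, \<open>VL\<close>
  is the Laplacian of \<open>V\<close>, and \<open>N\<close> the nonlinear term of its evolution equation.\<close>

definition V :: "real \<Rightarrow> 3 \<Rightarrow> real \<Rightarrow> vec3 \<Rightarrow> real" where
  "V s k t x = (LINT y|lborel. v k t y * hk s (y - x))"
definition VL :: "real \<Rightarrow> 3 \<Rightarrow> real \<Rightarrow> vec3 \<Rightarrow> real" where
  "VL s k t x = (LINT y|lborel. v k t y * hkL s (y - x))"
definition N :: "real \<Rightarrow> 3 \<Rightarrow> real \<Rightarrow> vec3 \<Rightarrow> real" where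
  "N s k t x = (\<Sum>i\<in>UNIV. \<Sum>j\<in>UNIV. LINT y|lborel. (b j t y * v i t y) * Dk s k i j (y - x))"

lemma cont_pair_v:
  assumes g: "continuous_on UNIV g" "sqi g"
  shows "continuous_on UNIV (\<lambda>t. LINT y|lborel. v k t y * g y)"
    and "continuous_on UNIV (\<lambda>t. LINT y|lborel. (b j t y * v i t y) * g y)"
proof -
  have "continuous_on {..<T} (\<lambda>t. LINT y|lborel. v k t y * g y) \<and> continuous_on {..<T} (\<lambda>t. LINT y|lborel. (b j t y * v i t y) * g y)" for T
  proof -
    obtain M B where mb: "\<And>t k. t \<le> T \<Longrightarrow> l2n (v k t) \<le> M" "\<And>t k x. t \<le> T \<Longrightarrow> \<bar>b k t x\<bar> \<le> B"
      using obtain_bounds[of T] by metis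
    have cg: "continuous_on ({..<T} \<times> UNIV) (\<lambda>(p::real,y). g y)"
      unfolding split_beta by (rule continuous_on_compose2[OF g(1)]) (auto intro: continuous_intros)
    have "continuous_on {..<T} (\<lambda>t. LINT y|lborel. v k t y * g y)"
      by (rule continuous_integral_L2_pair[where M=M and h="\<lambda>y. \<bar>g y\<bar>", OF continuous_on_subset[OF cont_v] cg])
         (use mb g sqi_v in auto)
    moreover have "continuous_on {..<T} (\<lambda>t. LINT y|lborel. (b j t y * v i t y) * g y)"
      by (rule continuous_integral_L2_pair[where M="B*M" and h="\<lambda>y. \<bar>g y\<bar>", OF continuous_on_subset[OF cont_bv] cg])
         (use mb g in \<open>auto intro!: sqi_bv bv_le\<close>)
    ultimately show ?thesis by simp
  qed
  moreover have "(\<Union>T::real. {..<T}) = UNIV" by (auto intro: gt_ex)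
  ultimately show "continuous_on UNIV (\<lambda>t. LINT y|lborel. v k t y * g y)"
    "continuous_on UNIV (\<lambda>t. LINT y|lborel. (b j t y * v i t y) * g y)"
    using continuous_on_open_UN[of UNIV "\<lambda>T::real. {..<T}"] by (metis (no_types, lifting) open_lessThan)+
qed

lemma cont_V_t: "s > 0 \<Longrightarrow> continuous_on UNIV (\<lambda>t. V s k t x)"
  unfolding V_def by (intro cont_pair_v continuous_on_shift cont_hk sqi_shift hk_sqi)
lemma cont_VL_t: "s > 0 \<Longrightarrow> continuous_on UNIV (\<lambda>t. VL s k t x)"
  unfolding VL_def by (intro cont_pair_v continuous_on_shift cont_hkL sqi_shift hkL_class)
lemma cont_N_t: "s > 0 \<Longrightarrow> continuous_on UNIV (\<lambda>t. N s k t x)"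
  unfolding N_def by (intro continuous_on_sum cont_pair_v continuous_on_shift cont_Dk sqi_shift Dk_class)

text \<open>The equation tested with the approximants, integrated in time, in the limit. Working with increments
  needs only pointwise convergence of the approximate right-hand sides and a bound.\<close>

lemma V_increment:
  assumes s: "s > 0" and t: "0 < t1" "t1 \<le> t2"
  shows "V s k t2 x - V s k t1 x = integral {t1..t2} (\<lambda>t. VL s k t x + N s k t x)"
proof -
  \<comment> \<open>the shift by \<open>8\<close> makes the derivatives up to the order needed exist and satisfy the common bounds\<close>
  define P where "P n = Pa (n + 8) (lam s)" for n
  define \<phi> where "\<phi> n t = (LINT y|lborel. v k t y * T0 (LP (P n)) (y - x))" for n t
  define \<psi> where "\<psi> n t = (LINT y|lborel. v k t y * T0 (LP (LP (P n))) (y - x)) +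
     (\<Sum>i\<in>UNIV. \<Sum>j\<in>UNIV. LINT y|lborel. (b j t y * v i t y) * (dl i k * T1 (LP (P n)) j (y - x) - T3 (P n) i j k (y - x)))" for n t
  have l: "lam s > 0" by (rule lam_pos[OF s])
  have dQ: "domQ (lam s) (P n)" for n unfolding P_def by (rule domQ_Pa) simp
  have cP: "continuous_on UNIV (P n m)" for n m unfolding P_def by (rule continuous_Pa)
  have der: "(\<phi> n has_real_derivative \<psi> n t) (at t)" if "t > 0" for n t
    unfolding \<phi>_def \<psi>_def
  proof (rule tested_pde[where P="P n" and R="real (n + 8) ^ 3", OF _ cP _ that])
    show "(P n m has_real_derivative - P n (Suc m) u) (at u)" if "m \<le> 3" for m u
      unfolding P_def by (rule DERIV_Pa) (use that in simp)
    show "P n m u = 0" if "m \<le> 7" "u \<ge> real (n + 8) ^ 3" for m u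
      unfolding P_def by (rule Pa_zero) (use that in auto)
  qed
  have Plim: "(\<lambda>n. P n m u) \<longlonglongrightarrow> PL s m u" if "u \<ge> 0" for m u
    unfolding P_def PL_def by (rule LIMSEQ_ignore_initial_segment[OF Pa_limit[OF that]])
  have LPlim: "(\<lambda>n. LP (P n) m u) \<longlonglongrightarrow> LP (PL s) m u" if "u \<ge> 0" for m u
    unfolding LP_def by (intro tendsto_intros Plim that)
  have LLPlim: "(\<lambda>n. LP (LP (P n)) m u) \<longlonglongrightarrow> LP (LP (PL s)) m u" if "u \<ge> 0" for m u
    unfolding LP_def[of "LP _"] by (intro tendsto_intros LPlim that)
  have m: "T0 (LP (P n)) \<in> borel_measurable borel" "T0 (LP (LP (P n))) \<in> borel_measurable borel"
    "(\<lambda>z. dl i k * T1 (LP (P n)) j z - T3 (P n) i j k z) \<in> borel_measurable borel" for n i j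
    by (intro borel_measurable_continuous_onI continuous_intros cont_T cont_LP cP)+
  have k4: "sqi (\<lambda>z. 5148 * kf (lam s) 4 z)" "sqi (\<lambda>z. 1584 * kk s z)" "sqi (\<lambda>z. 330 * kf (lam s) 2 z)"
    using l s by (auto intro!: sqi_cmult kf_sqi kk_sqi kf_two_sqi)
  have tb: "\<bar>dl i k * T1 (LP Q) j z - T3 Q i j k z\<bar> \<le> 1584 * kk s z" if "domQ (lam s) Q" for Q i j z
  proof -
    have "\<bar>dl i k * T1 (LP Q) j z - T3 Q i j k z\<bar> \<le> \<bar>dl i k\<bar> * \<bar>T1 (LP Q) j z\<bar> + \<bar>T3 Q i j k z\<bar>"
      by (rule order_trans[OF abs_triangle_ineq4]) (simp add: abs_mult)
    also have "\<dots> \<le> 1 * (924 * kk s z) + 660 * kk s z"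
      unfolding kk_def by (intro add_mono mult_mono dl_abs T1LP_bound T3_bound that) auto
    finally show ?thesis by simp
  qed
  have phi_lim: "(\<lambda>n. \<phi> n t) \<longlonglongrightarrow> (LINT y|lborel. v k t y * T0 (LP (PL s)) (y - x))" for t
    unfolding \<phi>_def
    by (rule pair_limit[OF sqi_v m(1) _ T0LP_bound[OF dQ] k4(3)]) (auto simp: T0_def intro!: LPlim)
  have psi_lim: "(\<lambda>n. \<psi> n t) \<longlonglongrightarrow> (LINT y|lborel. v k t y * T0 (LP (LP (PL s))) (y - x)) +
     (\<Sum>i\<in>UNIV. \<Sum>j\<in>UNIV. LINT y|lborel. (b j t y * v i t y) * (dl i k * T1 (LP (PL s)) j (y - x) - T3 (PL s) i j k (y - x)))" (is "_ \<longlonglongrightarrow> ?P t") for t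
    unfolding \<psi>_def
  proof (intro tendsto_add tendsto_sum)
    show "(\<lambda>n. LINT y|lborel. v k t y * T0 (LP (LP (P n))) (y - x)) \<longlonglongrightarrow> (LINT y|lborel. v k t y * T0 (LP (LP (PL s))) (y - x))"
      by (rule pair_limit[OF sqi_v m(2) _ T0LLP_bound[OF dQ] k4(1)]) (auto simp: T0_def intro!: LLPlim)
    fix i j :: 3
    have "(\<lambda>n. dl i k * T1 (LP (P n)) j z - T3 (P n) i j k z) \<longlonglongrightarrow> dl i k * T1 (LP (PL s)) j z - T3 (PL s) i j k z" for z
      unfolding T1_def T3_def by (intro tendsto_intros LPlim Plim) auto
    from pair_limit[OF sqi_bv m(3) this tb[OF dQ] k4(2)]
    show "(\<lambda>n. LINT y|lborel. (b j t y * v i t y) * (dl i k * T1 (LP (P n)) j (y - x) - T3 (P n) i j k (y - x)))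
       \<longlonglongrightarrow> (LINT y|lborel. (b j t y * v i t y) * (dl i k * T1 (LP (PL s)) j (y - x) - T3 (PL s) i j k (y - x)))" .
  qed
  obtain M B where mb: "\<And>t k. t \<le> t2 \<Longrightarrow> l2n (v k t) \<le> M" "\<And>t k x. t \<le> t2 \<Longrightarrow> \<bar>b k t x\<bar> \<le> B" and MB: "M \<ge> 0" "B \<ge> 0"
    using obtain_bounds[of t2] by metis
  define K where "K = M * l2n (\<lambda>z. 5148 * kf (lam s) 4 z) + 9 * (B * M * l2n (\<lambda>z. 1584 * kk s z))"
  have psi_bound: "\<bar>\<psi> n t\<bar> \<le> K" if "t \<le> t2" for n t
  proof -
    have gb: "sqi g \<and> l2n (\<lambda>y. g (y - x)) \<le> l2n G" if "g \<in> borel_measurable borel" "\<And>z. \<bar>g z\<bar> \<le> G z" "sqi G" for g G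
    proof -
      have le: "\<bar>g z\<bar> \<le> \<bar>G z\<bar>" for z using that(2)[of z] by linarith
      show ?thesis using sqi_dominated[OF that(1,3) le] sqi_shift(2)[of g x] by simp
    qed
    have 1: "\<bar>LINT y|lborel. v k t y * T0 (LP (LP (P n))) (y - x)\<bar> \<le> M * l2n (\<lambda>z. 5148 * kf (lam s) 4 z)"
      using gb[OF m(2)[of n] T0LLP_bound[OF dQ] k4(1)] mb(1)[OF that] MB
      by (intro order_trans[OF pair_le[OF sqi_v sqi_shift(1)]] mult_mono) auto
    have 2: "\<bar>LINT y|lborel. (b j t y * v i t y) * (dl i k * T1 (LP (P n)) j (y - x) - T3 (P n) i j k (y - x))\<bar> \<le> B * M * l2n (\<lambda>z. 1584 * kk s z)" for i j
      using gb[OF m(3) tb[OF dQ] k4(2)] bv_le[OF mb(2)[OF that] mb(1)[OF that]] MB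
      by (intro order_trans[OF pair_le[OF sqi_bv sqi_shift(1)]] mult_mono) auto
    have "\<bar>\<Sum>i\<in>UNIV. \<Sum>j\<in>UNIV. LINT y|lborel. (b j t y * v i t y) * (dl i k * T1 (LP (P n)) j (y - x) - T3 (P n) i j k (y - x))\<bar>
      \<le> (\<Sum>i\<in>(UNIV::3 set). \<Sum>j\<in>(UNIV::3 set). B * M * l2n (\<lambda>z. 1584 * kk s z))"
      by (intro order_trans[OF sum_abs] sum_mono 2)
    also have "\<dots> = 9 * (B * M * l2n (\<lambda>z. 1584 * kk s z))" by simp
    finally show ?thesis using 1 unfolding \<psi>_def K_def by linarith
  qed
  have FTC: "(\<psi> n has_integral (\<phi> n t2 - \<phi> n t1)) {t1..t2}" for n
    by (rule fundamental_theorem_of_calculus[OF t(2)])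
       (use der t in \<open>auto simp: has_real_derivative_iff_has_vector_derivative[symmetric] intro: has_field_derivative_at_within\<close>)
  have "?P integrable_on {t1..t2} \<and> (\<lambda>n. integral {t1..t2} (\<psi> n)) \<longlonglongrightarrow> integral {t1..t2} ?P"
    using dominated_convergence[where f=\<psi> and g="?P" and h="\<lambda>_. K" and S="{t1..t2}"] FTC psi_bound psi_lim
    by (auto simp: integrable_on_def)
  moreover have "(\<lambda>n. integral {t1..t2} (\<psi> n)) \<longlonglongrightarrow> (LINT y|lborel. v k t2 y * T0 (LP (PL s)) (y - x)) - (LINT y|lborel. v k t1 y * T0 (LP (PL s)) (y - x))"
    unfolding integral_unique[OF FTC] by (intro tendsto_diff phi_lim)
  ultimately have e: "(LINT y|lborel. v k t2 y * T0 (LP (PL s)) (y - x)) - (LINT y|lborel. v k t1 y * T0 (LP (PL s)) (y - x)) = integral {t1..t2} ?P"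
    using LIMSEQ_unique by blast
  have c: "(LINT y|lborel. f y * (- cN * g y)) = - cN * (LINT y|lborel. f y * g y)" for f g :: "vec3 \<Rightarrow> real"
    by (subst integral_mult_right_zero[symmetric]) (simp add: mult_ac)
  have V: "V s k t x = - cN * (LINT y|lborel. v k t y * T0 (LP (PL s)) (y - x))" for t
    unfolding V_def hk_def by (rule c)
  have "VL s k t x + N s k t x = - cN * ?P t" for t
    unfolding VL_def hkL_def N_def Dk_def c by (simp only: distrib_left sum_distrib_left)
  then show ?thesis unfolding V right_diff_distrib[symmetric] e by simp
qed

text \<open>The integrand in \<open>V_increment\<close> is continuous in time, so the increment can be differentiated.\<close>

lemma mollified_equation:
  assumes s: "s > 0" and t: "t > 0"
  shows "((\<lambda>t. V s k t x) has_real_derivative VL s k t x + N s k t x) (at t)"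
proof -
  let ?g = "\<lambda>t. VL s k t x + N s k t x"
  have c: "continuous_on {t/2..2*t} ?g"
    by (intro continuous_on_add continuous_on_subset[OF cont_VL_t] continuous_on_subset[OF cont_N_t] s) auto
  have "((\<lambda>r. V s k (t/2) x + integral {t/2..r} ?g) has_real_derivative ?g t) (at t within {t/2..2*t})"
    using integral_has_real_derivative[OF c, of t] t by (auto intro!: derivative_eq_intros)
  then have "((\<lambda>r. V s k (t/2) x + integral {t/2..r} ?g) has_real_derivative ?g t) (at t)"
    using t by (simp add: at_within_Icc_at)
  then show ?thesis
  proof (rule has_field_derivative_transform_within_open[where S="{t/2<..}"])
    show "V s k (t/2) x + integral {t/2..r} ?g = V s k r x" if "r \<in> {t/2<..}" for r
      using V_increment[OF s, of "t/2" r k x] t that by simp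
  qed (use t in auto)
qed

text \<open>The divergence of \<open>S(s) v\<close> vanishes. The heat kernel is not a test function, hence the detour through
  the compactly supported approximants.\<close>

lemma heat_flow_solenoidal:
  assumes s: "s > 0" and t: "t > 0"
  shows "(\<Sum>a\<in>UNIV. LINT y|lborel. v a t y * hk1 s a (y - x)) = 0"
proof -
  define P where "P n = Pa (n + 8) (lam s)" for n
  have l: "lam s > 0" by (rule lam_pos[OF s])
  have cP: "continuous_on UNIV (P n m)" for n m unfolding P_def by (rule continuous_Pa)
  have Plim: "(\<lambda>n. P n m u) \<longlonglongrightarrow> PL s m u" if "u \<ge> 0" for m u
    unfolding P_def PL_def by (rule LIMSEQ_ignore_initial_segment[OF Pa_limit[OF that]])
  have LPlim: "(\<lambda>n. LP (P n) m u) \<longlonglongrightarrow> LP (PL s) m u" if "u \<ge> 0" for m u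
    unfolding LP_def by (intro tendsto_intros Plim that)
  have z: "(\<Sum>a\<in>UNIV. LINT y|lborel. v a t y * T1 (LP (P n)) a (y - x)) = 0" for n
  proof -
    have D: "(P n m has_real_derivative - P n (Suc m) u) (at u)" if "m \<le> 3" for m u
      unfolding P_def by (rule DERIV_Pa) (use that in simp)
    have S: "P n m u = 0" if "m \<le> 7" "u \<ge> real (n + 8) ^ 3" for m u
      unfolding P_def by (rule Pa_zero) (use that in auto)
    show ?thesis
      by (rule grad_test[OF t, where g="T0 (LP (P n))"])
         (intro tLP(1,2)[where P="P n" and R="real (n + 8) ^ 3"] dT0L[where P="P n" and R="real (n + 8) ^ 3"] D cP S; assumption)+
  qed
  have "(\<lambda>n. \<Sum>a\<in>UNIV. LINT y|lborel. v a t y * T1 (LP (P n)) a (y - x)) \<longlonglongrightarrow> (\<Sum>a\<in>UNIV. LINT y|lborel. v a t y * T1 (LP (PL s)) a (y - x))"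
  proof (intro tendsto_sum pair_limit[OF sqi_v, where G="\<lambda>z. 924 * kf (lam s) 3 z"])
    show "T1 (LP (P n)) a \<in> borel_measurable borel" for n a by (intro borel_measurable_continuous_onI cont_T cont_LP cP)
    show "(\<lambda>n. T1 (LP (P n)) a z) \<longlonglongrightarrow> T1 (LP (PL s)) a z" for a z
      unfolding T1_def by (intro tendsto_intros LPlim) simp
    show "\<bar>T1 (LP (P n)) a z\<bar> \<le> 924 * kf (lam s) 3 z" for n a z
      unfolding P_def by (intro T1LP_bound domQ_Pa) simp
    show "sqi (\<lambda>z. 924 * kf (lam s) 3 z)" using l by (intro sqi_cmult kf_sqi) auto
  qed
  then have 0: "(\<Sum>a\<in>UNIV. LINT y|lborel. v a t y * T1 (LP (PL s)) a (y - x)) = 0"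
    unfolding z by (simp add: LIMSEQ_const_iff)
  have c: "(LINT y|lborel. f y * (- cN * g y)) = - cN * (LINT y|lborel. f y * g y)" for f g :: "vec3 \<Rightarrow> real"
    by (subst integral_mult_right_zero[symmetric]) (simp add: mult_ac)
  show ?thesis unfolding hk1_def c sum_distrib_left[symmetric] 0 by simp
qed

end


section \<open>The mild formulation\<close>

text \<open>The bound is assumed in the open interval only: in the application it degenerates at the right
  end point.\<close>

lemma has_integral_le_nn:
  fixes f w :: "real \<Rightarrow> real"
  assumes f: "(f has_integral I) {a..b}" and w[measurable]: "w \<in> borel_measurable borel"
    and le: "\<And>r. r \<in> {a<..<b} \<Longrightarrow> \<bar>f r\<bar> \<le> w r"
  shows "ennreal \<bar>I\<bar> \<le> (\<integral>\<^sup>+r. ennreal (w r) * indicator {a<..<b} r \<partial>lborel)"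
proof (cases "(\<integral>\<^sup>+r. ennreal (w r) * indicator {a<..<b} r \<partial>lborel) = \<infinity>")
  case False
  define w' where "w' r = indicator {a<..<b} r * w r" for r
  have nn: "(\<integral>\<^sup>+r. ennreal (w r) * indicator {a<..<b} r \<partial>lborel) = (\<integral>\<^sup>+r. ennreal (w' r) \<partial>lborel)"
    by (intro nn_integral_cong) (auto simp: w'_def indicator_def)
  have w0: "0 \<le> w' r" for r
  proof (cases "r \<in> {a<..<b}")
    case True then show ?thesis using le[OF True] by (simp add: w'_def)
  qed (simp add: w'_def)
  have i: "integrable lborel w'"
  proof (rule integrableI_nonneg)
    show "w' \<in> borel_measurable lborel" unfolding w'_def by measurable
  qed (use w0 False nn in \<open>auto simp: less_top\<close>)
  have s: "set_integrable lborel {a<..<b} w"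
    using i unfolding set_integrable_def w'_def by simp
  have f': "(f has_integral I) {a<..<b}" using f has_integral_open_interval[of f I a b] by simp
  have "norm (integral {a<..<b} f) \<le> integral {a<..<b} w"
    by (rule integral_norm_bound_integral) (use f' set_borel_integral_eq_integral(1)[OF s] le in \<open>auto simp: has_integral_integrable\<close>)
  then have "\<bar>I\<bar> \<le> (LINT r:{a<..<b}|lborel. w r)"
    using f' set_borel_integral_eq_integral(2)[OF s] by (simp add: integral_unique)
  also have "\<dots> = (LINT r|lborel. w' r)" by (simp add: set_lebesgue_integral_def w'_def)
  finally show ?thesis unfolding nn using i w0 by (subst nn_integral_eq_integral) auto
qed simp

lemma DERIV_heat_s:
  assumes s: "s > 0" and f: "sqi f"
  shows "((\<lambda>s. LINT y|lborel. f y * hk s (y - x)) has_real_derivative (LINT y|lborel. f y * hkL s (y - x))) (at s)"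
proof (rule DERIV_integral_dominated[where a="s/2" and b="2 * s" and g="\<lambda>y. \<bar>f y\<bar> * (5148 * kf (lam (s/2)) 4 (y - x))"])
  have k: "sqi (\<lambda>z. 5148 * kf (lam (s/2)) 4 z)" using s by (intro sqi_cmult kf_sqi) auto
  show "integrable lborel (\<lambda>y. \<bar>f y\<bar> * (5148 * kf (lam (s/2)) 4 (y - x)))"
    by (rule sqi_mult[OF sqi_abs[OF f] sqi_shift(1)[OF k]])
  show "integrable lborel (\<lambda>y. f y * hk r (y - x))" if "s/2 < r" for r
    by (intro sqi_mult f sqi_shift hk_sqi) (use s that in auto)
  show "((\<lambda>s. f y * hk s (y - x)) has_real_derivative f y * hkL r (y - x)) (at r)" if "s/2 < r" for r y
    by (intro DERIV_cmult DERIV_hk) (use s that in auto)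
  show "\<bar>f y * hkL r (y - x)\<bar> \<le> \<bar>f y\<bar> * (5148 * kf (lam (s/2)) 4 (y - x))" if "s/2 < r" for r y
  proof -
    have "\<bar>hkL r (y - x)\<bar> \<le> 5148 * kf (lam r) 4 (y - x)" by (rule hkL_bound)
    also have "\<dots> \<le> 5148 * kf (lam (s/2)) 4 (y - x)" using s that by (intro mult_left_mono kf_mono lam_anti) auto
    finally show ?thesis by (simp add: abs_mult mult_left_mono)
  qed
  show "(\<lambda>y. f y * hkL s (y - x)) \<in> borel_measurable lborel" using sqi_meas[OF f] by measurable
qed (use s in auto)

context regularized_flow
begin

lemma DERIV_V_s: "s > 0 \<Longrightarrow> ((\<lambda>s. V s k t x) has_real_derivative VL s k t x) (at s)"
  unfolding V_def VL_def by (rule DERIV_heat_s[OF _ sqi_v])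

lemma cont2_V:
  assumes a: "a > 0"
  shows "continuous_on ({..T} \<times> {a..}) (\<lambda>(t,s). V s k t x)" "continuous_on ({..T} \<times> {a..}) (\<lambda>(t,s). VL s k t x)"
proof -
  obtain M B where mb: "\<And>t k. t \<le> T \<Longrightarrow> l2n (v k t) \<le> M" using obtain_bounds[of T] by metis
  let ?S = "({..T} \<times> {a..}) \<times> (UNIV :: vec3 set)"
  have "continuous_on ?S (\<lambda>p. (fst (fst p), snd p))" by (intro continuous_intros)
  from continuous_on_compose2[OF cont_v[of k] this]
  have cv: "continuous_on ?S (\<lambda>(p,y). v k (fst p) y)" by (simp add: split_beta)
  have c: "continuous_on ?S (\<lambda>p. (snd (fst p), snd p - x))" by (intro continuous_intros)
  have ch: "continuous_on ?S (\<lambda>(p,y). hk (snd p) (y - x))"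
    using continuous_on_compose2[OF cont2_hk c] a by (simp add: split_beta image_subset_iff)
  have cl: "continuous_on ?S (\<lambda>(p,y). hkL (snd p) (y - x))"
    using continuous_on_compose2[OF cont2_hkL c] a by (simp add: split_beta image_subset_iff)
  have hb: "\<bar>hk s z\<bar> \<le> 330 * kf (lam a) 2 z" if "s \<ge> a" for s z
  proof -
    have "\<bar>hk s z\<bar> \<le> 330 * kf (lam s) 2 z" unfolding hk_def by (rule order_trans[OF abs_cN_le T0LP_bound[OF domQ_PL]])
    also have "\<dots> \<le> 330 * kf (lam a) 2 z" using a that by (intro mult_left_mono kf_mono lam_anti) auto
    finally show ?thesis .
  qed
  have lb: "\<bar>hkL s z\<bar> \<le> 5148 * kf (lam a) 4 z" if "s \<ge> a" for s z
  proof -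
    have "\<bar>hkL s z\<bar> \<le> 5148 * kf (lam s) 4 z" by (rule hkL_bound)
    also have "\<dots> \<le> 5148 * kf (lam a) 4 z" using a that by (intro mult_left_mono kf_mono lam_anti) auto
    finally show ?thesis .
  qed
  have k: "sqi (\<lambda>y. 330 * kf (lam a) 2 (y - x))" "sqi (\<lambda>y. 5148 * kf (lam a) 4 (y - x))"
    using a sqi_shift(1)[OF kf_two_sqi[of "lam a"]] sqi_shift(1)[OF kf_sqi(1)[of "lam a" 4]] by (auto intro!: sqi_cmult)
  show "continuous_on ({..T} \<times> {a..}) (\<lambda>(t,s). V s k t x)"
    unfolding V_def split_beta
    by (rule continuous_integral_L2_pair[where M=M, OF cv ch _ _ _ k(1)]) (use mb hb sqi_v in auto)
  show "continuous_on ({..T} \<times> {a..}) (\<lambda>(t,s). VL s k t x)"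
    unfolding VL_def split_beta
    by (rule continuous_integral_L2_pair[where M=M, OF cv cl _ _ _ k(2)]) (use mb lb sqi_v in auto)
qed

text \<open>Along the lines \<open>s + t = const\<close> the two Laplacians cancel, so that only the nonlinear term remains:
  this is Duhamel's principle.\<close>

lemma DERIV_characteristic:
  assumes r: "r > 0" and s: "c - r > 0"
  shows "((\<lambda>r. V (c - r) k r x) has_real_derivative N (c - r) k r x) (at r)"
proof -
  define a where "a = (c - r) / 2"
  have a: "a > 0" "a < c - r" using s by (auto simp: a_def)
  let ?X = "{..<r+1}" and ?Y = "{a<..}"
  have fx: "((\<lambda>t. V (c - r) k t x) has_derivative (\<lambda>h. (VL (c - r) k r x + N (c - r) k r x) * h)) (at r within ?X)"
    using mollified_equation[OF s r, of k x] by (auto simp: has_field_derivative_def intro: has_derivative_at_withinI)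
  have fy: "((\<lambda>s. V s k t x) has_derivative blinfun_apply (blinfun_mult_right (VL y k t x))) (at y within ?Y)" if "y \<in> ?Y" for t y
    using DERIV_V_s[of y k t x] that a by (auto simp: has_field_derivative_eq_has_derivative_blinfun intro: has_derivative_at_withinI)
  have cy: "continuous (at (r, c - r) within ?X \<times> ?Y) (\<lambda>(t,y). blinfun_mult_right (VL y k t x))"
  proof -
    have "continuous_on (?X \<times> ?Y) (\<lambda>(t,s). VL s k t x)"
      by (rule continuous_on_subset[OF cont2_V(2)[OF a(1), of "r+1"]]) auto
    then have "continuous (at (r, c - r) within ?X \<times> ?Y) (\<lambda>(t,s). VL s k t x)"
      using a by (auto simp: continuous_on_eq_continuous_within)
    then show ?thesis unfolding split_beta
      by (intro bounded_linear.continuous[OF bounded_linear_blinfun_mult_right])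
  qed
  have "((\<lambda>(t, s). V s k t x) has_derivative (\<lambda>(tx, ty). (VL (c - r) k r x + N (c - r) k r x) * tx + blinfun_mult_right (VL (c - r) k r x) ty)) (at (r, c - r) within ?X \<times> ?Y)"
    by (rule has_derivative_partialsI[where f="\<lambda>t s. V s k t x", OF fx fy cy]) (use a in auto)
  moreover have "at (r, c - r) within ?X \<times> ?Y = at (r, c - r)"
    by (rule at_within_open) (use a in \<open>auto intro: open_Times\<close>)
  ultimately have d: "((\<lambda>(t, s). V s k t x) has_derivative (\<lambda>(tx, ty). (VL (c - r) k r x + N (c - r) k r x) * tx + VL (c - r) k r x * ty)) (at (r, c - r))"
    by (simp add: mult.commute)
  have g: "((\<lambda>r. (r, c - r)) has_derivative (\<lambda>h. (h, - h))) (at r)"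
    by (auto intro!: derivative_eq_intros)
  from has_derivative_compose[OF g d] show ?thesis
    by (simp add: has_field_derivative_def split_beta algebra_simps mult_commute_abs)
qed

text \<open>A majorant for all products \<open>b\<^sub>j v\<^sub>i\<close> at once.\<close>

definition Sv :: "real \<Rightarrow> vec3 \<Rightarrow> real" where
  "Sv t y = (\<Sum>i\<in>UNIV. \<Sum>j\<in>UNIV. \<bar>b j t y * v i t y\<bar>)"

lemma Sv_nonneg[simp]: "0 \<le> Sv t y" by (simp add: Sv_def sum_nonneg)
lemma sqi_Sv: "sqi (Sv t)" unfolding Sv_def[abs_def] by (intro sqi_sum sqi_abs sqi_bv)

lemma fields_measurable_pair: "(\<lambda>p. v k (fst p) (snd p)) \<in> borel_measurable (borel \<Otimes>\<^sub>M borel)"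
  "(\<lambda>p. b k (fst p) (snd p)) \<in> borel_measurable (borel \<Otimes>\<^sub>M borel)"
  unfolding borel_prod using cont_v[of k] cont_b[of k]
  by (auto simp: split_beta intro!: borel_measurable_continuous_onI)

lemma fields_measurable[measurable (raw)]:
  assumes "f \<in> borel_measurable M" "g \<in> borel_measurable M"
  shows "(\<lambda>x. v k (f x) (g x)) \<in> borel_measurable M" "(\<lambda>x. b k (f x) (g x)) \<in> borel_measurable M"
  using measurable_compose[OF measurable_Pair[OF assms] fields_measurable_pair(1)[of k]] measurable_compose[OF measurable_Pair[OF assms] fields_measurable_pair(2)[of k]]
  by simp_all

lemma meas_Sv[measurable (raw)]:
  assumes [measurable]: "f \<in> borel_measurable M" "g \<in> borel_measurable M"
  shows "(\<lambda>x. Sv (f x) (g x)) \<in> borel_measurable M"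
  unfolding Sv_def by measurable

lemma N_bound:
  assumes s: "0 < s'" "s' \<le> s"
  shows "\<bar>N s k t x\<bar> \<le> (LINT y|lborel. 1584 * (kk s' (y - x) * Sv t y))"
proof -
  have s0: "s > 0" using s by simp
  have i: "integrable lborel (\<lambda>y. 1584 * (kk s' (y - x) * Sv t y))"
    by (intro integrable_mult_right sqi_mult sqi_shift kk_sqi s sqi_Sv)
  have "\<bar>N s k t x\<bar> \<le> (\<Sum>i\<in>UNIV. \<Sum>j\<in>UNIV. LINT y|lborel. \<bar>(b j t y * v i t y) * Dk s k i j (y - x)\<bar>)"
    unfolding N_def by (intro order_trans[OF sum_abs] sum_mono integral_abs_bound)
  also have "\<dots> = (LINT y|lborel. (\<Sum>i\<in>UNIV. \<Sum>j\<in>UNIV. \<bar>(b j t y * v i t y) * Dk s k i j (y - x)\<bar>))"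
    by (subst Bochner_Integration.integral_sum, (intro Bochner_Integration.integrable_sum integrable_abs sqi_mult sqi_bv sqi_shift Dk_class s0)+,
        intro sum.cong[OF refl] Bochner_Integration.integral_sum[symmetric] integrable_abs sqi_mult sqi_bv sqi_shift Dk_class s0)
  also have "\<dots> \<le> (LINT y|lborel. 1584 * (kk s' (y - x) * Sv t y))"
  proof (rule integral_mono[OF _ i])
    show "integrable lborel (\<lambda>y. \<Sum>i\<in>UNIV. \<Sum>j\<in>UNIV. \<bar>(b j t y * v i t y) * Dk s k i j (y - x)\<bar>)"
      by (intro Bochner_Integration.integrable_sum integrable_abs sqi_mult sqi_bv sqi_shift Dk_class s0)
    fix y
    have "\<bar>(b j t y * v i t y) * Dk s k i j (y - x)\<bar> \<le> \<bar>b j t y * v i t y\<bar> * (1584 * kk s' (y - x))" for i j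
    proof -
      have "\<bar>Dk s k i j (y - x)\<bar> \<le> 1584 * kk s (y - x)" by (rule Dk_bound)
      also have "\<dots> \<le> 1584 * kk s' (y - x)" using kk_anti[OF s] by simp
      finally show ?thesis by (simp only: abs_mult) (rule mult_left_mono, auto)
    qed
    then have "(\<Sum>i\<in>UNIV. \<Sum>j\<in>UNIV. \<bar>(b j t y * v i t y) * Dk s k i j (y - x)\<bar>) \<le> (\<Sum>i\<in>UNIV. \<Sum>j\<in>UNIV. \<bar>b j t y * v i t y\<bar> * (1584 * kk s' (y - x)))"
      by (intro sum_mono)
    also have "\<dots> = 1584 * (kk s' (y - x) * Sv t y)" by (simp add: Sv_def sum_distrib_left sum_distrib_right mult_ac)
    finally show "(\<Sum>i\<in>UNIV. \<Sum>j\<in>UNIV. \<bar>(b j t y * v i t y) * Dk s k i j (y - x)\<bar>) \<le> 1584 * (kk s' (y - x) * Sv t y)" .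
  qed
  finally show ?thesis .
qed

text \<open>The Duhamel term as a nonnegative integral, which allows it to be infinite until bounds are available.\<close>

definition J :: "real \<Rightarrow> real \<Rightarrow> vec3 \<Rightarrow> ennreal" where
  "J t0 t x = (\<integral>\<^sup>+r. (\<integral>\<^sup>+y. ennreal (kk (t - r) (y - x)) * ennreal (Sv r y) \<partial>lborel) * indicator {t0<..<t} r \<partial>lborel)"

lemma mild_smoothed:
  assumes t: "0 \<le> t0" "t0 \<le> t" and s: "s > 0"
  shows "ennreal \<bar>V s k t x - V (s + t - t0) k t0 x\<bar> \<le> 1584 * J t0 t x"
proof -
  let ?w = "\<lambda>r. LINT y|lborel. 1584 * (kk (t - r) (y - x) * Sv r y)"
  have cont: "continuous_on {t0..t} (\<lambda>r. V (s + t - r) k r x)"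
  proof -
    have "continuous_on {t0..t} (\<lambda>r. (r, s + t - r))" by (intro continuous_intros)
    from continuous_on_compose2[OF cont2_V(1)[OF s, of t k x] this] show ?thesis by (auto simp: image_subset_iff)
  qed
  have hi: "((\<lambda>r. N (s + t - r) k r x) has_integral (V (s + t - t) k t x - V (s + t - t0) k t0 x)) {t0..t}"
    by (rule fundamental_theorem_of_calculus_interior[OF t(2) cont])
       (use DERIV_characteristic[of _ "s + t" k x] t s in \<open>auto simp: has_real_derivative_iff_has_vector_derivative\<close>)
  have [measurable]: "?w \<in> borel_measurable borel" by measurable
  have "ennreal \<bar>V (s + t - t) k t x - V (s + t - t0) k t0 x\<bar> \<le> (\<integral>\<^sup>+r. ennreal (?w r) * indicator {t0<..<t} r \<partial>lborel)"
    by (rule has_integral_le_nn[OF hi]) (use N_bound s in auto)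
  also have "\<dots> = (\<integral>\<^sup>+r. 1584 * ((\<integral>\<^sup>+y. ennreal (kk (t - r) (y - x)) * ennreal (Sv r y) \<partial>lborel) * indicator {t0<..<t} r) \<partial>lborel)"
  proof (rule nn_integral_cong)
    fix r
    show "ennreal (?w r) * indicator {t0<..<t} r = 1584 * ((\<integral>\<^sup>+y. ennreal (kk (t - r) (y - x)) * ennreal (Sv r y) \<partial>lborel) * indicator {t0<..<t} r)"
    proof (cases "r \<in> {t0<..<t}")
      case True
      then have i: "integrable lborel (\<lambda>y. 1584 * (kk (t - r) (y - x) * Sv r y))"
        by (intro integrable_mult_right sqi_mult sqi_shift kk_sqi sqi_Sv) auto
      have "ennreal (?w r) = (\<integral>\<^sup>+y. ennreal (1584 * (kk (t - r) (y - x) * Sv r y)) \<partial>lborel)"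
        by (rule nn_integral_eq_integral[symmetric, OF i]) auto
      also have "\<dots> = (\<integral>\<^sup>+y. 1584 * (ennreal (kk (t - r) (y - x)) * ennreal (Sv r y)) \<partial>lborel)"
        by (intro nn_integral_cong) (simp add: ennreal_mult)
      also have "\<dots> = 1584 * (\<integral>\<^sup>+y. ennreal (kk (t - r) (y - x)) * ennreal (Sv r y) \<partial>lborel)"
        by (rule nn_integral_cmult) measurable
      finally show ?thesis using True by simp
    qed simp
  qed
  also have "\<dots> = 1584 * J t0 t x" unfolding J_def by (rule nn_integral_cmult) measurable
  finally show ?thesis by simp
qed

text \<open>Continuity of \<open>v\<close> controls the integral near \<open>x\<close>. The rest is a fixed integral times a factor
  \<open>O(sqrt s)\<close>, by the bound \<open>hk_tail\<close>.\<close>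

lemma V_tendsto: "((\<lambda>s. V s k t x) \<longlongrightarrow> v k t x) (at_right 0)"
proof (rule tendstoI)
  fix e :: real assume e: "e > 0"
  have "isCont (\<lambda>y. v k t y) x" using cont_slice(1) by (simp add: continuous_on_eq_continuous_at)
  then obtain d where d: "d > 0" "\<And>y. norm (y - x) < d \<Longrightarrow> \<bar>v k t y - v k t x\<bar> < e/2"
    using e by (auto simp: continuous_at_eps_delta dist_norm dest!: spec[of _ "e/2"])
  let ?G = "\<lambda>z::vec3. exp (- (1/4 * (z \<bullet> z)))"
  have G: "integrable lborel ?G" by (rule gauss_3d(1)) simp
  have Gs: "sqi ?G" by (rule sqi_bounded(1)[OF _ G, of 1 "l1n ?G"]) auto
  define h where "h y = ?G (y - x) * (\<bar>v k t y\<bar> + \<bar>v k t x\<bar>)" for y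
  have hi: "integrable lborel h" unfolding h_def distrib_left
    by (intro Bochner_Integration.integrable_add sqi_mult sqi_shift(1)[OF Gs] sqi_abs sqi_v integrable_mult_left integrable_shift[OF G])
  define K where "K = (LINT y|lborel. h y)"
  have K: "K \<ge> 0" unfolding K_def h_def by (rule Bochner_Integration.integral_nonneg) simp
  have main: "\<bar>V s k t x - v k t x\<bar> \<le> e/2 + 8 * 16 / d ^ 4 * sqrt s * K" if s: "0 < s" "s \<le> 1/2" for s
  proof -
    have hs: "integrable lborel (\<lambda>y. hk s (y - x))" by (rule integrable_shift[OF hk_L1(1)[OF s(1)]])
    have h1: "(LINT y|lborel. hk s (y - x)) = 1" using integral_shift[of "hk s" x] hk_L1(2)[OF s(1)] by simp
    have vi: "integrable lborel (\<lambda>y. v k t y * hk s (y - x))" by (intro sqi_mult sqi_v sqi_shift hk_sqi s)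
    define c where "c = 8 * 16 / d ^ 4 * sqrt s"
    have c0: "c \<ge> 0" using d s by (simp add: c_def)
    have cb: "lam s ^ 3 * exp (- (d\<^sup>2 * (lam s)\<^sup>2 / 2)) \<le> c"
    proof -
      define l where "l = lam s"
      have l: "l > 0" unfolding l_def by (rule lam_pos[OF s(1)])
      let ?u = "d\<^sup>2 * l\<^sup>2 / 2"
      have "?u\<^sup>2 / 2 \<le> exp ?u" 
      proof -
        have "0 \<le> ?u" by simp
        then show ?thesis using exp_lower_Taylor_quadratic[of ?u] by linarith
      qed
      moreover have "?u\<^sup>2 / 2 = d ^ 4 * l ^ 4 / 8" by (simp add: power_divide power_mult_distrib)
      ultimately have "d ^ 4 * l ^ 4 / 8 * exp (- ?u) \<le> 1"
        by (simp add: exp_minus divide_simps)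
      then have "l ^ 3 * exp (- ?u) \<le> 8 / (d ^ 4 * l)" using d l by (simp add: field_simps power4_eq_xxxx power3_eq_cube)
      also have "\<dots> = 16 / d ^ 4 * sqrt s" using s d by (simp add: l_def lam_def)
      also have "\<dots> \<le> c" unfolding c_def using d s by (intro mult_right_mono divide_right_mono) auto
      finally show ?thesis unfolding l_def .
    qed
    have "V s k t x - v k t x = (LINT y|lborel. (v k t y - v k t x) * hk s (y - x))"
      unfolding V_def left_diff_distrib using vi hs h1 by simp
    also have "\<bar>\<dots>\<bar> \<le> (LINT y|lborel. \<bar>(v k t y - v k t x) * hk s (y - x)\<bar>)" by (rule integral_abs_bound)
    also have "\<dots> \<le> (LINT y|lborel. e/2 * hk s (y - x) + c * h y)"
    proof (rule integral_mono)
      show "integrable lborel (\<lambda>y. \<bar>(v k t y - v k t x) * hk s (y - x)\<bar>)"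
        unfolding left_diff_distrib using vi hs by simp
      show "integrable lborel (\<lambda>y. e/2 * hk s (y - x) + c * h y)" using hs hi by simp
      fix y
      have h0: "0 \<le> hk s (y - x)" by (rule hk_nonneg[OF s(1)])
      show "\<bar>(v k t y - v k t x) * hk s (y - x)\<bar> \<le> e/2 * hk s (y - x) + c * h y"
      proof (cases "norm (y - x) < d")
        case True
        have "\<bar>v k t y - v k t x\<bar> * hk s (y - x) \<le> e/2 * hk s (y - x)"
          using d(2)[OF True] h0 by (intro mult_right_mono) auto
        moreover have "0 \<le> c * h y" using c0 by (simp add: h_def)
        ultimately show ?thesis using h0 by (simp add: abs_mult)
      next
        case False
        have "hk s (y - x) \<le> lam s ^ 3 * exp (- (d\<^sup>2 * (lam s)\<^sup>2 / 2)) * ?G (y - x)"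
          by (rule hk_tail) (use s d False in auto)
        also have "\<dots> \<le> c * ?G (y - x)" by (rule mult_right_mono[OF cb]) simp
        finally have "\<bar>v k t y - v k t x\<bar> * hk s (y - x) \<le> (\<bar>v k t y\<bar> + \<bar>v k t x\<bar>) * (c * ?G (y - x))"
          using h0 by (intro mult_mono) auto
        moreover have "0 \<le> e/2 * hk s (y - x)" using e h0 by simp
        ultimately show ?thesis using h0 by (simp add: abs_mult h_def mult_ac)
      qed
    qed
    also have "\<dots> = e/2 + c * K" using hs hi h1 by (simp add: K_def)
    finally show ?thesis by (simp add: c_def)
  qed
  define c where "c = 8 * 16 / d ^ 4"
  have lim: "((\<lambda>s. c * sqrt s * K) \<longlongrightarrow> c * sqrt 0 * K) (at_right 0)"
    by (intro tendsto_intros)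
  have ev: "\<forall>\<^sub>F s in at_right 0. c * sqrt s * K < e/2"
    using order_tendstoD(2)[OF lim, of "e/2"] e by simp
  have ev2: "\<forall>\<^sub>F s in at_right (0::real). 0 < s \<and> s \<le> 1/2"
    by (rule eventually_at_right_less[THEN eventually_mono, THEN eventually_conj, OF _ eventually_at_right_real[of 0 "1/2", THEN eventually_mono], simplified]) auto
  show "\<forall>\<^sub>F s in at_right 0. dist (V s k t x) (v k t x) < e"
    using ev ev2
  proof eventually_elim
    case (elim s)
    then show ?case using main[of s] by (simp add: dist_real_def c_def)
  qed
qed

text \<open>Let the mollification parameter tend to zero in the Duhamel formula for \<open>V\<close>. At \<open>t0\<close> this
  requires only continuity in the parameter at \<open>t - t0 > 0\<close>.\<close>

lemma mild_inequality:
  assumes t: "0 \<le> t0" "t0 < t"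
  shows "ennreal \<bar>v k t x\<bar> \<le> ennreal \<bar>V (t - t0) k t0 x\<bar> + 1584 * J t0 t x"
proof (cases "J t0 t x")
  case (real j)
  have le: "\<bar>V s k t x - V (s + t - t0) k t0 x\<bar> \<le> 1584 * j" if "s > 0" for s
    using mild_smoothed[OF t(1) _ that, of t k x] t real by (simp add: ennreal_mult[symmetric] flip: ennreal_numeral)
  have l1: "((\<lambda>s. V s k t x) \<longlongrightarrow> v k t x) (at_right 0)" by (rule V_tendsto)
  have "isCont (\<lambda>s. V s k t0 x) (t - t0)" by (rule DERIV_isCont[OF DERIV_V_s]) (use t in simp)
  then have "((\<lambda>s. V (s + t - t0) k t0 x) \<longlongrightarrow> V (t - t0) k t0 x) (at_right 0)"
    by (rule isCont_tendsto_compose) (auto intro!: tendsto_eq_intros)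
  with l1 have "((\<lambda>s. \<bar>V s k t x - V (s + t - t0) k t0 x\<bar>) \<longlongrightarrow> \<bar>v k t x - V (t - t0) k t0 x\<bar>) (at_right 0)"
    by (intro tendsto_intros)
  then have "\<bar>v k t x - V (t - t0) k t0 x\<bar> \<le> 1584 * j"
    by (rule tendsto_upperbound) (auto intro!: eventually_at_right_less[THEN eventually_mono] le)
  then have "\<bar>v k t x\<bar> \<le> \<bar>V (t - t0) k t0 x\<bar> + 1584 * j" by linarith
  then have "ennreal \<bar>v k t x\<bar> \<le> ennreal (\<bar>V (t - t0) k t0 x\<bar> + 1584 * j)" by (rule ennreal_leI)
  then show ?thesis using real by (simp add: ennreal_mult)
qed (simp add: ennreal_mult_top)

end


section \<open>Bounds in the supremum norm\<close>

lemma nn_powr_left: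
  assumes p: "p < 1" and ab: "a \<le> b"
  shows "(\<integral>\<^sup>+r. ennreal ((r - a) powr (- p)) * indicator {a..b} r \<partial>lborel) = ennreal ((b - a) powr (1 - p) / (1 - p))"
proof -
  have hi: "((\<lambda>x. x powr (- p)) has_integral ((b - a) powr (- p + 1) / (- p + 1))) {0..b - a}"
    by (rule has_integral_powr_from_0) (use p ab in auto)
  have "(\<integral>\<^sup>+r. ennreal ((r - a) powr (- p)) * indicator {a..b} r \<partial>lborel) = (\<integral>\<^sup>+r. (\<lambda>x. indicator {0..b - a} x * ennreal (x powr (- p))) (r - a) \<partial>lborel)"
    by (intro nn_integral_cong) (auto simp: indicator_def)
  also have "\<dots> = (\<integral>\<^sup>+x. indicator {0..b - a} x * ennreal (x powr (- p)) \<partial>lborel)"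
    by (rule nn_shift) measurable
  also have "\<dots> = (\<integral>\<^sup>+x. ennreal (indicator {0..b - a} x * x powr (- p)) \<partial>lborel)"
    by (intro nn_integral_cong) (auto simp: indicator_def)
  also have "\<dots> = ennreal ((b - a) powr (- p + 1) / (- p + 1))"
  proof (rule nn_integral_has_integral_lborel)
    have "(\<lambda>x. indicator {0..b - a} x * x powr (- p)) = (\<lambda>x. if x \<in> {0..b - a} then x powr (- p) else 0)"
      by (auto simp: indicator_def fun_eq_iff)
    then show "((\<lambda>x. indicator {0..b - a} x * x powr (- p)) has_integral ((b - a) powr (- p + 1) / (- p + 1))) UNIV"
      using hi by (simp only: has_integral_restrict_UNIV)
  qed auto
  finally show ?thesis by (simp add: add.commute)
qed

lemma nn_powr_right:
  assumes p: "p < 1" and ab: "a \<le> b"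
  shows "(\<integral>\<^sup>+r. ennreal ((b - r) powr (- p)) * indicator {a..b} r \<partial>lborel) = ennreal ((b - a) powr (1 - p) / (1 - p))"
proof -
  have "(\<integral>\<^sup>+r. ennreal ((b - r) powr (- p)) * indicator {a..b} r \<partial>lborel) =
    (\<integral>\<^sup>+r. (\<lambda>x. ennreal ((x - a) powr (- p)) * indicator {a..b} x) ((a + b) - r) \<partial>lborel)"
    by (intro nn_integral_cong) (auto simp: indicator_def)
  also have "\<dots> = (\<integral>\<^sup>+x. ennreal ((x - a) powr (- p)) * indicator {a..b} x \<partial>lborel)"
    by (rule nn_reflect) measurable
  finally show ?thesis using nn_powr_left[OF p ab] by simp
qed

text \<open>Splitting at the midpoint; a crude bound for the Beta integral with the right homogeneity.\<close>

lemma nn_beta: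
  assumes p: "0 \<le> p" "p < 1" and q: "0 \<le> q" "q < 1" and ab: "a < b"
  shows "(\<integral>\<^sup>+r. ennreal ((b - r) powr (- p) * (r - a) powr (- q)) * indicator {a<..<b} r \<partial>lborel)
    \<le> ennreal (((b - a) / 2) powr (1 - p - q) * (1 / (1 - p) + 1 / (1 - q)))"
proof -
  define h where "h = (b - a) / 2"
  define m where "m = (a + b) / 2"
  have h: "h > 0" "m - a = h" "b - m = h" using ab by (auto simp: h_def m_def field_simps)
  have le: "ennreal ((b - r) powr (- p) * (r - a) powr (- q)) * indicator {a<..<b} r \<le>
     ennreal (h powr (- p)) * (ennreal ((r - a) powr (- q)) * indicator {a..m} r) + ennreal (h powr (- q)) * (ennreal ((b - r) powr (- p)) * indicator {m..b} r)" for r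
  proof (cases "r \<in> {a<..<b}")
    case True
    show ?thesis
    proof (cases "r \<le> m")
      case le: True
      then have "(b - r) powr (- p) \<le> h powr (- p)" using h p True by (intro powr_mono2') auto
      then have "ennreal ((b - r) powr (- p) * (r - a) powr (- q)) \<le> ennreal (h powr (- p)) * ennreal ((r - a) powr (- q))"
        unfolding ennreal_mult[symmetric, OF powr_ge_zero powr_ge_zero] by (intro ennreal_leI mult_right_mono) auto
      then show ?thesis using True le by (simp add: indicator_def add_increasing2)
    next
      case False
      then have "(r - a) powr (- q) \<le> h powr (- q)" using h q True by (intro powr_mono2') auto
      then have "(b - r) powr (- p) * (r - a) powr (- q) \<le> (b - r) powr (- p) * h powr (- q)" by (intro mult_left_mono) auto
      then have "ennreal ((b - r) powr (- p) * (r - a) powr (- q)) \<le> ennreal (h powr (- q)) * ennreal ((b - r) powr (- p))"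
        unfolding ennreal_mult[symmetric, OF powr_ge_zero powr_ge_zero] by (intro ennreal_leI) (simp add: mult.commute)
      then show ?thesis using True False by (simp add: indicator_def)
    qed
  qed simp
  have "(\<integral>\<^sup>+r. ennreal ((b - r) powr (- p) * (r - a) powr (- q)) * indicator {a<..<b} r \<partial>lborel) \<le>
    (\<integral>\<^sup>+r. ennreal (h powr (- p)) * (ennreal ((r - a) powr (- q)) * indicator {a..m} r) + ennreal (h powr (- q)) * (ennreal ((b - r) powr (- p)) * indicator {m..b} r) \<partial>lborel)"
    by (intro nn_integral_mono le)
  also have "\<dots> = ennreal (h powr (- p)) * ennreal (h powr (1 - q) / (1 - q)) + ennreal (h powr (- q)) * ennreal (h powr (1 - p) / (1 - p))"
    using nn_powr_left[of q a m] nn_powr_right[of p m b] p q h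
    by (subst nn_integral_add) (auto simp: nn_integral_cmult)
  also have "\<dots> = ennreal (h powr (- p) * (h powr (1 - q) / (1 - q)) + h powr (- q) * (h powr (1 - p) / (1 - p)))"
    using p q by (simp flip: ennreal_mult ennreal_plus)
  also have "h powr (- p) * (h powr (1 - q) / (1 - q)) + h powr (- q) * (h powr (1 - p) / (1 - p)) = h powr (1 - p - q) * (1 / (1 - p) + 1 / (1 - q))"
  proof -
    have "h powr (- p) * h powr (1 - q) = h powr (1 - p - q)" "h powr (- q) * h powr (1 - p) = h powr (1 - p - q)"
      by (simp_all add: powr_add[symmetric] algebra_simps)
    then show ?thesis by (simp add: distrib_left)
  qed
  finally show ?thesis unfolding h_def .
qed

lemma numeral_mult_ennreal: "0 \<le> x \<Longrightarrow> numeral n * ennreal x = ennreal (numeral n * x)"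
  by (simp add: ennreal_mult)

lemma lam_le: assumes "t > 0" shows "lam t \<le> t powr (- 1/2)"
proof -
  have "t powr (- 1/2) = 1 / sqrt t" using assms by (simp add: powr_minus powr_half_sqrt inverse_eq_divide)
  then show ?thesis using assms by (simp add: lam_def field_simps)
qed

lemma lam_pow_le: assumes "t > 0" shows "lam t ^ n \<le> t powr (- real n / 2)"
proof -
  have "lam t ^ n \<le> (t powr (- 1/2)) ^ n" using lam_le[OF assms] lam_pos[OF assms] by (intro power_mono) auto
  also have "\<dots> = t powr (- real n / 2)" using assms by (simp add: powr_powr powr_realpow[symmetric] mult.commute)
  finally show ?thesis .
qed

lemma sqrt_powr: "x > 0 \<Longrightarrow> sqrt (x powr a) = x powr (a / 2)"
  by (simp add: powr_half_sqrt[symmetric] powr_powr)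

lemma kk_nn: assumes "t > 0" shows "(\<integral>\<^sup>+y. ennreal (kk t (y - x)) \<partial>lborel) \<le> ennreal (cK * t powr (- 1/2))"
proof -
  have "(\<integral>\<^sup>+y. ennreal (kk t (y - x)) \<partial>lborel) = (\<integral>\<^sup>+y. ennreal (kk t y) \<partial>lborel)"
    by (rule nn_shift[of "\<lambda>y. ennreal (kk t y)"]) measurable
  also have "\<dots> = ennreal (l1n (kk t))" using nn_l1n[OF kk_L1(1)[OF assms]] by simp
  also have "\<dots> \<le> ennreal (cK * t powr (- 1/2))"
    using kk_L1(2)[OF assms] lam_le[OF assms] cK_pos by (intro ennreal_leI) (meson mult_left_mono less_imp_le order_trans)
  finally show ?thesis .
qed

text \<open>Interpolation between the supremum \<open>s\<^sup>-\<^sup>2\<close> and the \<open>L\<^sup>1\<close> norm \<open>s\<^sup>-\<^sup>1\<^sup>/\<^sup>2\<close>.\<close>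

lemma kk_l2: assumes a: "a > 0" shows "l2n (kk a) \<le> sqrt cK * a powr (- 5/4)"
proof -
  have "l2n (kk a) \<le> sqrt (lam a ^ 4 * (cK * lam a))" by (rule kk_sqi(2)[OF a])
  also have "lam a ^ 4 * (cK * lam a) = cK * lam a ^ 5" by (simp add: eval_nat_numeral)
  also have "sqrt (cK * lam a ^ 5) \<le> sqrt (cK * a powr (- real 5 / 2))"
    using lam_pow_le[OF a, of 5] cK_pos by (intro real_sqrt_le_mono mult_left_mono) auto
  also have "\<dots> = sqrt cK * a powr (- 5/4)" using a by (simp add: real_sqrt_mult sqrt_powr)
  finally show ?thesis .
qed

lemma kk_kk_one:
  assumes a: "a > 0" and b: "b > 0" and f: "sqi f"
  shows "(\<integral>\<^sup>+y. (\<integral>\<^sup>+z. ennreal (kk a (y - x)) * (ennreal (kk b (z - y)) * ennreal \<bar>f z\<bar>) \<partial>lborel) \<partial>lborel)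
     \<le> ennreal (cK * sqrt cK * b powr (- 1/2) * a powr (- 5/4) * l2n f)"
proof -
  have "(\<integral>\<^sup>+y. (\<integral>\<^sup>+z. ennreal (kk a (y - x)) * (ennreal (kk b (z - y)) * ennreal \<bar>f z\<bar>) \<partial>lborel) \<partial>lborel)
     \<le> ennreal (l1n (kk b) * l2n (kk a) * l2n f)"
    using bilinear_nn[OF f sqi_shift(1)[OF kk_sqi(1)[OF a], of x] kk_L1(1)[OF b]] sqi_shift(2)[OF kk_sqi(1)[OF a], of x] by simp
  also have "\<dots> \<le> ennreal ((cK * b powr (- 1/2)) * (sqrt cK * a powr (- 5/4)) * l2n f)"
  proof (intro ennreal_leI mult_right_mono mult_mono)
    show "l1n (kk b) \<le> cK * b powr (- 1/2)"
      using kk_L1(2)[OF b] lam_le[OF b] cK_pos by (meson mult_left_mono less_imp_le order_trans)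
    show "l2n (kk a) \<le> sqrt cK * a powr (- 5/4)" by (rule kk_l2[OF a])
  qed (use cK_pos in auto)
  finally show ?thesis by (simp add: mult_ac)
qed

lemma kk_kk_swap:
  assumes [measurable]: "f \<in> borel_measurable borel"
  shows "(\<integral>\<^sup>+y. (\<integral>\<^sup>+z. ennreal (kk a (y - x)) * (ennreal (kk b (z - y)) * ennreal \<bar>f z\<bar>) \<partial>lborel) \<partial>lborel)
     = (\<integral>\<^sup>+y. (\<integral>\<^sup>+z. ennreal (kk b (y - x)) * (ennreal (kk a (z - y)) * ennreal \<bar>f z\<bar>) \<partial>lborel) \<partial>lborel)"
proof -
  have 1: "(\<integral>\<^sup>+y. (\<integral>\<^sup>+z. ennreal (kk a (y - x)) * (ennreal (kk b (z - y)) * ennreal \<bar>f z\<bar>) \<partial>lborel) \<partial>lborel)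
     = (\<integral>\<^sup>+z. (\<integral>\<^sup>+y. ennreal (kk a (y - x)) * (ennreal (kk b (z - y)) * ennreal \<bar>f z\<bar>) \<partial>lborel) \<partial>lborel)" for a b
    by (rule lborel_pair.Fubini') measurable
  have 2: "(\<integral>\<^sup>+y. ennreal (kk a (y - x)) * (ennreal (kk b (z - y)) * ennreal \<bar>f z\<bar>) \<partial>lborel)
     = (\<integral>\<^sup>+y. ennreal (kk b (y - x)) * (ennreal (kk a (z - y)) * ennreal \<bar>f z\<bar>) \<partial>lborel)" for z
    using nn_reflect[of "\<lambda>y. ennreal (kk a (y - x)) * (ennreal (kk b (z - y)) * ennreal \<bar>f z\<bar>)" "x + z"]
    by (simp add: mult_ac)
  show ?thesis unfolding 1 2 ..
qed

text \<open>Placing the \<open>L\<^sup>2\<close> norm on one kernel and the \<open>L\<^sup>1\<close> norm on the other gives an exponent \<open>-5/4\<close> on one of the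
  two time differences, which is not integrable. The geometric mean of the two possibilities has the
  integrable exponent \<open>-7/8\<close> on both.\<close>

lemma kk_kk:
  assumes a: "a > 0" and b: "b > 0" and f: "sqi f"
  shows "(\<integral>\<^sup>+y. (\<integral>\<^sup>+z. ennreal (kk a (y - x)) * (ennreal (kk b (z - y)) * ennreal \<bar>f z\<bar>) \<partial>lborel) \<partial>lborel)
     \<le> ennreal (cK * sqrt cK * l2n f * (a powr (- 7/8) * b powr (- 7/8)))" (is "?X \<le> _")
proof -
  define c where "c = cK * sqrt cK * l2n f"
  have c: "c \<ge> 0" using cK_pos by (simp add: c_def)
  define A where "A = c * (b powr (- 1/2) * a powr (- 5/4))"
  define B where "B = c * (a powr (- 1/2) * b powr (- 5/4))"
  have X: "?X \<le> ennreal A" "?X \<le> ennreal B"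
    using kk_kk_one[OF a b f, of x] kk_kk_one[OF b a f, of x] kk_kk_swap[of f a x b] sqi_meas[OF f]
    by (simp_all add: A_def B_def c_def mult_ac)
  have AB: "A \<ge> 0" "B \<ge> 0" using c by (auto simp: A_def B_def)
  have pw: "x powr (- 1/2) * x powr (- 5/4) = x powr (- 7/4)" for x :: real by (simp add: powr_add[symmetric])
  have "A * B = c * c * ((a powr (- 1/2) * a powr (- 5/4)) * (b powr (- 1/2) * b powr (- 5/4)))"
    unfolding A_def B_def by (simp add: mult_ac)
  also have "\<dots> = c * c * (a powr (- 7/4) * b powr (- 7/4))" unfolding pw ..
  finally have "sqrt (A * B) = c * (a powr (- 7/8) * b powr (- 7/8))"
    using a b c by (simp add: real_sqrt_mult sqrt_powr)
  moreover have "min A B \<le> sqrt (A * B)"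
    by (rule real_le_rsqrt) (use AB in \<open>auto simp: power2_eq_square intro!: mult_mono\<close>)
  moreover have "?X \<le> ennreal (min A B)" using X by (simp add: min_def)
  ultimately have "?X \<le> ennreal (c * (a powr (- 7/8) * b powr (- 7/8)))"
    using order_trans[OF _ ennreal_leI[of "min A B"]] by (simp only:)
  then show ?thesis unfolding c_def .
qed

context regularized_flow
begin

definition vsup_le :: "real \<Rightarrow> real \<Rightarrow> bool" where "vsup_le t a \<longleftrightarrow> (\<forall>k x. \<bar>v k t x\<bar> \<le> a)"

lemma vsup_le_mono: "vsup_le t a \<Longrightarrow> a \<le> a' \<Longrightarrow> vsup_le t a'" unfolding vsup_le_def by (meson order_trans)

lemma vsup_le_nonneg: "vsup_le t a \<Longrightarrow> 0 \<le> a" unfolding vsup_le_def by (meson abs_ge_zero order_trans)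

text \<open>The \<open>L\<^sup>2\<close> norm of the heat kernel is of order \<open>s\<^sup>-\<^sup>3\<^sup>/\<^sup>4\<close>.\<close>

lemma V_sup_L2:
  assumes s: "s > 0" shows "\<bar>V s k t x\<bar> \<le> s powr (- 3/4) * l2n (v k t)"
proof -
  have 1: "\<bar>V s k t x\<bar> \<le> l2n (v k t) * l2n (hk s)"
    unfolding V_def sqi_shift(2)[OF hk_sqi(1)[OF s], of x, symmetric]
    by (rule pair_le[OF sqi_v sqi_shift(1)[OF hk_sqi(1)[OF s]]])
  have "l2n (hk s) \<le> s powr (- 3/4)"
  proof -
    have "l2n (hk s) \<le> sqrt (lam s ^ 3)" by (rule hk_sqi(2)[OF s])
    also have "\<dots> \<le> sqrt (s powr (- real 3 / 2))" using lam_pow_le[OF s, of 3] by (rule real_sqrt_le_mono)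
    also have "\<dots> = s powr (- 3/4)" using s by (simp add: sqrt_powr)
    finally show ?thesis .
  qed
  then have "l2n (v k t) * l2n (hk s) \<le> l2n (v k t) * s powr (- 3/4)" by (rule mult_left_mono) simp
  with 1 show ?thesis by (simp add: mult.commute)
qed

lemma V_sup_contraction:
  assumes s: "s > 0" and a: "vsup_le t a" shows "\<bar>V s k t x\<bar> \<le> a"
proof -
  have i: "integrable lborel (\<lambda>y. hk s (y - x))" by (rule integrable_shift[OF hk_L1(1)[OF s]])
  have "\<bar>V s k t x\<bar> \<le> (LINT y|lborel. \<bar>v k t y * hk s (y - x)\<bar>)" unfolding V_def by (rule integral_abs_bound)
  also have "\<dots> \<le> (LINT y|lborel. a * hk s (y - x))"
  proof (rule integral_mono)
    show "integrable lborel (\<lambda>y. \<bar>v k t y * hk s (y - x)\<bar>)"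
      by (intro integrable_abs sqi_mult sqi_v sqi_shift hk_sqi s)
    show "\<bar>v k t y * hk s (y - x)\<bar> \<le> a * hk s (y - x)" for y
      using a hk_nonneg[OF s] by (simp add: vsup_le_def abs_mult mult_right_mono)
  qed (use i in simp)
  also have "\<dots> = a" using integral_shift[of "hk s" x] hk_L1(2)[OF s] by simp
  finally show ?thesis .
qed

lemma Sv_vsup_le: assumes "vsup_le t a" shows "Sv t y \<le> 9 * a\<^sup>2"
proof -
  have "\<bar>b j t y * v i t y\<bar> \<le> a * a" for i j
    unfolding abs_mult by (intro mult_mono b_sup) (use assms vsup_le_nonneg[OF assms] in \<open>auto simp: vsup_le_def\<close>)
  then have "Sv t y \<le> (\<Sum>i\<in>(UNIV::3 set). \<Sum>j\<in>(UNIV::3 set). a * a)" unfolding Sv_def by (intro sum_mono)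
  then show ?thesis by (simp add: power2_eq_square)
qed

lemma J_vsup_le:
  assumes \<phi>[measurable]: "\<phi> \<in> borel_measurable borel" and le: "\<And>r. r \<in> {t0<..<t} \<Longrightarrow> vsup_le r (\<phi> r)"
  shows "J t0 t x \<le> ennreal (9 * cK) * (\<integral>\<^sup>+r. ennreal ((t - r) powr (- 1/2) * (\<phi> r)\<^sup>2) * indicator {t0<..<t} r \<partial>lborel)"
proof -
  have "J t0 t x \<le> (\<integral>\<^sup>+r. ennreal (9 * cK) * (ennreal ((t - r) powr (- 1/2) * (\<phi> r)\<^sup>2) * indicator {t0<..<t} r) \<partial>lborel)"
    unfolding J_def
  proof (rule nn_integral_mono)
    fix r
    show "(\<integral>\<^sup>+y. ennreal (kk (t - r) (y - x)) * ennreal (Sv r y) \<partial>lborel) * indicator {t0<..<t} r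
      \<le> ennreal (9 * cK) * (ennreal ((t - r) powr (- 1/2) * (\<phi> r)\<^sup>2) * indicator {t0<..<t} r)"
    proof (cases "r \<in> {t0<..<t}")
      case True
      have "(\<integral>\<^sup>+y. ennreal (kk (t - r) (y - x)) * ennreal (Sv r y) \<partial>lborel) \<le> (\<integral>\<^sup>+y. ennreal (kk (t - r) (y - x)) * ennreal (9 * (\<phi> r)\<^sup>2) \<partial>lborel)"
        by (intro nn_integral_mono mult_left_mono ennreal_leI Sv_vsup_le le True) auto
      also have "\<dots> = (\<integral>\<^sup>+y. ennreal (kk (t - r) (y - x)) \<partial>lborel) * ennreal (9 * (\<phi> r)\<^sup>2)"
        by (rule nn_integral_multc) measurable
      also have "\<dots> \<le> ennreal (cK * (t - r) powr (- 1/2)) * ennreal (9 * (\<phi> r)\<^sup>2)"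
        by (intro mult_right_mono kk_nn) (use True in auto)
      also have "\<dots> = ennreal (9 * cK) * ennreal ((t - r) powr (- 1/2) * (\<phi> r)\<^sup>2)"
        using cK_pos by (simp flip: ennreal_mult add: mult_ac)
      finally show ?thesis using True by simp
    qed simp
  qed
  also have "\<dots> = ennreal (9 * cK) * (\<integral>\<^sup>+r. ennreal ((t - r) powr (- 1/2) * (\<phi> r)\<^sup>2) * indicator {t0<..<t} r \<partial>lborel)"
    by (rule nn_integral_cmult) measurable
  finally show ?thesis .
qed

text \<open>Over a short interval the supremum can grow only by the contribution of the Duhamel term. In
  \<open>bootstrap\<close> this replaces continuity in time of the supremum, which is not known.\<close>

lemma vsup_le_step:
  assumes t: "0 \<le> t" "t < t'" and a: "vsup_le t a" and B: "\<And>r. r \<in> {t<..<t'} \<Longrightarrow> vsup_le r B"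
  shows "vsup_le t' (a + 1584 * (18 * cK) * B\<^sup>2 * (t' - t) powr (1/2))"
  unfolding vsup_le_def
proof (intro allI)
  fix k x
  have j: "J t t' x \<le> ennreal (9 * cK) * (\<integral>\<^sup>+r. ennreal ((t' - r) powr (- 1/2) * B\<^sup>2) * indicator {t<..<t'} r \<partial>lborel)"
    by (rule J_vsup_le) (use B in auto)
  have "(\<integral>\<^sup>+r. ennreal ((t' - r) powr (- 1/2) * B\<^sup>2) * indicator {t<..<t'} r \<partial>lborel) \<le> (\<integral>\<^sup>+r. ennreal (B\<^sup>2) * (ennreal ((t' - r) powr - (1/2)) * indicator {t..t'} r) \<partial>lborel)"
    by (intro nn_integral_mono) (auto simp: indicator_def ennreal_mult[symmetric] mult.commute)
  also have "\<dots> = ennreal (B\<^sup>2) * ennreal ((t' - t) powr (1/2) / (1/2))"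
    using nn_powr_right[of "1/2" t t'] t by (subst nn_integral_cmult) auto
  finally have "ennreal (9 * cK) * (\<integral>\<^sup>+r. ennreal ((t' - r) powr (- 1/2) * B\<^sup>2) * indicator {t<..<t'} r \<partial>lborel)
      \<le> ennreal (9 * cK) * (ennreal (B\<^sup>2) * ennreal ((t' - t) powr (1/2) / (1/2)))"
    by (rule mult_left_mono) simp
  also have "\<dots> = ennreal (18 * cK * B\<^sup>2 * (t' - t) powr (1/2))"
    using cK_pos by (simp add: ennreal_mult[symmetric] mult_ac)
  finally have "J t t' x \<le> ennreal (18 * cK * B\<^sup>2 * (t' - t) powr (1/2))" using j by (rule order_trans[rotated])
  then have "1584 * J t t' x \<le> 1584 * ennreal (18 * cK * B\<^sup>2 * (t' - t) powr (1/2))" by (rule mult_left_mono) simp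
  also have "\<dots> = ennreal (1584 * (18 * cK) * B\<^sup>2 * (t' - t) powr (1/2))"
    using cK_pos by (subst numeral_mult_ennreal) (auto simp: mult_ac)
  finally have 1: "1584 * J t t' x \<le> ennreal (1584 * (18 * cK) * B\<^sup>2 * (t' - t) powr (1/2))" .
  have "\<bar>V (t' - t) k t x\<bar> \<le> a" using t by (intro V_sup_contraction a) auto
  then have 2: "ennreal \<bar>V (t' - t) k t x\<bar> \<le> ennreal a" by (rule ennreal_leI)
  have "ennreal \<bar>v k t' x\<bar> \<le> ennreal a + ennreal (1584 * (18 * cK) * B\<^sup>2 * (t' - t) powr (1/2))"
    using mild_inequality[OF t, of k x] add_mono[OF 2 1] by (rule order_trans)
  then show "\<bar>v k t' x\<bar> \<le> a + 1584 * (18 * cK) * B\<^sup>2 * (t' - t) powr (1/2)"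
    using vsup_le_nonneg[OF a] cK_pos by (simp flip: ennreal_plus)
qed

text \<open>A qualitative bound that depends on the regularization. Since \<open>b\<close> is bounded, the mild inequality is
  linear in \<open>v\<close>, but a single kernel does not map \<open>L\<^sup>2\<close> into bounded functions integrably in time.
  Substituting the inequality into itself once produces the composition of two kernels, which does
  (\<open>kk_kk\<close>). The initial time is excluded, because the linear part is only of order \<open>t\<^sup>-\<^sup>3\<^sup>/\<^sup>4\<close>.\<close>

lemma sup_bounded_on_compacts:
  assumes t0: "0 < t0" "t0 \<le> T"
  shows "\<exists>A. \<forall>t\<in>{t0..T}. vsup_le t A"
proof -
  obtain M B where mb: "\<And>t k. t \<le> T \<Longrightarrow> l2n (v k t) \<le> M" "\<And>t k x. t \<le> T \<Longrightarrow> \<bar>b k t x\<bar> \<le> B" "M \<ge> 0" "B \<ge> 0"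
    using obtain_bounds[of T] by metis
  define u where "u t y = (\<Sum>i\<in>UNIV. \<bar>v i t y\<bar>)" for t y
  have um[measurable (raw)]: "(\<lambda>x. u (f x) (g x)) \<in> borel_measurable N" if [measurable]: "f \<in> borel_measurable N" "g \<in> borel_measurable N" for f g and N :: "'x measure"
    unfolding u_def by measurable
  define I where "I t x = (\<integral>\<^sup>+r. (\<integral>\<^sup>+y. ennreal (kk (t - r) (y - x)) * ennreal (u r y) \<partial>lborel) * indicator {0<..<t} r \<partial>lborel)" for t x
  have u0: "0 \<le> u t y" for t y by (simp add: u_def sum_nonneg)
  have SvB: "Sv t y \<le> 3 * B * u t y" if "t \<le> T" for t y
  proof -
    have "Sv t y \<le> (\<Sum>i\<in>UNIV. \<Sum>j\<in>(UNIV::3 set). B * \<bar>v i t y\<bar>)"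
      unfolding Sv_def abs_mult by (intro sum_mono mult_right_mono mb(2) that) auto
    then show ?thesis by (simp add: u_def sum_distrib_left mult_ac)
  qed
  have JI: "J 0 t x \<le> ennreal (3 * B) * I t x" if "t \<le> T" for t x
  proof -
    have "J 0 t x \<le> (\<integral>\<^sup>+r. ennreal (3 * B) * ((\<integral>\<^sup>+y. ennreal (kk (t - r) (y - x)) * ennreal (u r y) \<partial>lborel) * indicator {0<..<t} r) \<partial>lborel)"
      unfolding J_def
    proof (rule nn_integral_mono)
      fix r
      show "(\<integral>\<^sup>+y. ennreal (kk (t - r) (y - x)) * ennreal (Sv r y) \<partial>lborel) * indicator {0<..<t} r
        \<le> ennreal (3 * B) * ((\<integral>\<^sup>+y. ennreal (kk (t - r) (y - x)) * ennreal (u r y) \<partial>lborel) * indicator {0<..<t} r)"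
      proof (cases "r \<in> {0<..<t}")
        case True
        have "(\<integral>\<^sup>+y. ennreal (kk (t - r) (y - x)) * ennreal (Sv r y) \<partial>lborel) \<le> (\<integral>\<^sup>+y. ennreal (3 * B) * (ennreal (kk (t - r) (y - x)) * ennreal (u r y)) \<partial>lborel)"
        proof (rule nn_integral_mono)
          fix y
          have "ennreal (Sv r y) \<le> ennreal (3 * B * u r y)" by (rule ennreal_leI[OF SvB]) (use True that in auto)
          also have "\<dots> = ennreal (3 * B) * ennreal (u r y)" using mb u0 by (simp add: ennreal_mult)
          finally have "ennreal (kk (t - r) (y - x)) * ennreal (Sv r y) \<le> ennreal (kk (t - r) (y - x)) * (ennreal (3 * B) * ennreal (u r y))"
            by (rule mult_left_mono) simp
          then show "ennreal (kk (t - r) (y - x)) * ennreal (Sv r y) \<le> ennreal (3 * B) * (ennreal (kk (t - r) (y - x)) * ennreal (u r y))"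
            by (simp only: mult.left_commute)
        qed
        also have "\<dots> = ennreal (3 * B) * (\<integral>\<^sup>+y. ennreal (kk (t - r) (y - x)) * ennreal (u r y) \<partial>lborel)"
          by (rule nn_integral_cmult) measurable
        finally show ?thesis using True by simp
      qed simp
    qed
    also have "\<dots> = ennreal (3 * B) * I t x" unfolding I_def by (rule nn_integral_cmult) measurable
    finally show ?thesis .
  qed
  define C1 where "C1 = 3 * 1584 * ennreal (3 * B)"
  have step: "ennreal (u t x) \<le> ennreal (3 * M * t powr (- 3/4)) + C1 * I t x" if t: "0 < t" "t \<le> T" for t x
  proof -
    have "ennreal \<bar>v k t x\<bar> \<le> ennreal (t powr (- 3/4) * M) + 1584 * (ennreal (3 * B) * I t x)" for k
    proof -
      have "\<bar>V (t - 0) k 0 x\<bar> \<le> t powr (- 3/4) * M"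
      proof -
        have "\<bar>V t k 0 x\<bar> \<le> t powr (- 3/4) * l2n (v k 0)" by (rule V_sup_L2[OF t(1)])
        also have "\<dots> \<le> t powr (- 3/4) * M" using mb(1)[of 0 k] t by (intro mult_left_mono) auto
        finally show ?thesis by simp
      qed
      then have "ennreal \<bar>V (t - 0) k 0 x\<bar> + 1584 * J 0 t x \<le> ennreal (t powr (- 3/4) * M) + 1584 * (ennreal (3 * B) * I t x)"
        by (intro add_mono mult_left_mono ennreal_leI JI t) auto
      then show ?thesis using mild_inequality[of 0 t k x] t by (meson order_refl order_trans)
    qed
    then have "(\<Sum>k\<in>(UNIV::3 set). ennreal \<bar>v k t x\<bar>) \<le> (\<Sum>k\<in>(UNIV::3 set). ennreal (t powr (- 3/4) * M) + 1584 * (ennreal (3 * B) * I t x))"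
      by (rule sum_mono)
    also have "\<dots> = 3 * (ennreal (t powr (- 3/4) * M) + 1584 * (ennreal (3 * B) * I t x))" by simp
    also have "\<dots> = ennreal (3 * M * t powr (- 3/4)) + C1 * I t x"
    proof -
      have "3 * ennreal (t powr (- 3/4) * M) = ennreal (3 * M * t powr (- 3/4))"
        using mb by (subst numeral_mult_ennreal) (auto simp: mult_ac)
      then show ?thesis by (simp add: C1_def distrib_left mult.assoc)
    qed
    finally show ?thesis by (simp add: u_def)
  qed
  define C2 where "C2 = cK * sqrt cK * (3 * M)"
  have C2: "C2 \<ge> 0" using mb cK_pos by (simp add: C2_def)
  have us: "sqi (u q)" "l2n (u q) \<le> 3 * M" if "q \<le> T" for q
  proof -
    have s: "sqi (\<lambda>y. \<bar>v i q y\<bar>)" for i by (intro sqi_abs sqi_v)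
    show "sqi (u q)" unfolding u_def[abs_def] by (intro sqi_sum s)
    have "(u q y)\<^sup>2 \<le> 3 * (\<Sum>i\<in>UNIV. (v i q y)\<^sup>2)" for y
      using sum_squared_le_sum_of_squares[of "\<lambda>i. \<bar>v i q y\<bar>" UNIV] by (simp add: u_def)
    then have "(l2n (u q))\<^sup>2 \<le> (LINT y|lborel. 3 * (\<Sum>i\<in>UNIV. (v i q y)\<^sup>2))"
      unfolding l2n_sq by (intro integral_mono) (use \<open>sqi (u q)\<close> sqi_v in \<open>auto simp: sqi_def\<close>)
    also have "\<dots> = 3 * (\<Sum>i\<in>UNIV. (l2n (v i q))\<^sup>2)"
      unfolding l2n_sq using sqi_v by (simp add: sqi_def)
    also have "\<dots> \<le> 3 * (\<Sum>i\<in>(UNIV::3 set). M\<^sup>2)" by (intro mult_left_mono sum_mono power_mono mb that) auto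
    also have "\<dots> = (3 * M)\<^sup>2" by (simp add: power_mult_distrib)
    finally show "l2n (u q) \<le> 3 * M" by (rule power2_le_imp_le) (use mb in simp)
  qed
  have II: "(\<integral>\<^sup>+y. ennreal (kk (t - r) (y - x)) * I r y \<partial>lborel) \<le> ennreal (C2 * 8 * T powr (1/8) * (t - r) powr (- 7/8))" if r: "0 < r" "r < t" "t \<le> T" for r t x
  proof -
    have "(\<integral>\<^sup>+y. ennreal (kk (t - r) (y - x)) * I r y \<partial>lborel) =
      (\<integral>\<^sup>+y. (\<integral>\<^sup>+q. (\<integral>\<^sup>+z. ennreal (kk (t - r) (y - x)) * (ennreal (kk (r - q) (z - y)) * ennreal (u q z)) \<partial>lborel) * indicator {0<..<r} q \<partial>lborel) \<partial>lborel)"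
    proof (rule nn_integral_cong)
      fix y
      have "ennreal (kk (t - r) (y - x)) * I r y = (\<integral>\<^sup>+q. ennreal (kk (t - r) (y - x)) * ((\<integral>\<^sup>+z. ennreal (kk (r - q) (z - y)) * ennreal (u q z) \<partial>lborel) * indicator {0<..<r} q) \<partial>lborel)"
        unfolding I_def by (rule nn_integral_cmult[symmetric]) measurable
      also have "\<dots> = (\<integral>\<^sup>+q. (\<integral>\<^sup>+z. ennreal (kk (t - r) (y - x)) * (ennreal (kk (r - q) (z - y)) * ennreal (u q z)) \<partial>lborel) * indicator {0<..<r} q \<partial>lborel)"
      proof (rule nn_integral_cong)
        fix q
        have "(\<integral>\<^sup>+z. ennreal (kk (t - r) (y - x)) * (ennreal (kk (r - q) (z - y)) * ennreal (u q z)) \<partial>lborel) =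
          ennreal (kk (t - r) (y - x)) * (\<integral>\<^sup>+z. ennreal (kk (r - q) (z - y)) * ennreal (u q z) \<partial>lborel)"
          by (rule nn_integral_cmult) measurable
        then show "ennreal (kk (t - r) (y - x)) * ((\<integral>\<^sup>+z. ennreal (kk (r - q) (z - y)) * ennreal (u q z) \<partial>lborel) * indicator {0<..<r} q) =
          (\<integral>\<^sup>+z. ennreal (kk (t - r) (y - x)) * (ennreal (kk (r - q) (z - y)) * ennreal (u q z)) \<partial>lborel) * indicator {0<..<r} q"
          by (simp only: mult.assoc)
      qed
      finally show "ennreal (kk (t - r) (y - x)) * I r y = (\<integral>\<^sup>+q. (\<integral>\<^sup>+z. ennreal (kk (t - r) (y - x)) * (ennreal (kk (r - q) (z - y)) * ennreal (u q z)) \<partial>lborel) * indicator {0<..<r} q \<partial>lborel)" .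
    qed
    also have "\<dots> = (\<integral>\<^sup>+q. (\<integral>\<^sup>+y. (\<integral>\<^sup>+z. ennreal (kk (t - r) (y - x)) * (ennreal (kk (r - q) (z - y)) * ennreal (u q z)) \<partial>lborel) * indicator {0<..<r} q \<partial>lborel) \<partial>lborel)"
      by (rule lborel_pair.Fubini') measurable
    also have "\<dots> \<le> (\<integral>\<^sup>+q. ennreal (C2 * (t - r) powr (- 7/8)) * (ennreal ((r - q) powr - (7/8)) * indicator {0..r} q) \<partial>lborel)"
    proof (rule nn_integral_mono)
      fix q
      show "(\<integral>\<^sup>+y. (\<integral>\<^sup>+z. ennreal (kk (t - r) (y - x)) * (ennreal (kk (r - q) (z - y)) * ennreal (u q z)) \<partial>lborel) * indicator {0<..<r} q \<partial>lborel)
        \<le> ennreal (C2 * (t - r) powr (- 7/8)) * (ennreal ((r - q) powr - (7/8)) * indicator {0..r} q)"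
      proof (cases "q \<in> {0<..<r}")
        case True
        have "(\<integral>\<^sup>+y. (\<integral>\<^sup>+z. ennreal (kk (t - r) (y - x)) * (ennreal (kk (r - q) (z - y)) * ennreal (u q z)) \<partial>lborel) \<partial>lborel)
          \<le> ennreal (cK * sqrt cK * l2n (u q) * ((t - r) powr (- 7/8) * (r - q) powr (- 7/8)))"
          using kk_kk[of "t - r" "r - q" "u q" x] us(1)[of q] True r u0 by simp
        also have "\<dots> \<le> ennreal (C2 * ((t - r) powr (- 7/8) * (r - q) powr (- 7/8)))"
          unfolding C2_def using us(2)[of q] True r cK_pos by (intro ennreal_leI mult_right_mono mult_left_mono) auto
        also have "\<dots> = ennreal (C2 * (t - r) powr (- 7/8)) * ennreal ((r - q) powr - (7/8))"
          using C2 by (simp flip: ennreal_mult add: mult_ac)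
        finally show ?thesis using True by simp
      qed simp
    qed
    also have "\<dots> = ennreal (C2 * (t - r) powr (- 7/8)) * ennreal (r powr (1/8) / (1/8))"
      using nn_powr_right[of "7/8" 0 r] r by (subst nn_integral_cmult) auto
    also have "\<dots> = ennreal (C2 * (t - r) powr (- 7/8) * (8 * r powr (1/8)))"
      using C2 by (simp flip: ennreal_mult)
    also have "\<dots> \<le> ennreal (C2 * (t - r) powr (- 7/8) * (8 * T powr (1/8)))"
      using C2 r by (intro ennreal_leI mult_left_mono powr_mono2) auto
    finally show ?thesis by (simp add: mult_ac)
  qed
  \<comment> \<open>the bound for \<open>I\<close>: the first summand comes from the linear part, the second from the iterated kernels\<close>
  define K where "K = ennreal (3 * M * cK) * ennreal ((t0 / 2) powr (- 1/4) * 6) + C1 * ennreal (C2 * 8 * T powr (1/8) * (8 * T powr (1/8)))"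
  have IK: "I t x \<le> K" if t: "t0 \<le> t" "t \<le> T" for t x
  proof -
    have "I t x \<le> (\<integral>\<^sup>+r. ennreal (3 * M * cK) * (ennreal ((t - r) powr - (1/2) * (r - 0) powr - (3/4)) * indicator {0<..<t} r)
        + C1 * (ennreal (C2 * 8 * T powr (1/8)) * (ennreal ((t - r) powr - (7/8)) * indicator {0..t} r)) \<partial>lborel)"
      unfolding I_def
    proof (rule nn_integral_mono)
      fix r
      show "(\<integral>\<^sup>+y. ennreal (kk (t - r) (y - x)) * ennreal (u r y) \<partial>lborel) * indicator {0<..<t} r \<le>
        ennreal (3 * M * cK) * (ennreal ((t - r) powr - (1/2) * (r - 0) powr - (3/4)) * indicator {0<..<t} r)
        + C1 * (ennreal (C2 * 8 * T powr (1/8)) * (ennreal ((t - r) powr - (7/8)) * indicator {0..t} r))"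
      proof (cases "r \<in> {0<..<t}")
        case True
        have Im: "(\<lambda>y. I r y) \<in> borel_measurable borel" unfolding I_def by measurable
        have "(\<integral>\<^sup>+y. ennreal (kk (t - r) (y - x)) * ennreal (u r y) \<partial>lborel) \<le>
          (\<integral>\<^sup>+y. ennreal (3 * M * r powr (- 3/4)) * ennreal (kk (t - r) (y - x)) + C1 * (ennreal (kk (t - r) (y - x)) * I r y) \<partial>lborel)"
        proof (rule nn_integral_mono)
          fix y
          have "ennreal (kk (t - r) (y - x)) * ennreal (u r y) \<le> ennreal (kk (t - r) (y - x)) * (ennreal (3 * M * r powr (- 3/4)) + C1 * I r y)"
            by (rule mult_left_mono[OF step]) (use True t in auto)
          then show "ennreal (kk (t - r) (y - x)) * ennreal (u r y) \<le> ennreal (3 * M * r powr (- 3/4)) * ennreal (kk (t - r) (y - x)) + C1 * (ennreal (kk (t - r) (y - x)) * I r y)"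
            by (simp add: distrib_left mult_ac)
        qed
        also have "\<dots> = ennreal (3 * M * r powr (- 3/4)) * (\<integral>\<^sup>+y. ennreal (kk (t - r) (y - x)) \<partial>lborel) + C1 * (\<integral>\<^sup>+y. ennreal (kk (t - r) (y - x)) * I r y \<partial>lborel)"
          using Im by (subst nn_integral_add) (auto simp: nn_integral_cmult)
        also have "\<dots> \<le> ennreal (3 * M * r powr (- 3/4)) * ennreal (cK * (t - r) powr (- 1/2)) + C1 * ennreal (C2 * 8 * T powr (1/8) * (t - r) powr (- 7/8))"
          by (intro add_mono mult_left_mono kk_nn II) (use True t in auto)
        also have "\<dots> = ennreal (3 * M * cK) * ennreal ((t - r) powr - (1/2) * (r - 0) powr - (3/4)) + C1 * (ennreal (C2 * 8 * T powr (1/8)) * ennreal ((t - r) powr - (7/8)))"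
          using mb C2 cK_pos by (simp add: ennreal_mult[symmetric] mult_ac)
        finally show ?thesis using True by simp
      qed simp
    qed
    also have "\<dots> = ennreal (3 * M * cK) * (\<integral>\<^sup>+r. ennreal ((t - r) powr - (1/2) * (r - 0) powr - (3/4)) * indicator {0<..<t} r \<partial>lborel)
        + C1 * (ennreal (C2 * 8 * T powr (1/8)) * (\<integral>\<^sup>+r. ennreal ((t - r) powr - (7/8)) * indicator {0..t} r \<partial>lborel))"
      by (subst nn_integral_add) (auto simp: nn_integral_cmult)
    also have "\<dots> \<le> K" unfolding K_def
    proof (intro add_mono mult_left_mono)
      have "(\<integral>\<^sup>+r. ennreal ((t - r) powr - (1/2) * (r - 0) powr - (3/4)) * indicator {0<..<t} r \<partial>lborel) \<le> ennreal (((t - 0) / 2) powr (1 - 1/2 - 3/4) * (1 / (1 - 1/2) + 1 / (1 - 3/4)))"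
        by (rule nn_beta) (use t t0 in auto)
      also have "\<dots> \<le> ennreal ((t0 / 2) powr (- 1/4) * 6)"
        using t t0 powr_mono2'[of "-(1/4)" "t0/2" "t/2"] by (intro ennreal_leI) simp
      finally show "(\<integral>\<^sup>+r. ennreal ((t - r) powr - (1/2) * (r - 0) powr - (3/4)) * indicator {0<..<t} r \<partial>lborel) \<le> ennreal ((t0 / 2) powr (- 1/4) * 6)" .
      have "(\<integral>\<^sup>+r. ennreal ((t - r) powr - (7/8)) * indicator {0..t} r \<partial>lborel) = ennreal (8 * t powr (1/8))"
        using nn_powr_right[of "7/8" 0 t] t t0 by simp
      also have "\<dots> \<le> ennreal (8 * T powr (1/8))" using t t0 by (intro ennreal_leI mult_left_mono powr_mono2) auto
      finally have "ennreal (C2 * 8 * T powr (1/8)) * (\<integral>\<^sup>+r. ennreal ((t - r) powr - (7/8)) * indicator {0..t} r \<partial>lborel) \<le> ennreal (C2 * 8 * T powr (1/8)) * ennreal (8 * T powr (1/8))"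
        by (rule mult_left_mono) simp
      moreover have "ennreal (C2 * 8 * T powr (1/8)) * ennreal (8 * T powr (1/8)) = ennreal (C2 * 8 * T powr (1/8) * (8 * T powr (1/8)))"
        by (rule ennreal_mult[symmetric]) (use C2 in auto)
      ultimately show "ennreal (C2 * 8 * T powr (1/8)) * (\<integral>\<^sup>+r. ennreal ((t - r) powr - (7/8)) * indicator {0..t} r \<partial>lborel) \<le> ennreal (C2 * 8 * T powr (1/8) * (8 * T powr (1/8)))"
        by (simp only:)
    qed auto
    finally show ?thesis .
  qed
  have Kfin: "K < \<infinity>" unfolding K_def C1_def by (simp add: ennreal_mult_less_top)
  define A where "A = enn2real (ennreal (3 * M * t0 powr (- 3/4)) + C1 * K)"
  have Afin: "ennreal (3 * M * t0 powr (- 3/4)) + C1 * K < \<infinity>" using Kfin by (simp add: C1_def ennreal_mult_less_top)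
  have "vsup_le t A" if t: "t \<in> {t0..T}" for t
    unfolding vsup_le_def
  proof (intro allI)
    fix k x
    have "\<bar>v k t x\<bar> \<le> u t x" unfolding u_def by (rule member_le_sum) auto
    then have "ennreal \<bar>v k t x\<bar> \<le> ennreal (u t x)" by (rule ennreal_leI)
    also have "\<dots> \<le> ennreal (3 * M * t powr (- 3/4)) + C1 * I t x" by (rule step) (use t t0 in auto)
    also have "\<dots> \<le> ennreal (3 * M * t0 powr (- 3/4)) + C1 * K"
      using t t0 mb powr_mono2'[of "-(3/4)" t0 t] by (intro add_mono mult_left_mono IK ennreal_leI) auto
    also have "\<dots> = ennreal A" unfolding A_def using Afin by simp
    finally have "ennreal \<bar>v k t x\<bar> \<le> ennreal A" .
    moreover have "0 \<le> A" unfolding A_def by (rule enn2real_nonneg)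
    ultimately show "\<bar>v k t x\<bar> \<le> A" by (simp only: ennreal_le_iff)
  qed
  then show ?thesis by blast
qed

text \<open>If the heat flow from time \<open>t0\<close> is at most half of \<open>A s\<^sup>-\<^sup>1\<^sup>/\<^sup>4\<close> and \<open>A S\<^sup>1\<^sup>/\<^sup>4\<close> is small, the solution is at
  most \<open>A s\<^sup>-\<^sup>1\<^sup>/\<^sup>4\<close> for \<open>s \<le> S\<close>: the bound \<open>2 A s\<^sup>-\<^sup>1\<^sup>/\<^sup>4\<close> makes the Duhamel term at most
  \<open>C A\<^sup>2\<close>, because the Beta integral with exponents \<open>-1/2\<close>, \<open>-1/2\<close> is scale invariant, and this is less than
  the other half. The bound is propagated in steps so short that, by \<open>vsup_le_step\<close>, it cannot double
  within one step.\<close>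

lemma bootstrap:
  assumes t0: "0 < t0" and S: "S > 0" and A: "A > 0"
    and lin: "\<And>s k x. 0 < s \<Longrightarrow> s \<le> S \<Longrightarrow> \<bar>V s k t0 x\<bar> \<le> A / 2 * s powr (- 1/4)"
    and small: "8 * (1584 * (36 * cK)) * A * S powr (1/4) \<le> 1"
  shows "vsup_le (t0 + S) (A * S powr (- 1/4))"
proof -
  define CB where "CB = 1584 * (36 * cK)"
  have CB: "CB > 0" using cK_pos by (simp add: CB_def)
  obtain B0 where B0': "\<forall>t\<in>{t0..t0 + S}. vsup_le t B0" using sup_bounded_on_compacts[of t0 "t0 + S"] t0 S by auto
  then have B0: "\<And>t. t \<in> {t0..t0 + S} \<Longrightarrow> vsup_le t B0" by blast
  define B where "B = max B0 1"
  have B: "\<And>t. t \<in> {t0..t0 + S} \<Longrightarrow> vsup_le t B" "B \<ge> 1" unfolding B_def using vsup_le_mono[OF B0 max.cobounded1] by auto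
  have inv: "S powr (1/4) * S powr (- 1/4) = 1" using S by (simp add: powr_add[symmetric])
  have small': "CB * (2 * A)\<^sup>2 \<le> A / 2 * s powr (- 1/4)" if "0 < s" "s \<le> S" for s
  proof -
    have "CB * (2 * A)\<^sup>2 = A / 2 * (8 * CB * A * S powr (1/4)) * S powr (- 1/4)"
      using inv by (simp add: power2_eq_square mult_ac)
    also have "\<dots> \<le> A / 2 * 1 * S powr (- 1/4)" using small A unfolding CB_def by (intro mult_right_mono mult_left_mono) auto
    also have "\<dots> \<le> A / 2 * s powr (- 1/4)" using A that S powr_mono2'[of "-(1/4)" s S] by (simp add: mult_left_mono)
    finally show ?thesis .
  qed
  have "(\<lambda>n. (S / real n) powr (1/4) * B) \<longlonglongrightarrow> 0 powr (1/4) * B"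
    by (intro tendsto_intros tendsto_powr' lim_const_over_n) (use S in auto)
  then have ev1: "eventually (\<lambda>n. (S / real n) powr (1/4) * B < A) sequentially"
    using A by (intro order_tendstoD(2)) auto
  have "(\<lambda>n. CB * B\<^sup>2 * (S / real n) powr (1/2)) \<longlonglongrightarrow> CB * B\<^sup>2 * 0 powr (1/2)"
    by (intro tendsto_intros tendsto_powr' lim_const_over_n) (use S in auto)
  then have ev2: "eventually (\<lambda>n. CB * B\<^sup>2 * (S / real n) powr (1/2) < A / 2 * S powr (- 1/4)) sequentially"
    using A S by (intro order_tendstoD(2)) auto
  have "eventually (\<lambda>n. (S / real n) powr (1/4) * B < A \<and> CB * B\<^sup>2 * (S / real n) powr (1/2) < A / 2 * S powr (- 1/4) \<and> n > 0) sequentially"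
    using ev1 ev2 eventually_gt_at_top[of 0] by eventually_elim simp
  then obtain n where n: "(S / real n) powr (1/4) * B < A" "CB * B\<^sup>2 * (S / real n) powr (1/2) < A / 2 * S powr (- 1/4)" "n > 0"
    by (metis (no_types, lifting) eventually_sequentially order_refl)
  \<comment> \<open>step length: on the first step the a priori bound \<open>B\<close> is below \<open>A s\<^sup>-\<^sup>1\<^sup>/\<^sup>4\<close>, and on later steps the growth is below half of it\<close>
  define h where "h = S / real n"
  have h: "h > 0" "h powr (1/4) * B < A" "CB * B\<^sup>2 * h powr (1/2) < A / 2 * S powr (- 1/4)" using n S by (auto simp: h_def)
  have "\<forall>s. 0 < s \<longrightarrow> s \<le> real m * h \<longrightarrow> vsup_le (t0 + s) (A * s powr (- 1/4))" if "m \<le> n" for m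
    using that
  proof (induction m)
    case (Suc m)
    have "real (Suc m) * h \<le> real n * h" using Suc.prems h by (intro mult_right_mono) auto
    then have mS: "real (Suc m) * h \<le> S" using n by (simp add: h_def)
    have IH: "vsup_le (t0 + s) (A * s powr (- 1/4))" if "0 < s" "s \<le> real m * h" for s using Suc that by simp
    \<comment> \<open>the weak form of the bound, with \<open>2 A\<close> in place of \<open>A\<close>, on the next step\<close>
    have rough: "vsup_le (t0 + s) (2 * A * s powr (- 1/4))" if s: "0 < s" "s \<le> real (Suc m) * h" for s
    proof (cases "s \<le> real m * h")
      case True
      show ?thesis by (rule vsup_le_mono[OF IH[OF s(1) True]]) (use A in auto)
    next
      case False
      show ?thesis
      proof (cases "m = 0")
        case True
        then have sh: "s \<le> h" using s by simp
        have "vsup_le (t0 + s) B" by (rule B(1)) (use s mS in auto)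
        moreover have "B \<le> 2 * A * s powr (- 1/4)"
        proof -
          have "B = h powr (1/4) * B * h powr (- 1/4)" using h by (simp add: powr_add[symmetric] mult_ac)
          also have "\<dots> \<le> A * h powr (- 1/4)" using h by (intro mult_right_mono) auto
          also have "\<dots> \<le> A * s powr (- 1/4)" using A s sh powr_mono2'[of "-(1/4)" s h] by (simp add: mult_left_mono)
          also have "\<dots> \<le> 2 * A * s powr (- 1/4)" using A by simp
          finally show ?thesis .
        qed
        ultimately show ?thesis by (rule vsup_le_mono)
      next
        case m: False
        define r where "r = real m * h"
        have hr: "h \<le> r" unfolding r_def using m h mult_right_mono[of 1 "real m" h] by simp
        have sr: "s \<le> r + h" using s by (simp add: r_def algebra_simps)
        have rs: "r < s" using False by (simp add: r_def)
        have r: "r > 0" "r < s" "s \<le> 2 * r" "s - r \<le> h"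
          using hr sr h(1) rs by linarith+
        have "vsup_le (t0 + s) (A * r powr (- 1/4) + 1584 * (18 * cK) * B\<^sup>2 * ((t0 + s) - (t0 + r)) powr (1/2))"
          by (rule vsup_le_step) (use r t0 IH[of r] B(1) s mS in \<open>auto simp: r_def\<close>)
        moreover have "A * r powr (- 1/4) \<le> 3/2 * A * s powr (- 1/4)"
        proof -
          have "r powr (- 1/4) \<le> (s / 2) powr (- 1/4)" using r powr_mono2'[of "-(1/4)" "s/2" r] by simp
          also have "\<dots> = 2 powr (1/4) * s powr (- 1/4)" using r by (simp add: powr_divide powr_minus field_simps)
          also have "\<dots> \<le> 3/2 * s powr (- 1/4)"
          proof (rule mult_right_mono)
            have "2 powr (1/4) \<le> ((3/2) powr 4) powr (1/4 :: real)" by (rule powr_mono2) (auto simp: powr_numeral eval_nat_numeral)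
            moreover have "((3/2) powr 4) powr (1/4) = (3/2 :: real)" by (subst powr_powr) simp
            ultimately show "2 powr (1/4) \<le> (3/2 :: real)" by (simp only:)
          qed simp
          finally have "r powr (- 1/4) \<le> 3/2 * s powr (- 1/4)" .
          from mult_left_mono[OF this, of A] A show ?thesis by (simp add: mult_ac)
        qed
        moreover have "1584 * (18 * cK) * B\<^sup>2 * ((t0 + s) - (t0 + r)) powr (1/2) \<le> A / 2 * s powr (- 1/4)"
        proof -
          have "1584 * (18 * cK) * B\<^sup>2 * ((t0 + s) - (t0 + r)) powr (1/2) \<le> CB * B\<^sup>2 * h powr (1/2)"
            unfolding CB_def using cK_pos r by (intro mult_mono powr_mono2) auto
          also have "\<dots> \<le> A / 2 * S powr (- 1/4)" using h by simp
          also have "\<dots> \<le> A / 2 * s powr (- 1/4)" using A s mS S powr_mono2'[of "-(1/4)" s S] by (simp add: mult_left_mono)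
          finally show ?thesis .
        qed
        ultimately show ?thesis by (elim vsup_le_mono) linarith
      qed
    qed
    show ?case
    proof (intro allI impI)
      fix s assume s: "0 < s" "s \<le> real (Suc m) * h"
      show "vsup_le (t0 + s) (A * s powr (- 1/4))"
        unfolding vsup_le_def
      proof (intro allI)
        fix k x
        \<comment> \<open>the weak form implies the bound itself\<close>
        have j: "J t0 (t0 + s) x \<le> ennreal (9 * cK) * (\<integral>\<^sup>+r. ennreal ((t0 + s - r) powr (- 1/2) * (2 * A * (r - t0) powr (- 1/4))\<^sup>2) * indicator {t0<..<t0 + s} r \<partial>lborel)"
        proof (rule J_vsup_le)
          fix r assume "r \<in> {t0<..<t0 + s}"
          then show "vsup_le r (2 * A * (r - t0) powr (- 1/4))" using rough[of "r - t0"] s by simp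
        qed measurable
        have "(\<integral>\<^sup>+r. ennreal ((t0 + s - r) powr (- 1/2) * (2 * A * (r - t0) powr (- 1/4))\<^sup>2) * indicator {t0<..<t0 + s} r \<partial>lborel)
           = (\<integral>\<^sup>+r. ennreal ((2 * A)\<^sup>2) * (ennreal ((t0 + s - r) powr - (1/2) * (r - t0) powr - (1/2)) * indicator {t0<..<t0 + s} r) \<partial>lborel)"
        proof (rule nn_integral_cong)
          fix r
          show "ennreal ((t0 + s - r) powr (- 1/2) * (2 * A * (r - t0) powr (- 1/4))\<^sup>2) * indicator {t0<..<t0 + s} r =
            ennreal ((2 * A)\<^sup>2) * (ennreal ((t0 + s - r) powr - (1/2) * (r - t0) powr - (1/2)) * indicator {t0<..<t0 + s} r)"
          proof (cases "r \<in> {t0<..<t0 + s}")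
            case True
            have e: "((r - t0) powr (- 1/4))\<^sup>2 = (r - t0) powr - (1/2)"
              using True by (simp add: power2_eq_square powr_add[symmetric])
            have "(t0 + s - r) powr (- 1/2) * (2 * A * (r - t0) powr (- 1/4))\<^sup>2 = (2 * A)\<^sup>2 * ((t0 + s - r) powr - (1/2) * (r - t0) powr - (1/2))"
              unfolding power_mult_distrib[of "2 * A"] e by simp
            then show ?thesis using True by (simp add: ennreal_mult[symmetric])
          qed simp
        qed
        also have "\<dots> = ennreal ((2 * A)\<^sup>2) * (\<integral>\<^sup>+r. ennreal ((t0 + s - r) powr - (1/2) * (r - t0) powr - (1/2)) * indicator {t0<..<t0 + s} r \<partial>lborel)"
          by (rule nn_integral_cmult) measurable
        also have "\<dots> \<le> ennreal ((2 * A)\<^sup>2) * ennreal ((((t0 + s) - t0) / 2) powr (1 - 1/2 - 1/2) * (1 / (1 - 1/2) + 1 / (1 - 1/2)))"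
          by (intro mult_left_mono nn_beta) (use s in auto)
        also have "\<dots> = ennreal (4 * (2 * A)\<^sup>2)"
        proof -
          have "(((t0 + s) - t0) / 2) powr (1 - 1/2 - 1/2) * (1 / (1 - 1/2) + 1 / (1 - 1/2)) = (4::real)" using s by simp
          then show ?thesis by (simp only:) (subst ennreal_mult[symmetric], auto simp: mult.commute)
        qed
        finally have "1584 * J t0 (t0 + s) x \<le> 1584 * (ennreal (9 * cK) * ennreal (4 * (2 * A)\<^sup>2))"
          by (intro mult_left_mono order_trans[OF j]) auto
        also have "\<dots> = ennreal (CB * (2 * A)\<^sup>2)"
        proof -
          have "ennreal (9 * cK) * ennreal (4 * (2 * A)\<^sup>2) = ennreal (9 * cK * (4 * (2 * A)\<^sup>2))"
            by (rule ennreal_mult[symmetric]) (use cK_pos in auto)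
          then show ?thesis
            unfolding CB_def using cK_pos by (simp only:) (subst numeral_mult_ennreal, auto simp: mult_ac)
        qed
        also have "\<dots> \<le> ennreal (A / 2 * s powr (- 1/4))" by (rule ennreal_leI[OF small']) (use s mS in auto)
        finally have 1: "1584 * J t0 (t0 + s) x \<le> ennreal (A / 2 * s powr (- 1/4))" .
        have 2: "ennreal \<bar>V s k t0 x\<bar> \<le> ennreal (A / 2 * s powr (- 1/4))" by (rule ennreal_leI[OF lin]) (use s mS in auto)
        have "ennreal \<bar>v k (t0 + s) x\<bar> \<le> ennreal (A / 2 * s powr (- 1/4)) + ennreal (A / 2 * s powr (- 1/4))"
          using mild_inequality[of t0 "t0 + s" k x] s t0 add_mono[OF 2 1] by simp
        also have "\<dots> = ennreal (A * s powr (- 1/4))" using A by (simp flip: ennreal_plus)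
        finally show "\<bar>v k (t0 + s) x\<bar> \<le> A * s powr (- 1/4)" using A by simp
      qed
    qed
  qed simp
  from this[of n] show ?thesis using S n by (simp add: h_def)
qed

end


section \<open>The energy inequality\<close>

text \<open>Translating the integrand puts the dependence on \<open>x\<close> into the factor \<open>f\<close>, to which
  \<open>continuous_integral_L2_pair\<close> applies.\<close>

lemma conv_cont:
  fixes f g :: "vec3 \<Rightarrow> real"
  assumes cf: "continuous_on UNIV f" and f: "sqi f" and cg: "continuous_on UNIV g" and g: "sqi g"
  shows "continuous_on UNIV (\<lambda>x. LINT y|lborel. f y * g (y - x))"
proof -
  note [measurable] = sqi_meas[OF f] sqi_meas[OF g]
  have e: "(LINT y|lborel. f y * g (y - x)) = (LINT z|lborel. f (z - (- x)) * g z)" for x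
    using integral_shift[of "\<lambda>y. f y * g (y - x)" "- x"] by simp
  have c1: "continuous_on (UNIV \<times> UNIV) (\<lambda>(x,z). f (z - (- x)))"
    unfolding split_beta by (rule continuous_on_compose2[OF cf]) (auto intro!: continuous_intros)
  have c2: "continuous_on (UNIV \<times> UNIV) (\<lambda>(x::vec3,z). g z)"
    unfolding split_beta by (rule continuous_on_compose2[OF cg]) (auto intro!: continuous_intros)
  show ?thesis unfolding e
    by (rule continuous_integral_L2_pair[where M="l2n f" and h="\<lambda>y. \<bar>g y\<bar>", OF c1 c2])
       (use sqi_shift[OF f, of "- x" for x] g in auto)
qed

text \<open>The difference of two values is the integral of the candidate derivative along the segment, by Fubini;
  the candidate is continuous.\<close>

lemma conv_deriv:
  fixes f g g' :: "vec3 \<Rightarrow> real"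
  assumes cf: "continuous_on UNIV f" and f: "sqi f" and g: "sqi g" and cg': "continuous_on UNIV g'" and g': "sqi g'"
    and d: "deriv_along e g g'"
  shows "deriv_along e (\<lambda>x. LINT y|lborel. f y * g (y - x)) (\<lambda>x. - (LINT y|lborel. f y * g' (y - x)))"
  unfolding deriv_along_def
proof
  fix x
  note [measurable] = sqi_meas[OF f] sqi_meas[OF g] sqi_meas[OF g']
  let ?C = "\<lambda>r. LINT y|lborel. f y * g (y - (x + r *\<^sub>R e))"
  let ?D = "\<lambda>r. - (LINT y|lborel. f y * g' (y - (x + r *\<^sub>R e)))"
  have cD: "continuous_on S ?D" for S
    by (intro continuous_on_minus continuous_on_compose2[OF conv_cont[OF cf f cg' g'], of _ "\<lambda>r. x + r *\<^sub>R e"] continuous_intros) auto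
  have incr: "?C b - ?C a = integral {a..b} ?D" if ab: "a \<le> b" for a b
  proof -
    let ?F = "\<lambda>r y. indicator {a..b} r * (- (f y * g' (y - (x + r *\<^sub>R e))))"
    have int: "integrable (lborel \<Otimes>\<^sub>M lborel) (\<lambda>(r,y). ?F r y)"
    proof (rule integrableI_bounded)
      show "(\<lambda>(r,y). ?F r y) \<in> borel_measurable (lborel \<Otimes>\<^sub>M lborel)" by measurable
      have "(\<integral>\<^sup>+p. ennreal (norm (case p of (r,y) \<Rightarrow> ?F r y)) \<partial>(lborel \<Otimes>\<^sub>M lborel)) =
        (\<integral>\<^sup>+r. (\<integral>\<^sup>+y. indicator {a..b} r * (ennreal \<bar>f y\<bar> * ennreal \<bar>g' (y - (x + r *\<^sub>R e))\<bar>) \<partial>lborel) \<partial>lborel)"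
        by (subst lborel.nn_integral_fst[symmetric]) (auto simp: abs_mult indicator_def ennreal_mult intro!: nn_integral_cong)
      also have "\<dots> \<le> (\<integral>\<^sup>+r. indicator {a..b} r * ennreal (l2n f * l2n g') \<partial>lborel)"
      proof (rule nn_integral_mono)
        fix r
        have "(\<integral>\<^sup>+y. ennreal \<bar>f y\<bar> * ennreal \<bar>g' (y - (x + r *\<^sub>R e))\<bar> \<partial>lborel) \<le> ennreal (l2n f * l2n g')"
          using nn_pair_le[OF f sqi_shift(1)[OF g', of "x + r *\<^sub>R e"]] sqi_shift(2)[OF g', of "x + r *\<^sub>R e"] by simp
        then show "(\<integral>\<^sup>+y. indicator {a..b} r * (ennreal \<bar>f y\<bar> * ennreal \<bar>g' (y - (x + r *\<^sub>R e))\<bar>) \<partial>lborel) \<le> indicator {a..b} r * ennreal (l2n f * l2n g')"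
          by (subst nn_integral_cmult) (auto intro: mult_left_mono)
      qed
      also have "\<dots> < \<infinity>" using ab by (subst nn_integral_multc) (auto simp: ennreal_mult_less_top)
      finally show "(\<integral>\<^sup>+p. ennreal (norm (case p of (r,y) \<Rightarrow> ?F r y)) \<partial>(lborel \<Otimes>\<^sub>M lborel)) < \<infinity>" .
    qed
    have inner: "(LINT r|lborel. ?F r y) = f y * g (y - (x + b *\<^sub>R e)) - f y * g (y - (x + a *\<^sub>R e))" for y
    proof -
      have der: "((\<lambda>r. f y * g (y - (x + r *\<^sub>R e))) has_real_derivative - (f y * g' (y - (x + r *\<^sub>R e)))) (at r)" for r
      proof -
        have "((\<lambda>h. g ((y - x) + h *\<^sub>R e)) has_real_derivative g' ((y - x) + (- r) *\<^sub>R e)) (at (- r))"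
          by (rule deriv_alongD[OF d])
        then have "((\<lambda>h. g ((y - x) + (- h) *\<^sub>R e)) has_real_derivative - g' ((y - x) + (- r) *\<^sub>R e)) (at r)"
          by (subst (asm) DERIV_mirror) simp
        then have "((\<lambda>h. f y * g ((y - x) + (- h) *\<^sub>R e)) has_real_derivative f y * (- g' ((y - x) + (- r) *\<^sub>R e))) (at r)"
          by (rule DERIV_cmult)
        then show ?thesis by (simp add: algebra_simps)
      qed
      have cc: "isCont (\<lambda>r. - (f y * g' (y - (x + r *\<^sub>R e)))) r" for r
      proof -
        have "continuous_on UNIV (\<lambda>r. - (f y * g' (y - (x + r *\<^sub>R e))))"
          by (intro continuous_intros continuous_on_compose2[OF cg']) auto
        then show ?thesis by (simp add: continuous_on_eq_continuous_at)
      qed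
      have "(LINT r|lborel. (- (f y * g' (y - (x + r *\<^sub>R e)))) * indicator {a..b} r) = f y * g (y - (x + b *\<^sub>R e)) - f y * g (y - (x + a *\<^sub>R e))"
        by (rule integral_FTC_Icc_real[OF ab der cc])
      then show ?thesis by (simp only: mult.commute)
    qed
    have i: "integrable lborel (\<lambda>y. f y * g (y - (x + r *\<^sub>R e)))" for r by (rule sqi_mult[OF f sqi_shift(1)[OF g]])
    have "?C b - ?C a = (LINT y|lborel. (LINT r|lborel. ?F r y))"
      unfolding inner by (rule Bochner_Integration.integral_diff[symmetric, OF i i])
    also have "\<dots> = (LINT r|lborel. (LINT y|lborel. ?F r y))" by (rule lborel_pair.Fubini_integral[OF int])
    also have "\<dots> = (LINT r:{a..b}|lborel. ?D r)" by (simp add: set_lebesgue_integral_def)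
    also have "\<dots> = integral {a..b} ?D"
      by (rule set_borel_integral_eq_integral(2)[OF borel_integrable_atLeastAtMost'[OF cD]])
    finally show ?thesis .
  qed
  have "((\<lambda>r. ?C (-1) + integral {-1..r} ?D) has_real_derivative ?D 0) (at 0 within {-1..1})"
    using DERIV_add[OF DERIV_const[of "?C (-1)"] integral_has_real_derivative[OF cD[of "{-1..1}"], of 0]] by (simp only: add_0) simp
  then have "((\<lambda>r. ?C (-1) + integral {-1..r} ?D) has_real_derivative ?D 0) (at 0)"
    by (simp add: at_within_Icc_at)
  then have "(?C has_real_derivative ?D 0) (at 0)"
  proof (rule has_field_derivative_transform_within_open[where S="{-1<..}"])
    show "?C (-1) + integral {-1..r} ?D = ?C r" if "r \<in> {-1<..}" for r using incr[of "-1" r] that by simp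
  qed auto
  then show "(?C has_real_derivative - (LINT y|lborel. f y * g' (y - x))) (at 0)" by simp
qed

lemma hk_moment_bound:
  assumes t: "t > 0" shows "\<bar>norm z * hk t z\<bar> \<le> 2 * sqrt t * lam t ^ 3"
proof -
  have l: "lam t > 0" by (rule lam_pos[OF t])
  define x where "x = norm z * lam t"
  have x0: "x \<ge> 0" using l by (simp add: x_def)
  have "x \<le> 1 + x\<^sup>2" using zero_le_power2[of "x - 1"] x0 by (simp add: power2_diff)
  also have "\<dots> \<le> exp (x\<^sup>2)" by (rule exp_ge_add_one_self)
  finally have "x * exp (- x\<^sup>2) \<le> exp (x\<^sup>2) * exp (- x\<^sup>2)" by (rule mult_right_mono) simp
  then have xe: "x * exp (- x\<^sup>2) \<le> 1" by (simp add: exp_add[symmetric])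
  have e: "(lam t)\<^sup>2 * (z \<bullet> z) = x\<^sup>2" by (simp add: x_def power_mult_distrib power2_norm_eq_inner mult.commute)
  have n: "norm z = 2 * sqrt t * x" using t by (simp add: x_def lam_def)
  have "\<bar>norm z * hk t z\<bar> = 2 * sqrt t * (lam t ^ 3 / sqrt pi ^ 3) * (x * exp (- x\<^sup>2))"
    unfolding hk_eq[OF t] e using x0 l t by (simp add: abs_mult n)
  also have "\<dots> \<le> 2 * sqrt t * (lam t ^ 3 / 1) * 1"
    using sqrt_pi3_ge l t xe x0 by (intro mult_mono divide_left_mono) auto
  finally show ?thesis by simp
qed

lemma FTC_open:
  assumes ab: "a \<le> b" and cf: "continuous_on {a..b} f" and d: "\<And>r. a < r \<Longrightarrow> r < b \<Longrightarrow> (f has_real_derivative f' r) (at r)"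
    and cf': "continuous_on {a..b} f'"
  shows "(LINT r|lborel. indicator {a<..<b} r * f' r) = f b - f (a::real)"
proof -
  have hi: "(f' has_integral (f b - f a)) {a..b}"
    by (rule fundamental_theorem_of_calculus_interior[OF ab cf]) (use d in \<open>auto simp: has_real_derivative_iff_has_vector_derivative\<close>)
  have s: "set_integrable lborel {a<..<b} f'"
    by (rule set_integrable_subset[OF borel_integrable_atLeastAtMost'[OF cf']]) auto
  have "(LINT r|lborel. indicator {a<..<b} r * f' r) = (LINT r:{a<..<b}|lborel. f' r)"
    by (simp add: set_lebesgue_integral_def)
  also have "\<dots> = integral {a<..<b} f'" by (rule set_borel_integral_eq_integral(2)[OF s])
  also have "\<dots> = integral {a..b} f'" by (rule integral_open_interval_real[symmetric])
  also have "\<dots> = f b - f a" using hi by (rule integral_unique)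
  finally show ?thesis .
qed

lemma Dk_split: "Dk s k i j z = dl i k * hk1 s j z + cN * T3 (PL s) i j k z"
  by (simp add: Dk_def hk1_def algebra_simps)

context regularized_flow
begin

text \<open>The first and the pure second derivatives of \<open>V\<close>; \<open>H\<close> is the heat flow of a product, \<open>W\<close> the squared \<open>L\<^sup>2\<close>
  norm of the gradient of \<open>V\<close>.\<close>

definition V1 :: "real \<Rightarrow> 3 \<Rightarrow> 3 \<Rightarrow> real \<Rightarrow> vec3 \<Rightarrow> real" where
  "V1 s j k t x = - (LINT y|lborel. v k t y * hk1 s j (y - x))"
definition V2 :: "real \<Rightarrow> 3 \<Rightarrow> 3 \<Rightarrow> real \<Rightarrow> vec3 \<Rightarrow> real" where
  "V2 s j k t x = (LINT y|lborel. v k t y * hk2 s j j (y - x))"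
definition H :: "real \<Rightarrow> 3 \<Rightarrow> 3 \<Rightarrow> real \<Rightarrow> vec3 \<Rightarrow> real" where
  "H s i j t x = (LINT y|lborel. (b j t y * v i t y) * hk s (y - x))"
definition W :: "real \<Rightarrow> real \<Rightarrow> real" where
  "W s t = (\<Sum>j\<in>UNIV. \<Sum>k\<in>UNIV. (l2n (V1 s j k t))\<^sup>2)"
definition E :: "real \<Rightarrow> real \<Rightarrow> real" where "E s t = (\<Sum>k\<in>UNIV. (l2n (V s k t))\<^sup>2)"
definition E0 :: "real \<Rightarrow> real" where "E0 t = (\<Sum>k\<in>UNIV. (l2n (v k t))\<^sup>2)"

lemma sqi_V: assumes "s > 0" shows "sqi (V s k t)" "l2n (V s k t) \<le> l2n (v k t)"
  using conv_L2_left[OF sqi_v hk_L1(1)[OF assms], of k t] hk_L1(3)[OF assms] unfolding V_def[abs_def] by auto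
lemma sqi_V1: assumes "s > 0" shows "sqi (V1 s j k t)" "l2n (V1 s j k t) \<le> 924 * (cK * lam s) * l2n (v k t)"
proof -
  show "sqi (V1 s j k t)" unfolding V1_def[abs_def] by (intro sqi_minus conv_L2_left sqi_v hk1_class assms)
  have "l2n (V1 s j k t) \<le> l1n (hk1 s j) * l2n (v k t)"
    unfolding V1_def[abs_def] sqi_minus(2) by (intro conv_L2_left sqi_v hk1_class assms)
  also have "\<dots> \<le> 924 * (cK * lam s) * l2n (v k t)" by (intro mult_right_mono hk1_class assms) auto
  finally show "l2n (V1 s j k t) \<le> 924 * (cK * lam s) * l2n (v k t)" .
qed
lemma sqi_V2: assumes "s > 0" shows "sqi (V2 s j k t)"
  unfolding V2_def[abs_def] by (intro conv_L2_left sqi_v hk2_class assms)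
lemma sqi_VL: assumes "s > 0" shows "sqi (VL s k t)" "l2n (VL s k t) \<le> l1n (hkL s) * l2n (v k t)"
  unfolding VL_def[abs_def] by (intro conv_L2_left sqi_v hkL_class assms)+
lemma sqi_H: assumes "s > 0" shows "sqi (H s i j t)"
  unfolding H_def[abs_def] by (intro conv_L2_left sqi_bv hk_L1 assms)
lemma sqi_Nk: assumes "s > 0" shows "sqi (\<lambda>x. LINT y|lborel. (b j t y * v i t y) * Dk s k i j (y - x))"
  by (intro conv_L2_left sqi_bv Dk_class assms)
lemma sqi_N: assumes "s > 0" shows "sqi (N s k t)"
  unfolding N_def[abs_def] by (intro sqi_sum sqi_Nk assms)

lemma cont_bv_slice: "continuous_on UNIV (\<lambda>y. b j t y * v i t y)" by (intro continuous_intros cont_slice)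

lemma cont_Vs: assumes "s > 0"
  shows "continuous_on UNIV (V s k t)" "continuous_on UNIV (V1 s j k t)" "continuous_on UNIV (V2 s j k t)" "continuous_on UNIV (H s i j t)"
  unfolding V_def[abs_def] V1_def[abs_def] V2_def[abs_def] H_def[abs_def]
  by (intro continuous_on_minus conv_cont cont_slice sqi_v cont_hk cont_hk1 cont_hk2 hk_sqi hk1_class hk2_class assms cont_bv_slice sqi_bv)+

lemma deriv_V: assumes "s > 0" shows "deriv_along (axis j 1) (V s k t) (V1 s j k t)"
  unfolding V_def[abs_def] V1_def[abs_def]
  by (intro conv_deriv cont_slice sqi_v hk_sqi cont_hk1 hk1_class deriv_hk assms)
lemma deriv_V1: assumes "s > 0" shows "deriv_along (axis j 1) (V1 s j k t) (V2 s j k t)"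
proof -
  have "deriv_along (axis j 1) (\<lambda>x. (-1) * (LINT y|lborel. v k t y * hk1 s j (y - x))) (\<lambda>x. (-1) * - (LINT y|lborel. v k t y * hk2 s j j (y - x)))"
    by (intro deriv_along_cmult conv_deriv cont_slice sqi_v hk1_class hk2_class cont_hk2 deriv_hk1 assms)
  then show ?thesis unfolding V1_def[abs_def] V2_def[abs_def] by simp
qed
lemma deriv_H: assumes "s > 0"
  shows "deriv_along (axis j 1) (H s i j t) (\<lambda>x. - (LINT y|lborel. (b j t y * v i t y) * hk1 s j (y - x)))"
  unfolding H_def[abs_def]
  by (intro conv_deriv cont_bv_slice sqi_bv hk_sqi cont_hk1 hk1_class deriv_hk assms)

lemma dissipation:
  assumes s: "s > 0"
  shows "(\<Sum>k\<in>UNIV. LINT x|lborel. V s k t x * VL s k t x) = - W s t"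
proof -
  have "(LINT x|lborel. V s k t x * VL s k t x) = - (\<Sum>j\<in>UNIV. (l2n (V1 s j k t))\<^sup>2)" for k
  proof -
    have e: "VL s k t x = (\<Sum>j\<in>UNIV. V2 s j k t x)" for x
    proof -
      have "(\<Sum>j\<in>UNIV. V2 s j k t x) = (LINT y|lborel. (\<Sum>j\<in>UNIV. v k t y * hk2 s j j (y - x)))"
        unfolding V2_def by (intro Bochner_Integration.integral_sum[symmetric] sqi_mult sqi_v sqi_shift hk2_class s)
      then show ?thesis unfolding VL_def sum_distrib_left[symmetric] sum_hk2 by simp
    qed
    have "(LINT x|lborel. V2 s j k t x * V s k t x) = - (LINT x|lborel. V1 s j k t x * V1 s j k t x)" for j
      by (intro integral_by_parts_along[OF deriv_V1[OF s] deriv_V[OF s]] cont_Vs sqi_mult sqi_V sqi_V1 sqi_V2 s)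
    then have ibp: "(LINT x|lborel. V2 s j k t x * V s k t x) = - (l2n (V1 s j k t))\<^sup>2" for j
      by (simp add: l2n_sq power2_eq_square[of "V1 _ _ _ _ _"])
    have "(LINT x|lborel. V s k t x * VL s k t x) = (LINT x|lborel. (\<Sum>j\<in>UNIV. V2 s j k t x * V s k t x))"
      unfolding e by (simp add: sum_distrib_left mult.commute)
    also have "\<dots> = (\<Sum>j\<in>UNIV. LINT x|lborel. V2 s j k t x * V s k t x)"
      by (intro Bochner_Integration.integral_sum sqi_mult sqi_V sqi_V2 s)
    finally show ?thesis unfolding ibp by (simp add: sum_negf)
  qed
  then show ?thesis unfolding W_def by (subst sum.swap) (simp add: sum_negf)
qed

lemma div_V1: "s > 0 \<Longrightarrow> t > 0 \<Longrightarrow> (\<Sum>k\<in>UNIV. V1 s k k t x) = 0"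
  using heat_flow_solenoidal[of s t x] by (simp add: V1_def sum_negf)

text \<open>The part of the nonlinear term that stems from the pressure is a gradient in \<open>k\<close>, and \<open>V\<close> is solenoidal.\<close>

lemma pressure_free:
  assumes s: "s > 0" and t: "t > 0"
  shows "(\<Sum>k\<in>UNIV. LINT x|lborel. V s k t x * (LINT y|lborel. (b j t y * v i t y) * T3 (PL s) i j k (y - x))) = 0"
proof -
  define F where "F y = b j t y * v i t y" for y
  have F: "sqi F" unfolding F_def[abs_def] by (rule sqi_bv)
  have dT2: "deriv_along (axis k 1) (T2 (PL s) i j) (T3 (PL s) i j k)" for k by (rule deriv_T2) (rule DERIV_PL'; simp)+
  have zero: "(\<Sum>k\<in>UNIV. LINT x|lborel. V s k t x * T3 (PL s) i j k (y - x)) = 0" for y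
  proof -
    have "(LINT x|lborel. V1 s k k t x * T2 (PL s) i j (y - x)) = - (LINT x|lborel. V s k t x * - T3 (PL s) i j k (y - x))" for k
    proof (rule integral_by_parts_along[OF deriv_V[OF s] deriv_along_reflect[OF dT2]])
      have c: "continuous_on UNIV (\<lambda>x. f (y - x))" if "continuous_on UNIV f" for f :: "vec3 \<Rightarrow> real"
        by (rule continuous_on_compose2[OF that]) (auto intro!: continuous_intros)
      show "continuous_on UNIV (\<lambda>x. T2 (PL s) i j (y - x))" "continuous_on UNIV (\<lambda>x. - T3 (PL s) i j k (y - x))"
        by (intro continuous_on_minus c cont_T2PL cont_T3PL)+
      show "integrable lborel (\<lambda>x. V s k t x * T2 (PL s) i j (y - x))" "integrable lborel (\<lambda>x. V1 s k k t x * T2 (PL s) i j (y - x))"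
        "integrable lborel (\<lambda>x. V s k t x * - T3 (PL s) i j k (y - x))"
        by (intro sqi_mult sqi_V sqi_V1 sqi_minus sqi_reflect T2PL_class T3PL_class s)+
    qed (intro cont_Vs s)+
    then have "(\<Sum>k\<in>UNIV. LINT x|lborel. V s k t x * T3 (PL s) i j k (y - x)) = (\<Sum>k\<in>UNIV. LINT x|lborel. V1 s k k t x * T2 (PL s) i j (y - x))"
      by simp
    also have "\<dots> = (LINT x|lborel. (\<Sum>k\<in>UNIV. V1 s k k t x * T2 (PL s) i j (y - x)))"
      by (intro Bochner_Integration.integral_sum[symmetric] sqi_mult sqi_V1 sqi_reflect T2PL_class s)
    also have "\<dots> = 0" unfolding sum_distrib_right[symmetric] div_V1[OF s t] by simp
    finally show ?thesis .
  qed
  have int: "integrable (lborel \<Otimes>\<^sub>M lborel) (\<lambda>(x,y). V s k t x * (T3 (PL s) i j k (y - x) * F y))" for k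
    by (rule bilinear_integrable[OF F sqi_V(1)[OF s] T3PL_class(1)[OF s]])
  have sw: "(LINT x|lborel. V s k t x * (LINT y|lborel. F y * T3 (PL s) i j k (y - x))) = (LINT y|lborel. F y * (LINT x|lborel. V s k t x * T3 (PL s) i j k (y - x)))" for k
  proof -
    have "(LINT x|lborel. V s k t x * (LINT y|lborel. F y * T3 (PL s) i j k (y - x))) = (LINT x|lborel. (LINT y|lborel. V s k t x * (T3 (PL s) i j k (y - x) * F y)))"
      by (simp add: mult.commute[of "F _"])
    also have "\<dots> = (LINT y|lborel. (LINT x|lborel. V s k t x * (T3 (PL s) i j k (y - x) * F y)))"
      by (rule lborel_pair.Fubini_integral[OF int, symmetric])
    also have "\<dots> = (LINT y|lborel. F y * (LINT x|lborel. V s k t x * T3 (PL s) i j k (y - x)))"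
      by (intro Bochner_Integration.integral_cong refl) (simp add: mult.assoc[symmetric] mult.commute[of "F _"])
    finally show ?thesis .
  qed
  have ii: "integrable lborel (\<lambda>y. F y * (LINT x|lborel. V s k t x * T3 (PL s) i j k (y - x)))" for k
  proof -
    have "integrable lborel (\<lambda>y. LINT x|lborel. V s k t x * (T3 (PL s) i j k (y - x) * F y))"
      using lborel_pair.integrable_snd[OF int[of k]] by simp
    also have "(\<lambda>y. LINT x|lborel. V s k t x * (T3 (PL s) i j k (y - x) * F y)) = (\<lambda>y. F y * (LINT x|lborel. V s k t x * T3 (PL s) i j k (y - x)))"
      by (simp add: mult.assoc[symmetric] mult.commute[of "F _"])
    finally show ?thesis .
  qed
  have "(\<Sum>k\<in>UNIV. LINT x|lborel. V s k t x * (LINT y|lborel. F y * T3 (PL s) i j k (y - x))) = (LINT y|lborel. (\<Sum>k\<in>UNIV. F y * (LINT x|lborel. V s k t x * T3 (PL s) i j k (y - x))))"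
    unfolding sw by (intro Bochner_Integration.integral_sum[symmetric] ii)
  also have "\<dots> = 0" unfolding sum_distrib_left[symmetric] zero by simp
  finally show ?thesis unfolding F_def .
qed

text \<open>Transport by the solenoidal field \<open>b\<close> preserves the \<open>L\<^sup>2\<close> norm.\<close>

lemma transport_zero:
  assumes s: "s > 0"
  shows "(\<Sum>j\<in>UNIV. LINT x|lborel. V1 s j i t x * (b j t x * V s i t x)) = 0"
proof -
  obtain B where B: "\<And>k x. \<bar>b k t x\<bar> \<le> B" using b_bound[of t] by auto
  obtain B' where B': "\<And>j k x. \<bar>db j k t x\<bar> \<le> B'" using db_bound[of t] by auto
  have dbm: "db j k t \<in> borel_measurable borel" for j k by (intro borel_measurable_continuous_onI cont_db)
  have bV: "sqi (\<lambda>x. b j t x * V s i t x)" for j by (rule sqi_bmul(1)[OF _ B sqi_V(1)[OF s]]) measurable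
  have dbV: "sqi (\<lambda>x. db j j t x * V s i t x)" for j by (rule sqi_bmul(1)[OF dbm B' sqi_V(1)[OF s]])
  have "(LINT x|lborel. db j j t x * V s i t x * V s i t x) + 2 * (LINT x|lborel. V1 s j i t x * (b j t x * V s i t x)) = 0" for j
  proof -
    have d: "deriv_along (axis j 1) (\<lambda>x. b j t x * (V s i t x * V s i t x)) (\<lambda>x. db j j t x * V s i t x * V s i t x + 2 * (V1 s j i t x * (b j t x * V s i t x)))"
      by (rule deriv_along_eq[OF deriv_along_mult[OF d_b deriv_along_mult[OF deriv_V[OF s] deriv_V[OF s]]]]) (simp add: algebra_simps)
    have i1: "integrable lborel (\<lambda>x. db j j t x * V s i t x * V s i t x)" by (rule sqi_mult[OF dbV sqi_V(1)[OF s]])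
    have i2: "integrable lborel (\<lambda>x. V1 s j i t x * (b j t x * V s i t x))" by (rule sqi_mult[OF sqi_V1(1)[OF s] bV])
    have i3: "integrable lborel (\<lambda>x. b j t x * (V s i t x * V s i t x))" using sqi_mult[OF bV sqi_V(1)[OF s], of j] by (simp add: mult.assoc)
    have "(LINT x|lborel. db j j t x * V s i t x * V s i t x + 2 * (V1 s j i t x * (b j t x * V s i t x))) = 0"
      by (rule integral_deriv_along_zero[OF d _ i3]) (use i1 i2 in \<open>auto intro!: continuous_intros cont_Vs cont_slice cont_db s\<close>)
    then show ?thesis using i1 i2 by simp
  qed
  then have e: "2 * (LINT x|lborel. V1 s j i t x * (b j t x * V s i t x)) = - (LINT x|lborel. db j j t x * V s i t x * V s i t x)" for j
    by (simp add: eq_neg_iff_add_eq_0 add.commute)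
  have "2 * (\<Sum>j\<in>UNIV. LINT x|lborel. V1 s j i t x * (b j t x * V s i t x)) = - (\<Sum>j\<in>UNIV. LINT x|lborel. db j j t x * V s i t x * V s i t x)"
    unfolding sum_distrib_left e sum_negf ..
  also have "(\<Sum>j\<in>UNIV. LINT x|lborel. db j j t x * V s i t x * V s i t x) = (LINT x|lborel. (\<Sum>j\<in>UNIV. db j j t x * V s i t x * V s i t x))"
    by (intro Bochner_Integration.integral_sum[symmetric] sqi_mult dbV sqi_V s)
  also have "\<dots> = 0" unfolding sum_distrib_right[symmetric] div_b by simp
  finally show ?thesis by simp
qed

text \<open>By \<open>transport_zero\<close> the term \<open>b\<^sub>j V\<^sub>i\<close> may be subtracted. What is left is the commutator of
  multiplication by \<open>b\<^sub>j\<close> with the heat flow.\<close>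

lemma nonlinear_term:
  assumes s: "s > 0" and t: "t > 0"
  shows "(\<Sum>k\<in>UNIV. LINT x|lborel. V s k t x * N s k t x) =
    (\<Sum>i\<in>UNIV. \<Sum>j\<in>UNIV. LINT x|lborel. V1 s j i t x * (H s i j t x - b j t x * V s i t x))"
proof -
  obtain B where B: "\<And>k x. \<bar>b k t x\<bar> \<le> B" using b_bound[of t] by auto
  have bV: "sqi (\<lambda>x. b j t x * V s i t x)" for i j by (rule sqi_bmul(1)[OF _ B sqi_V(1)[OF s]]) measurable
  let ?F = "\<lambda>i j y. b j t y * v i t y"
  let ?P = "\<lambda>j i x. LINT y|lborel. ?F i j y * hk1 s j (y - x)"
  let ?Q = "\<lambda>k j i x. LINT y|lborel. ?F i j y * T3 (PL s) i j k (y - x)"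
  have sP: "sqi (?P j i)" for i j by (intro conv_L2_left sqi_bv hk1_class s)
  have sQ: "sqi (?Q k j i)" for i j k by (intro conv_L2_left sqi_bv T3PL_class s)
  have Nx: "(LINT y|lborel. ?F i j y * Dk s k i j (y - x)) = dl k i * ?P j i x + cN * ?Q k j i x" for i j k x
  proof -
    have "(LINT y|lborel. ?F i j y * Dk s k i j (y - x)) = (LINT y|lborel. dl k i * (?F i j y * hk1 s j (y - x)) + cN * (?F i j y * T3 (PL s) i j k (y - x)))"
      by (intro Bochner_Integration.integral_cong refl) (simp add: Dk_split dl_sym[of i k] algebra_simps)
    also have "\<dots> = dl k i * ?P j i x + cN * ?Q k j i x"
      by (subst Bochner_Integration.integral_add)
         (auto intro!: integrable_mult_right sqi_mult[OF sqi_bv] sqi_shift hk1_class T3PL_class s)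
    finally show ?thesis .
  qed
  have "(LINT x|lborel. V s k t x * N s k t x) = (\<Sum>i\<in>UNIV. \<Sum>j\<in>UNIV. dl k i * (LINT x|lborel. V s k t x * ?P j i x) + cN * (LINT x|lborel. V s k t x * ?Q k j i x))" for k
  proof -
    have "(LINT x|lborel. V s k t x * N s k t x) = (LINT x|lborel. (\<Sum>i\<in>UNIV. \<Sum>j\<in>UNIV. dl k i * (V s k t x * ?P j i x) + cN * (V s k t x * ?Q k j i x)))"
      unfolding N_def Nx by (simp add: sum_distrib_left algebra_simps)
    also have "\<dots> = (\<Sum>i\<in>UNIV. \<Sum>j\<in>UNIV. LINT x|lborel. dl k i * (V s k t x * ?P j i x) + cN * (V s k t x * ?Q k j i x))"
      by (subst Bochner_Integration.integral_sum, (intro Bochner_Integration.integrable_sum Bochner_Integration.integrable_add integrable_mult_right sqi_mult sqi_V sP sQ s)+,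
          intro sum.cong[OF refl] Bochner_Integration.integral_sum Bochner_Integration.integrable_add integrable_mult_right sqi_mult sqi_V sP sQ s)
    also have "\<dots> = (\<Sum>i\<in>UNIV. \<Sum>j\<in>UNIV. dl k i * (LINT x|lborel. V s k t x * ?P j i x) + cN * (LINT x|lborel. V s k t x * ?Q k j i x))"
      by (intro sum.cong[OF refl], subst Bochner_Integration.integral_add, (intro integrable_mult_right sqi_mult sqi_V sP sQ s)+, simp)
    finally show ?thesis .
  qed
  then have "(\<Sum>k\<in>UNIV. LINT x|lborel. V s k t x * N s k t x) =
     (\<Sum>k\<in>UNIV. \<Sum>i\<in>UNIV. dl k i * (\<Sum>j\<in>UNIV. LINT x|lborel. V s k t x * ?P j i x)) + cN * (\<Sum>k\<in>UNIV. \<Sum>i\<in>UNIV. \<Sum>j\<in>UNIV. LINT x|lborel. V s k t x * ?Q k j i x)"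
    by (simp add: sum.distrib sum_distrib_left)
  also have "(\<Sum>k\<in>UNIV. \<Sum>i\<in>UNIV. \<Sum>j\<in>UNIV. LINT x|lborel. V s k t x * ?Q k j i x) = (\<Sum>i\<in>UNIV. \<Sum>j\<in>UNIV. \<Sum>k\<in>UNIV. LINT x|lborel. V s k t x * ?Q k j i x)"
    by (subst sum.swap) (intro sum.cong[OF refl] sum.swap)
  also have "\<dots> = 0" using pressure_free[OF s t] by simp
  also have "(\<Sum>k\<in>UNIV. \<Sum>i\<in>UNIV. dl k i * (\<Sum>j\<in>UNIV. LINT x|lborel. V s k t x * ?P j i x)) = (\<Sum>k\<in>UNIV. \<Sum>j\<in>UNIV. LINT x|lborel. V s k t x * ?P j k x)"
    unfolding dl_sum ..
  also have "\<dots> = (\<Sum>i\<in>UNIV. \<Sum>j\<in>UNIV. LINT x|lborel. V1 s j i t x * H s i j t x)"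
  proof (intro sum.cong[OF refl])
    fix i j
    have "(LINT x|lborel. - ?P j i x * V s i t x) = - (LINT x|lborel. H s i j t x * V1 s j i t x)"
      by (intro integral_by_parts_along[OF deriv_H[OF s] deriv_V[OF s]] cont_Vs sqi_mult sqi_H sqi_V sqi_V1 sqi_minus sP s continuous_on_minus conv_cont cont_bv_slice sqi_bv cont_hk1 hk1_class)
    then show "(LINT x|lborel. V s i t x * ?P j i x) = (LINT x|lborel. V1 s j i t x * H s i j t x)"
      by (simp add: mult.commute)
  qed
  also have "\<dots> + cN * 0 = (\<Sum>i\<in>UNIV. \<Sum>j\<in>UNIV. LINT x|lborel. V1 s j i t x * H s i j t x) - (\<Sum>i\<in>UNIV. \<Sum>j\<in>UNIV. LINT x|lborel. V1 s j i t x * (b j t x * V s i t x))"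
    unfolding transport_zero[OF s] by simp
  also have "\<dots> = (\<Sum>i\<in>UNIV. \<Sum>j\<in>UNIV. LINT x|lborel. V1 s j i t x * (H s i j t x - b j t x * V s i t x))"
    unfolding sum_subtractf[symmetric] right_diff_distrib
    by (intro sum.cong[OF refl] Bochner_Integration.integral_diff[symmetric] sqi_mult sqi_V1 sqi_H bV s)
  finally show ?thesis .
qed

text \<open>\<open>b\<close> is Lipschitz, so the kernel of the commutator is at most \<open>L \<bar>z\<bar>\<close> times the heat kernel, and the first
  moment of the latter is \<open>O(sqrt s)\<close>.\<close>

lemma commutator:
  assumes s: "s > 0" and L: "\<And>x y. \<bar>b j t x - b j t y\<bar> \<le> L * norm (x - y)" "L \<ge> 0"
  shows "sqi (\<lambda>x. H s i j t x - b j t x * V s i t x)" "l2n (\<lambda>x. H s i j t x - b j t x * V s i t x) \<le> L * (6 * sqrt s) * l2n (v i t)"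
proof -
  let ?k = "\<lambda>z. norm z * hk s z"
  let ?g = "\<lambda>x. LINT y|lborel. \<bar>v i t y\<bar> * ?k (y - x)"
  have k: "integrable lborel ?k" "l1n ?k \<le> 6 * sqrt s" using hk_moment[OF s] by auto
  obtain B where B: "\<And>k x. \<bar>b k t x\<bar> \<le> B" using b_bound[of t] by auto
  have bV: "sqi (\<lambda>x. b j t x * V s i t x)" by (rule sqi_bmul(1)[OF _ B sqi_V(1)[OF s]]) measurable
  show q: "sqi (\<lambda>x. H s i j t x - b j t x * V s i t x)" by (intro sqi_diff sqi_H bV s)
  have g: "sqi ?g" "l2n ?g \<le> l1n ?k * l2n (\<lambda>y. \<bar>v i t y\<bar>)" by (rule conv_L2_left[OF sqi_abs[OF sqi_v] k(1)])+
  have ks: "sqi ?k"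
    by (rule sqi_bounded(1)[OF _ k(1) hk_moment_bound[OF s] order_refl]) (use s lam_pos[OF s] in auto)
  have le: "\<bar>H s i j t x - b j t x * V s i t x\<bar> \<le> \<bar>L * ?g x\<bar>" for x
  proof -
    have "H s i j t x - b j t x * V s i t x = (LINT y|lborel. (b j t y - b j t x) * v i t y * hk s (y - x))"
    proof -
      have "b j t x * V s i t x = (LINT y|lborel. b j t x * (v i t y * hk s (y - x)))" unfolding V_def by simp
      then have "H s i j t x - b j t x * V s i t x = (LINT y|lborel. (b j t y * v i t y) * hk s (y - x) - b j t x * (v i t y * hk s (y - x)))"
        unfolding H_def
        by (simp only:) (intro Bochner_Integration.integral_diff[symmetric] sqi_mult[OF sqi_bv] integrable_mult_right sqi_mult sqi_v sqi_shift hk_sqi s)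
      then show ?thesis by (simp add: algebra_simps)
    qed
    also have "\<bar>\<dots>\<bar> \<le> (LINT y|lborel. L * (\<bar>v i t y\<bar> * ?k (y - x)))"
    proof (rule order_trans[OF integral_abs_bound], rule integral_mono_AE')
      show "integrable lborel (\<lambda>y. L * (\<bar>v i t y\<bar> * ?k (y - x)))"
        by (intro integrable_mult_right sqi_mult sqi_abs sqi_v sqi_shift ks)
      have "\<bar>(b j t y - b j t x) * v i t y * hk s (y - x)\<bar> \<le> L * (\<bar>v i t y\<bar> * ?k (y - x))" for y
      proof -
        have "\<bar>b j t y - b j t x\<bar> * (\<bar>v i t y\<bar> * hk s (y - x)) \<le> (L * norm (y - x)) * (\<bar>v i t y\<bar> * hk s (y - x))"
          using hk_nonneg[OF s] by (intro mult_right_mono L) auto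
        then show ?thesis using hk_nonneg[OF s, of "y - x"] by (simp add: abs_mult mult_ac)
      qed
      then show "AE y in lborel. \<bar>(b j t y - b j t x) * v i t y * hk s (y - x)\<bar> \<le> L * (\<bar>v i t y\<bar> * ?k (y - x))" by simp
    qed (use L(2) hk_nonneg[OF s] in auto)
    also have "\<dots> = L * ?g x" by simp
    finally show ?thesis by (meson abs_ge_self order_trans)
  qed
  have "l2n (\<lambda>x. H s i j t x - b j t x * V s i t x) \<le> l2n (\<lambda>x. L * ?g x)"
    by (rule sqi_dominated(2)[OF sqi_meas[OF q] sqi_cmult[OF g(1)] le])
  also have "\<dots> = L * l2n ?g" using L by (simp add: l2n_cmult)
  also have "\<dots> \<le> L * (l1n ?k * l2n (v i t))" using g(2) L by (intro mult_left_mono) auto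
  also have "\<dots> \<le> L * ((6 * sqrt s) * l2n (v i t))" using k(2) L by (intro mult_left_mono mult_right_mono) auto
  finally show "l2n (\<lambda>x. H s i j t x - b j t x * V s i t x) \<le> L * (6 * sqrt s) * l2n (v i t)" by (simp add: mult.assoc)
qed

lemma meas_conv_pair:
  assumes [measurable]: "g \<in> borel_measurable borel"
  shows "(\<lambda>p. LINT y|lborel. v k (fst p) y * g (y - snd p)) \<in> borel_measurable (borel \<Otimes>\<^sub>M borel)"
    "(\<lambda>p. LINT y|lborel. (b j (fst p) y * v k (fst p) y) * g (y - snd p)) \<in> borel_measurable (borel \<Otimes>\<^sub>M borel)"
  by measurable

lemma meas_fields:
  "(\<lambda>p. V s k (fst p) (snd p)) \<in> borel_measurable (borel \<Otimes>\<^sub>M borel)"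
  "(\<lambda>p. VL s k (fst p) (snd p)) \<in> borel_measurable (borel \<Otimes>\<^sub>M borel)"
  "(\<lambda>p. V1 s j k (fst p) (snd p)) \<in> borel_measurable (borel \<Otimes>\<^sub>M borel)"
  "(\<lambda>p. N s k (fst p) (snd p)) \<in> borel_measurable (borel \<Otimes>\<^sub>M borel)"
proof -
  show "(\<lambda>p. V s k (fst p) (snd p)) \<in> borel_measurable (borel \<Otimes>\<^sub>M borel)"
    unfolding V_def by (rule meas_conv_pair(1)) measurable
  show "(\<lambda>p. VL s k (fst p) (snd p)) \<in> borel_measurable (borel \<Otimes>\<^sub>M borel)"
    unfolding VL_def by (rule meas_conv_pair(1)) measurable
  show "(\<lambda>p. V1 s j k (fst p) (snd p)) \<in> borel_measurable (borel \<Otimes>\<^sub>M borel)"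
    unfolding V1_def by (rule borel_measurable_uminus, rule meas_conv_pair(1)) measurable
  show "(\<lambda>p. N s k (fst p) (snd p)) \<in> borel_measurable (borel \<Otimes>\<^sub>M borel)"
    unfolding N_def by (intro borel_measurable_sum meas_conv_pair(2)) measurable
qed

lemma meas_W: "W s \<in> borel_measurable borel"
proof -
  have [measurable]: "(\<lambda>p. V1 s j k (fst p) (snd p)) \<in> borel_measurable (borel \<Otimes>\<^sub>M borel)" for j k by (rule meas_fields)
  have "(\<lambda>t. LINT x|lborel. (V1 s j k t x)\<^sup>2) \<in> borel_measurable borel" for j k
  proof -
    have "(\<lambda>(t,x). (V1 s j k t x)\<^sup>2) \<in> borel_measurable (borel \<Otimes>\<^sub>M lborel)"
      using borel_measurable_power[OF meas_fields(3)[of s j k], of 2] by (simp add: split_beta measurable_pair_measure_countable1 cong: measurable_cong_sets)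
    then show ?thesis by (rule lborel.borel_measurable_lebesgue_integral)
  qed
  then show ?thesis unfolding W_def[abs_def] l2n_sq by measurable
qed

lemma W_nonneg[simp]: "0 \<le> W s t" by (simp add: W_def sum_nonneg)

lemma W_bound: assumes "s > 0" "\<And>k. l2n (v k t) \<le> M" shows "W s t \<le> 9 * (924 * (cK * lam s) * M)\<^sup>2"
proof -
  have "(l2n (V1 s j k t))\<^sup>2 \<le> (924 * (cK * lam s) * M)\<^sup>2" for j k
  proof (rule power_mono)
    show "l2n (V1 s j k t) \<le> 924 * (cK * lam s) * M"
      by (rule order_trans[OF sqi_V1(2)[OF assms(1)]]) (use assms cK_pos lam_pos[OF assms(1)] in \<open>auto intro!: mult_left_mono\<close>)
  qed simp
  then have "W s t \<le> (\<Sum>j\<in>(UNIV::3 set). \<Sum>k\<in>(UNIV::3 set). (924 * (cK * lam s) * M)\<^sup>2)"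
    unfolding W_def by (intro sum_mono)
  then show ?thesis by simp
qed

text \<open>Half of the dissipation absorbs the commutator. The Lipschitz constant of \<open>b\<close> depends on the
  regularization, but it comes with the factor \<open>s\<close>, which tends to zero.\<close>

lemma energy_rate:
  assumes s: "s > 0" and t: "0 < t" "t \<le> T" and L: "\<And>k t x y. t \<le> T \<Longrightarrow> \<bar>b k t x - b k t y\<bar> \<le> L * norm (x - y)" "L \<ge> 0"
    and M: "\<And>k. l2n (v k t) \<le> M"
  shows "(\<Sum>k\<in>UNIV. 2 * (LINT x|lborel. V s k t x * (VL s k t x + N s k t x))) \<le> - W s t + 324 * (L * M)\<^sup>2 * s"
proof -
  have M0: "M \<ge> 0" using M[of undefined] l2n_nonneg[of "v undefined t"] by linarith
  have "(LINT x|lborel. V s k t x * (VL s k t x + N s k t x)) = (LINT x|lborel. V s k t x * VL s k t x) + (LINT x|lborel. V s k t x * N s k t x)" for k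
    unfolding distrib_left by (intro Bochner_Integration.integral_add sqi_mult sqi_V sqi_VL sqi_N s)
  then have "(\<Sum>k\<in>UNIV. 2 * (LINT x|lborel. V s k t x * (VL s k t x + N s k t x))) =
    2 * (\<Sum>k\<in>UNIV. LINT x|lborel. V s k t x * VL s k t x) + 2 * (\<Sum>k\<in>UNIV. LINT x|lborel. V s k t x * N s k t x)"
    by (simp add: sum.distrib sum_distrib_left)
  also have "\<dots> = - 2 * W s t + (\<Sum>i\<in>UNIV. \<Sum>j\<in>UNIV. 2 * (LINT x|lborel. V1 s j i t x * (H s i j t x - b j t x * V s i t x)))"
    unfolding dissipation[OF s] nonlinear_term[OF s t(1)] by (simp add: sum_distrib_left)
  also have "\<dots> \<le> - 2 * W s t + (\<Sum>i\<in>UNIV. \<Sum>j\<in>UNIV. (l2n (V1 s j i t))\<^sup>2 + 36 * (L * M)\<^sup>2 * s)"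
  proof (intro add_left_mono sum_mono)
    fix i j :: 3
    note c = commutator[OF s L(1)[OF t(2)] L(2), of i j]
    have "l2n (\<lambda>x. H s i j t x - b j t x * V s i t x) \<le> L * (6 * sqrt s) * M"
      using c(2) L s by (rule_tac order_trans[OF _ mult_left_mono[OF M[of i]]]) auto
    then have q: "(l2n (\<lambda>x. H s i j t x - b j t x * V s i t x))\<^sup>2 \<le> (L * (6 * sqrt s) * M)\<^sup>2" by (rule power_mono) simp
    have "2 * (LINT x|lborel. V1 s j i t x * (H s i j t x - b j t x * V s i t x)) \<le> 2 * (l2n (V1 s j i t) * l2n (\<lambda>x. H s i j t x - b j t x * V s i t x))"
      using pair_le[OF sqi_V1(1)[OF s] c(1)] by (simp add: abs_le_iff)
    also have "\<dots> \<le> (l2n (V1 s j i t))\<^sup>2 + (l2n (\<lambda>x. H s i j t x - b j t x * V s i t x))\<^sup>2"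
      by (simp only: mult.assoc[symmetric]) (rule sum_squares_bound)
    also have "\<dots> \<le> (l2n (V1 s j i t))\<^sup>2 + (L * (6 * sqrt s) * M)\<^sup>2" using q by simp
    also have "(L * (6 * sqrt s) * M)\<^sup>2 = 36 * (L * M)\<^sup>2 * s" using s by (simp add: power_mult_distrib)
    finally show "2 * (LINT x|lborel. V1 s j i t x * (H s i j t x - b j t x * V s i t x)) \<le> (l2n (V1 s j i t))\<^sup>2 + 36 * (L * M)\<^sup>2 * s" .
  qed
  also have "(\<Sum>i\<in>UNIV. \<Sum>j\<in>UNIV. (l2n (V1 s j i t))\<^sup>2 + 36 * (L * M)\<^sup>2 * s) = W s t + 324 * (L * M)\<^sup>2 * s"
    unfolding W_def by (subst sum.swap) (simp add: sum.distrib)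
  finally show ?thesis by simp
qed

text \<open>The derivative of \<open>V\<^sup>2 / 2\<close>, integrated over time and space in either order. Integrating first in time,
  for fixed \<open>x\<close>, avoids differentiating the \<open>L\<^sup>2\<close> norm.\<close>

lemma energy_increment:
  assumes s: "s > 0" and t: "0 \<le> t1" "t1 \<le> t2"
  shows "integrable lborel (\<lambda>r. indicator {t1<..<t2} r * (LINT x|lborel. V s k r x * (VL s k r x + N s k r x)))"
    and "(l2n (V s k t2))\<^sup>2 - (l2n (V s k t1))\<^sup>2 =
     (LINT r|lborel. indicator {t1<..<t2} r * (2 * (LINT x|lborel. V s k r x * (VL s k r x + N s k r x))))"
proof -
  let ?R = "\<lambda>r x. VL s k r x + N s k r x"
  let ?F = "\<lambda>r x. indicator {t1<..<t2} r * (V s k r x * ?R r x)"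
  obtain M B where mb: "\<And>t k. t \<le> t2 \<Longrightarrow> l2n (v k t) \<le> M" "\<And>t k x. t \<le> t2 \<Longrightarrow> \<bar>b k t x\<bar> \<le> B" "M \<ge> 0" "B \<ge> 0"
    using obtain_bounds[of t2] by metis
  have sR: "sqi (?R r)" for r by (intro sqi_add sqi_VL sqi_N s)
  define Q where "Q = l1n (hkL s) * M + (\<Sum>i\<in>UNIV. \<Sum>j\<in>UNIV. l1n (Dk s k i j) * (B * M))"
  have trisum: "l2n (\<lambda>x. \<Sum>i\<in>I. f i x) \<le> (\<Sum>i\<in>I. l2n (f i))" if "finite I" "\<And>i. sqi (f i)" for I and f :: "3 \<Rightarrow> vec3 \<Rightarrow> real"
    using that
  proof (induction I rule: finite_induct)
    case (insert i I)
    then show ?case using l2n_triangle[of "f i" "\<lambda>x. \<Sum>i\<in>I. f i x"] sqi_sum[of I f] by simp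
  qed (simp add: l2n_def)
  have Rb: "l2n (?R r) \<le> Q" if "r \<le> t2" for r
  proof -
    have "l2n (?R r) \<le> l2n (VL s k r) + l2n (N s k r)" by (intro l2n_triangle sqi_VL sqi_N s)
    also have "l2n (N s k r) \<le> (\<Sum>i\<in>UNIV. \<Sum>j\<in>UNIV. l1n (Dk s k i j) * (B * M))"
      unfolding N_def[abs_def]
    proof (rule order_trans[OF trisum sum_mono], simp, intro sqi_sum sqi_Nk s)
      fix i
      show "l2n (\<lambda>x. \<Sum>j\<in>UNIV. LINT y|lborel. (b j r y * v i r y) * Dk s k i j (y - x)) \<le> (\<Sum>j\<in>UNIV. l1n (Dk s k i j) * (B * M))"
      proof (rule order_trans[OF trisum sum_mono], simp, intro sqi_Nk s)
        fix j
        have "l2n (\<lambda>x. LINT y|lborel. (b j r y * v i r y) * Dk s k i j (y - x)) \<le> l1n (Dk s k i j) * l2n (\<lambda>y. b j r y * v i r y)"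
          by (intro conv_L2_left sqi_bv Dk_class s)
        also have "\<dots> \<le> l1n (Dk s k i j) * (B * M)"
          by (intro mult_left_mono bv_le mb that) auto
        finally show "l2n (\<lambda>x. LINT y|lborel. (b j r y * v i r y) * Dk s k i j (y - x)) \<le> l1n (Dk s k i j) * (B * M)" .
      qed
    qed
    also have "l2n (VL s k r) \<le> l1n (hkL s) * M"
      by (rule order_trans[OF sqi_VL(2)[OF s] mult_left_mono[OF mb(1)[OF that]]]) simp
    finally show ?thesis by (simp add: Q_def)
  qed
  have Fm: "(\<lambda>(r,x). ?F r x) \<in> borel_measurable (lborel \<Otimes>\<^sub>M lborel)"
  proof -
    have "(\<lambda>p. indicator {t1<..<t2} (fst p) * (V s k (fst p) (snd p) * (VL s k (fst p) (snd p) + N s k (fst p) (snd p)))) \<in> borel_measurable (borel \<Otimes>\<^sub>M borel)"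
      by (intro borel_measurable_times borel_measurable_add meas_fields) measurable
    then show ?thesis by (simp add: split_beta cong: measurable_cong_sets)
  qed
  have int: "integrable (lborel \<Otimes>\<^sub>M lborel) (\<lambda>(r,x). ?F r x)"
  proof (rule integrableI_bounded[OF Fm])
    have "(\<integral>\<^sup>+p. ennreal (norm (case p of (r,x) \<Rightarrow> ?F r x)) \<partial>(lborel \<Otimes>\<^sub>M lborel)) =
      (\<integral>\<^sup>+r. (\<integral>\<^sup>+x. indicator {t1<..<t2} r * (ennreal \<bar>V s k r x\<bar> * ennreal \<bar>?R r x\<bar>) \<partial>lborel) \<partial>lborel)"
      using Fm by (subst lborel.nn_integral_fst[symmetric]) (auto simp: abs_mult indicator_def ennreal_mult intro!: nn_integral_cong)
    also have "\<dots> \<le> (\<integral>\<^sup>+r. indicator {t1<..<t2} r * ennreal (M * Q) \<partial>lborel)"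
    proof (rule nn_integral_mono)
      fix r
      show "(\<integral>\<^sup>+x. indicator {t1<..<t2} r * (ennreal \<bar>V s k r x\<bar> * ennreal \<bar>?R r x\<bar>) \<partial>lborel) \<le> indicator {t1<..<t2} r * ennreal (M * Q)"
      proof (cases "r \<in> {t1<..<t2}")
        case True
        have "(\<integral>\<^sup>+x. ennreal \<bar>V s k r x\<bar> * ennreal \<bar>?R r x\<bar> \<partial>lborel) \<le> ennreal (l2n (V s k r) * l2n (?R r))"
          by (rule nn_pair_le[OF sqi_V(1)[OF s] sR])
        also have "\<dots> \<le> ennreal (M * Q)"
          by (intro ennreal_leI mult_mono order_trans[OF sqi_V(2)[OF s]] mb Rb) (use True mb in auto)
        finally show ?thesis using True by simp
      qed simp
    qed
    also have "\<dots> < \<infinity>" using t by (subst nn_integral_multc) (auto simp: ennreal_mult_less_top)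
    finally show "(\<integral>\<^sup>+p. ennreal (norm (case p of (r,x) \<Rightarrow> ?F r x)) \<partial>(lborel \<Otimes>\<^sub>M lborel)) < \<infinity>" .
  qed
  show "integrable lborel (\<lambda>r. indicator {t1<..<t2} r * (LINT x|lborel. V s k r x * ?R r x))"
    using lborel_pair.integrable_fst[OF int] by simp
  have inner: "(LINT r|lborel. ?F r x) = ((V s k t2 x)\<^sup>2 - (V s k t1 x)\<^sup>2) / 2" for x
  proof -
    have "(LINT r|lborel. indicator {t1<..<t2} r * (V s k r x * ?R r x)) = (V s k t2 x)\<^sup>2 / 2 - (V s k t1 x)\<^sup>2 / 2"
    proof (rule FTC_open[OF t(2)])
      show "continuous_on {t1..t2} (\<lambda>r. (V s k r x)\<^sup>2 / 2)"
        by (intro continuous_intros continuous_on_subset[OF cont_V_t[OF s]]) auto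
      show "continuous_on {t1..t2} (\<lambda>r. V s k r x * ?R r x)"
        by (intro continuous_intros continuous_on_subset[OF cont_V_t[OF s]] continuous_on_subset[OF cont_VL_t[OF s]] continuous_on_subset[OF cont_N_t[OF s]]) auto
      show "((\<lambda>r. (V s k r x)\<^sup>2 / 2) has_real_derivative V s k r x * ?R r x) (at r)" if "t1 < r" "r < t2" for r
        using mollified_equation[OF s, of r k x] that t by (auto intro!: derivative_eq_intros)
    qed
    then show ?thesis by (simp add: diff_divide_distrib)
  qed
  have sq: "integrable lborel (\<lambda>x. (V s k r x)\<^sup>2)" for r using sqi_V(1)[OF s, of k r] by (simp add: sqi_def)
  have "(l2n (V s k t2))\<^sup>2 - (l2n (V s k t1))\<^sup>2 = 2 * (LINT x|lborel. (LINT r|lborel. ?F r x))"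
    unfolding inner l2n_sq using sq by simp
  also have "(LINT x|lborel. (LINT r|lborel. ?F r x)) = (LINT r|lborel. (LINT x|lborel. ?F r x))"
    by (rule lborel_pair.Fubini_integral[OF int])
  also have "2 * (LINT r|lborel. (LINT x|lborel. ?F r x)) = (LINT r|lborel. indicator {t1<..<t2} r * (2 * (LINT x|lborel. V s k r x * ?R r x)))"
    by (subst integral_mult_right_zero[symmetric]) (simp add: mult_ac)
  finally show "(l2n (V s k t2))\<^sup>2 - (l2n (V s k t1))\<^sup>2 = (LINT r|lborel. indicator {t1<..<t2} r * (2 * (LINT x|lborel. V s k r x * ?R r x)))" .
qed

text \<open>The constant \<open>C\<close> depends on the regularization but not on \<open>s\<close>, so it disappears in the limit \<open>s \<rightarrow> 0\<close>, in
  which both terms on the left are treated with Fatou's lemma.\<close>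

lemma energy_mollified:
  assumes t: "0 \<le> t1" "t1 \<le> t2"
  shows "\<exists>C\<ge>0. \<forall>s>0. ennreal (E s t2) + (\<integral>\<^sup>+r. ennreal (W s r) * indicator {t1<..<t2} r \<partial>lborel) \<le> ennreal (E0 t1 + C * s)"
proof -
  obtain M B where mb: "\<And>t k. t \<le> t2 \<Longrightarrow> l2n (v k t) \<le> M" "M \<ge> 0"
    using obtain_bounds[of t2] by metis
  obtain L where L: "L \<ge> 0" "\<And>k t x y. t \<le> t2 \<Longrightarrow> \<bar>b k t x - b k t y\<bar> \<le> L * norm (x - y)"
    using b_lip[of t2] by blast
  define C where "C = 324 * (L * M)\<^sup>2 * (t2 - t1)"
  have C: "C \<ge> 0" using t by (simp add: C_def)
  have "ennreal (E s t2) + (\<integral>\<^sup>+r. ennreal (W s r) * indicator {t1<..<t2} r \<partial>lborel) \<le> ennreal (E0 t1 + C * s)" if s: "s > 0" for s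
  proof -
    note [measurable] = meas_W
    let ?I = "\<lambda>r. indicator {t1<..<t2} r :: real"
    have iI: "integrable lborel ?I" using t by simp
    have iW: "integrable lborel (\<lambda>r. ?I r * W s r)"
    proof (rule Bochner_Integration.integrable_bound[of _ "\<lambda>r. ?I r * (9 * (924 * (cK * lam s) * M)\<^sup>2)"])
      show "integrable lborel (\<lambda>r. ?I r * (9 * (924 * (cK * lam s) * M)\<^sup>2))" using iI by simp
      show "AE r in lborel. norm (?I r * W s r) \<le> norm (?I r * (9 * (924 * (cK * lam s) * M)\<^sup>2))"
        using W_bound[OF s, of _ M] mb by (intro AE_I2) (auto simp: indicator_def)
    qed measurable
    have "E s t2 - E s t1 = (\<Sum>k\<in>UNIV. LINT r|lborel. ?I r * (2 * (LINT x|lborel. V s k r x * (VL s k r x + N s k r x))))"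
      unfolding E_def sum_subtractf[symmetric] energy_increment(2)[OF s t] ..
    also have "\<dots> = (LINT r|lborel. (\<Sum>k\<in>UNIV. ?I r * (2 * (LINT x|lborel. V s k r x * (VL s k r x + N s k r x)))))"
      by (rule Bochner_Integration.integral_sum[symmetric])
         (use integrable_mult_right[OF energy_increment(1)[OF s t], of 2] in \<open>simp add: mult.left_commute\<close>)
    also have "\<dots> \<le> (LINT r|lborel. ?I r * (324 * (L * M)\<^sup>2 * s) - ?I r * W s r)"
    proof (rule integral_mono)
      show "integrable lborel (\<lambda>r. \<Sum>k\<in>UNIV. ?I r * (2 * (LINT x|lborel. V s k r x * (VL s k r x + N s k r x))))"
        by (rule Bochner_Integration.integrable_sum)
         (use integrable_mult_right[OF energy_increment(1)[OF s t], of 2] in \<open>simp add: mult.left_commute\<close>)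
      show "integrable lborel (\<lambda>r. ?I r * (324 * (L * M)\<^sup>2 * s) - ?I r * W s r)" using iI iW by simp
      show "(\<Sum>k\<in>UNIV. ?I r * (2 * (LINT x|lborel. V s k r x * (VL s k r x + N s k r x)))) \<le> ?I r * (324 * (L * M)\<^sup>2 * s) - ?I r * W s r" for r
        using energy_rate[OF s, of r t2 L M] L mb t by (auto simp: indicator_def)
    qed
    also have "\<dots> = C * s - (LINT r|lborel. ?I r * W s r)"
      using iI iW t by (simp add: C_def)
    finally have "E s t2 + (LINT r|lborel. ?I r * W s r) \<le> E s t1 + C * s" by simp
    also have "E s t1 \<le> E0 t1" unfolding E_def E0_def by (intro sum_mono power_mono sqi_V s) auto
    finally have main: "E s t2 + (LINT r|lborel. ?I r * W s r) \<le> E0 t1 + C * s" by simp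
    have "(\<integral>\<^sup>+r. ennreal (W s r) * indicator {t1<..<t2} r \<partial>lborel) = (\<integral>\<^sup>+r. ennreal (?I r * W s r) \<partial>lborel)"
      by (intro nn_integral_cong) (auto simp: indicator_def)
    also have "\<dots> = ennreal (LINT r|lborel. ?I r * W s r)" using iW by (intro nn_integral_eq_integral) auto
    finally have "ennreal (E s t2) + (\<integral>\<^sup>+r. ennreal (W s r) * indicator {t1<..<t2} r \<partial>lborel) = ennreal (E s t2 + (LINT r|lborel. ?I r * W s r))"
      by (simp add: E_def sum_nonneg)
    then show ?thesis using main by (simp add: ennreal_leI)
  qed
  then show ?thesis using C by blast
qed

lemma E0_nonneg[simp]: "0 \<le> E0 t" by (simp add: E0_def sum_nonneg)

lemma ennreal_inverse_Suc_limit: "(\<lambda>n. ennreal (a + c * (1 / real (Suc n)))) \<longlonglongrightarrow> ennreal a"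
proof -
  have "(\<lambda>n. a + c * (1 / real (Suc n))) \<longlonglongrightarrow> a + c * 0"
    by (intro tendsto_intros LIMSEQ_Suc lim_const_over_n)
  then show ?thesis by (intro tendsto_ennrealI) simp
qed

text \<open>Fatou's lemma, as \<open>V s\<close> converges pointwise to \<open>v\<close>.\<close>

lemma E0_decreasing:
  assumes t: "0 \<le> t1" "t1 \<le> t2" shows "E0 t2 \<le> E0 t1"
proof -
  obtain C where C: "C \<ge> 0" "\<And>s. s > 0 \<Longrightarrow> ennreal (E s t2) + (\<integral>\<^sup>+r. ennreal (W s r) * indicator {t1<..<t2} r \<partial>lborel) \<le> ennreal (E0 t1 + C * s)"
    using energy_mollified[OF t] by blast
  define \<sigma> where "\<sigma> n = 1 / real (Suc n)" for n
  have \<sigma>: "\<sigma> n > 0" for n by (simp add: \<sigma>_def)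
  have \<sigma>0: "filterlim \<sigma> (at_right 0) sequentially"
    unfolding filterlim_at \<sigma>_def using LIMSEQ_Suc[OF lim_const_over_n[of 1]] by auto
  have [measurable]: "V s k t \<in> borel_measurable borel" if "s > 0" for s k t using sqi_meas[OF sqi_V(1)[OF that]] .
  have E0nn: "ennreal (E0 t2) = (\<integral>\<^sup>+x. (\<Sum>k\<in>UNIV. ennreal ((v k t2 x)\<^sup>2)) \<partial>lborel)"
    by (subst nn_integral_sum) (auto simp: E0_def nn_sqi[OF sqi_v] simp flip: sum_ennreal)
  have Enn: "(\<integral>\<^sup>+x. (\<Sum>k\<in>UNIV. ennreal ((V s k t2 x)\<^sup>2)) \<partial>lborel) = ennreal (E s t2)" if "s > 0" for s
    using that by (subst nn_integral_sum) (auto simp: E_def nn_sqi[OF sqi_V(1)] simp flip: sum_ennreal)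
  have "ennreal (E0 t2) \<le> (\<integral>\<^sup>+x. liminf (\<lambda>n. (\<Sum>k\<in>UNIV. ennreal ((V (\<sigma> n) k t2 x)\<^sup>2))) \<partial>lborel)"
    unfolding E0nn
  proof (rule nn_integral_mono)
    fix x
    have "(\<lambda>n. \<Sum>k\<in>UNIV. ennreal ((V (\<sigma> n) k t2 x)\<^sup>2)) \<longlonglongrightarrow> (\<Sum>k\<in>UNIV. ennreal ((v k t2 x)\<^sup>2))"
      by (intro tendsto_sum tendsto_ennrealI tendsto_power filterlim_compose[OF V_tendsto \<sigma>0])
    then show "(\<Sum>k\<in>UNIV. ennreal ((v k t2 x)\<^sup>2)) \<le> liminf (\<lambda>n. (\<Sum>k\<in>UNIV. ennreal ((V (\<sigma> n) k t2 x)\<^sup>2)))"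
      by (simp add: lim_imp_Liminf)
  qed
  also have "\<dots> \<le> liminf (\<lambda>n. \<integral>\<^sup>+x. (\<Sum>k\<in>UNIV. ennreal ((V (\<sigma> n) k t2 x)\<^sup>2)) \<partial>lborel)"
    by (rule nn_integral_liminf) (use \<sigma> in measurable)
  also have "\<dots> \<le> liminf (\<lambda>n. ennreal (E0 t1 + C * (1 / real (Suc n))))"
  proof (rule Liminf_mono, rule always_eventually, rule allI)
    fix n
    have "ennreal (E (\<sigma> n) t2) \<le> ennreal (E (\<sigma> n) t2) + (\<integral>\<^sup>+r. ennreal (W (\<sigma> n) r) * indicator {t1<..<t2} r \<partial>lborel)" by simp
    also have "\<dots> \<le> ennreal (E0 t1 + C * \<sigma> n)" by (rule C(2)[OF \<sigma>])
    finally show "(\<integral>\<^sup>+x. (\<Sum>k\<in>UNIV. ennreal ((V (\<sigma> n) k t2 x)\<^sup>2)) \<partial>lborel) \<le> ennreal (E0 t1 + C * (1 / real (Suc n)))"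
      unfolding Enn[OF \<sigma>] by (simp add: \<sigma>_def)
  qed
  also have "\<dots> = ennreal (E0 t1)" by (intro lim_imp_Liminf ennreal_inverse_Suc_limit) simp
  finally show ?thesis by simp
qed

text \<open>If the gradient were large at all times of the interval for all small parameters, Fatou's lemma would
  contradict the energy inequality. The gradient of \<open>v\<close> itself is never formed; it is enough that
  the mollified gradients are bounded along a subsequence.\<close>

lemma good_time:
  assumes t: "0 \<le> t1" "t1 < t2" and \<rho>: "E0 t1 \<le> \<rho>\<^sup>2" "\<rho> > 0"
  shows "\<exists>t0\<in>{t1<..<t2}. \<exists>\<^sub>F n in sequentially. W (1 / real (Suc n)) t0 \<le> 2 * \<rho>\<^sup>2 / (t2 - t1)"
proof (rule ccontr)
  define c where "c = 2 * \<rho>\<^sup>2 / (t2 - t1)"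
  have c: "c > 0" using t \<rho> by (simp add: c_def)
  assume "\<not> ?thesis"
  then have ev: "\<And>t0. t0 \<in> {t1<..<t2} \<Longrightarrow> eventually (\<lambda>n. c < W (1 / real (Suc n)) t0) sequentially"
    by (auto simp: not_frequently c_def not_le)
  obtain C where C: "C \<ge> 0" "\<And>s. s > 0 \<Longrightarrow> ennreal (E s t2) + (\<integral>\<^sup>+r. ennreal (W s r) * indicator {t1<..<t2} r \<partial>lborel) \<le> ennreal (E0 t1 + C * s)"
    using energy_mollified[of t1 t2] t by auto
  note [measurable] = meas_W
  have "ennreal (2 * \<rho>\<^sup>2) = ennreal c * ennreal (t2 - t1)"
    using t c by (simp add: ennreal_mult[symmetric]) (simp add: c_def)
  also have "\<dots> = (\<integral>\<^sup>+r. ennreal c * indicator {t1<..<t2} r \<partial>lborel)"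
    using t by (subst nn_integral_cmult_indicator) auto
  also have "\<dots> \<le> (\<integral>\<^sup>+r. liminf (\<lambda>n. ennreal (W (1 / real (Suc n)) r) * indicator {t1<..<t2} r) \<partial>lborel)"
  proof (rule nn_integral_mono)
    fix r
    show "ennreal c * indicator {t1<..<t2} r \<le> liminf (\<lambda>n. ennreal (W (1 / real (Suc n)) r) * indicator {t1<..<t2} r)"
    proof (cases "r \<in> {t1<..<t2}")
      case True
      have "eventually (\<lambda>n. ennreal c \<le> ennreal (W (1 / real (Suc n)) r)) sequentially"
        using ev[OF True] by eventually_elim (auto intro: ennreal_leI)
      then have "ennreal c \<le> liminf (\<lambda>n. ennreal (W (1 / real (Suc n)) r))" by (rule Liminf_bounded)
      then show ?thesis using True by simp
    qed simp
  qed
  also have "\<dots> \<le> liminf (\<lambda>n. \<integral>\<^sup>+r. ennreal (W (1 / real (Suc n)) r) * indicator {t1<..<t2} r \<partial>lborel)"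
    by (rule nn_integral_liminf) measurable
  also have "\<dots> \<le> liminf (\<lambda>n. ennreal (E0 t1 + C * (1 / real (Suc n))))"
  proof (rule Liminf_mono, rule always_eventually, rule allI)
    fix n
    have "(\<integral>\<^sup>+r. ennreal (W (1 / real (Suc n)) r) * indicator {t1<..<t2} r \<partial>lborel) \<le> ennreal (E (1 / real (Suc n)) t2) + (\<integral>\<^sup>+r. ennreal (W (1 / real (Suc n)) r) * indicator {t1<..<t2} r \<partial>lborel)" by simp
    also have "\<dots> \<le> ennreal (E0 t1 + C * (1 / real (Suc n)))" by (rule C(2)) simp
    finally show "(\<integral>\<^sup>+r. ennreal (W (1 / real (Suc n)) r) * indicator {t1<..<t2} r \<partial>lborel) \<le> ennreal (E0 t1 + C * (1 / real (Suc n)))" .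
  qed
  also have "\<dots> = ennreal (E0 t1)" by (intro lim_imp_Liminf ennreal_inverse_Suc_limit) simp
  finally have "2 * \<rho>\<^sup>2 \<le> E0 t1" by simp
  then have "\<rho>\<^sup>2 \<le> 0" using \<rho>(1) by linarith
  then show False using \<rho>(2) by simp
qed

end


section \<open>Decay\<close>

text \<open>The sum over the three directions of the constants in \<open>hk1_l2\<close>.\<close>

definition cG :: real where "cG = 3 * (924 * sqrt cK)"
lemma cG_pos: "cG > 0" using cK_pos by (simp add: cG_def)

lemma hk1_l2: assumes s: "s > 0" shows "l2n (hk1 s j) \<le> 924 * sqrt cK * s powr (- 5/4)"
proof -
  have le: "\<bar>hk1 s j z\<bar> \<le> \<bar>924 * kk s z\<bar>" for z using hk1_bound[of s j z] by simp
  have "l2n (hk1 s j) \<le> l2n (\<lambda>z. 924 * kk s z)"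
    by (rule sqi_dominated(2)[OF meas_hk(2) sqi_cmult[OF kk_sqi(1)[OF s]] le])
  also have "\<dots> = 924 * l2n (kk s)" by (simp add: l2n_cmult)
  also have "l2n (kk s) \<le> sqrt cK * s powr (- 5/4)" by (rule kk_l2[OF s])
  finally show ?thesis by simp
qed

context regularized_flow
begin

lemma V_semigroup:
  assumes s: "s > 0" and r: "r > 0"
  shows "V (s + r) k t x = (LINT z|lborel. V r k t z * hk s (z - x))"
proof -
  have int: "integrable (lborel \<Otimes>\<^sub>M lborel) (\<lambda>(z,y). hk s (z - x) * (hk r (y - z) * v k t y))"
    by (rule bilinear_integrable[OF sqi_v sqi_shift(1)[OF hk_sqi(1)[OF s]] hk_L1(1)[OF r]])
  have "(LINT z|lborel. V r k t z * hk s (z - x)) = (LINT z|lborel. (LINT y|lborel. hk s (z - x) * (hk r (y - z) * v k t y)))"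
    unfolding V_def by (simp add: mult.commute)
  also have "\<dots> = (LINT y|lborel. (LINT z|lborel. hk s (z - x) * (hk r (y - z) * v k t y)))"
    by (rule lborel_pair.Fubini_integral[OF int, symmetric])
  also have "\<dots> = (LINT y|lborel. v k t y * hk (s + r) (y - x))"
    by (intro Bochner_Integration.integral_cong refl) (simp add: hk_semigroup[OF s r, symmetric] mult.assoc[symmetric] mult.commute[of "v k t _"])
  finally show ?thesis unfolding V_def by simp
qed

text \<open>The derivative of \<open>S(q) f\<close> in \<open>q\<close> is \<open>\<Delta> S(q) f\<close>; moving one derivative to \<open>f\<close> bounds it by
  \<open>C \<eta> q\<^sup>-\<^sup>5\<^sup>/\<^sup>4\<close>, since \<open>\<nabla>\<close> of the heat kernel has \<open>L\<^sup>2\<close> norm of order \<open>q\<^sup>-\<^sup>5\<^sup>/\<^sup>4\<close>. Integrating from \<open>s\<close> to infinity,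
  where \<open>S(q) f\<close> tends to zero, gives the claim.\<close>

lemma heat_gradient_aux:
  assumes s: "s > 0" and r: "r > 0" and W: "W r t \<le> \<eta>\<^sup>2" and \<eta>: "\<eta> \<ge> 0"
  shows "\<bar>V (s + r) k t x\<bar> \<le> 4 * cG * \<eta> * s powr (- 1/4)"
proof -
  define G where "G q = (LINT z|lborel. V r k t z * hk q (z - x))" for q
  define G' where "G' q = (LINT z|lborel. V r k t z * hkL q (z - x))" for q
  have der: "(G has_real_derivative G' q) (at q)" if "q > 0" for q
    unfolding G_def[abs_def] G'_def by (rule DERIV_heat_s[OF that sqi_V(1)[OF r]])
  have V1n: "l2n (V1 r j k t) \<le> \<eta>" for j
  proof (rule power2_le_imp_le[OF _ \<eta>])
    have "(l2n (V1 r j k t))\<^sup>2 \<le> (\<Sum>k\<in>UNIV. (l2n (V1 r j k t))\<^sup>2)" by (rule member_le_sum) auto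
    also have "\<dots> \<le> W r t" unfolding W_def by (rule member_le_sum) (auto intro: sum_nonneg)
    finally show "(l2n (V1 r j k t))\<^sup>2 \<le> \<eta>\<^sup>2" using W by simp
  qed
  have bd: "\<bar>G' q\<bar> \<le> cG * \<eta> * q powr (- 5/4)" if q: "q > 0" for q
  proof -
    have "G' q = (LINT z|lborel. (\<Sum>j\<in>UNIV. V r k t z * hk2 q j j (z - x)))"
      unfolding G'_def sum_distrib_left[symmetric] sum_hk2 ..
    also have "\<dots> = (\<Sum>j\<in>UNIV. LINT z|lborel. V r k t z * hk2 q j j (z - x))"
      by (intro Bochner_Integration.integral_sum sqi_mult sqi_V sqi_shift hk2_class q r)
    also have "\<dots> = (\<Sum>j\<in>UNIV. - (LINT z|lborel. V1 r j k t z * hk1 q j (z - x)))"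
    proof (rule sum.cong[OF refl])
      fix j
      have "(LINT z|lborel. V1 r j k t z * hk1 q j (z - x)) = - (LINT z|lborel. V r k t z * hk2 q j j (z - x))"
        by (intro integral_by_parts_along[OF deriv_V[OF r] deriv_along_shift[OF deriv_hk1]] cont_Vs continuous_on_shift cont_hk1 cont_hk2 sqi_mult sqi_V sqi_V1 sqi_shift hk1_class hk2_class q r)
      then show "(LINT z|lborel. V r k t z * hk2 q j j (z - x)) = - (LINT z|lborel. V1 r j k t z * hk1 q j (z - x))" by simp
    qed
    also have "\<bar>\<dots>\<bar> \<le> (\<Sum>j\<in>(UNIV::3 set). \<eta> * (924 * sqrt cK * q powr (- 5/4)))"
    proof (rule order_trans[OF sum_abs], rule sum_mono)
      fix j
      have "\<bar>LINT z|lborel. V1 r j k t z * hk1 q j (z - x)\<bar> \<le> l2n (V1 r j k t) * l2n (hk1 q j)"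
        using pair_le[OF sqi_V1(1)[OF r] sqi_shift(1)[OF hk1_class(3)[OF q]]] unfolding sqi_shift(2)[OF hk1_class(3)[OF q]] .
      also have "\<dots> \<le> \<eta> * (924 * sqrt cK * q powr (- 5/4))" by (intro mult_mono V1n hk1_l2 q \<eta>) auto
      finally show "\<bar>- (LINT z|lborel. V1 r j k t z * hk1 q j (z - x))\<bar> \<le> \<eta> * (924 * sqrt cK * q powr (- 5/4))" by simp
    qed
    also have "\<dots> = cG * \<eta> * q powr (- 5/4)" by (simp add: cG_def)
    finally show ?thesis .
  qed
  \<comment> \<open>a primitive of the bound for the derivative, up to sign\<close>
  define m where "m q = 4 * cG * \<eta> * q powr (- 1/4)" for q
  have dm: "(m has_real_derivative - (cG * \<eta> * q powr (- 5/4))) (at q)" if "q > 0" for q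
    unfolding m_def[abs_def] using that by (auto intro!: derivative_eq_intros)
  have up: "\<epsilon> * G s \<le> m s + \<bar>G S\<bar>" if S: "S > s" and \<epsilon>: "\<epsilon> = 1 \<or> \<epsilon> = - 1" for \<epsilon> S
  proof -
    have "\<epsilon> * G s - m s \<le> \<epsilon> * G S - m S"
    proof (rule DERIV_nonneg_imp_nondecreasing[of s S "\<lambda>q. \<epsilon> * G q - m q"])
      fix q assume q: "s \<le> q" "q \<le> S"
      have q0: "q > 0" using q s by simp
      have "((\<lambda>q. \<epsilon> * G q - m q) has_real_derivative \<epsilon> * G' q - (- (cG * \<eta> * q powr (- 5/4)))) (at q)"
        by (intro DERIV_diff DERIV_cmult der dm q0)
      moreover have "0 \<le> \<epsilon> * G' q - (- (cG * \<eta> * q powr (- 5/4)))" using bd[OF q0] \<epsilon> by auto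
      ultimately show "\<exists>y. ((\<lambda>q. \<epsilon> * G q - m q) has_real_derivative y) (at q) \<and> 0 \<le> y" by blast
    qed (use S in simp)
    moreover have "0 \<le> m S" using cG_pos \<eta> by (simp add: m_def)
    moreover have "\<epsilon> * G S \<le> \<bar>G S\<bar>" using \<epsilon> by auto
    ultimately show ?thesis by linarith
  qed
  have absG: "\<bar>G s\<bar> \<le> m s + \<bar>G S\<bar>" if "S > s" for S using up[OF that, of 1] up[OF that, of "-1"] by (auto simp: abs_le_iff)
  have GS: "\<bar>G S\<bar> \<le> S powr (- 3/4) * l2n (v k t)" if "S > 0" for S
  proof -
    have "\<bar>V (S + r) k t x\<bar> \<le> (S + r) powr (- 3/4) * l2n (v k t)" using that r by (intro V_sup_L2) auto
    also have "\<dots> \<le> S powr (- 3/4) * l2n (v k t)" using that r powr_mono2'[of "-(3/4)" S "S + r"] by (intro mult_right_mono) auto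
    finally show ?thesis unfolding G_def V_semigroup[OF that r] .
  qed
  have "((\<lambda>S. m s + S powr (- 3/4) * l2n (v k t)) \<longlongrightarrow> m s + 0 * l2n (v k t)) at_top"
    by (intro tendsto_intros tendsto_neg_powr filterlim_ident) auto
  then have "\<bar>G s\<bar> \<le> m s + 0 * l2n (v k t)"
  proof (rule tendsto_lowerbound)
    show "\<forall>\<^sub>F S in at_top. \<bar>G s\<bar> \<le> m s + S powr (- 3/4) * l2n (v k t)"
      using eventually_gt_at_top[of s]
    proof eventually_elim
      case (elim S)
      then show ?case using absG[of S] GS[of S] s by linarith
    qed
  qed simp
  then show ?thesis unfolding G_def V_semigroup[OF s r] by (simp add: m_def)
qed

text \<open>By continuity in the parameter, the bound of \<open>heat_gradient_aux\<close> needs to be available only for some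
  arbitrarily small mollification parameters.\<close>

lemma heat_gradient:
  assumes s: "s > 0" and W: "\<exists>\<^sub>F n in sequentially. W (1 / real (Suc n)) t \<le> \<eta>\<^sup>2" and \<eta>: "\<eta> \<ge> 0"
  shows "\<bar>V s k t x\<bar> \<le> 4 * cG * \<eta> * s powr (- 1/4)"
proof (rule ccontr)
  assume "\<not> ?thesis"
  then have lt: "4 * cG * \<eta> * s powr (- 1/4) < \<bar>V s k t x\<bar>" by simp
  have "isCont (\<lambda>s. V s k t x) s" by (rule DERIV_isCont[OF DERIV_V_s[OF s]])
  moreover have "(\<lambda>n. s + 1 / real (Suc n)) \<longlonglongrightarrow> s"
    using tendsto_add[OF tendsto_const[of s] LIMSEQ_Suc[OF lim_const_over_n[of 1]]] by simp
  ultimately have "(\<lambda>n. V (s + 1 / real (Suc n)) k t x) \<longlonglongrightarrow> V s k t x" by (rule isCont_tendsto_compose)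
  then have "(\<lambda>n. \<bar>V (s + 1 / real (Suc n)) k t x\<bar>) \<longlonglongrightarrow> \<bar>V s k t x\<bar>" by (rule tendsto_rabs)
  then have "eventually (\<lambda>n. 4 * cG * \<eta> * s powr (- 1/4) < \<bar>V (s + 1 / real (Suc n)) k t x\<bar>) sequentially"
    using lt by (rule order_tendstoD(1))
  with W have "\<exists>\<^sub>F n in sequentially. W (1 / real (Suc n)) t \<le> \<eta>\<^sup>2 \<and> 4 * cG * \<eta> * s powr (- 1/4) < \<bar>V (s + 1 / real (Suc n)) k t x\<bar>"
    by (rule frequently_eventually_frequently)
  then obtain n where "W (1 / real (Suc n)) t \<le> \<eta>\<^sup>2" "4 * cG * \<eta> * s powr (- 1/4) < \<bar>V (s + 1 / real (Suc n)) k t x\<bar>"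
    using frequently_ex by blast
  then show False using heat_gradient_aux[OF s _ _ \<eta>, of "1 / real (Suc n)" t k x] by simp
qed

text \<open>Start from a time \<open>t0 \<in> (t/4, t/2)\<close> with a small gradient. The hypothesis on \<open>t\<close> is the smallness required by
  \<open>bootstrap\<close> for \<open>A = 8 cG \<eta>\<close> and \<open>S \<le> t\<close>, where \<open>\<eta> = 3 \<rho> t\<^sup>-\<^sup>1\<^sup>/\<^sup>2\<close>.\<close>

lemma sup_decay:
  assumes t: "t > 0" and \<rho>: "\<rho> > 0" "E0 (t / 4) \<le> \<rho>\<^sup>2"
    and large: "192 * (1584 * (36 * cK)) * cG * \<rho> \<le> t powr (1/4)"
  shows "vsup_le t (48 * cG * \<rho> * t powr (- 3/4))"
proof -
  obtain t0 where t0: "t / 4 < t0" "t0 < t / 2" and W: "\<exists>\<^sub>F n in sequentially. W (1 / real (Suc n)) t0 \<le> 2 * \<rho>\<^sup>2 / (t / 2 - t / 4)"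
    using good_time[of "t/4" "t/2" \<rho>] t \<rho> by auto
  \<comment> \<open>\<open>good_time\<close> gives the bound \<open>8 \<rho>\<^sup>2 / t\<close> for the squared norm of the gradient, and \<open>8 \<le> 3\<^sup>2\<close>\<close>
  define \<eta> where "\<eta> = 3 * \<rho> * t powr (- 1/2)"
  have \<eta>: "\<eta> > 0" using \<rho> t by (simp add: \<eta>_def)
  have "\<eta>\<^sup>2 = 9 * \<rho>\<^sup>2 / t"
  proof -
    have "(t powr (- 1/2))\<^sup>2 = 1 / t" using t by (simp add: power2_eq_square powr_add[symmetric] powr_minus inverse_eq_divide)
    then show ?thesis by (simp add: \<eta>_def power_mult_distrib)
  qed
  then have "2 * \<rho>\<^sup>2 / (t / 2 - t / 4) \<le> \<eta>\<^sup>2" using t by (simp add: field_simps)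
  with W have W': "\<exists>\<^sub>F n in sequentially. W (1 / real (Suc n)) t0 \<le> \<eta>\<^sup>2"
    by (elim frequently_elim1) simp
  define S where "S = t - t0"
  have S: "t / 2 < S" "S \<le> t" "S > 0" using t0 t by (auto simp: S_def)
  define A where "A = 8 * cG * \<eta>"
  have "vsup_le (t0 + S) (A * S powr (- 1/4))"
  proof (rule bootstrap)
    show "0 < t0" "S > 0" "A > 0" using t0 t S \<eta> cG_pos by (auto simp: A_def)
    show "\<bar>V s k t0 x\<bar> \<le> A / 2 * s powr (- 1/4)" if "0 < s" for s k x
      using heat_gradient[OF that W', of k x] \<eta> by (simp add: A_def)
    have "8 * (1584 * (36 * cK)) * A * S powr (1/4) \<le> 8 * (1584 * (36 * cK)) * A * t powr (1/4)"
      using S cK_pos cG_pos \<eta> by (intro mult_left_mono powr_mono2) (auto simp: A_def)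
    also have "\<dots> = (192 * (1584 * (36 * cK)) * cG * \<rho>) * (t powr (- 1/2) * t powr (1/4))"
      by (simp add: A_def \<eta>_def mult_ac)
    also have "\<dots> \<le> t powr (1/4) * (t powr (- 1/2) * t powr (1/4))" by (rule mult_right_mono[OF large]) simp
    also have "\<dots> = 1" using t by (simp add: powr_add[symmetric])
    finally show "8 * (1584 * (36 * cK)) * A * S powr (1/4) \<le> 1" .
  qed
  moreover have "A * S powr (- 1/4) \<le> 48 * cG * \<rho> * t powr (- 3/4)"
  proof -
    have "S powr (- 1/4) \<le> (t / 2) powr (- 1/4)" using S t powr_mono2'[of "-(1/4)" "t/2" S] by simp
    also have "\<dots> = 2 powr (1/4) * t powr (- 1/4)" using t by (simp add: powr_divide powr_minus field_simps)
    also have "\<dots> \<le> 2 * t powr (- 1/4)" using powr_mono[of "1/4" 1 "2::real"] by (intro mult_right_mono) auto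
    finally have "A * S powr (- 1/4) \<le> A * (2 * t powr (- 1/4))" using \<eta> cG_pos by (intro mult_left_mono) (auto simp: A_def)
    also have "\<dots> = 48 * cG * \<rho> * (t powr (- 1/2) * t powr (- 1/4))" by (simp add: A_def \<eta>_def)
    also have "t powr (- 1/2) * t powr (- 1/4) = t powr (- 3/4)" by (simp add: powr_add[symmetric])
    finally show ?thesis .
  qed
  ultimately show ?thesis unfolding S_def using vsup_le_mono by simp
qed

text \<open>The heat kernel has \<open>L\<^sup>2\<close> norm at most \<open>s\<^sup>-\<^sup>3\<^sup>/\<^sup>4\<close>, which by Young's inequality bounds the flow of the integrable part.\<close>

lemma linear_decay:
  assumes s: "s > 0" and e: "\<And>y. v k t y = f y + h y" and p: "integrable lborel f" "sqi f" and q: "sqi h"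
  shows "l2n (V s k t) \<le> l1n f * s powr (- 3/4) + l2n h"
proof -
  note [measurable] = sqi_meas[OF p(2)] sqi_meas[OF q]
  let ?P = "\<lambda>x. LINT y|lborel. f y * hk s (y - x)" and ?Q = "\<lambda>x. LINT y|lborel. h y * hk s (y - x)"
  have V: "V s k t = (\<lambda>x. ?P x + ?Q x)"
    unfolding V_def e distrib_right
    by (intro ext Bochner_Integration.integral_add sqi_mult p q sqi_shift hk_sqi s)
  have Q: "sqi ?Q" "l2n ?Q \<le> l1n (hk s) * l2n h" by (rule conv_L2_left[OF q hk_L1(1)[OF s]])+
  let ?p = "\<lambda>z. f (0 - z)"
  have pi: "integrable lborel ?p" by (rule integrable_reflect_vec[OF p(1)])
  have pn: "l1n ?p = l1n f" unfolding l1n_def using integral_reflect_vec[of "\<lambda>z. \<bar>f z\<bar>" 0] by simp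
  have Pe: "?P x = (LINT w|lborel. hk s w * ?p (w - x))" for x
  proof -
    have "?P x = (LINT w|lborel. f (x - w) * hk s ((x - w) - x))"
      by (rule integral_reflect_vec[of "\<lambda>y. f y * hk s (y - x)" x, symmetric]) measurable
    then show ?thesis by (simp add: hk_even mult.commute)
  qed
  have P: "sqi ?P" "l2n ?P \<le> l1n f * l2n (hk s)"
    using conv_L2_left[OF hk_sqi(1)[OF s] pi] unfolding Pe pn by auto
  have "l2n (V s k t) \<le> l2n ?P + l2n ?Q" unfolding V by (rule l2n_triangle[OF P(1) Q(1)])
  also have "\<dots> \<le> l1n f * s powr (- 3/4) + l2n h"
  proof (rule add_mono)
    have "l2n (hk s) \<le> sqrt (lam s ^ 3)" by (rule hk_sqi(2)[OF s])
    also have "\<dots> \<le> sqrt (s powr (- real 3 / 2))" using lam_pow_le[OF s, of 3] by (rule real_sqrt_le_mono)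
    also have "\<dots> = s powr (- 3/4)" using s by (simp add: sqrt_powr)
    finally show "l2n ?P \<le> l1n f * s powr (- 3/4)" using P(2) by (meson mult_left_mono l1n_nonneg order_trans)
    show "l2n ?Q \<le> l2n h" using Q(2) hk_L1(3)[OF s] by simp
  qed
  finally show ?thesis .
qed

text \<open>Pair the mild inequality with \<open>\<bar>v(t)\<bar>\<close>. Before the time \<open>T\<close> the products \<open>b\<^sub>j v\<^sub>i\<close> are bounded in \<open>L\<^sup>1\<close> and the
  kernel in \<open>L\<^sup>2\<close> is small, because \<open>t - r \<ge> t - T\<close>. After \<open>T\<close> they decay in \<open>L\<^sup>2\<close> like \<open>r\<^sup>-\<^sup>3\<^sup>/\<^sup>4\<close> by
  hypothesis, which against \<open>(t - r)\<^sup>-\<^sup>1\<^sup>/\<^sup>2\<close> leaves \<open>t\<^sup>-\<^sup>1\<^sup>/\<^sup>4\<close>.\<close>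

lemma L2_decay:
  assumes T: "0 < T" "T < t" and M: "\<And>k r. 0 \<le> r \<Longrightarrow> l2n (v k r) \<le> M"
    and c: "\<And>r. T \<le> r \<Longrightarrow> vsup_le r (c * r powr (- 3/4))" and c0: "c \<ge> 0"
  shows "l2n (v k t) \<le> l2n (V t k 0) + 1584 * (9 * M\<^sup>2 * sqrt cK * T * (t - T) powr (- 5/4) + 9 * cK * c * M * (6 * (t / 2) powr (- 1/4)))"
proof -
  have M0: "M \<ge> 0" using M[of 0 undefined] l2n_nonneg[of "v undefined 0"] by linarith
  define g where "g x = \<bar>v k t x\<bar>" for x
  have g: "sqi g" "l2n g = l2n (v k t)" unfolding g_def using sqi_v by auto
  note [measurable] = sqi_meas[OF g(1)]
  let ?D1 = "9 * M\<^sup>2 * sqrt cK * (t - T) powr (- 5/4)"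
  let ?D2 = "\<lambda>r. 9 * cK * c * M * ((t - r) powr - (1/2) * (r - 0) powr - (3/4))"
  have V0: "V t k 0 \<in> borel_measurable borel" using sqi_meas[OF sqi_V(1)] T by simp
  have Jm: "(\<lambda>x. J 0 t x) \<in> borel_measurable borel" unfolding J_def by measurable
  have SvL2: "l2n (Sv r) \<le> 9 * (a * M)" if a: "vsup_le r a" and r: "r \<ge> 0" for r a
  proof -
    have a0: "a \<ge> 0" by (rule vsup_le_nonneg[OF a])
    have "Sv r y \<le> 3 * a * (\<Sum>i\<in>UNIV. \<bar>v i r y\<bar>)" for y
    proof -
      have "\<bar>b j r y * v i r y\<bar> \<le> a * \<bar>v i r y\<bar>" for i j
        unfolding abs_mult by (intro mult_right_mono b_sup) (use a in \<open>auto simp: vsup_le_def\<close>)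
      then have "Sv r y \<le> (\<Sum>i\<in>UNIV. \<Sum>j\<in>(UNIV::3 set). a * \<bar>v i r y\<bar>)" unfolding Sv_def by (intro sum_mono)
      then show ?thesis by (simp add: sum_distrib_left mult_ac)
    qed
    then have "(Sv r y)\<^sup>2 \<le> (3 * a * (\<Sum>i\<in>UNIV. \<bar>v i r y\<bar>))\<^sup>2" for y by (intro power_mono) auto
    also have "(3 * a * (\<Sum>i\<in>UNIV. \<bar>v i r y\<bar>))\<^sup>2 \<le> (3 * a)\<^sup>2 * (3 * (\<Sum>i\<in>UNIV. (v i r y)\<^sup>2))" for y
      unfolding power_mult_distrib[of "3 * a"]
      using sum_squared_le_sum_of_squares[of "\<lambda>i. \<bar>v i r y\<bar>" UNIV] by (intro mult_left_mono) auto
    finally have "(l2n (Sv r))\<^sup>2 \<le> (LINT y|lborel. (3 * a)\<^sup>2 * (3 * (\<Sum>i\<in>UNIV. (v i r y)\<^sup>2)))"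
      unfolding l2n_sq by (intro integral_mono) (use sqi_Sv sqi_v in \<open>auto simp: sqi_def\<close>)
    also have "\<dots> = (3 * a)\<^sup>2 * (3 * (\<Sum>i\<in>UNIV. (l2n (v i r))\<^sup>2))"
      unfolding l2n_sq using sqi_v by (simp add: sqi_def)
    also have "\<dots> \<le> (3 * a)\<^sup>2 * (3 * (\<Sum>i\<in>(UNIV::3 set). M\<^sup>2))" by (intro mult_left_mono sum_mono power_mono M r) auto
    also have "\<dots> = (9 * (a * M))\<^sup>2" by (simp add: power_mult_distrib)
    finally show ?thesis by (rule power2_le_imp_le) (use a0 M0 in simp)
  qed
  have SvL1: "(\<integral>\<^sup>+y. ennreal (Sv r y) \<partial>lborel) \<le> ennreal (9 * M\<^sup>2)" if r: "r \<ge> 0" for r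
  proof -
    have "(\<integral>\<^sup>+y. ennreal (Sv r y) \<partial>lborel) = (\<integral>\<^sup>+y. (\<Sum>i\<in>UNIV. \<Sum>j\<in>UNIV. ennreal \<bar>b j r y\<bar> * ennreal \<bar>v i r y\<bar>) \<partial>lborel)"
      unfolding Sv_def by (simp add: abs_mult sum_nonneg ennreal_mult flip: sum_ennreal)
    also have "\<dots> = (\<Sum>i\<in>UNIV. \<Sum>j\<in>UNIV. \<integral>\<^sup>+y. ennreal \<bar>b j r y\<bar> * ennreal \<bar>v i r y\<bar> \<partial>lborel)"
      by (subst nn_integral_sum, measurable) (intro sum.cong[OF refl] nn_integral_sum, measurable)
    also have "\<dots> \<le> (\<Sum>i\<in>(UNIV::3 set). \<Sum>j\<in>(UNIV::3 set). ennreal (M * M))"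
      by (intro sum_mono order_trans[OF nn_pair_le[OF b_L2(1) sqi_v]] ennreal_leI mult_mono order_trans[OF b_L2(2)] M r M0) auto
    also have "\<dots> = ennreal (9 * M\<^sup>2)" using M0 by (simp add: power2_eq_square ennreal_mult)
    finally show ?thesis .
  qed
  have X1: "(\<integral>\<^sup>+x. (\<integral>\<^sup>+y. ennreal (g x) * (ennreal (kk (t - r) (y - x)) * ennreal (Sv r y)) \<partial>lborel) \<partial>lborel) \<le> ennreal (l2n g * ?D1)" if r: "0 < r" "r < T" for r
  proof -
    have tr: "t - r > 0" using r T by simp
    have "(\<integral>\<^sup>+x. (\<integral>\<^sup>+y. ennreal (g x) * (ennreal (kk (t - r) (y - x)) * ennreal (Sv r y)) \<partial>lborel) \<partial>lborel)
      = (\<integral>\<^sup>+y. (\<integral>\<^sup>+x. ennreal (g x) * (ennreal (kk (t - r) (y - x)) * ennreal (Sv r y)) \<partial>lborel) \<partial>lborel)"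
      by (rule lborel_pair.Fubini') measurable
    also have "\<dots> \<le> (\<integral>\<^sup>+y. ennreal (l2n g * (sqrt cK * (t - T) powr (- 5/4))) * ennreal (Sv r y) \<partial>lborel)"
    proof (rule nn_integral_mono)
      fix y
      have k: "sqi (\<lambda>x. kk (t - r) (y - x))" "l2n (\<lambda>x. kk (t - r) (y - x)) = l2n (kk (t - r))"
        using sqi_reflect[OF kk_sqi(1)[OF tr]] by auto
      have "(\<integral>\<^sup>+x. ennreal (g x) * (ennreal (kk (t - r) (y - x)) * ennreal (Sv r y)) \<partial>lborel) = (\<integral>\<^sup>+x. ennreal \<bar>g x\<bar> * ennreal \<bar>kk (t - r) (y - x)\<bar> \<partial>lborel) * ennreal (Sv r y)"
        by (subst nn_integral_multc[symmetric]) (auto simp: g_def mult.assoc)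
      also have "\<dots> \<le> ennreal (l2n g * l2n (kk (t - r))) * ennreal (Sv r y)"
        using nn_pair_le[OF g(1) k(1)] unfolding k(2) by (rule mult_right_mono) simp
      also have "\<dots> \<le> ennreal (l2n g * (sqrt cK * (t - T) powr (- 5/4))) * ennreal (Sv r y)"
      proof (intro mult_right_mono ennreal_leI mult_left_mono)
        have "l2n (kk (t - r)) \<le> sqrt cK * (t - r) powr (- 5/4)" by (rule kk_l2[OF tr])
        also have "\<dots> \<le> sqrt cK * (t - T) powr (- 5/4)"
          using r T cK_pos powr_mono2'[of "-(5/4)" "t - T" "t - r"] by (intro mult_left_mono) auto
        finally show "l2n (kk (t - r)) \<le> sqrt cK * (t - T) powr (- 5/4)" .
      qed auto
      finally show "(\<integral>\<^sup>+x. ennreal (g x) * (ennreal (kk (t - r) (y - x)) * ennreal (Sv r y)) \<partial>lborel) \<le> ennreal (l2n g * (sqrt cK * (t - T) powr (- 5/4))) * ennreal (Sv r y)" .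
    qed
    also have "\<dots> = ennreal (l2n g * (sqrt cK * (t - T) powr (- 5/4))) * (\<integral>\<^sup>+y. ennreal (Sv r y) \<partial>lborel)"
      by (rule nn_integral_cmult) measurable
    also have "\<dots> \<le> ennreal (l2n g * (sqrt cK * (t - T) powr (- 5/4))) * ennreal (9 * M\<^sup>2)"
      by (intro mult_left_mono SvL1) (use r in auto)
    also have "\<dots> = ennreal (l2n g * ?D1)" using cK_pos by (subst ennreal_mult[symmetric]) (auto simp: mult_ac)
    finally show ?thesis .
  qed
  have X2: "(\<integral>\<^sup>+x. (\<integral>\<^sup>+y. ennreal (g x) * (ennreal (kk (t - r) (y - x)) * ennreal (Sv r y)) \<partial>lborel) \<partial>lborel) \<le> ennreal (l2n g * ?D2 r)" if r: "T \<le> r" "r < t" for r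
  proof -
    have tr: "t - r > 0" using r by simp
    have "(\<integral>\<^sup>+x. (\<integral>\<^sup>+y. ennreal (g x) * (ennreal (kk (t - r) (y - x)) * ennreal (Sv r y)) \<partial>lborel) \<partial>lborel) \<le> ennreal (l1n (kk (t - r)) * l2n g * l2n (Sv r))"
      using bilinear_nn[OF sqi_Sv g(1) kk_L1(1)[OF tr], of r] by (simp add: g_def)
    also have "\<dots> \<le> ennreal ((cK * (t - r) powr - (1/2)) * l2n g * (9 * (c * r powr (- 3/4) * M)))"
    proof (intro ennreal_leI mult_mono)
      show "l1n (kk (t - r)) \<le> cK * (t - r) powr - (1/2)"
        using kk_L1(2)[OF tr] lam_le[OF tr] cK_pos by (simp add: mult_left_mono order_trans)
      show "l2n (Sv r) \<le> 9 * (c * r powr (- 3/4) * M)" by (rule SvL2[OF c]) (use r T in auto)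
    qed (use cK_pos in auto)
    also have "\<dots> = ennreal (l2n g * ?D2 r)" by (simp add: mult_ac)
    finally show ?thesis .
  qed
  have GJ: "(\<integral>\<^sup>+x. ennreal (g x) * J 0 t x \<partial>lborel) \<le> ennreal (l2n g * (?D1 * T + 9 * cK * c * M * (6 * (t / 2) powr (- 1/4))))"
  proof -
    have "(\<integral>\<^sup>+x. ennreal (g x) * J 0 t x \<partial>lborel) = (\<integral>\<^sup>+x. (\<integral>\<^sup>+r. (\<integral>\<^sup>+y. ennreal (g x) * (ennreal (kk (t - r) (y - x)) * ennreal (Sv r y)) \<partial>lborel) * indicator {0<..<t} r \<partial>lborel) \<partial>lborel)"
    proof (rule nn_integral_cong)
      fix x
      have "ennreal (g x) * J 0 t x = (\<integral>\<^sup>+r. ennreal (g x) * ((\<integral>\<^sup>+y. ennreal (kk (t - r) (y - x)) * ennreal (Sv r y) \<partial>lborel) * indicator {0<..<t} r) \<partial>lborel)"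
        unfolding J_def by (rule nn_integral_cmult[symmetric]) measurable
      also have "\<dots> = (\<integral>\<^sup>+r. (\<integral>\<^sup>+y. ennreal (g x) * (ennreal (kk (t - r) (y - x)) * ennreal (Sv r y)) \<partial>lborel) * indicator {0<..<t} r \<partial>lborel)"
      proof (rule nn_integral_cong)
        fix r
        have "(\<integral>\<^sup>+y. ennreal (g x) * (ennreal (kk (t - r) (y - x)) * ennreal (Sv r y)) \<partial>lborel) = ennreal (g x) * (\<integral>\<^sup>+y. ennreal (kk (t - r) (y - x)) * ennreal (Sv r y) \<partial>lborel)"
          by (rule nn_integral_cmult) measurable
        then show "ennreal (g x) * ((\<integral>\<^sup>+y. ennreal (kk (t - r) (y - x)) * ennreal (Sv r y) \<partial>lborel) * indicator {0<..<t} r) =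
           (\<integral>\<^sup>+y. ennreal (g x) * (ennreal (kk (t - r) (y - x)) * ennreal (Sv r y)) \<partial>lborel) * indicator {0<..<t} r"
          by (simp only: mult.assoc)
      qed
      finally show "ennreal (g x) * J 0 t x = (\<integral>\<^sup>+r. (\<integral>\<^sup>+y. ennreal (g x) * (ennreal (kk (t - r) (y - x)) * ennreal (Sv r y)) \<partial>lborel) * indicator {0<..<t} r \<partial>lborel)" .
    qed
    also have "\<dots> = (\<integral>\<^sup>+r. (\<integral>\<^sup>+x. (\<integral>\<^sup>+y. ennreal (g x) * (ennreal (kk (t - r) (y - x)) * ennreal (Sv r y)) \<partial>lborel) * indicator {0<..<t} r \<partial>lborel) \<partial>lborel)"
      by (rule lborel_pair.Fubini') measurable
    also have "\<dots> \<le> (\<integral>\<^sup>+r. ennreal (l2n g * ?D1) * indicator {0..T} r + ennreal (l2n g * (9 * cK * c * M)) * (ennreal ((t - r) powr - (1/2) * (r - 0) powr - (3/4)) * indicator {0<..<t} r) \<partial>lborel)"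
    proof (rule nn_integral_mono)
      fix r
      let ?X = "\<integral>\<^sup>+x. (\<integral>\<^sup>+y. ennreal (g x) * (ennreal (kk (t - r) (y - x)) * ennreal (Sv r y)) \<partial>lborel) \<partial>lborel"
      have e: "(\<integral>\<^sup>+x. (\<integral>\<^sup>+y. ennreal (g x) * (ennreal (kk (t - r) (y - x)) * ennreal (Sv r y)) \<partial>lborel) * indicator {0<..<t} r \<partial>lborel) = ?X * indicator {0<..<t} r"
        by (rule nn_integral_multc) measurable
      consider "r \<notin> {0<..<t}" | "0 < r" "r < T" | "T \<le> r" "r < t" using T by force
      then show "(\<integral>\<^sup>+x. (\<integral>\<^sup>+y. ennreal (g x) * (ennreal (kk (t - r) (y - x)) * ennreal (Sv r y)) \<partial>lborel) * indicator {0<..<t} r \<partial>lborel) \<le>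
        ennreal (l2n g * ?D1) * indicator {0..T} r + ennreal (l2n g * (9 * cK * c * M)) * (ennreal ((t - r) powr - (1/2) * (r - 0) powr - (3/4)) * indicator {0<..<t} r)"
        unfolding e
      proof cases
        case 2
        then show "?X * indicator {0<..<t} r \<le> ennreal (l2n g * ?D1) * indicator {0..T} r + ennreal (l2n g * (9 * cK * c * M)) * (ennreal ((t - r) powr - (1/2) * (r - 0) powr - (3/4)) * indicator {0<..<t} r)"
          using X1[of r] T by (simp add: add_increasing2)
      next
        case 3
        have "ennreal (l2n g * ?D2 r) = ennreal (l2n g * (9 * cK * c * M)) * ennreal ((t - r) powr - (1/2) * (r - 0) powr - (3/4))"
          using cK_pos c0 M0 by (subst ennreal_mult[symmetric]) (auto simp: mult_ac)
        then show "?X * indicator {0<..<t} r \<le> ennreal (l2n g * ?D1) * indicator {0..T} r + ennreal (l2n g * (9 * cK * c * M)) * (ennreal ((t - r) powr - (1/2) * (r - 0) powr - (3/4)) * indicator {0<..<t} r)"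
          using X2[of r] 3 T by (simp add: add_increasing)
      qed simp
    qed
    also have "\<dots> = ennreal (l2n g * ?D1) * ennreal T + ennreal (l2n g * (9 * cK * c * M)) * (\<integral>\<^sup>+r. ennreal ((t - r) powr - (1/2) * (r - 0) powr - (3/4)) * indicator {0<..<t} r \<partial>lborel)"
      using T by (subst nn_integral_add) (auto simp: nn_integral_cmult nn_integral_cmult_indicator)
    also have "\<dots> \<le> ennreal (l2n g * ?D1) * ennreal T + ennreal (l2n g * (9 * cK * c * M)) * ennreal (6 * (t / 2) powr (- 1/4))"
    proof (intro add_left_mono mult_left_mono)
      have "(\<integral>\<^sup>+r. ennreal ((t - r) powr - (1/2) * (r - 0) powr - (3/4)) * indicator {0<..<t} r \<partial>lborel) \<le> ennreal (((t - 0) / 2) powr (1 - 1/2 - 3/4) * (1 / (1 - 1/2) + 1 / (1 - 3/4)))"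
        by (rule nn_beta) (use T in auto)
      then show "(\<integral>\<^sup>+r. ennreal ((t - r) powr - (1/2) * (r - 0) powr - (3/4)) * indicator {0<..<t} r \<partial>lborel) \<le> ennreal (6 * (t / 2) powr (- 1/4))"
        by (simp add: mult.commute)
    qed simp
    also have "\<dots> = ennreal (l2n g * (?D1 * T + 9 * cK * c * M * (6 * (t / 2) powr (- 1/4))))"
      using T cK_pos c0 M0 by (simp add: distrib_left mult.assoc flip: ennreal_mult ennreal_plus)
    finally show ?thesis .
  qed
  define Z where "Z = l2n (V t k 0) + 1584 * (?D1 * T + 9 * cK * c * M * (6 * (t / 2) powr (- 1/4)))"
  have D0: "0 \<le> ?D1 * T + 9 * cK * c * M * (6 * (t / 2) powr (- 1/4))" using T cK_pos c0 M0 by simp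
  have Z0: "Z \<ge> 0" unfolding Z_def using D0 by simp
  have "ennreal ((l2n g)\<^sup>2) = (\<integral>\<^sup>+x. ennreal (g x) * ennreal \<bar>v k t x\<bar> \<partial>lborel)"
    unfolding nn_sqi[OF g(1), symmetric]
    by (intro nn_integral_cong) (simp add: g_def power2_eq_square ennreal_mult[symmetric])
  also have "\<dots> \<le> (\<integral>\<^sup>+x. ennreal (g x) * ennreal \<bar>V t k 0 x\<bar> + 1584 * (ennreal (g x) * J 0 t x) \<partial>lborel)"
  proof (rule nn_integral_mono)
    fix x
    have "ennreal \<bar>v k t x\<bar> \<le> ennreal \<bar>V t k 0 x\<bar> + 1584 * J 0 t x" using mild_inequality[of 0 t k x] T by simp
    then have "ennreal (g x) * ennreal \<bar>v k t x\<bar> \<le> ennreal (g x) * (ennreal \<bar>V t k 0 x\<bar> + 1584 * J 0 t x)" by (rule mult_left_mono) simp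
    then show "ennreal (g x) * ennreal \<bar>v k t x\<bar> \<le> ennreal (g x) * ennreal \<bar>V t k 0 x\<bar> + 1584 * (ennreal (g x) * J 0 t x)"
      by (simp add: distrib_left mult.left_commute)
  qed
  also have "\<dots> = (\<integral>\<^sup>+x. ennreal (g x) * ennreal \<bar>V t k 0 x\<bar> \<partial>lborel) + 1584 * (\<integral>\<^sup>+x. ennreal (g x) * J 0 t x \<partial>lborel)"
    using V0 Jm by (subst nn_integral_add) (auto simp: nn_integral_cmult)
  also have "\<dots> \<le> ennreal (l2n g * l2n (V t k 0)) + 1584 * ennreal (l2n g * (?D1 * T + 9 * cK * c * M * (6 * (t / 2) powr (- 1/4))))"
  proof (intro add_mono mult_left_mono GJ)
    show "(\<integral>\<^sup>+x. ennreal (g x) * ennreal \<bar>V t k 0 x\<bar> \<partial>lborel) \<le> ennreal (l2n g * l2n (V t k 0))"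
      using nn_pair_le[OF g(1) sqi_V(1)[of t k 0]] T by (simp add: g_def)
  qed simp
  also have "\<dots> = ennreal (l2n g * Z)"
  proof -
    have gen: "ennreal (a * b) + 1584 * ennreal (a * D) = ennreal (a * (b + 1584 * D))" if "a \<ge> 0" "b \<ge> 0" "D \<ge> 0" for a b D :: real
    proof -
      have 1: "1584 * ennreal (a * D) = ennreal (1584 * (a * D))" by (rule numeral_mult_ennreal) (use that in simp)
      have "ennreal (a * b) + ennreal (1584 * (a * D)) = ennreal (a * b + 1584 * (a * D))"
        by (rule ennreal_plus[symmetric]) (use that in auto)
      then show ?thesis unfolding 1 by (simp add: distrib_left mult.left_commute)
    qed
    show ?thesis unfolding Z_def by (rule gen) (use D0 in auto)
  qed
  finally have "(l2n g)\<^sup>2 \<le> l2n g * Z" using Z0 by simp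
  then have "l2n g \<le> Z"
    using Z0 by (cases "l2n g = 0") (auto simp: power2_eq_square mult_le_cancel_left less_le)
  then show ?thesis unfolding g(2) Z_def by (simp add: mult_ac)
qed

end


section \<open>The regularized problem\<close>

text \<open>On the half space derivatives are taken relative to the closed set, but a slice \<open>t = const\<close> lies inside
  it, so spatial derivatives are ordinary ones even at \<open>t = 0\<close>.\<close>

lemma slice_derivative:
  fixes F :: "'a::euclidean_space \<times> real \<Rightarrow> 'b::real_normed_vector"
  assumes F: "F differentiable_on (UNIV \<times> {0..})" and t: "t \<ge> 0"
  shows "((\<lambda>y. F (y, t)) has_derivative (\<lambda>h. frechet_derivative F (at (x, t) within UNIV \<times> {0..}) (h, 0))) (at x)"
proof -
  have "(F has_derivative frechet_derivative F (at (x, t) within UNIV \<times> {0..})) (at (x, t) within UNIV \<times> {0..})"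
    using F t unfolding differentiable_on_def frechet_derivative_works by auto
  then have "(F has_derivative frechet_derivative F (at (x, t) within UNIV \<times> {0..})) (at (x, t) within (\<lambda>y. (y, t)) ` UNIV)"
    by (rule has_derivative_subset) (use t in auto)
  moreover have "((\<lambda>y. (y, t)) has_derivative (\<lambda>h. (h, 0))) (at x)"
    by (auto intro!: derivative_eq_intros)
  ultimately show ?thesis using has_derivative_in_compose by blast
qed

lemma time_derivative:
  fixes F :: "'a::euclidean_space \<times> real \<Rightarrow> 'b::real_normed_vector"
  assumes F: "F differentiable_on (UNIV \<times> {0..})" and t: "t > 0"
  shows "((\<lambda>s. F (x, s)) has_vector_derivative partial_within (UNIV \<times> {0..}) (0, 1) F (x, t)) (at t)"
proof -
  let ?D = "frechet_derivative F (at (x, t) within UNIV \<times> {0..})"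
  have D: "(F has_derivative ?D) (at (x, t) within UNIV \<times> {0..})"
    using F t unfolding differentiable_on_def frechet_derivative_works by auto
  then have "(F has_derivative ?D) (at (x, t) within (\<lambda>s. (x, s)) ` {0..})"
    by (rule has_derivative_subset) auto
  moreover have "((\<lambda>s. (x, s)) has_derivative (\<lambda>h. (0, h))) (at t within {0..})"
    by (auto intro!: derivative_eq_intros)
  ultimately have "((\<lambda>s. F (x, s)) has_derivative (\<lambda>h. ?D (0, h))) (at t within {0..})"
    using has_derivative_in_compose by blast
  moreover have "at t within {0..} = at t" using t by (intro at_within_interior) (auto simp: interior_real_atLeast)
  moreover have "(\<lambda>h. ?D (0, h)) = (\<lambda>h. h *\<^sub>R ?D (0, 1))"
    by (rule ext, rule linear_cmul[OF has_derivative_linear[OF D], of _ "(0, 1)",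
          unfolded scaleR_Pair scaleR_zero_right real_scaleR_def mult_1_right])
  ultimately show ?thesis by (simp only: has_vector_derivative_def partial_within_def)
qed

lemma partial_slice:
  fixes F :: "'a::euclidean_space \<times> real \<Rightarrow> 'b::real_normed_vector"
  assumes "F differentiable_on (UNIV \<times> {0..})" "t \<ge> 0"
  shows "partial e (\<lambda>y. F (y, t)) = (\<lambda>x. partial_within (UNIV \<times> {0..}) (e, 0) F (x, t))"
  unfolding partial_within_def by (rule ext) (simp add: frechet_derivative_at[OF slice_derivative[OF assms], symmetric])

lemma deriv_along_linear:
  assumes f: "\<And>x. (f has_derivative f' x) (at x)" and L: "bounded_linear L"
  shows "deriv_along e (\<lambda>x. L (f x)) (\<lambda>x. L (f' x e))"
  unfolding deriv_along_def
proof
  fix x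
  have "((\<lambda>h. x + h *\<^sub>R e) has_derivative (\<lambda>h. h *\<^sub>R e)) (at 0)" by (auto intro!: derivative_eq_intros)
  moreover have "(f has_derivative f' x) (at (x + 0 *\<^sub>R e))" using f by simp
  ultimately have "((\<lambda>h. f (x + h *\<^sub>R e)) has_derivative (\<lambda>h. f' x (h *\<^sub>R e))) (at 0)"
    by (rule has_derivative_compose)
  from bounded_linear.has_derivative[OF L this]
  show "((\<lambda>h. L (f (x + h *\<^sub>R e))) has_real_derivative L (f' x e)) (at 0)"
    by (simp add: has_field_derivative_def linear_cmul[OF has_derivative_linear[OF f]] linear_cmul[OF bounded_linear.linear[OF L]] mult_commute_abs)
qed

lemma slice_deriv_along:
  fixes F :: "'a::euclidean_space \<times> real \<Rightarrow> 'b::real_normed_vector"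
  assumes "F differentiable_on (UNIV \<times> {0..})" "t \<ge> 0" "bounded_linear L"
  shows "deriv_along e (\<lambda>x. L (F (x, t))) (\<lambda>x. L (partial e (\<lambda>y. F (y, t)) x))"
  using deriv_along_linear[OF slice_derivative[OF assms(1,2)] assms(3), of e]
  unfolding partial_slice[OF assms(1,2)] by (simp add: partial_within_def)

lemma smooth_on_differentiable: "smooth_on S f \<Longrightarrow> f differentiable_on S"
  unfolding smooth_on_def by (metis Ck_on.simps(2))

lemma smooth_on_continuous: "smooth_on S f \<Longrightarrow> continuous_on S f"
  unfolding smooth_on_def by (metis Ck_on.simps(1))

lemma smooth_on_partial: "smooth_on S f \<Longrightarrow> b \<in> Basis \<Longrightarrow> smooth_on S (partial_within S b f)"
  unfolding smooth_on_def by (metis Ck_on.simps(2))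

lemma cont_slice_half:
  "continuous_on (UNIV \<times> {0..}) F \<Longrightarrow> t \<ge> 0 \<Longrightarrow> continuous_on UNIV (\<lambda>x. F (x, t :: real))"
  by (erule continuous_on_compose2) (auto intro!: continuous_intros)

lemma axis_Basis_pair: "(axis j (1::real), 0 :: real) \<in> Basis" "(0 :: real ^ 3, 1 :: real) \<in> Basis"
  by (auto simp: Basis_prod_def Basis_vec_def image_iff)

lemma integral_scale:
  fixes G :: "vec3 \<Rightarrow> real"
  assumes [measurable]: "G \<in> borel_measurable borel" and \<delta>: "\<delta> > 0"
  shows "(LINT z|lborel. G (- (z /\<^sub>R \<delta>)) / \<delta> ^ 3) = (LINT z|lborel. G z)"
proof -
  have "(LINT z|lborel. G z) = (LINT z|density (distr lborel borel (\<lambda>x. 0 + (- (1 / \<delta>)) *\<^sub>R x)) (\<lambda>_. ennreal (\<bar>- (1 / \<delta>)\<bar> ^ DIM(vec3))). G z)"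
    using \<delta> by (subst lborel_affine[of "- (1 / \<delta>)" 0]) auto
  also have "\<dots> = (LINT z|lborel. (1 / \<delta>) ^ 3 * G (- (z /\<^sub>R \<delta>)))"
    using \<delta> by (subst integral_density) (auto simp: integral_distr inverse_eq_divide)
  finally show ?thesis by (simp add: power_divide mult.commute)
qed

text \<open>The reflected and scaled mollifier: mollification is \<open>\<integral> f(y) mkern (y - x) dy\<close>, in the convention used for all
  convolutions here. Its derivative in direction \<open>e\<close> is \<open>mkern1\<close>.\<close>

definition mkern :: "(vec3 \<Rightarrow> real) \<Rightarrow> real \<Rightarrow> vec3 \<Rightarrow> real" where
  "mkern G \<delta> z = G (- (z /\<^sub>R \<delta>)) / \<delta> ^ 3"

definition mkern1 :: "(vec3 \<Rightarrow> real) \<Rightarrow> real \<Rightarrow> vec3 \<Rightarrow> vec3 \<Rightarrow> real" where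
  "mkern1 G \<delta> e z = - (partial e G (- (z /\<^sub>R \<delta>)) / \<delta> ^ 4)"

lemma csupp_mkern:
  assumes G: "mollifier G" and \<delta>: "\<delta> > 0"
  shows "csupp (mkern G \<delta>)" "csupp (mkern1 G \<delta> (axis j 1))"
proof -
  have s: "smooth_on UNIV G" and K: "compact (closure {x. G x \<noteq> 0})" using G by (auto simp: mollifier_def test_function_def)
  obtain R where R: "\<And>x. x \<in> closure {x. G x \<noteq> 0} \<Longrightarrow> norm x \<le> R"
    using compact_imp_bounded[OF K] unfolding bounded_iff by auto
  have z: "G x = 0" if "norm x > R" for x using R[OF subsetD[OF closure_subset]] that by force
  have z1: "partial e G x = 0" if x: "norm x > R" for x e
  proof -
    have "x \<in> - cball 0 R" using x by auto
    moreover have "((\<lambda>_. 0 :: real) has_derivative (\<lambda>_. 0)) (at x)" by auto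
    ultimately have "(G has_derivative (\<lambda>_. 0)) (at x)"
      by (intro has_derivative_transform_within_open[of "\<lambda>_. 0" "\<lambda>_. 0" x UNIV "- cball 0 R" G]) (auto simp: z)
    then show ?thesis by (simp add: partial_within_def frechet_derivative_at[symmetric])
  qed
  have n: "norm (- (y /\<^sub>R \<delta>)) > R" if "norm y > R * \<delta>" for y :: vec3
    using that \<delta> by (simp add: pos_less_divide_eq divide_inverse[symmetric] mult.commute[of "inverse _"])
  have c: "continuous_on UNIV (\<lambda>y. H (- (y /\<^sub>R \<delta>)))" if "continuous_on UNIV H" for H :: "vec3 \<Rightarrow> real"
    by (rule continuous_on_compose2[OF that]) (auto intro!: continuous_intros)
  have "csupp (\<lambda>y. c0 * H (- (y /\<^sub>R \<delta>)))" if H: "continuous_on UNIV H" "\<And>x. norm x > R \<Longrightarrow> H x = 0" for H :: "vec3 \<Rightarrow> real" and c0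
    unfolding csupp_def
  proof (intro conjI exI[of _ "R * \<delta>"] allI impI)
    show "continuous_on UNIV (\<lambda>y. c0 * H (- (y /\<^sub>R \<delta>)))" by (intro continuous_on_mult_left c H(1))
    fix y :: vec3 assume "R * \<delta> < norm y"
    from H(2)[OF n[OF this]] show "c0 * H (- (y /\<^sub>R \<delta>)) = 0" by simp
  qed
  from this[OF smooth_on_continuous[OF s] z, of "1 / \<delta> ^ 3"]
    this[OF smooth_on_continuous[OF smooth_on_partial[OF s]] z1, of "axis j 1" "- (1 / \<delta> ^ 4)"]
  show "csupp (mkern G \<delta>)" "csupp (mkern1 G \<delta> (axis j 1))"
    by (simp_all add: mkern_def[abs_def] mkern1_def[abs_def])
qed

lemma mkern_nonneg: "mollifier G \<Longrightarrow> \<delta> > 0 \<Longrightarrow> 0 \<le> mkern G \<delta> z"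
  by (simp add: mkern_def mollifier_def)

lemma mkern_integral:
  assumes G: "mollifier G" and \<delta>: "\<delta> > 0"
  shows "integrable lborel (mkern G \<delta>)" "(LINT z|lborel. mkern G \<delta> z) = 1" "l1n (mkern G \<delta>) = 1"
proof -
  show i: "integrable lborel (mkern G \<delta>)" using csupp_integrable[OF csupp_mkern(1)[OF assms], of "\<lambda>_. 1"] by simp
  have s: "smooth_on UNIV G" using G by (auto simp: mollifier_def test_function_def)
  have [measurable]: "G \<in> borel_measurable borel"
    by (rule borel_measurable_continuous_onI[OF smooth_on_continuous[OF s]])
  have "(LINT z|lborel. G z) = 1" using G integral_completion[of G lborel] by (simp add: mollifier_def)
  then show e: "(LINT z|lborel. mkern G \<delta> z) = 1" unfolding mkern_def by (subst integral_scale[OF _ \<delta>]) auto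
  show "l1n (mkern G \<delta>) = 1" unfolding l1n_def using e by (simp add: mkern_nonneg[OF assms])
qed

lemma mkern_deriv:
  assumes G: "mollifier G" and \<delta>: "\<delta> > 0"
  shows "deriv_along e (mkern G \<delta>) (mkern1 G \<delta> e)"
    and "mkern1 G \<delta> e z = (\<Sum>j\<in>UNIV. e $ j * mkern1 G \<delta> (axis j 1) z)"
proof -
  have s: "G differentiable_on UNIV" using G by (auto simp: mollifier_def test_function_def smooth_on_differentiable)
  have D: "(G has_derivative frechet_derivative G (at x)) (at x)" for x
    using s unfolding differentiable_on_def frechet_derivative_works by auto
  have "(mkern G \<delta> has_derivative (\<lambda>h. frechet_derivative G (at (- (z /\<^sub>R \<delta>))) (- (h /\<^sub>R \<delta>)) / \<delta> ^ 3)) (at z)" for z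
  proof -
    have "((\<lambda>z. - (z /\<^sub>R \<delta>)) has_derivative (\<lambda>h. - (h /\<^sub>R \<delta>))) (at z)" by (auto intro!: derivative_eq_intros)
    from has_derivative_compose[OF this D] show ?thesis
      unfolding mkern_def[abs_def] using bounded_linear.has_derivative[OF bounded_linear_divide] by blast
  qed
  from deriv_along_linear[OF this bounded_linear_ident, of e]
  have "deriv_along e (mkern G \<delta>) (\<lambda>x. frechet_derivative G (at (- (x /\<^sub>R \<delta>))) (- (e /\<^sub>R \<delta>)) / \<delta> ^ 3)" .
  moreover have "frechet_derivative G (at y) (- (e /\<^sub>R \<delta>)) = - (frechet_derivative G (at y) e / \<delta>)" for y
    using linear_cmul[OF has_derivative_linear[OF D], of y "- inverse \<delta>" e] by (simp add: divide_inverse)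
  ultimately show "deriv_along e (mkern G \<delta>) (mkern1 G \<delta> e)"
    by (simp add: mkern1_def[abs_def] partial_within_def power_Suc2[symmetric] eval_nat_numeral mult_ac)
  have "frechet_derivative G (at y) e = (\<Sum>j\<in>UNIV. e $ j * frechet_derivative G (at y) (axis j 1))" for y
  proof -
    note L = has_derivative_linear[OF D[of y]]
    have "frechet_derivative G (at y) (\<Sum>j\<in>UNIV. (e $ j) *\<^sub>R axis j 1) = (\<Sum>j\<in>UNIV. e $ j * frechet_derivative G (at y) (axis j 1))"
      by (simp add: linear_sum[OF L] linear_cmul[OF L])
    then show ?thesis using basis_expansion[of e] by (simp add: scalar_mult_eq_scaleR)
  qed
  then show "mkern1 G \<delta> e z = (\<Sum>j\<in>UNIV. e $ j * mkern1 G \<delta> (axis j 1) z)"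
    unfolding mkern1_def partial_within_def by (simp add: sum_negf sum_divide_distrib)
qed

text \<open>The field \<open>f\<close> is only Lebesgue measurable; \<open>f'\<close> stands for a Borel measurable representative.\<close>

lemma mollify_component:
  fixes f :: field3 and f' :: "3 \<Rightarrow> vec3 \<Rightarrow> real"
  assumes G: "mollifier G" and \<delta>: "\<delta> > 0" and f: "f \<in> borel_measurable lebesgue"
    and f': "\<And>k. sqi (f' k)" and ae: "\<And>k. AE y in lborel. f y $ k = f' k y"
  shows "mollify G \<delta> f x $ k = (LINT y|lborel. f' k y * mkern G \<delta> (y - x))"
proof -
  note [measurable] = sqi_meas[OF f']
  have t: "csupp (mkern G \<delta>)" by (rule csupp_mkern[OF G \<delta>])
  have ts: "csupp (\<lambda>y. mkern G \<delta> (y - x))" by (rule csupp_shift[OF t])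
  have [measurable]: "mkern G \<delta> \<in> borel_measurable borel" by (rule borel_measurable_continuous_onI[OF csupp_cont[OF t]])
  have sg: "sqi (\<lambda>y. mkern G \<delta> (y - x))"
    unfolding sqi_def power2_eq_square using csupp_integrable[OF ts csupp_cont[OF ts]] by auto
  have i: "integrable lborel (\<lambda>y. f' k y * mkern G \<delta> (y - x))" for k by (rule sqi_mult[OF f' sg])
  let ?h = "\<lambda>y. \<Sum>k\<in>UNIV. (f' k y * mkern G \<delta> (y - x)) *\<^sub>R (axis k 1 :: vec3)"
  have e: "G ((x - y) /\<^sub>R \<delta>) / \<delta> ^ 3 = mkern G \<delta> (y - x)" for y
    by (simp add: mkern_def scaleR_minus_right[symmetric])
  have "AE y in lborel. \<forall>k\<in>UNIV. f y $ k = f' k y" using ae by (intro AE_finite_allI) auto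
  then have "AE y in lborel. \<forall>k. f y $ k = f' k y" by simp
  then have "AE y in lebesgue. \<forall>k. f y $ k = f' k y" by (rule AE_completion)
  then have "AE y in lebesgue. (G ((x - y) /\<^sub>R \<delta>) / \<delta> ^ 3) *\<^sub>R f y = ?h y"
  proof eventually_elim
    case (elim y)
    have "f y = (\<Sum>k\<in>UNIV. f y $ k *\<^sub>R axis k 1)" using basis_expansion[of "f y"] by (simp add: scalar_mult_eq_scaleR)
    then show ?case unfolding e using elim by (simp add: scaleR_sum_right mult.commute)
  qed
  moreover have "?h \<in> borel_measurable lborel" by measurable
  then have "?h \<in> borel_measurable lebesgue" by (rule measurable_completion)
  moreover have "(\<lambda>y. (G ((x - y) /\<^sub>R \<delta>) / \<delta> ^ 3) *\<^sub>R f y) \<in> borel_measurable lebesgue"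
    unfolding e by (intro borel_measurable_scaleR f measurable_completion) measurable
  ultimately have "mollify G \<delta> f x = (LINT y|lebesgue. ?h y)"
    unfolding mollify_def by (intro integral_cong_AE)
  also have "\<dots> = (LINT y|lborel. ?h y)" by (rule integral_completion) measurable
  also have "\<dots> = (\<Sum>k\<in>UNIV. (LINT y|lborel. f' k y * mkern G \<delta> (y - x)) *\<^sub>R axis k 1)"
    by (subst Bochner_Integration.integral_sum) (auto intro!: integrable_scaleR_left i simp: i)
  finally show ?thesis by (simp add: sum_component axis_def if_distrib cong: if_cong)
qed

lemma L2_component:
  assumes "in_L2 f" and [measurable]: "(\<lambda>x. f x $ k) \<in> borel_measurable borel" "f \<in> borel_measurable borel"
  shows "sqi (\<lambda>x. f x $ k)" "l2n (\<lambda>x. f x $ k) \<le> L2_norm f"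
proof -
  have i: "integrable lborel (\<lambda>x. (norm (f x))\<^sup>2)"
    using assms(1) integrable_completion[of "\<lambda>x. (norm (f x))\<^sup>2" lborel] by (simp add: in_L2_def)
  have le: "(f x $ k)\<^sup>2 \<le> (norm (f x))\<^sup>2" for x
    using power_mono[OF component_le_norm_cart[of "f x" k], of 2] by simp
  have i2: "integrable lborel (\<lambda>x. (f x $ k)\<^sup>2)" by (rule Bochner_Integration.integrable_bound[OF i]) (auto simp: le)
  then show "sqi (\<lambda>x. f x $ k)" by (simp add: sqi_def)
  have "(LINT x|lborel. (f x $ k)\<^sup>2) \<le> (LINT x|lborel. (norm (f x))\<^sup>2)" by (intro integral_mono i i2 le)
  then show "l2n (\<lambda>x. f x $ k) \<le> L2_norm f"
    unfolding l2n_def L2_norm_def using integral_completion[of "\<lambda>x. (norm (f x))\<^sup>2" lborel] by simp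
qed


lemma pair_shift_le:
  assumes "sqi f" "sqi g" shows "\<bar>LINT y|lborel. f y * g (y - (x::vec3))\<bar> \<le> l2n f * l2n g"
  using pair_le[OF assms(1) sqi_shift(1)[OF assms(2), of x]] sqi_shift(2)[OF assms(2), of x] by simp

lemma csupp_sqi: "csupp g \<Longrightarrow> sqi g"
  unfolding sqi_def power2_eq_square using csupp_integrable[OF _ csupp_cont, of g g] 
  by (auto intro!: borel_measurable_continuous_onI csupp_cont)

text \<open>For negative times the solution is continued by its initial value, which keeps it jointly continuous;
  all spatial properties hold up to \<open>t = 0\<close>, since the solution is smooth up to the boundary.\<close>

lemma regularized_solution_flow:
  fixes w :: "real \<Rightarrow> field3"
  assumes G: "mollifier G" and \<delta>: "\<delta> > 0" and R: "regularized_solution G \<delta> u0 w p"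
  shows "regularized_flow (\<lambda>k t x. w (max 0 t) x $ k) (\<lambda>k t x. mollify G \<delta> (w (max 0 t)) x $ k)
    (\<lambda>j k t x. partial (axis j 1) (w (max 0 t)) x $ k)
    (\<lambda>j k t x. partial (axis j 1) (partial (axis j 1) (w (max 0 t))) x $ k)
    (\<lambda>j k t x. - (LINT y|lborel. w (max 0 t) y $ k * mkern1 G \<delta> (axis j 1) (y - x)))
    (\<lambda>k t x. vector_derivative (\<lambda>s. w s x) (at t within {0..}) $ k)
    (\<lambda>j t x. partial (axis j 1) (p (max 0 t)) x) (\<lambda>t x. p (max 0 t) x)"
proof -
  let ?S = "UNIV \<times> {0..} :: (vec3 \<times> real) set"
  let ?F = "\<lambda>(x, t). w t x" and ?P = "\<lambda>(x, t). p t x"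
  let ?g = "mkern G \<delta>" and ?g1 = "\<lambda>j. mkern1 G \<delta> (axis j 1)"
  let ?v = "\<lambda>k t x. w (max 0 t) x $ k"
  have sF: "smooth_on ?S ?F" and sP: "smooth_on ?S ?P" and L2: "\<And>t. t \<ge> 0 \<Longrightarrow> in_L2 (w t)"
    and bd: "\<And>T. \<exists>C. \<forall>t\<in>{0..T}. L2_norm (w t) \<le> C"
    and eq: "\<And>t x. t \<ge> 0 \<Longrightarrow> vector_derivative (\<lambda>s. w s x) (at t within {0..})
          + advection (mollify G \<delta> (w t)) (w t) x + gradient (p t) x = vector_laplacian (w t) x"
    and dv: "\<And>t x. t \<ge> 0 \<Longrightarrow> divergence (w t) x = 0"
    using R unfolding regularized_solution_def by auto
  have nth: "bounded_linear (\<lambda>x. x $ k)" for k :: 3 by (rule bounded_linear_vec_nth)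
  note dF = smooth_on_differentiable[OF sF] and dP = smooth_on_differentiable[OF sP]
  note cF = smooth_on_continuous[OF sF] and cP = smooth_on_continuous[OF sP]
  have s1: "smooth_on ?S (partial_within ?S (axis j 1, 0) ?F)" "smooth_on ?S (partial_within ?S (axis j 1, 0) ?P)" for j
    by (rule smooth_on_partial[OF sF axis_Basis_pair(1)] smooth_on_partial[OF sP axis_Basis_pair(1)])+
  have p1: "partial (axis j 1) (w t) = (\<lambda>x. partial_within ?S (axis j 1, 0) ?F (x, t))"
    "partial (axis j 1) (p t) = (\<lambda>x. partial_within ?S (axis j 1, 0) ?P (x, t))" if "t \<ge> 0" for j t
    using partial_slice[OF dF that] partial_slice[OF dP that] by auto
  have p2: "partial (axis j 1) (partial (axis j 1) (w t)) = (\<lambda>x. partial_within ?S (axis j 1, 0) (partial_within ?S (axis j 1, 0) ?F) (x, t))" if "t \<ge> 0" for j t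
    unfolding p1[OF that] using partial_slice[OF smooth_on_differentiable[OF s1(1)] that] .
  have cv: "continuous_on UNIV (\<lambda>(t,x). ?v k t x)" for k
  proof -
    have "continuous_on UNIV (\<lambda>z. ?F (snd z, max 0 (fst z)) $ k)"
      by (intro continuous_on_component continuous_on_compose2[OF cF] continuous_intros) auto
    then show ?thesis by (simp add: split_beta)
  qed
  have cw: "continuous_on UNIV (w (max 0 t))" for t using cont_slice_half[OF cF, of "max 0 t"] by simp
  then have [measurable]: "w (max 0 t) \<in> borel_measurable borel" for t by (rule borel_measurable_continuous_onI)
  have cvs: "continuous_on UNIV (?v k t)" for k t by (intro continuous_on_component cw)
  have [measurable]: "?v k t \<in> borel_measurable borel" for k t by (rule borel_measurable_continuous_onI[OF cvs])
  have v: "sqi (?v k t)" "l2n (?v k t) \<le> L2_norm (w (max 0 t))" for k t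
    by (rule L2_component[OF L2]; simp)+
  have vb: "\<exists>M. \<forall>t\<le>T. \<forall>k. l2n (?v k t) \<le> M" for T
  proof -
    obtain C where C: "\<And>t. t \<in> {0..max 0 T} \<Longrightarrow> L2_norm (w t) \<le> C" using bd by blast
    have "l2n (?v k t) \<le> C" if "t \<le> T" for k t using v(2)[of t k] order_trans[OF that, of "max 0 T"] C[of "max 0 t"] by auto
    then show ?thesis by blast
  qed
  have b: "mollify G \<delta> (w (max 0 t)) x $ k = (LINT y|lborel. ?v k t y * ?g (y - x))" for t x k
    by (rule mollify_component[OF G \<delta> _ v(1)]) (auto intro: measurable_completion)
  note tg = csupp_mkern[OF G \<delta>]
  have sg: "sqi ?g" "sqi (?g1 j)" for j by (rule csupp_sqi tg)+
  note cg = csupp_cont[OF tg(1)] csupp_cont[OF tg(2)]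
  note gi = mkern_integral[OF G \<delta>]
  have d1: "deriv_along (axis j 1) (?v k t) (\<lambda>x. partial (axis j 1) (w (max 0 t)) x $ k)" for j k t
    using slice_deriv_along[OF dF _ nth, of "max 0 t" "axis j 1"] by simp
  have c1: "continuous_on UNIV (\<lambda>x. partial (axis j 1) (w (max 0 t)) x $ k)" for j k t
    using cont_slice_half[OF smooth_on_continuous[OF s1(1)], of "max 0 t"] by (simp add: p1 continuous_on_component)
  have div: "(\<Sum>j\<in>UNIV. partial (axis j 1) (w (max 0 t)) x $ j) = 0" for t x
    using dv[of "max 0 t" x] by (simp add: divergence_def)
  have gen: "deriv_along e (\<lambda>x. LINT y|lborel. ?v k t y * ?g (y - x)) (\<lambda>x. - (LINT y|lborel. ?v k t y * mkern1 G \<delta> e (y - x)))"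
    and ge: "sqi (mkern1 G \<delta> e)" "l2n (?v k t) \<le> M \<Longrightarrow> \<bar>LINT y|lborel. ?v k t y * mkern1 G \<delta> e (y - x)\<bar> \<le> (M * (\<Sum>j\<in>UNIV. l2n (?g1 j))) * norm e" for e k t M x
  proof -
    have e: "mkern1 G \<delta> e = (\<lambda>z. \<Sum>j\<in>UNIV. e $ j * ?g1 j z)" using mkern_deriv(2)[OF G \<delta>] by blast
    show s: "sqi (mkern1 G \<delta> e)" unfolding e by (intro sqi_sum sqi_cmult sg)
    have c: "continuous_on UNIV (mkern1 G \<delta> e)" unfolding e by (intro continuous_intros cg)
    show "deriv_along e (\<lambda>x. LINT y|lborel. ?v k t y * ?g (y - x)) (\<lambda>x. - (LINT y|lborel. ?v k t y * mkern1 G \<delta> e (y - x)))"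
      by (rule conv_deriv[OF cvs v(1) sg(1) c s mkern_deriv(1)[OF G \<delta>]])
    assume M: "l2n (?v k t) \<le> M"
    have "(LINT y|lborel. ?v k t y * mkern1 G \<delta> e (y - x)) = (LINT y|lborel. (\<Sum>j\<in>UNIV. e $ j * (?v k t y * ?g1 j (y - x))))"
      unfolding e by (simp add: sum_distrib_left mult_ac)
    also have "\<dots> = (\<Sum>j\<in>UNIV. e $ j * (LINT y|lborel. ?v k t y * ?g1 j (y - x)))"
      by (subst Bochner_Integration.integral_sum) (auto intro!: sqi_mult v sqi_shift sg)
    also have "\<bar>\<dots>\<bar> \<le> (\<Sum>j\<in>UNIV. norm e * (M * l2n (?g1 j)))"
    proof (rule order_trans[OF sum_abs], rule sum_mono)
      fix j
      have "\<bar>LINT y|lborel. ?v k t y * ?g1 j (y - x)\<bar> \<le> M * l2n (?g1 j)"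
        using pair_shift_le[OF v(1)[of t k] sg(2)[of j], of x] mult_right_mono[OF M l2n_nonneg[of "?g1 j"]] by linarith
      then show "\<bar>e $ j * (LINT y|lborel. ?v k t y * ?g1 j (y - x))\<bar> \<le> norm e * (M * l2n (?g1 j))"
        unfolding abs_mult by (intro mult_mono component_le_norm_cart) auto
    qed
    finally show "\<bar>LINT y|lborel. ?v k t y * mkern1 G \<delta> e (y - x)\<bar> \<le> (M * (\<Sum>j\<in>UNIV. l2n (?g1 j))) * norm e"
      by (simp add: sum_distrib_left mult_ac)
  qed
  have tD: "vector_derivative (\<lambda>s. w s x) (at t within {0..}) = partial_within ?S (0, 1) ?F (x, t)" if t: "t > 0" for t x
  proof -
    have "at t within {0..} = at t" using t by (intro at_within_interior) (auto simp: interior_real_atLeast)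
    then show ?thesis using vector_derivative_at[OF time_derivative[OF dF t, of x]] by simp
  qed
  show ?thesis
  proof
    show "continuous_on UNIV (\<lambda>(t,x). ?v k t x)" for k by (rule cv)
    show "sqi (?v k t)" for k t by (rule v)
    show "\<exists>M. \<forall>t\<le>T. \<forall>k. l2n (?v k t) \<le> M" for T by (rule vb)
    show "continuous_on UNIV (\<lambda>(t,x). mollify G \<delta> (w (max 0 t)) x $ k)" for k
    proof -
      have "continuous_on ({..<T} \<times> UNIV) (\<lambda>p. LINT y|lborel. ?v k (fst p) (y - (- snd p)) * ?g y)" for T
      proof -
        obtain M where M: "\<And>t k. t \<le> T \<Longrightarrow> l2n (?v k t) \<le> M" using vb by blast
        show ?thesis
        proof (rule continuous_integral_L2_pair[where M=M and h="\<lambda>y. \<bar>?g y\<bar>"])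
          show "continuous_on (({..<T} \<times> UNIV) \<times> UNIV) (\<lambda>(p, y). ?v k (fst p) (y - (- snd p)))"
            using continuous_on_compose2[OF cv, of "({..<T} \<times> UNIV) \<times> UNIV" "\<lambda>z. (fst (fst z), snd z - (- snd (fst z)))" k]
            by (simp add: split_beta continuous_intros)
          show "continuous_on (({..<T} \<times> UNIV) \<times> UNIV) (\<lambda>(p :: real \<times> vec3, y). ?g y)"
            unfolding split_beta by (rule continuous_on_compose2[OF cg(1)]) (auto intro!: continuous_intros)
          show "sqi (\<lambda>y. ?v k (fst p) (y - (- snd p)))" for p :: "real \<times> vec3" by (rule sqi_shift[OF v(1)])
          show "l2n (\<lambda>y. ?v k (fst p) (y - (- snd p))) \<le> M" if "p \<in> {..<T} \<times> UNIV" for p :: "real \<times> vec3"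
            unfolding sqi_shift(2)[OF v(1)] using that by (intro M) auto
        qed (use sg in auto)
      qed
      then have "continuous_on (\<Union>T\<in>(UNIV::real set). {..<T} \<times> UNIV) (\<lambda>p. LINT y|lborel. ?v k (fst p) (y - (- snd p)) * ?g y)"
        by (intro continuous_on_open_UN) (auto intro!: open_Times)
      moreover have "(\<Union>T\<in>(UNIV::real set). {..<T} \<times> (UNIV::vec3 set)) = UNIV" using lt_ex gt_ex by auto
      moreover have "(LINT y|lborel. ?v k t (y - (- x)) * ?g y) = (LINT y|lborel. ?v k t y * ?g (y - x))" for t x
      proof -
        have [measurable]: "?g \<in> borel_measurable borel" using sg(1) by (rule sqi_meas)
        show ?thesis using integral_shift[of "\<lambda>y. ?v k t y * ?g (y - x)" "- x"] by simp
      qed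
      ultimately show ?thesis unfolding b by (simp add: split_beta)
    qed
    show "\<exists>B. \<forall>t\<le>T. \<forall>k x. \<bar>mollify G \<delta> (w (max 0 t)) x $ k\<bar> \<le> B" for T
    proof -
      obtain M where M: "\<And>t k. t \<le> T \<Longrightarrow> l2n (?v k t) \<le> M" using vb by blast
      have "\<bar>LINT y|lborel. ?v k t y * ?g (y - x)\<bar> \<le> M * l2n ?g" if "t \<le> T" for t k x
        using pair_shift_le[OF v(1)[of t k] sg(1), of x] mult_right_mono[OF M[OF that, of k] l2n_nonneg[of ?g]] by linarith
      then show ?thesis unfolding b by blast
    qed
    \<comment> \<open>mean value theorem along the segment from \<open>y\<close> to \<open>x\<close>\<close>
    show "\<exists>L\<ge>0. \<forall>t\<le>T. \<forall>k x y. \<bar>mollify G \<delta> (w (max 0 t)) x $ k - mollify G \<delta> (w (max 0 t)) y $ k\<bar> \<le> L * norm (x - y)" for T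
    proof -
      obtain M where M: "\<And>t k. t \<le> T \<Longrightarrow> l2n (?v k t) \<le> M" using vb by blast
      have M0: "0 \<le> M" using M[of T undefined] l2n_nonneg order_trans by blast
      let ?L = "M * (\<Sum>j\<in>UNIV. l2n (?g1 j))"
      have "\<bar>mollify G \<delta> (w (max 0 t)) x $ k - mollify G \<delta> (w (max 0 t)) y $ k\<bar> \<le> ?L * norm (x - y)" if t: "t \<le> T" for t k x y
      proof -
        let ?B = "\<lambda>x. LINT z|lborel. ?v k t z * ?g (z - x)"
        have "\<exists>r>0. r < 1 \<and> ?B (y + 1 *\<^sub>R (x - y)) - ?B (y + 0 *\<^sub>R (x - y))
            = (1 - 0) * - (LINT z|lborel. ?v k t z * mkern1 G \<delta> (x - y) (z - (y + r *\<^sub>R (x - y))))"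
          by (rule MVT2[where f="\<lambda>r. ?B (y + r *\<^sub>R (x - y))"]) (auto intro!: deriv_alongD[OF gen])
        then obtain r where "?B x - ?B y = - (LINT z|lborel. ?v k t z * mkern1 G \<delta> (x - y) (z - (y + r *\<^sub>R (x - y))))" by auto
        then show ?thesis unfolding b using ge(2)[OF M[OF t], of k "x - y" "y + r *\<^sub>R (x - y)"] by simp
      qed
      then show ?thesis using M0 by (intro exI[of _ ?L]) (auto intro!: mult_nonneg_nonneg sum_nonneg)
    qed
    show "\<bar>mollify G \<delta> (w (max 0 t)) x $ k\<bar> \<le> a" if "\<And>j x. \<bar>?v j t x\<bar> \<le> a" for t k x a
    proof -
      have a: "0 \<le> a" using that[of undefined undefined] by linarith
      have i: "integrable lborel (\<lambda>y. ?g (y - x))" by (rule integrable_shift[OF gi(1)])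
      have iv: "integrable lborel (\<lambda>y. ?v k t y * ?g (y - x))" by (rule sqi_mult[OF v(1) sqi_shift(1)[OF sg(1)]])
      have le: "\<bar>?v k t y * ?g (y - x)\<bar> \<le> a * ?g (y - x)" for y
        unfolding abs_mult abs_of_nonneg[OF mkern_nonneg[OF G \<delta>]] by (rule mult_right_mono[OF that mkern_nonneg[OF G \<delta>]])
      have "\<bar>LINT y|lborel. ?v k t y * ?g (y - x)\<bar> \<le> (LINT y|lborel. \<bar>?v k t y * ?g (y - x)\<bar>)" by (rule integral_abs_bound)
      also have "\<dots> \<le> (LINT y|lborel. a * ?g (y - x))"
        by (rule integral_mono[OF integrable_abs[OF iv] integrable_mult_right[OF i] le])
      also have "\<dots> = a" using integral_shift[OF sqi_meas[OF sg(1)], of x] gi(2) by simp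
      finally show ?thesis unfolding b .
    qed
    show "sqi (\<lambda>x. mollify G \<delta> (w (max 0 t)) x $ k)" "l2n (\<lambda>x. mollify G \<delta> (w (max 0 t)) x $ k) \<le> l2n (?v k t)" for k t
      unfolding b using conv_L2[OF v(1)[of t k] gi(1)] gi(3) by (simp_all add: mult.commute)
    show "deriv_along (axis j 1) (\<lambda>x. mollify G \<delta> (w (max 0 t)) x $ k) (\<lambda>x. - (LINT y|lborel. ?v k t y * ?g1 j (y - x)))" for j k t
      unfolding b by (rule gen)
    show "continuous_on UNIV (\<lambda>x. - (LINT y|lborel. ?v k t y * ?g1 j (y - x)))" for j k t
      by (intro continuous_intros conv_cont cvs v cg sg)
    show "\<exists>B. \<forall>j k x. \<bar>- (LINT y|lborel. ?v k t y * ?g1 j (y - x))\<bar> \<le> B" for t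
    proof -
      obtain M where M: "\<And>k. l2n (?v k t) \<le> M" using vb[of t] by blast
      show ?thesis using ge(2)[OF M, of _ "axis _ 1"] by (intro exI[of _ "M * (\<Sum>j\<in>UNIV. l2n (?g1 j))"]) simp
    qed
    show "(\<Sum>j\<in>UNIV. - (LINT y|lborel. ?v j t y * ?g1 j (y - x))) = 0" for t x
    proof -
      have "(\<Sum>j\<in>UNIV. - (LINT y|lborel. ?v j t y * ?g1 j (y - x))) = (\<Sum>j\<in>UNIV. LINT y|lborel. partial (axis j 1) (w (max 0 t)) y $ j * ?g (y - x))"
        using ibp_csupp[OF d1 cvs c1 mkern_deriv(1)[OF G \<delta>] tg] by simp
      also have "\<dots> = (LINT y|lborel. (\<Sum>j\<in>UNIV. partial (axis j 1) (w (max 0 t)) y $ j * ?g (y - x)))"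
        by (rule Bochner_Integration.integral_sum[symmetric]) (intro csupp_integrable csupp_shift tg c1)
      finally show ?thesis by (simp add: sum_distrib_right[symmetric] div)
    qed
    show "((\<lambda>s. ?v k s x) has_real_derivative vector_derivative (\<lambda>s. w s x) (at t within {0..}) $ k) (at t)" if t: "t > 0" for t k x
    proof -
      have D: "((\<lambda>s. w s x) has_vector_derivative partial_within ?S (0, 1) ?F (x, t)) (at t)"
        using time_derivative[OF dF t] by simp
      have "((\<lambda>s. w s x $ k) has_real_derivative partial_within ?S (0, 1) ?F (x, t) $ k) (at t)"
        using bounded_linear.has_vector_derivative[OF nth D] by (simp add: has_real_derivative_iff_has_vector_derivative)
      then show ?thesis unfolding tD[OF t]
        by (rule has_field_derivative_transform_within_open[of _ _ _ "{0<..}"]) (use t in auto)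
    qed
    show "continuous_on ({0<..} \<times> UNIV) (\<lambda>(t,x). vector_derivative (\<lambda>s. w s x) (at t within {0..}) $ k)" for k
    proof -
      have "continuous_on ({0<..} \<times> UNIV) (\<lambda>z. partial_within ?S (0, 1) ?F (snd z, fst z) $ k)"
        by (intro continuous_on_component continuous_on_compose2[OF smooth_on_continuous[OF smooth_on_partial[OF sF axis_Basis_pair(2)]]] continuous_intros) auto
      then show ?thesis by (rule continuous_on_eq) (clarsimp simp: tD)
    qed
    show "deriv_along (axis j 1) (?v k t) (\<lambda>x. partial (axis j 1) (w (max 0 t)) x $ k)" for j k t by (rule d1)
    show "continuous_on UNIV (\<lambda>x. partial (axis j 1) (w (max 0 t)) x $ k)" for j k t by (rule c1)
    show "deriv_along (axis j 1) (\<lambda>x. partial (axis j 1) (w (max 0 t)) x $ k) (\<lambda>x. partial (axis j 1) (partial (axis j 1) (w (max 0 t))) x $ k)" for j k t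
      using slice_deriv_along[OF smooth_on_differentiable[OF s1(1)] _ nth, of "max 0 t" "axis j 1" j k] by (simp add: p1)
    show "continuous_on UNIV (\<lambda>x. partial (axis j 1) (partial (axis j 1) (w (max 0 t))) x $ k)" for j k t
      using cont_slice_half[OF smooth_on_continuous[OF smooth_on_partial[OF s1(1) axis_Basis_pair(1)]], of "max 0 t"]
      by (simp add: p2 continuous_on_component)
    show "deriv_along (axis j 1) (p (max 0 t)) (partial (axis j 1) (p (max 0 t)))" for j t
      using slice_deriv_along[OF dP _ bounded_linear_ident, of "max 0 t" "axis j 1"] by simp
    show "continuous_on UNIV (p (max 0 t))" for t using cont_slice_half[OF cP, of "max 0 t"] by simp
    show "continuous_on UNIV (partial (axis j 1) (p (max 0 t)))" for j t
      using cont_slice_half[OF smooth_on_continuous[OF s1(2)], of "max 0 t"] by (simp add: p1)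
    show "(\<Sum>j\<in>UNIV. partial (axis j 1) (w (max 0 t)) x $ j) = 0" for t x by (rule div)
    show "vector_derivative (\<lambda>s. w s x) (at t within {0..}) $ k
        + (\<Sum>j\<in>UNIV. mollify G \<delta> (w (max 0 t)) x $ j * partial (axis j 1) (w (max 0 t)) x $ k)
        + partial (axis k 1) (p (max 0 t)) x
      = (\<Sum>j\<in>UNIV. partial (axis j 1) (partial (axis j 1) (w (max 0 t))) x $ k)" if t: "t > 0" for t k x
      using arg_cong[OF eq[of t x], of "\<lambda>z. z $ k"] t
      by (simp add: advection_def gradient_def vector_laplacian_def sum_component)
  qed
qed


section \<open>Decay uniform in the regularization\<close>

lemma L2_representative:
  assumes "in_L2 f"
  obtains f' :: "3 \<Rightarrow> vec3 \<Rightarrow> real" where "\<And>k. sqi (f' k)" "\<And>k. AE y in lborel. f y $ k = f' k y"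
proof -
  have f: "f \<in> borel_measurable lebesgue" and i: "integrable lebesgue (\<lambda>x. (norm (f x))\<^sup>2)"
    using assms by (auto simp: in_L2_def)
  have fk: "(\<lambda>x. f x $ k) \<in> borel_measurable lebesgue" for k
    by (rule borel_measurable_continuous_on[OF _ f]) (intro continuous_intros)
  have "\<exists>g. sqi g \<and> (AE y in lborel. f y $ k = g y)" for k
  proof -
    obtain g where [measurable]: "g \<in> borel_measurable lborel" and ae: "AE y in lborel. f y $ k = g y"
      using completion_ex_borel_measurable_real[OF fk] by blast
    have "integrable lebesgue (\<lambda>y. (f y $ k)\<^sup>2)"
    proof (rule Bochner_Integration.integrable_bound[OF i])
      show "AE y in lebesgue. norm ((f y $ k)\<^sup>2) \<le> norm ((norm (f y))\<^sup>2)"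
        by (rule AE_I2) (use power_mono[OF component_le_norm_cart abs_ge_zero, where n=2] in simp)
    qed (intro borel_measurable_power fk)
    moreover have "(\<lambda>y. (g y)\<^sup>2) \<in> borel_measurable lebesgue" by (rule measurable_completion) measurable
    moreover have "AE y in lebesgue. (f y $ k)\<^sup>2 = (g y)\<^sup>2" using AE_completion[OF ae] by eventually_elim simp
    ultimately have "integrable lebesgue (\<lambda>y. (g y)\<^sup>2)" by (rule integrable_cong_AE_imp)
    then show ?thesis using ae integrable_completion[of "\<lambda>y. (g y)\<^sup>2" lborel] by (intro exI[of _ g]) (simp add: sqi_def)
  qed
  then show ?thesis using that by metis
qed

lemma sqi_indicator_cball: "sqi (indicator (cball 0 R) :: vec3 \<Rightarrow> real)"
proof -
  have "integrable lborel (indicator (cball 0 R) :: vec3 \<Rightarrow> real)"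
    using emeasure_lborel_cball_finite[of "0::vec3" R] by (intro integrable_real_indicator) auto
  moreover have "(\<lambda>x. (indicator (cball 0 R) x)\<^sup>2 :: real) = indicator (cball (0::vec3) R)"
    by (auto simp: indicator_def)
  ultimately show ?thesis by (simp add: sqi_def)
qed

text \<open>Restrict \<open>f\<close> to a large ball, on which it is integrable by Cauchy--Schwarz.\<close>

lemma L1_L2_split:
  fixes f :: "vec3 \<Rightarrow> real"
  assumes f: "sqi f" and \<epsilon>: "\<epsilon> > 0"
  obtains g h where "\<And>x. f x = g x + h x" "integrable lborel g" "sqi g" "sqi h" "l2n h \<le> \<epsilon>"
proof -
  note [measurable] = sqi_meas[OF f]
  define h where "h n x = indicator (- cball 0 (real n)) x * f x" for n x
  have hm[measurable]: "h n \<in> borel_measurable borel" for n unfolding h_def[abs_def] by measurable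
  have hs: "sqi (h n)" for n by (rule sqi_dominated(1)[OF hm f]) (auto simp: h_def indicator_def)
  have "(\<lambda>n. LINT x|lborel. (h n x)\<^sup>2) \<longlonglongrightarrow> (integral\<^sup>L lborel (\<lambda>x::vec3. 0::real))"
  proof (rule integral_dominated_convergence[where w="\<lambda>x. (f x)\<^sup>2"])
    show "integrable lborel (\<lambda>x. (f x)\<^sup>2)" using f by (simp add: sqi_def)
    show "AE x in lborel. (\<lambda>n. (h n x)\<^sup>2) \<longlonglongrightarrow> 0"
    proof (rule AE_I2)
      fix x :: vec3
      obtain N where N: "norm x < real N" using reals_Archimedean2 by blast
      have "\<forall>\<^sub>F n in sequentially. (h n x)\<^sup>2 = 0"
        using eventually_ge_at_top[of N] by eventually_elim (use N in \<open>auto simp: h_def indicator_def\<close>)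
      then show "(\<lambda>n. (h n x)\<^sup>2) \<longlonglongrightarrow> 0" by (rule tendsto_eventually)
    qed
  qed (auto simp: h_def indicator_def)
  then have "\<forall>\<^sub>F n in sequentially. (LINT x|lborel. (h n x)\<^sup>2) < \<epsilon>\<^sup>2"
    using \<epsilon> by (intro order_tendstoD(2)[of _ 0]) auto
  then obtain n where n: "(LINT x|lborel. (h n x)\<^sup>2) < \<epsilon>\<^sup>2" using eventually_happens trivial_limit_sequentially by blast
  have "l2n (h n) \<le> \<epsilon>"
    unfolding l2n_def using n \<epsilon> by (intro real_le_lsqrt) auto
  moreover have "f x = indicator (cball 0 (real n)) x * f x + h n x" for x by (auto simp: h_def indicator_def)
  moreover have "integrable lborel (\<lambda>x. indicator (cball 0 (real n)) x * f x)" by (rule sqi_mult[OF sqi_indicator_cball f])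
  moreover have "sqi (\<lambda>x. indicator (cball 0 (real n)) x * f x)"
    by (rule sqi_dominated(1)[OF _ f]) (auto simp: indicator_def)
  ultimately show ?thesis by (intro that[of "\<lambda>x. indicator (cball 0 (real n)) x * f x" "h n"] hs)
qed

lemma conv_L1:
  fixes f k :: "vec3 \<Rightarrow> real"
  assumes f: "integrable lborel f" and k: "integrable lborel k"
  shows "integrable lborel (\<lambda>x. LINT y|lborel. f y * k (y - x))"
    and "l1n (\<lambda>x. LINT y|lborel. f y * k (y - x)) \<le> l1n k * l1n f"
proof -
  have [measurable]: "f \<in> borel_measurable borel" "k \<in> borel_measurable borel" using f k by auto
  let ?c = "\<lambda>x. LINT y|lborel. f y * k (y - x)"
  have m: "?c \<in> borel_measurable lborel" by measurable
  have "(\<integral>\<^sup>+x. ennreal (norm (?c x)) \<partial>lborel) \<le> (\<integral>\<^sup>+x. (\<integral>\<^sup>+y. ennreal \<bar>k (y - x)\<bar> * ennreal \<bar>f y\<bar> \<partial>lborel) \<partial>lborel)"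
  proof (rule nn_integral_mono)
    fix x
    show "ennreal (norm (?c x)) \<le> (\<integral>\<^sup>+y. ennreal \<bar>k (y - x)\<bar> * ennreal \<bar>f y\<bar> \<partial>lborel)"
      using integral_norm_bound_ennreal[of lborel "\<lambda>y. f y * k (y - x)"]
      by (cases "integrable lborel (\<lambda>y. f y * k (y - x))") (simp_all add: abs_mult ennreal_mult mult.commute not_integrable_integral_eq)
  qed
  also have "\<dots> = (\<integral>\<^sup>+y. (\<integral>\<^sup>+x. ennreal \<bar>k (y - x)\<bar> * ennreal \<bar>f y\<bar> \<partial>lborel) \<partial>lborel)"
    by (rule lborel_pair.Fubini') measurable
  also have "\<dots> = (\<integral>\<^sup>+y. ennreal (l1n k) * ennreal \<bar>f y\<bar> \<partial>lborel)"
  proof (rule nn_integral_cong)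
    fix y
    have "(\<integral>\<^sup>+x. ennreal \<bar>k (y - x)\<bar> \<partial>lborel) = ennreal (l1n k)"
      using nn_reflect[of "\<lambda>y. ennreal \<bar>k y\<bar>" y] nn_l1n[OF k] by simp
    then show "(\<integral>\<^sup>+x. ennreal \<bar>k (y - x)\<bar> * ennreal \<bar>f y\<bar> \<partial>lborel) = ennreal (l1n k) * ennreal \<bar>f y\<bar>"
      by (subst nn_integral_multc) auto
  qed
  also have "\<dots> = ennreal (l1n k) * ennreal (l1n f)"
    by (subst nn_integral_cmult) (auto simp: nn_l1n[OF f])
  also have "\<dots> = ennreal (l1n k * l1n f)" by (rule ennreal_mult[symmetric]) auto
  finally have le: "(\<integral>\<^sup>+x. ennreal (norm (?c x)) \<partial>lborel) \<le> ennreal (l1n k * l1n f)" .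
  show i: "integrable lborel ?c"
    by (rule integrableI_bounded[OF m]) (use le_less_trans[OF le ennreal_less_top] in simp)
  show "l1n ?c \<le> l1n k * l1n f"
    using le nn_l1n[OF i] by (simp add: ennreal_le_iff)
qed

lemma decay_terms:
  fixes M T c L :: real assumes \<epsilon>: "\<epsilon> > 0"
  shows "\<forall>\<^sub>F t in at_top. L * t powr (- 3/4) + 1584 * (9 * M\<^sup>2 * sqrt cK * T * (t - T) powr (- 5/4) + 9 * cK * c * M * (6 * (t / 2) powr (- 1/4))) < \<epsilon>"
proof -
  have 1: "((\<lambda>t. t powr a) \<longlongrightarrow> 0) at_top" if "a < 0" for a :: real
    using tendsto_neg_powr[OF that filterlim_ident] .
  have s: "filterlim (\<lambda>t. t - T) at_top at_top" "filterlim (\<lambda>t::real. t / 2) at_top at_top"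
    using filterlim_tendsto_add_at_top[OF tendsto_const[of "-T"] filterlim_ident]
      filterlim_tendsto_pos_mult_at_top[OF tendsto_const[of "1/2 :: real"] _ filterlim_ident] by (simp_all add: algebra_simps)
  have 2: "((\<lambda>t. (t - T) powr a) \<longlongrightarrow> 0) at_top" "((\<lambda>t. (t / 2) powr a) \<longlongrightarrow> 0) at_top" if "a < 0" for a :: real
    by (rule filterlim_compose[OF 1[OF that]] s)+
  have "((\<lambda>t. L * t powr (- 3/4) + 1584 * (9 * M\<^sup>2 * sqrt cK * T * (t - T) powr (- 5/4) + 9 * cK * c * M * (6 * (t / 2) powr (- 1/4))))
     \<longlongrightarrow> L * 0 + 1584 * (9 * M\<^sup>2 * sqrt cK * T * 0 + 9 * cK * c * M * (6 * 0))) at_top"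
    by (intro tendsto_intros 1 2) auto
  then show ?thesis using \<epsilon> by (intro order_tendstoD(2)[of _ 0]) simp_all
qed

text \<open>\<open>T1\<close> is the time after which \<open>sup_decay\<close> applies with the norm \<open>M\<close> of the initial data; \<open>T2\<close> is a time
  after which the \<open>L\<^sup>2\<close> norm is below \<open>\<rho>\<close>. Both depend on the initial data only, because mollification
  increases neither the \<open>L\<^sup>2\<close> norm of a function nor the \<open>L\<^sup>1\<close> norm of its integrable part.\<close>

lemma regularized_decay:
  assumes G: "mollifier G" and u0: "in_L2 u0" and \<epsilon>: "\<epsilon> > 0"
  obtains T where "T > 0" "\<And>\<delta> w p t x k. \<delta> > 0 \<Longrightarrow> regularized_solution G \<delta> u0 w p \<Longrightarrow> t \<ge> T \<Longrightarrow> \<bar>w t x $ k\<bar> \<le> \<epsilon> * t powr (- 3/4)"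
proof -
  obtain f :: "3 \<Rightarrow> vec3 \<Rightarrow> real" where f: "\<And>k. sqi (f k)" "\<And>k. AE y in lborel. u0 y $ k = f k y"
    using L2_representative[OF u0] by metis
  \<comment> \<open>the summand \<open>1\<close> ensures that \<open>M\<close> is positive\<close>
  define M where "M = sqrt (\<Sum>k\<in>UNIV. (l2n (f k))\<^sup>2) + 1"
  have S0: "0 \<le> (\<Sum>k\<in>UNIV. (l2n (f k))\<^sup>2)" by (intro sum_nonneg) auto
  have M: "M > 0" "(\<Sum>k\<in>UNIV. (l2n (f k))\<^sup>2) \<le> M\<^sup>2"
  proof -
    have "0 \<le> sqrt (\<Sum>k\<in>UNIV. (l2n (f k))\<^sup>2)" using S0 by simp
    then show "M > 0" unfolding M_def by linarith
    have "(\<Sum>k\<in>UNIV. (l2n (f k))\<^sup>2) = (sqrt (\<Sum>k\<in>UNIV. (l2n (f k))\<^sup>2))\<^sup>2" using S0 by simp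
    also have "\<dots> \<le> M\<^sup>2" using S0 by (intro power_mono) (auto simp: M_def)
    finally show "(\<Sum>k\<in>UNIV. (l2n (f k))\<^sup>2) \<le> M\<^sup>2" .
  qed
  let ?\<Lambda> = "192 * (1584 * (36 * cK)) * cG"
  define c where "c = 48 * cG * M"
  have cG: "cG > 0" by (rule cG_pos)
  have c0: "c \<ge> 0" using cG M by (simp add: c_def)
  \<comment> \<open>with this choice the constant in \<open>sup_decay\<close> becomes \<open>\<epsilon>\<close>\<close>
  define \<rho> where "\<rho> = \<epsilon> / (48 * cG)"
  have \<rho>: "\<rho> > 0" "48 * cG * \<rho> = \<epsilon>" using \<epsilon> cG by (simp_all add: \<rho>_def)
  obtain g h where gh: "\<And>k x. f k x = g k x + h k x" "\<And>k. integrable lborel (g k)" "\<And>k. sqi (g k)" "\<And>k. sqi (h k)" "\<And>k. l2n (h k) \<le> \<rho> / 4"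
  proof -
    have "\<exists>g h. (\<forall>x. f k x = g x + h x) \<and> integrable lborel g \<and> sqi g \<and> sqi h \<and> l2n h \<le> \<rho> / 4" for k
      using L1_L2_split[OF f(1), of "\<rho> / 4" k] \<rho> by (metis zero_less_divide_iff zero_less_numeral)
    then show ?thesis using that by metis
  qed
  define L where "L = (\<Sum>k\<in>UNIV. l1n (g k))"
  have L: "l1n (g k) \<le> L" for k unfolding L_def by (rule member_le_sum) auto
  have pl: "\<forall>\<^sub>F t in at_top. a \<le> t powr (1/4)" for a :: real
    using eventually_ge_at_top[of "max a 0 powr 4"]
  proof eventually_elim
    case (elim t)
    have "a \<le> (max a 0 powr 4) powr (1/4)" unfolding powr_powr by simp
    also have "\<dots> \<le> t powr (1/4)" using elim by (intro powr_mono2) auto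
    finally show ?case .
  qed
  obtain T1 where T1: "T1 > 0" "\<And>t. t \<ge> T1 \<Longrightarrow> ?\<Lambda> * M \<le> t powr (1/4)"
  proof -
    obtain N where "\<And>t. t \<ge> N \<Longrightarrow> ?\<Lambda> * M \<le> t powr (1/4)"
      using pl[of "?\<Lambda> * M"] unfolding eventually_at_top_linorder by blast
    then show ?thesis by (intro that[of "max 1 N"]) auto
  qed
  obtain T2 where T2: "\<And>t. t \<ge> T2 \<Longrightarrow> T1 < t \<and> L * t powr (- 3/4) + 1584 * (9 * M\<^sup>2 * sqrt cK * T1 * (t - T1) powr (- 5/4) + 9 * cK * c * M * (6 * (t / 2) powr (- 1/4))) < \<rho> / 4"
    using eventually_conj[OF eventually_gt_at_top[of T1] decay_terms[of "\<rho> / 4" L M T1 c]] \<rho> unfolding eventually_at_top_linorder by auto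
  obtain T3 where T3: "\<And>t. t \<ge> T3 \<Longrightarrow> ?\<Lambda> * \<rho> \<le> t powr (1/4)"
    using pl[of "?\<Lambda> * \<rho>"] unfolding eventually_at_top_linorder by auto
  define T where "T = max 1 (max (4 * T2) T3)"
  show ?thesis
  proof (rule that[of T])
    show "T > 0" by (simp add: T_def)
    fix \<delta> w p t x k
    assume \<delta>: "\<delta> > 0" and R: "regularized_solution G \<delta> u0 w p" and t: "t \<ge> T"
    interpret regularized_flow "\<lambda>k t x. w (max 0 t) x $ k" "\<lambda>k t x. mollify G \<delta> (w (max 0 t)) x $ k"
      "\<lambda>j k t x. partial (axis j 1) (w (max 0 t)) x $ k"
      "\<lambda>j k t x. partial (axis j 1) (partial (axis j 1) (w (max 0 t))) x $ k"
      "\<lambda>j k t x. - (LINT y|lborel. w (max 0 t) y $ k * mkern1 G \<delta> (axis j 1) (y - x))"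
      "\<lambda>k t x. vector_derivative (\<lambda>s. w s x) (at t within {0..}) $ k"
      "\<lambda>j t x. partial (axis j 1) (p (max 0 t)) x" "\<lambda>t x. p (max 0 t) x"
      by (rule regularized_solution_flow[OF G \<delta> R])
    let ?v = "\<lambda>k t x. w (max 0 t) x $ k" and ?g = "mkern G \<delta>"
    note gi = mkern_integral[OF G \<delta>]
    have u0m: "u0 \<in> borel_measurable lebesgue" using u0 by (simp add: in_L2_def)
    have v0: "?v k 0 x = (LINT y|lborel. f k y * ?g (y - x))" for k x
      using mollify_component[OF G \<delta> u0m f] R by (simp add: regularized_solution_def)
    have v0_le: "l2n (?v k 0) \<le> l2n (f k)" for k
      unfolding v0 using conv_L2(2)[OF f(1)[of k] gi(1)] gi(3) by (simp add: mult.commute)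
    have E00: "E0 0 \<le> M\<^sup>2"
    proof -
      have "E0 0 \<le> (\<Sum>k\<in>UNIV. (l2n (f k))\<^sup>2)" unfolding E0_def by (intro sum_mono power_mono v0_le) auto
      then show ?thesis using M(2) by linarith
    qed
    have E0M: "E0 r \<le> M\<^sup>2" if "r \<ge> 0" for r using E0_decreasing[OF order_refl that] E00 by linarith
    have vM: "l2n (?v k r) \<le> M" if "r \<ge> 0" for k r
    proof -
      have "(l2n (?v k r))\<^sup>2 \<le> E0 r" unfolding E0_def by (rule member_le_sum) auto
      then have "(l2n (?v k r))\<^sup>2 \<le> M\<^sup>2" using E0M[OF that] by linarith
      then show ?thesis using M(1) power2_le_imp_le by (metis less_imp_le)
    qed
    have b1: "vsup_le r (c * r powr (- 3/4))" if "r \<ge> T1" for r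
    proof -
      have r: "r > 0" using that T1(1) by linarith
      show ?thesis unfolding c_def by (rule sup_decay[OF r M(1) E0M T1(2)[OF that]]) (use r in simp)
    qed
    have lin: "l2n (V r k 0) \<le> L * r powr (- 3/4) + \<rho> / 4" if r: "r > 0" for r k
    proof -
      let ?P = "\<lambda>x. LINT y|lborel. g k y * ?g (y - x)" and ?Q = "\<lambda>x. LINT y|lborel. h k y * ?g (y - x)"
      have sg: "sqi ?g" by (rule csupp_sqi[OF csupp_mkern(1)[OF G \<delta>]])
      have e: "?v k 0 x = ?P x + ?Q x" for x
        unfolding v0 gh(1) distrib_right by (intro Bochner_Integration.integral_add sqi_mult gh sqi_shift sg)
      have P: "integrable lborel ?P" "l1n ?P \<le> l1n (g k)" using conv_L1[OF gh(2)[of k] gi(1)] gi(3) by simp_all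
      have P2: "sqi ?P" and Q: "sqi ?Q" "l2n ?Q \<le> l2n (h k)"
        using conv_L2[OF gh(3)[of k] gi(1)] conv_L2[OF gh(4)[of k] gi(1)] gi(3) by (simp_all add: mult.commute)
      have "l2n (V r k 0) \<le> l1n ?P * r powr (- 3/4) + l2n ?Q" by (rule linear_decay[OF r e P(1) P2 Q(1)])
      moreover have "l1n ?P * r powr (- 3/4) \<le> L * r powr (- 3/4)" using P(2) L[of k] by (intro mult_right_mono) auto
      ultimately show ?thesis using Q(2) gh(5)[of k] by linarith
    qed
    \<comment> \<open>each of the three components has norm at most \<open>\<rho> / 2\<close>\<close>
    have small: "E0 r \<le> \<rho>\<^sup>2" if "r \<ge> T2" for r
    proof -
      have r: "T1 < r" and s: "L * r powr (- 3/4) + 1584 * (9 * M\<^sup>2 * sqrt cK * T1 * (r - T1) powr (- 5/4) + 9 * cK * c * M * (6 * (r / 2) powr (- 1/4))) < \<rho> / 4"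
        using T2[OF that] by auto
      have "l2n (?v k r) \<le> \<rho> / 2" for k
        using L2_decay[OF T1(1) r vM b1 c0, of k] lin[of r k] s r T1(1) by simp
      then have "E0 r \<le> (\<Sum>k\<in>(UNIV :: 3 set). (\<rho> / 2)\<^sup>2)" unfolding E0_def by (intro sum_mono power_mono) auto
      also have "\<dots> = 3 / 4 * \<rho>\<^sup>2" by (simp add: power_divide)
      finally show ?thesis using zero_le_power2[of \<rho>] by linarith
    qed
    have t0: "t > 0" "t / 4 \<ge> T2" "t \<ge> T3" using t by (auto simp: T_def)
    have "vsup_le t (48 * cG * \<rho> * t powr (- 3/4))"
      by (rule sup_decay[OF t0(1) \<rho>(1) small[OF t0(2)] T3[OF t0(3)]])
    then show "\<bar>w t x $ k\<bar> \<le> \<epsilon> * t powr (- 3/4)" unfolding vsup_le_def \<rho>(2) using t0(1) by simp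
  qed
qed

section \<open>Passage to the weak limit\<close>

text \<open>Test with \<open>e\<close> times the indicator of the bounded set where \<open>f \<bullet> e\<close> exceeds \<open>\<kappa>\<close>: the mean of \<open>f \<bullet> e\<close> over this
  set is at most \<open>\<kappa>\<close>, so the set is a null set.\<close>

lemma weak_limit_one_sided:
  assumes W: "weakly_converges_L2 F f" and \<kappa>: "\<kappa> \<ge> 0" and le: "\<And>n x. F n x \<bullet> e \<le> \<kappa>"
  shows "AE x in lebesgue. f x \<bullet> e \<le> \<kappa>"
proof -
  have F: "in_L2 (F n)" for n using W by (simp add: weakly_converges_L2_def)
  have f: "in_L2 f" using W by (simp add: weakly_converges_L2_def)
  have fm[measurable]: "f \<in> borel_measurable lebesgue" and [measurable]: "F n \<in> borel_measurable lebesgue" for n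
    using f F by (auto simp: in_L2_def)
  have "AE x in lebesgue. x \<in> cball 0 (real R) \<longrightarrow> f x \<bullet> e \<le> \<kappa>" for R :: nat
  proof -
    define A where "A = {x \<in> space lebesgue. x \<in> cball 0 (real R) \<and> \<kappa> < f x \<bullet> e}"
    have cb: "cball 0 (real R) \<in> sets (lebesgue :: vec3 measure)" by simp
    have [measurable]: "A \<in> sets lebesgue" unfolding A_def using cb by measurable
    have "emeasure lebesgue A \<le> emeasure lebesgue (cball 0 (real R) :: vec3 set)"
      by (rule emeasure_mono) (auto simp: A_def)
    also have "\<dots> < \<infinity>" using emeasure_lborel_cball_finite[of "0::vec3" "real R"] by simp
    finally have iA: "integrable lebesgue (indicator A :: vec3 \<Rightarrow> real)" by (intro integrable_real_indicator) auto
    define g where "g x = indicator A x *\<^sub>R e" for x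
    have [measurable]: "g \<in> borel_measurable lebesgue" unfolding g_def[abs_def] by measurable
    have "(\<lambda>x. (norm (g x))\<^sup>2) = (\<lambda>x. indicator A x * (norm e)\<^sup>2)" by (auto simp: g_def indicator_def)
    then have g: "in_L2 g" unfolding in_L2_def using iA by simp
    have iH: "integrable lebesgue (\<lambda>x. H x \<bullet> g x)" if H: "in_L2 H" for H
    proof (rule Bochner_Integration.integrable_bound)
      have [measurable]: "H \<in> borel_measurable lebesgue" using H by (simp add: in_L2_def)
      show "integrable lebesgue (\<lambda>x. (norm (H x))\<^sup>2 + (norm (g x))\<^sup>2)" using H g by (simp add: in_L2_def)
      show "(\<lambda>x. H x \<bullet> g x) \<in> borel_measurable lebesgue" by measurable
      show "AE x in lebesgue. norm (H x \<bullet> g x) \<le> norm ((norm (H x))\<^sup>2 + (norm (g x))\<^sup>2)"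
      proof (rule AE_I2)
        fix x
        have "0 \<le> (norm (H x) - norm (g x))\<^sup>2" by simp
        then have "2 * (norm (H x) * norm (g x)) \<le> (norm (H x))\<^sup>2 + (norm (g x))\<^sup>2" by (simp add: power2_diff)
        moreover have "0 \<le> norm (H x) * norm (g x)" by simp
        ultimately show "norm (H x \<bullet> g x) \<le> norm ((norm (H x))\<^sup>2 + (norm (g x))\<^sup>2)"
          using Cauchy_Schwarz_ineq2[of "H x" "g x"] by (simp add: abs_of_nonneg) 
      qed
    qed
    have ik: "integrable lebesgue (\<lambda>x. \<kappa> * indicator A x)" using iA by simp
    have "(LINT x|lebesgue. F n x \<bullet> g x) \<le> (LINT x|lebesgue. \<kappa> * indicator A x)" for n
      by (rule integral_mono[OF iH[OF F] ik]) (use le in \<open>auto simp: g_def indicator_def\<close>)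
    moreover have "(\<lambda>n. LINT x|lebesgue. F n x \<bullet> g x) \<longlonglongrightarrow> (LINT x|lebesgue. f x \<bullet> g x)"
      using W g by (simp add: weakly_converges_L2_def)
    ultimately have "(LINT x|lebesgue. f x \<bullet> g x) \<le> (LINT x|lebesgue. \<kappa> * indicator A x)"
      by (intro LIMSEQ_le_const2) auto
    then have "(LINT x|lebesgue. f x \<bullet> g x - \<kappa> * indicator A x) \<le> 0"
      using Bochner_Integration.integral_diff[OF iH[OF f] ik] by simp
    moreover have nn: "0 \<le> f x \<bullet> g x - \<kappa> * indicator A x" for x by (auto simp: g_def indicator_def A_def)
    moreover have "0 \<le> (LINT x|lebesgue. f x \<bullet> g x - \<kappa> * indicator A x)" by (rule integral_nonneg_AE) (use nn in auto)
    ultimately have "(LINT x|lebesgue. f x \<bullet> g x - \<kappa> * indicator A x) = 0" by linarith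
    then have "AE x in lebesgue. f x \<bullet> g x - \<kappa> * indicator A x = 0"
      using integral_nonneg_eq_0_iff_AE[OF Bochner_Integration.integrable_diff[OF iH[OF f] ik]] nn by simp
    then show ?thesis by eventually_elim (auto simp: g_def indicator_def A_def split: if_splits)
  qed
  then have "AE x in lebesgue. \<forall>R. x \<in> cball 0 (real R) \<longrightarrow> f x \<bullet> e \<le> \<kappa>" by (simp only: AE_all_countable) simp
  then show ?thesis
  proof eventually_elim
    case (elim x)
    obtain R where "norm x < real R" using reals_Archimedean2 by blast
    then have "x \<in> cball 0 (real R)" by simp
    then show ?case using elim by blast
  qed
qed

lemma weak_limit_bound:
  assumes W: "weakly_converges_L2 F f" and \<kappa>: "\<kappa> \<ge> 0" and le: "\<And>n x k. \<bar>F n x $ k\<bar> \<le> \<kappa>"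
  shows "Linf_norm f \<le> ennreal \<kappa>"
proof -
  have f: "f \<in> borel_measurable lebesgue" using W by (simp add: weakly_converges_L2_def in_L2_def)
  have "esssup lebesgue (\<lambda>x. ennreal \<bar>f x $ i\<bar>) \<le> ennreal \<kappa>" for i
  proof (rule esssup_I)
    have "(\<lambda>x. f x $ i) \<in> borel_measurable lebesgue"
      by (rule borel_measurable_continuous_on[OF _ f]) (intro continuous_intros)
    then show "(\<lambda>x. ennreal \<bar>f x $ i\<bar>) \<in> borel_measurable lebesgue" by measurable
    have "F n x \<bullet> axis i 1 \<le> \<kappa>" "F n x \<bullet> (- axis i 1) \<le> \<kappa>" for n x
      using le[of n x i] by (simp_all add: inner_axis)
    then have "AE x in lebesgue. f x \<bullet> axis i 1 \<le> \<kappa>" "AE x in lebesgue. f x \<bullet> (- axis i 1) \<le> \<kappa>"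
      using weak_limit_one_sided[OF W \<kappa>] by blast+
    then show "AE x in lebesgue. ennreal \<bar>f x $ i\<bar> \<le> ennreal \<kappa>"
      by eventually_elim (auto simp: inner_axis intro!: ennreal_leI)
  qed
  then show ?thesis unfolding Linf_norm_def by (subst Max_le_iff) auto
qed

theorem theorem4p1:
  fixes u0 :: "real ^ 3 \<Rightarrow> real ^ 3" and u :: "real \<Rightarrow> real ^ 3 \<Rightarrow> real ^ 3"
  assumes "u0 \<in> L2_sigma"
    and "leray_hopf_solution u0 u"
  shows "((\<lambda>t. ennreal (t powr (3/4)) * Linf_norm (u t)) \<longlongrightarrow> 0) at_top"
proof (rule order_tendstoI)
  fix a :: ennreal assume "0 < a"
  then obtain z where z: "0 < z" "z < a" using dense by blast
  define \<epsilon> where "\<epsilon> = enn2real z"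
  have zt: "z < top" by (rule less_le_trans[OF z(2) top_greatest])
  have \<epsilon>: "z = ennreal \<epsilon>" "\<epsilon> > 0" unfolding \<epsilon>_def using zt z(1) by (simp_all add: enn2real_positive_iff)
  have u0: "in_L2 u0" using assms(1) by (simp add: L2_sigma_def)
  obtain G U Q d where G: "mollifier G" and U: "\<And>\<delta>. \<delta> > 0 \<Longrightarrow> regularized_solution G \<delta> u0 (U \<delta>) (Q \<delta>)"
    and d: "\<And>n. d n > 0" and lim: "\<And>t. t \<ge> 0 \<Longrightarrow> weakly_converges_L2 (\<lambda>n. U (d n) t) (u t)"
    using assms(2) unfolding leray_hopf_solution_def by blast
  obtain T where T: "T > 0" "\<And>\<delta> w p t x k. \<delta> > 0 \<Longrightarrow> regularized_solution G \<delta> u0 w p \<Longrightarrow> t \<ge> T \<Longrightarrow> \<bar>w t x $ k\<bar> \<le> \<epsilon> * t powr (- 3/4)"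
    by (rule regularized_decay[OF G u0 \<epsilon>(2)]) (rule that)
  show "\<forall>\<^sub>F t in at_top. ennreal (t powr (3/4)) * Linf_norm (u t) < a"
    using eventually_ge_at_top[of T]
  proof eventually_elim
    case (elim t)
    have t: "t > 0" using elim T(1) by linarith
    have "Linf_norm (u t) \<le> ennreal (\<epsilon> * t powr (- 3/4))"
      by (rule weak_limit_bound[OF lim]) (use t \<epsilon>(2) T(2)[OF d U[OF d] elim] in auto)
    then have "ennreal (t powr (3/4)) * Linf_norm (u t) \<le> ennreal (t powr (3/4)) * ennreal (\<epsilon> * t powr (- 3/4))"
      by (rule mult_left_mono) simp
    also have "\<dots> = ennreal (\<epsilon> * (t powr (3/4) * t powr (- 3/4)))"
      by (simp add: ennreal_mult[symmetric] \<epsilon>(2) less_imp_le mult_ac)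
    also have "t powr (3/4) * t powr (- 3/4) = 1" using t by (simp add: powr_add[symmetric])
    finally show ?case using z(2) \<epsilon>(1) by simp
  qed
qed simp

end
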